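(* Let $q$ be a prime power and $n\ge1$. The graded $\mathbb Z$-algebra $\mathcal G_n(q)$ has the multiplication given by $$P_{(\boldsymbol\lambda,k)}(n)\,P_{(\boldsymbol\mu,s)}(n)=\sum_{\|(\boldsymbol\nu,t)\|=\|(\boldsymbol\lambda,k)\|+\|(\boldsymbol\mu,s)\|}\mathfrak p_{(\boldsymbol\lambda,k),(\boldsymbol\mu,s)}^{(\boldsymbol\nu,t)}\,P_{(\boldsymbol\nu,t)}(n)$$ for $(\boldsymbol\lambda,k),(\boldsymbol\mu,s)\in\widehat{\mathscr P}^{\mathsf a}(\Phi_q)$. Moreover, for each $n$ there is a surjective algebra homomorphism $\mathcal G(q)\twoheadrightarrow\mathcal G_n(q)$ which maps $P_{(\boldsymbol\lambda,k)}$ to $P_{(\boldsymbol\lambda,k)}(n)$ for all $(\boldsymbol\lambda,k)\in\widehat{\mathscr P}^{\mathsf a}(\Phi_q)$.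
   Context: Let $q$ be a prime power; vectors in $\mathbb F_q^n$ are columns. $\Phi_q$ is the set of monic irreducible polynomials in $\mathbb F_q[t]$ other than $t$. $\mathscr P(\Phi_q)$ is the set of maps $\boldsymbol\lambda$ from $\Phi_q$ to partitions with $\boldsymbol\lambda(f)$ nonempty for only finitely many $f$; $\|\boldsymbol\lambda\|=\sum_{f}\deg(f)\,|\boldsymbol\lambda(f)|$; $\mathscr P_n(\Phi_q)=\{\boldsymbol\lambda:\|\boldsymbol\lambda\|=n\}$. Type in $GL_n(q)$: $g\in GL_n(q)$ has type $\boldsymbol\lambda\in\mathscr P_n(\Phi_q)$ if $\mathbb F_q^n$, with $t$ acting as $g$, is isomorphic to $\bigoplus_{f,i}\mathbb F_q[t]/(f)^{\boldsymbol\lambda_i(f)}$ as an $\mathbb F_q[t]$-module, where $\boldsymbol\lambda(f)=(\boldsymbol\lambda_1(f),\boldsymbol\lambda_2(f),\dots)$. The modified type of $g$ is $\mathring{\boldsymbol\lambda}\in\mathscr P(\Phi_q)$, where $\mathring{\boldsymbol\lambda}(f)=\boldsymbol\lambda(f)$ for $f\ne t-1$ and $\mathring{\boldsymbol\lambda}(t-1)$ is obtained from $\boldsymbol\lambda(t-1)$ by subtracting $1$ from every (positive) part. $GA_n(q)$ is the subgroup of $GL_n(q)$ of matrices $\begin{bmatrix}1&0\\ \alpha&g\end{bmatrix}$ with $g\in GL_{n-1}(q)$, $\alpha\in\mathbb F_q^{n-1}$. Canonical forms. For $f=t^d-\sum_{i=1}^d a_it^{i-1}\in\Phi_q$, $J(f)$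 is the companion matrix with $1$'s on the superdiagonal, last row $(a_1,\dots,a_d)$, and other entries $0$; $J_m(f)$ is the $dm\times dm$ block matrix with $m$ diagonal blocks $J(f)$, blocks $I_d$ on the block superdiagonal, and zeros elsewhere. For $\boldsymbol\lambda\in\mathscr P_{n-1}(\Phi_q)$ with $\boldsymbol\lambda(t-1)=(1^{m_1}2^{m_2}\cdots r^{m_r})$, $J_{\boldsymbol\lambda}=\mathrm{diag}(E^{(1)}_{\boldsymbol\lambda},\dots,E^{(r)}_{\boldsymbol\lambda},J^-_{\boldsymbol\lambda})$, where $E^{(i)}_{\boldsymbol\lambda}$ is the diagonal sum of $m_i$ copies of $J_i(t-1)$ and $J_{\boldsymbol\lambda}^-$ is the diagonal sum of the $J_{\boldsymbol\lambda_i(f)}(f)$ over $f\ne t-1$ and $i\geq 1$ (in a fixed order). For $k=0$ or $k$ a part of $\boldsymbol\lambda(t-1)$, put $J_{(\boldsymbol\lambda,k)}=\begin{bmatrix}1&0\\ \epsilon_k&J_{\boldsymbol\lambda}\end{bmatrix}\in GA_n(q)$, where $\epsilon_0=0$ and, for $k\ge1$, $\epsilon_k\in\mathbb F_q^{n-1}$ has entry $1$ in the last coordinate of the rows of $E^{(k)}_{\boldsymbol\lambda}$ (position $m_1+2m_2+\cdots+km_k$) and zeros elsewhere. Every $A\in GA_n(q)$ is conjugate in $GA_n(q)$ to exactly one $J_{(\boldsymbol\lambda,k)}$ with $\boldsymbol\lambda\in\mathscr P_{n-1}(\Phi_q)$ and $k=0$ or $k$ a part of $\boldsymbol\lambda(t-1)$;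 then $A$ is said to have type $(\boldsymbol\lambda,k)$ and modified type $(\mathring{\boldsymbol\lambda},k)$. Let $\widehat{\mathscr P}^{\mathsf a}(\Phi_q)$ be the set of pairs $(\boldsymbol\lambda,k)\in\mathscr P(\Phi_q)\times\mathbb Z_{\ge0}$ such that $k-1$ is a part of $\boldsymbol\lambda(t-1)$ whenever $k\ge1$, where $0$ is regarded as a part of every partition (so $k=1$ is always allowed). Set $\|(\boldsymbol\mu,l)\|=\|\boldsymbol\mu\|$ if $l=0$ and $\|\boldsymbol\mu\|+1$ if $l\ge1$. For $(\boldsymbol\lambda,k)\in\widehat{\mathscr P}^{\mathsf a}(\Phi_q)$, $P_{(\boldsymbol\lambda,k)}(n)$ is the sum in $\mathbb Z[GA_n(q)]$ of all elements of $GA_n(q)$ of modified type $(\boldsymbol\lambda,k)$ (it is $0$ if there are none, and otherwise is a conjugacy class sum). $\mathcal A_n(q)$ is the center of $\mathbb Z[GA_n(q)]$, and the structure constants $\mathfrak p_{(\boldsymbol\lambda,k),(\boldsymbol\mu,s)}^{(\boldsymbol\nu,t)}(n)$ are defined, for those $n$ such that $P_{(\boldsymbol\lambda,k)}(n)$, $P_{(\boldsymbol\mu,s)}(n)$, $P_{(\boldsymbol\nu,t)}(n)$ are all nonzero, as the coefficient of $P_{(\boldsymbol\nu,t)}(n)$ in $P_{(\boldsymbol\lambda,k)}(n)P_{(\boldsymbol\mu,s)}(n)$. When $\|(\boldsymbol\nu,t)\|=\|(\boldsymbol\lambda,k)\|+\|(\boldsymbol\mu,s)\|$ this coefficient does not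 depend on such $n$, and the common value is denoted $\mathfrak p_{(\boldsymbol\lambda,k),(\boldsymbol\mu,s)}^{(\boldsymbol\nu,t)}\in\mathbb N$. Let $\mathcal A_n^{(m)}(q)$ be the $\mathbb Z$-span of the $P_{(\boldsymbol\lambda,k)}(n)$ with $\|(\boldsymbol\lambda,k)\|\le m$, and $\mathcal A_n^{(-1)}(q)=0$. These give a ring filtration of $\mathcal A_n(q)$, and $\mathcal G_n(q)=\bigoplus_{i\ge0}\mathcal A_n^{(i)}(q)/\mathcal A_n^{(i-1)}(q)$ is the associated graded algebra; the image of $P_{(\boldsymbol\lambda,k)}(n)$ in degree $\|(\boldsymbol\lambda,k)\|$ is again denoted $P_{(\boldsymbol\lambda,k)}(n)$. $\mathcal G(q)$ is the graded associative $\mathbb Z$-algebra with $\mathbb Z$-basis of symbols $P_{(\boldsymbol\lambda,k)}$ (in degree $\|(\boldsymbol\lambda,k)\|$), $(\boldsymbol\lambda,k)\in\widehat{\mathscr P}^{\mathsf a}(\Phi_q)$, and multiplication $$P_{(\boldsymbol\lambda,k)}P_{(\boldsymbol\mu,s)}=\sum_{\|(\boldsymbol\nu,t)\|=\|(\boldsymbol\lambda,k)\|+\|(\boldsymbol\mu,s)\|}\mathfrak p_{(\boldsymbol\lambda,k),(\boldsymbol\mu,s)}^{(\boldsymbol\nu,t)}P_{(\boldsymbol\nu,t)}.$$ *)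

theory Defs
  imports
    "HOL-Algebra.RingHom"
    "HOL-Algebra.Generated_Groups"
    "HOL-Algebra.Product_Groups"
    "HOL-Computational_Algebra.Polynomial"
    "HOL-Computational_Algebra.Factorial_Ring"
    "HOL-Library.Multiset"
    "HOL-Library.Poly_Mapping"
    "Jordan_Normal_Form.Matrix"
begin

text \<open>
  The field \<open>\<F>\<^sub>q\<close> is a type \<open>'a\<close> of sort \<open>{field, finite}\<close>.  Matrices and the dimension \<open>n\<close> are
  those of \<open>Jordan_Normal_Form\<close>, because \<open>n\<close> varies inside the definition of the stable
  structure constants.
\<close>

section \<open>Partition-valued functions\<close>

abbreviation tm1 :: "'a::field poly" where
  "tm1 \<equiv> [:- 1, 1:]"

definition Phi :: "'a::field poly set" where
  "Phi = {f. lead_coeff f = 1 \<and> irreducible f \<and> f \<noteq> [:0, 1:]}"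

text \<open>A partition is the multiset of its (positive) parts.  Elements of \<open>PPhi\<close> are extended by the
  empty partition outside \<open>Phi\<close>, so that they are determined by their values on \<open>Phi\<close>.\<close>

type_synonym 'a ptype = "'a poly \<Rightarrow> nat multiset"

definition PPhi :: "'a::field ptype set" where
  "PPhi = {lam. (\<forall>f. 0 \<notin># lam f) \<and> (\<forall>f. lam f \<noteq> {#} \<longrightarrow> f \<in> Phi) \<and> finite {f. lam f \<noteq> {#}}}"

definition pnorm :: "'a::field ptype \<Rightarrow> nat" where
  "pnorm lam = (\<Sum>f | lam f \<noteq> {#}. degree f * sum_mset (lam f))"

definition modify :: "'a::field ptype \<Rightarrow> 'a ptype" where
  "modify lam = lam(tm1 := filter_mset (\<lambda>i. i > 0) (image_mset (\<lambda>i. i - 1) (lam tm1)))"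

definition Phat :: "('a::field ptype \<times> nat) set" where
  "Phat = {(lam, k). lam \<in> PPhi \<and> (k \<ge> 1 \<longrightarrow> k - 1 = 0 \<or> k - 1 \<in># lam tm1)}"

definition anorm :: "'a::field ptype \<times> nat \<Rightarrow> nat" where
  "anorm = (\<lambda>(mu, l). if l = 0 then pnorm mu else pnorm mu + 1)"

section \<open>The affine group and its canonical forms\<close>

definition GA :: "nat \<Rightarrow> 'a::field mat monoid" where
  "GA n = \<lparr>carrier = {four_block_mat (1\<^sub>m 1) (0\<^sub>m 1 (n - 1)) \<alpha> g | \<alpha> g.
               \<alpha> \<in> carrier_mat (n - 1) 1 \<and> g \<in> carrier_mat (n - 1) (n - 1) \<and> invertible_mat g},
           monoid.mult = (*), one = 1\<^sub>m n\<rparr>"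

text \<open>Indices start from \<open>0\<close>; the last row of the companion matrix of
  \<open>f = t^d - (\<Sum>i=1..d. a\<^sub>i t^(i-1))\<close> has entries \<open>a\<^sub>i = - coeff f (i - 1)\<close>.\<close>

definition companion :: "'a::field poly \<Rightarrow> 'a mat" where
  "companion f = (let d = degree f in
     mat d d (\<lambda>(i, j). if i = d - 1 then - coeff f j else if j = i + 1 then 1 else 0))"

definition Jblock :: "nat \<Rightarrow> 'a::field poly \<Rightarrow> 'a mat" where
  "Jblock m f = (let d = degree f in
     mat (d * m) (d * m) (\<lambda>(i, j).
       if j div d = i div d then companion f $$ (i mod d, j mod d)
       else if j div d = i div d + 1 \<and> i mod d = j mod d then 1 else 0))"

definition Eblock :: "'a::field ptype \<Rightarrow> nat \<Rightarrow> 'a mat" where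
  "Eblock lam i = diag_block_mat (replicate (count (lam tm1) i) (Jblock i tm1))"

text \<open>The fixed order of the blocks of \<open>Jminus\<close>: a chosen enumeration of the support of \<open>lam\<close>
  away from \<open>t - 1\<close>, and for each polynomial the parts in decreasing order.\<close>

definition Jminus :: "'a::field ptype \<Rightarrow> 'a mat" where
  "Jminus lam =
     (let fs = (SOME fs. distinct fs \<and> set fs = {f. f \<noteq> tm1 \<and> lam f \<noteq> {#}})
      in diag_block_mat
           (concat (map (\<lambda>f. map (\<lambda>m. Jblock m f) (rev (sorted_list_of_multiset (lam f)))) fs)))"

definition Jmat :: "'a::field ptype \<Rightarrow> 'a mat" where
  "Jmat lam = (let r = Max (insert 0 (set_mset (lam tm1)))
     in diag_block_mat (map (Eblock lam) [1..<Suc r] @ [Jminus lam]))"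

definition eps :: "'a::field ptype \<Rightarrow> nat \<Rightarrow> 'a mat" where
  "eps lam k = mat (pnorm lam) 1 (\<lambda>(i, _).
     if k \<ge> 1 \<and> i + 1 = (\<Sum>j = 1..k. j * count (lam tm1) j) then 1 else 0)"

definition Jaff :: "'a::field ptype \<Rightarrow> nat \<Rightarrow> 'a mat" where
  "Jaff lam k = four_block_mat (1\<^sub>m 1) (0\<^sub>m 1 (pnorm lam)) (eps lam k) (Jmat lam)"

definition has_type :: "nat \<Rightarrow> 'a::field mat \<Rightarrow> 'a ptype \<times> nat \<Rightarrow> bool" where
  "has_type n A = (\<lambda>(lam, k).
     lam \<in> PPhi \<and> pnorm lam = n - 1 \<and> (k = 0 \<or> k \<in># lam tm1) \<and>
     (\<exists>h \<in> carrier (GA n). A = h \<otimes>\<^bsub>GA n\<^esub> Jaff lam k \<otimes>\<^bsub>GA n\<^esub> inv\<^bsub>GA n\<^esub> h))"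

definition has_modified_type :: "nat \<Rightarrow> 'a::field mat \<Rightarrow> 'a ptype \<times> nat \<Rightarrow> bool" where
  "has_modified_type n A = (\<lambda>(mu, k). \<exists>lam. has_type n A (lam, k) \<and> modify lam = mu)"

section \<open>The center of the integral group ring\<close>

definition group_ring :: "('g, 'm) monoid_scheme \<Rightarrow> ('g \<Rightarrow>\<^sub>0 int) ring" where
  "group_ring G = \<lparr>carrier = {x. Poly_Mapping.keys x \<subseteq> carrier G},
     monoid.mult = (\<lambda>x y. frag_extend (\<lambda>g. frag_extend (\<lambda>h. frag_of (g \<otimes>\<^bsub>G\<^esub> h)) y) x),
     one = frag_of \<one>\<^bsub>G\<^esub>, zero = 0, add = (+)\<rparr>"

definition ring_center :: "('r, 'm) ring_scheme \<Rightarrow> 'r set" where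
  "ring_center R = {z \<in> carrier R. \<forall>a \<in> carrier R. z \<otimes>\<^bsub>R\<^esub> a = a \<otimes>\<^bsub>R\<^esub> z}"

definition Aring :: "nat \<Rightarrow> ('a::{field, finite} mat \<Rightarrow>\<^sub>0 int) ring" where
  "Aring n = (group_ring (GA n))\<lparr>carrier := ring_center (group_ring (GA n))\<rparr>"

definition class_sum :: "nat \<Rightarrow> 'a::{field, finite} ptype \<times> nat \<Rightarrow> ('a mat \<Rightarrow>\<^sub>0 int)" where
  "class_sum n x = (\<Sum>A \<in> {A \<in> carrier (GA n). has_modified_type n A x}. frag_of A)"

text \<open>\<open>struct_const n x y z\<close> is the coefficient of \<open>class_sum n z\<close> in the expansion of
  \<open>class_sum n x \<otimes> class_sum n y\<close> in terms of the nonzero class sums.\<close>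

definition struct_const ::
  "nat \<Rightarrow> 'a::{field, finite} ptype \<times> nat \<Rightarrow> 'a ptype \<times> nat \<Rightarrow> 'a ptype \<times> nat \<Rightarrow> int" where
  "struct_const n x y z = Poly_Mapping.lookup
     (THE c. Poly_Mapping.keys c \<subseteq> {v \<in> Phat. class_sum n v \<noteq> 0} \<and>
             class_sum n x \<otimes>\<^bsub>Aring n\<^esub> class_sum n y = frag_extend (class_sum n) c) z"

text \<open>The common value of \<open>struct_const n x y z\<close>, only meaningful when
  \<open>anorm z = anorm x + anorm y\<close>.  The bound \<open>n \<ge> 1\<close> is needed since \<open>GA 0\<close> is junk.\<close>

definition stable_const ::
  "'a::{field, finite} ptype \<times> nat \<Rightarrow> 'a ptype \<times> nat \<Rightarrow> 'a ptype \<times> nat \<Rightarrow> int" where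
  "stable_const x y z = (THE c. \<forall>n \<ge> 1.
     class_sum n x \<noteq> 0 \<and> class_sum n y \<noteq> 0 \<and> class_sum n z \<noteq> 0 \<longrightarrow> struct_const n x y z = c)"

section \<open>The associated graded ring\<close>

text \<open>A filtration of a ring \<open>R\<close> is a function \<open>F :: nat \<Rightarrow> _ set\<close>; \<open>below R F i\<close> is \<open>F (i - 1)\<close>,
  where \<open>F (-1)\<close> is zero.\<close>

definition below :: "('r, 'm) ring_scheme \<Rightarrow> (nat \<Rightarrow> 'r set) \<Rightarrow> nat \<Rightarrow> 'r set" where
  "below R F i = (case i of 0 \<Rightarrow> {\<zero>\<^bsub>R\<^esub>} | Suc j \<Rightarrow> F j)"

definition graded_group ::
  "('r, 'm) ring_scheme \<Rightarrow> (nat \<Rightarrow> 'r set) \<Rightarrow> (nat \<Rightarrow> 'r set) monoid" where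
  "graded_group R F = sum_group UNIV (\<lambda>i. (add_monoid R)\<lparr>carrier := F i\<rparr> Mod below R F i)"

text \<open>The degree \<open>m\<close> component of the product of \<open>x\<close> and \<open>y\<close> is the sum over \<open>i \<le> m\<close> of the classes
  of \<open>a i \<otimes> b (m - i)\<close>, where \<open>a i\<close>, \<open>b i\<close> are representatives of the cosets \<open>x i\<close>, \<open>y i\<close>.  It is
  written as the union over all choices of representatives; for a ring filtration all choices
  give the same coset.\<close>

definition graded_ring :: "('r, 'm) ring_scheme \<Rightarrow> (nat \<Rightarrow> 'r set) \<Rightarrow> (nat \<Rightarrow> 'r set) ring" where
  "graded_ring R F = \<lparr>carrier = carrier (graded_group R F),
     monoid.mult = (\<lambda>x y m. \<Union>{below R F m +>\<^bsub>R\<^esub> (\<Oplus>\<^bsub>R\<^esub>i \<in> {..m}. a i \<otimes>\<^bsub>R\<^esub> b (m - i)) | a b.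
                      \<forall>i \<le> m. a i \<in> x i \<and> b i \<in> y i}),
     one = (\<lambda>i. below R F i +>\<^bsub>R\<^esub> (if i = 0 then \<one>\<^bsub>R\<^esub> else \<zero>\<^bsub>R\<^esub>)),
     zero = \<one>\<^bsub>graded_group R F\<^esub>,
     add = monoid.mult (graded_group R F)\<rparr>"

definition graded_class ::
  "('r, 'm) ring_scheme \<Rightarrow> (nat \<Rightarrow> 'r set) \<Rightarrow> nat \<Rightarrow> 'r \<Rightarrow> (nat \<Rightarrow> 'r set)" where
  "graded_class R F d a = (\<lambda>i. below R F i +>\<^bsub>R\<^esub> (if i = d then a else \<zero>\<^bsub>R\<^esub>))"

definition Afilt :: "nat \<Rightarrow> nat \<Rightarrow> ('a::{field, finite} mat \<Rightarrow>\<^sub>0 int) set" where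
  "Afilt n m = generate (add_monoid (Aring n)) (class_sum n ` {x \<in> Phat. anorm x \<le> m})"

definition Gn_ring :: "nat \<Rightarrow> (nat \<Rightarrow> ('a::{field, finite} mat \<Rightarrow>\<^sub>0 int) set) ring" where
  "Gn_ring n = graded_ring (Aring n) (Afilt n)"

definition graded_class_sum ::
  "nat \<Rightarrow> 'a::{field, finite} ptype \<times> nat \<Rightarrow> (nat \<Rightarrow> ('a mat \<Rightarrow>\<^sub>0 int) set)" where
  "graded_class_sum n x = graded_class (Aring n) (Afilt n) (anorm x) (class_sum n x)"

section \<open>The stable graded algebra\<close>

definition G_ring :: "('a::{field, finite} ptype \<times> nat \<Rightarrow>\<^sub>0 int) ring" where
  "G_ring = \<lparr>carrier = {u. Poly_Mapping.keys u \<subseteq> Phat},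
     monoid.mult = (\<lambda>u v. frag_extend (\<lambda>x. frag_extend (\<lambda>y.
        \<Sum>z \<in> {z \<in> Phat. anorm z = anorm x + anorm y}. frag_cmul (stable_const x y z) (frag_of z)) v) u),
     one = frag_of (\<lambda>_. {#}, 0), zero = 0, add = (+)\<rparr>"

end

theory Submission
  imports
    Defs
    "HOL-Algebra.QuotRing"
    "HOL-Library.Function_Algebras"
    "HOL-Library.Cardinality"
    "Jordan_Normal_Form.Determinant"
begin

text \<open>The norm of the modified type of an affine matrix \<open>A\<close> is the rank of \<open>A - 1\<close>, so it is
  subadditive.  If it is additive on a product \<open>C = A B\<close>, then the image of \<open>C - 1\<close> is the direct sum
  of the images of \<open>A - 1\<close> and \<open>B - 1\<close>; hence \<open>A\<close> and \<open>B\<close> fix every vector that \<open>C\<close> fixes, and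
  extending \<open>C\<close> by a fixed coordinate creates no new factorizations of this kind.  This is the
  stability of the structure constants: they count norm-additive factorizations in any group
  \<open>GA n\<close>.  An element of the stable algebra gives a class function on every \<open>GA n\<close>, whose
  homogeneous parts modulo functions of smaller norm form the image in the graded ring of the
  centre; products match because both sides only see norm-additive factorizations.

  Types exist and are unique by the cyclic decomposition of finite modules over \<open>F[t]\<close>; the
  affine datum \<open>k\<close> records the least order of an element in a coset of the image of \<open>t - 1\<close>.\<close>

section \<open>Polynomials over a finite field\<close>

text \<open>The norm is a rank because each cyclic summand at \<open>t - 1\<close> contributes one
  dimension to the fixed space, and passing to the modified type removes exactly one unit per such
  summand; a fixed vector outside the invariant hyperplane exists precisely when
  \<open>k = 0\<close>, which accounts for the extra 1 in \<open>anorm\<close> for positive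
  \<open>k\<close>. Dimensions are handled as exponents of \<open>CARD('a)\<close>: over a finite
  field, directness of sums, independence and ranks become equalities of cardinalities. The obstacle
  in the canonical form is that \<open>Jblock\<close> has full identity blocks above the diagonal,
  so that it represents multiplication by \<open>t\<close> on \<open>F[t]/(f^m)\<close> only because
  finite fields are perfect; a Frobenius power supplies the basis. Ring axioms are not checked on
  cosets: associativity of the stable algebra is tested on all groups \<open>GA n\<close>, where it
  is a statement about factorizations into three factors, and the graded ring inherits its axioms as
  an image.\<close>

definition below_deg :: "nat \<Rightarrow> 'a::zero poly set" where
  "below_deg k = {p. \<forall>i\<ge>k. coeff p i = 0}"

lemma card_below_deg:
  "finite (below_deg k :: 'a::{field,finite} poly set)"
  "card (below_deg k :: 'a::{field,finite} poly set) = CARD('a) ^ k"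
proof -
  have bij: "bij_betw (\<lambda>p::'a poly. restrict (coeff p) {..<k}) (below_deg k) ({..<k} \<rightarrow>\<^sub>E UNIV)"
  proof (rule bij_betwI')
    fix p r :: "'a poly" assume p: "p \<in> below_deg k" and r: "r \<in> below_deg k"
    show "(restrict (coeff p) {..<k} = restrict (coeff r) {..<k}) = (p = r)"
    proof
      assume eq: "restrict (coeff p) {..<k} = restrict (coeff r) {..<k}"
      show "p = r"
      proof (rule poly_eqI)
        fix i show "coeff p i = coeff r i"
          using p r fun_cong[OF eq, of i] by (cases "i < k") (auto simp: below_deg_def)
      qed
    qed simp
  next
    fix a :: "nat \<Rightarrow> 'a" assume a: "a \<in> {..<k} \<rightarrow>\<^sub>E UNIV"
    let ?p = "\<Sum>i<k. monom (a i) i"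
    have c: "coeff ?p j = (if j < k then a j else 0)" for j
      by (simp add: coeff_sum)
    show "\<exists>p\<in>below_deg k. a = restrict (coeff p) {..<k}"
      using a by (intro bexI[of _ ?p]) (auto simp: c below_deg_def fun_eq_iff PiE_def extensional_def)
  qed auto
  have fin: "finite ({..<k} \<rightarrow>\<^sub>E (UNIV :: 'a set))" by (intro finite_PiE) auto
  show "finite (below_deg k :: 'a poly set)" using bij fin by (rule bij_betw_finite[THEN iffD2])
  show "card (below_deg k :: 'a poly set) = CARD('a) ^ k"
    using bij_betw_same_card[OF bij] by (simp add: card_PiE)
qed

lemma mod_below_deg: "g \<noteq> 0 \<Longrightarrow> (p :: 'a::field poly) mod g \<in> below_deg (degree g)"
  using degree_mod_less[of g p] by (auto simp: below_deg_def intro: coeff_eq_0)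

lemma mod_below_deg_id: "p \<in> below_deg (degree g) \<Longrightarrow> (p :: 'a::field poly) mod g = p"
proof (cases "p = 0")
  case False
  assume p: "p \<in> below_deg (degree g)"
  have "degree p < degree g"
  proof (rule ccontr)
    assume "\<not> degree p < degree g"
    with p have "coeff p (degree p) = 0" by (auto simp: below_deg_def)
    with False show False by simp
  qed
  thus ?thesis by (rule mod_poly_less)
qed simp

text \<open>An element of least degree in the ideal of \<open>g\<close> and \<open>f\<close> divides
  both by Euclidean division. Were it not a unit, irreducibility would make it a multiple of
  \<open>f\<close>, and \<open>f\<close> would divide \<open>g\<close>.\<close>

lemma bezout_irreducible:
  fixes f g :: "'a::field poly"
  assumes f: "irreducible f" and g: "\<not> f dvd g"
  obtains a b where "a * g + b * f = 1"
proof -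
  define I where "I = {h. h \<noteq> 0 \<and> (\<exists>a b. h = a * g + b * f)}"
  have "f = 0 * g + 1 * f" "f \<noteq> 0" using f by auto
  hence "f \<in> I" unfolding I_def by blast
  then obtain d where d: "d \<in> I" and min: "\<And>h. h \<in> I \<Longrightarrow> degree d \<le> degree h"
    using arg_min_natI[of "\<lambda>h. h \<in> I" f degree] arg_min_nat_le[of "\<lambda>h. h \<in> I" _ degree] by blast
  obtain a b where dab: "d = a * g + b * f" and d0: "d \<noteq> 0" using d by (auto simp: I_def)
  have dv: "d dvd a' * g + b' * f" for a' b'
  proof (rule ccontr)
    let ?h = "a' * g + b' * f"
    assume nd: "\<not> d dvd ?h"
    hence nz: "?h mod d \<noteq> 0" by (simp add: dvd_eq_mod_eq_0)
    have "?h mod d = ?h - (?h div d) * d" by (simp add: minus_div_mult_eq_mod)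
    also have "\<dots> = (a' - ?h div d * a) * g + (b' - ?h div d * b) * f"
      by (simp add: dab algebra_simps)
    finally have "?h mod d \<in> I" using nz by (auto simp: I_def)
    from min[OF this] degree_mod_less[OF d0, of ?h] nz show False by auto
  qed
  have df: "d dvd f" using dv[of 0 1] by simp
  have dg: "d dvd g" using dv[of 1 0] by simp
  have "is_unit d"
  proof (rule ccontr)
    assume "\<not> is_unit d"
    with df f have "f dvd d" by (meson irreducibleD' )
    with dg g show False using dvd_trans by blast
  qed
  then obtain c where "1 = d * c" by (elim dvdE)
  hence "(c * a) * g + (c * b) * f = 1" by (simp add: dab algebra_simps)
  thus ?thesis by (rule that)
qed

lemma irreducible_power_dvd_multD:
  fixes f :: "'a::field poly"
  assumes "irreducible f" "f ^ m dvd g * p" "\<not> f dvd g"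
  shows "f ^ m dvd p"
proof (cases "m = 0")
  case False
  then show ?thesis
    using prime_power_dvd_multD[OF field_poly_irreducible_imp_prime[OF assms(1)] assms(2) _ assms(3)] by simp
qed simp

lemma irreducible_dvd_powerD:
  fixes f :: "'a::field poly"
  shows "irreducible f \<Longrightarrow> f dvd g ^ m \<Longrightarrow> f dvd g"
  using field_poly_irreducible_imp_prime prime_elem_dvd_power by blast

lemma monic_irreducible_dvd_imp_eq:
  fixes f g :: "'a::field poly"
  assumes "irreducible f" "irreducible g" "lead_coeff f = 1" "lead_coeff g = 1" "f dvd g"
  shows "f = g"
proof -
  obtain c where c: "g = f * c" using assms(5) by (elim dvdE)
  have "is_unit c" using assms(1,2) c irreducibleD[of g f c] by (auto simp: irreducible_def)
  then obtain u where u: "c = [:u:]" by (auto simp: is_unit_poly_iff)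
  have "lead_coeff g = lead_coeff f * lead_coeff c" unfolding c by (rule lead_coeff_mult)
  with u assms(3,4) have "u = 1" by simp
  with u c show ?thesis by simp
qed

lemma degree_irreducible_pos: "irreducible (f :: 'a::field poly) \<Longrightarrow> degree f > 0"
  by (metis degree_eq_zeroE gr0I irreducible_def is_unit_const_poly_iff dvd_field_iff pCons_0_0)

lemma Phi_D:
  assumes "f \<in> Phi"
  shows "irreducible f" "lead_coeff f = 1" "degree f > 0" "f \<noteq> 0" "\<not> f dvd [:0, 1:]"
proof -
  show f: "irreducible f" "lead_coeff f = 1" using assms by (auto simp: Phi_def)
  show "degree f > 0" "f \<noteq> 0" using f(1) degree_irreducible_pos by auto
  have "irreducible [:0, 1::'a:]" by (rule irreducible_linear_field_poly) simp
  with f assms show "\<not> f dvd [:0, 1:]"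
    using monic_irreducible_dvd_imp_eq[of f "[:0,1:]"] by (auto simp: Phi_def)
qed

lemma tm1_Phi: "tm1 \<in> Phi"
  using irreducible_linear_field_poly[of 1 "- 1 :: 'a"] by (auto simp: Phi_def)

text \<open>The sequences \<open>t^(p^s) mod f\<close> and \<open>x^(p^s)\<close>, \<open>x\<close> in the field, are eventually periodic in \<open>s\<close>, and
  the \<open>p\<close>-th power map is injective on a reduced ring of characteristic \<open>p\<close>, so they are periodic.\<close>

lemma frobenius_exponent:
  fixes f :: "'a::{field,finite} poly"
  assumes f: "irreducible f"
  obtains Q where "Q \<ge> m" "\<And>p r :: 'a poly. (p + r) ^ Q = p ^ Q + r ^ Q"
    "\<And>c :: 'a. c ^ Q = c" "f dvd [:0, 1:] ^ Q - [:0, 1:]"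
proof -
  let ?p = "CHAR('a)" and ?t = "[:0, 1:] :: 'a poly"
  have prime: "prime ?p" by (rule prime_CHAR_semidom[OF finite_imp_CHAR_pos]) simp
  hence prime': "prime CHAR('a poly)" by simp
  have fr: "(x + y) ^ (?p ^ n) = x ^ (?p ^ n) + y ^ (?p ^ n)" for x y :: 'a and n
    by (rule freshmans_dream'[OF prime refl])
  have fr': "(x + y) ^ (?p ^ n) = x ^ (?p ^ n) + y ^ (?p ^ n)" for x y :: "'a poly" and n
    using freshmans_dream'[OF prime', of "?p ^ n" n x y] by simp
  define F where "F s = (\<lambda>c::'a. c ^ (?p ^ s), ?t ^ (?p ^ s) mod f)" for s
  have f0: "f \<noteq> 0" using f by auto
  have "range F \<subseteq> UNIV \<times> below_deg (degree f)" using mod_below_deg[OF f0] by (auto simp: F_def)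
  moreover have "finite (UNIV \<times> below_deg (degree f) :: (('a \<Rightarrow> 'a) \<times> 'a poly) set)"
    by (intro finite_cartesian_product card_below_deg) auto
  ultimately have "finite (range F)" by (rule finite_subset)
  hence "\<not> inj F" using finite_imageD infinite_UNIV_nat by blast
  then obtain i j where ij: "i < j" "F i = F j"
    by (metis injI linorder_neqE_nat)
  define R where "R = ?p ^ (j - i)"
  have pj: "?p ^ j = R * ?p ^ i" using ij by (simp add: R_def power_add[symmetric])
  have R1: "c ^ R = c" for c :: 'a
  proof -
    \<comment> \<open>Writing \<open>c ^ R\<close> as \<open>c + ?d\<close> and applying the
      additive power \<open>?p ^ i\<close> cancels the common term of \<open>F i = F j\<close> and
      leaves a power of \<open>?d\<close> equal to zero.\<close>
    let ?d = "c ^ R - c"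
    have "c ^ (?p ^ j) = (c + ?d) ^ (?p ^ i)" by (simp add: pj power_mult)
    also have "\<dots> = c ^ (?p ^ i) + ?d ^ (?p ^ i)" by (rule fr)
    finally have "?d ^ (?p ^ i) = 0" using ij(2) by (simp add: F_def fun_eq_iff)
    thus ?thesis by simp
  qed
  have R2: "f dvd ?t ^ R - ?t"
  proof -
    let ?d = "?t ^ R - ?t"
    have "?t ^ (?p ^ j) = (?t + ?d) ^ (?p ^ i)" by (simp add: pj power_mult)
    also have "\<dots> = ?t ^ (?p ^ i) + ?d ^ (?p ^ i)" by (rule fr')
    finally have "?d ^ (?p ^ i) = ?t ^ (?p ^ j) - ?t ^ (?p ^ i)" by simp
    moreover have "f dvd ?t ^ (?p ^ j) - ?t ^ (?p ^ i)"
      using ij(2) by (simp add: F_def mod_eq_dvd_iff dvd_diff_commute)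
    ultimately have "f dvd ?d ^ (?p ^ i)" by simp
    thus ?thesis by (rule irreducible_dvd_powerD[OF f])
  qed
  have fR: "(x + y) ^ R ^ n = x ^ R ^ n + y ^ R ^ n" for x y :: "'a poly" and n
    using fr'[of x y "(j - i) * n"] by (simp add: R_def power_mult)
  have "R \<ge> 2"
  proof -
    have "?p \<ge> 2" using prime by (rule prime_ge_2_nat)
    moreover have "?p ^ 1 \<le> R" unfolding R_def using ij \<open>?p \<ge> 2\<close> by (intro power_increasing) auto
    ultimately show ?thesis by simp
  qed
  show ?thesis
  \<comment> \<open>All properties survive iteration, and \<open>R \<ge> 2\<close> makes
    \<open>R ^ m\<close> at least \<open>m\<close>, which later lets \<open>f ^ m\<close> divide
    \<open>f ^ Q\<close>.\<close>
  proof (rule that[of "R ^ m"])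
    have "m \<le> 2 ^ m" by (simp add: less_imp_le)
    also have "\<dots> \<le> R ^ m" using \<open>R \<ge> 2\<close> by (rule power_mono) simp
    finally show "m \<le> R ^ m" .
    show "(p + r) ^ R ^ m = p ^ R ^ m + r ^ R ^ m" for p r :: "'a poly" by (rule fR)
    show "c ^ R ^ m = c" for c :: 'a
      by (induction m) (simp_all add: R1 power_mult)
    show "f dvd ?t ^ R ^ m - ?t"
    proof (induction m)
      case (Suc m)
      then obtain g where "?t ^ R ^ m - ?t = f * g" by (elim dvdE)
      hence "?t ^ R ^ m = ?t + f * g" by (simp add: algebra_simps)
      moreover have "?t ^ R ^ Suc m = (?t ^ R ^ m) ^ R" by (simp flip: power_mult add: mult.commute)
      ultimately have "?t ^ R ^ Suc m = (?t + f * g) ^ R" by simp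
      also have "\<dots> = ?t ^ R + (f * g) ^ R" using fR[of _ _ 1] by simp
      finally have eq: "?t ^ R ^ Suc m - ?t = (?t ^ R - ?t) + (f * g) ^ R" by simp
      moreover have "f dvd (f * g) ^ R" using \<open>R \<ge> 2\<close> by (simp add: power_mult_distrib dvd_power)
      ultimately show ?case unfolding eq using R2 by (blast intro: dvd_add)
    qed simp
  qed
qed

section \<open>The generalized Jordan block of a primary cyclic module\<close>

text \<open>Modulo \<open>f^m\<close>, the polynomial \<open>t^Q\<close> is a root of \<open>f\<close> and \<open>t - t^Q\<close> is nilpotent, so
  \<open>t = t^Q + (t - t^Q)\<close> is the Jordan decomposition of multiplication by \<open>t\<close>.  The polynomial
  \<open>blk f m Q c\<close> is the basis vector number \<open>c\<close> of \<open>F[t]/(f^m)\<close> for which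
  \<open>t\<close> acts by \<open>Jblock m f\<close>; \<open>poly_shift (j + 1) f\<close> are the Horner polynomials of \<open>f\<close>.\<close>

definition blk :: "'a::field poly \<Rightarrow> nat \<Rightarrow> nat \<Rightarrow> nat \<Rightarrow> 'a poly" where
  "blk f m Q c = poly_shift (Suc (c mod degree f)) f ^ Q *
     ([:0, 1:] - [:0, 1:] ^ Q) ^ (m - 1 - c div degree f)"

lemma poly_shift_Suc: fixes f :: "'a::comm_ring_1 poly" shows "poly_shift j f = [:coeff f j:] + [:0, 1:] * poly_shift (Suc j) f"
  by (rule poly_eqI) (simp add: coeff_poly_shift coeff_pCons split: nat.split)

lemma poly_shift_degree: "lead_coeff f = 1 \<Longrightarrow> poly_shift (degree f) f = 1"
  by (rule poly_eqI) (auto simp: coeff_poly_shift coeff_eq_0)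

lemma poly_smult_sum: "Polynomial.smult c (\<Sum>i\<in>S. g i) = (\<Sum>i\<in>S. Polynomial.smult c (g i))"
  by (induction S rule: infinite_finite_induct) (auto simp: smult_add_right)

lemma dim_Jblock: "Jblock m f \<in> carrier_mat (degree f * m) (degree f * m)"
  by (simp add: Jblock_def Let_def)

text \<open>Arranged by columns because column \<open>c\<close> gives the image of basis vector
  \<open>c\<close>. The possible nonzero positions, namely the last row of the companion block, its
  superdiagonal and the identity block above, are distinct, so their indicators can simply be
  added.\<close>

lemma Jblock_entry:
  assumes r: "r < degree f * m" and c: "c < degree f * m"
  defines "d \<equiv> degree f" defines "I \<equiv> c div degree f" defines "j \<equiv> c mod degree f"
  shows "Jblock m f $$ (r, c) = (if r = I * d + (d - 1) then - coeff f j else 0)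
     + (if j \<ge> 1 \<and> r = I * d + (j - 1) then 1 else 0)
     + (if I \<ge> 1 \<and> r = (I - 1) * d + j then 1 else 0)"
proof -
  have d: "d > 0" using r by (cases "d = 0") (auto simp: d_def)
  have r_eq: "r = r div d * d + r mod d" by simp
  have jd: "j < d" using d by (simp add: j_def d_def)
  have rd: "r mod d < d" using d by simp
  have eqI: "r = a * d + b \<longleftrightarrow> r div d = a \<and> r mod d = b" if "b < d" for a b
    using that r_eq by auto
  have e1: "r = I * d + (d - 1) \<longleftrightarrow> r div d = I \<and> r mod d = d - 1" using d by (intro eqI) simp
  have e2: "r = I * d + (j - 1) \<longleftrightarrow> r div d = I \<and> r mod d = j - 1" using jd by (intro eqI) simp
  have e3: "r = (I - 1) * d + j \<longleftrightarrow> r div d = I - 1 \<and> r mod d = j" using jd by (intro eqI) simp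
  have J: "Jblock m f $$ (r, c) = (if I = r div d then
         (if r mod d = d - 1 then - coeff f j else if j = r mod d + 1 then 1 else 0)
       else if I = r div d + 1 \<and> r mod d = j then 1 else 0)"
    using r c rd jd unfolding Jblock_def companion_def Let_def I_def j_def d_def by simp
  have aux: "(if I = x then (if y = d - 1 then a else if j = y + 1 then 1 else 0)
       else if I = x + 1 \<and> y = j then 1 else 0) =
     (if x = I \<and> y = d - 1 then a else 0) + (if j \<ge> 1 \<and> x = I \<and> y = j - 1 then 1 else 0)
      + (if I \<ge> 1 \<and> x = I - 1 \<and> y = j then 1 else 0)" for x y and a :: 'a
    using jd by (cases "x = I"; cases "y = j") auto
  show ?thesis unfolding J e1 e2 e3 by (rule aux)
qed

lemma Jblock_column_sum:
  fixes v :: "nat \<Rightarrow> 'a::field poly"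
  assumes c: "c < degree f * m"
  defines "d \<equiv> degree f" defines "I \<equiv> c div degree f" defines "j \<equiv> c mod degree f"
  shows "(\<Sum>r<degree f * m. Polynomial.smult (Jblock m f $$ (r, c)) (v r)) =
     (if j \<ge> 1 then v (I * d + (j - 1)) else 0) - Polynomial.smult (coeff f j) (v (I * d + (d - 1)))
      + (if I \<ge> 1 then v ((I - 1) * d + j) else 0)"
proof -
  have d: "d > 0" using c by (cases "d = 0") (auto simp: d_def)
  have jd: "j < d" using d by (simp add: j_def d_def)
  have Im: "I < m" using c by (simp add: I_def less_mult_imp_div_less mult.commute)
  have lt: "a * d + b < degree f * m" if "a \<le> I" "b < d" for a b
  proof -
    have "a * d + b < (a + 1) * d" using that by simp
    also have "\<dots> \<le> m * d" using that Im by (intro mult_right_mono) auto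
    finally show ?thesis by (simp add: d_def mult.commute)
  qed
  have "(\<Sum>r<degree f * m. Polynomial.smult (Jblock m f $$ (r, c)) (v r)) =
    (\<Sum>r<degree f * m. (if r = I * d + (d - 1) then Polynomial.smult (- coeff f j) (v r) else 0)
     + (if r = I * d + (j - 1) then (if j \<ge> 1 then v r else 0) else 0)
     + (if r = (I - 1) * d + j then (if I \<ge> 1 then v r else 0) else 0))"
    using Jblock_entry[OF _ c]
    by (intro sum.cong refl) (auto simp: smult_add_left I_def j_def d_def)
  also have "\<dots> = Polynomial.smult (- coeff f j) (v (I * d + (d - 1))) + (if j \<ge> 1 then v (I * d + (j - 1)) else 0)
      + (if I \<ge> 1 then v ((I - 1) * d + j) else 0)"
    using lt[of I "d - 1"] lt[of I "j - 1"] lt[of "I - 1" j] d jd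
    by (simp add: sum.distrib)
  finally show ?thesis by simp
qed

text \<open>A Frobenius power, kept abstract. Additivity and the fixing of constants give
  \<open>f(t^Q) = f^Q\<close>, and \<open>Q \<ge> m\<close> makes this vanish modulo
  \<open>f^m\<close>. Since \<open>t^Q\<close> agrees with \<open>t\<close> modulo \<open>f\<close>,
  the power \<open>(t - t^Q)^m\<close> vanishes there as well.\<close>

locale block_exponent =
  fixes f :: "'a::{field,finite} poly" and m Q :: nat
  assumes f: "f \<in> Phi" and m: "m \<ge> 1" and Q: "Q \<ge> m"
    and add_power: "\<And>p r :: 'a poly. (p + r) ^ Q = p ^ Q + r ^ Q"
    and const_power: "\<And>c :: 'a. c ^ Q = c"
    and dvd_t: "f dvd [:0, 1:] ^ Q - [:0, 1:]"
begin

abbreviation "D \<equiv> degree f * m"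
abbreviation "E \<equiv> blk f m Q"

lemma D_pos: "D > 0" using Phi_D[OF f] m by simp

lemma degree_f_power: "degree (f ^ m) = D"
  by (simp add: degree_power_eq Phi_D[OF f])

lemma shift_power:
  "poly_shift j f ^ Q = [:coeff f j:] + [:0, 1:] ^ Q * poly_shift (Suc j) f ^ Q"
proof -
  have "[:c:] ^ Q = [:c:]" for c :: 'a by (simp add: poly_const_pow const_power)
  thus ?thesis by (subst poly_shift_Suc, subst add_power) (simp add: power_mult_distrib del: mult_pCons_left)
qed

lemma blk_last: "E (D - 1) = 1"
proof -
  have d: "degree f > 0" using Phi_D[OF f] by simp
  have *: "D - 1 = (m - 1) * degree f + (degree f - 1)"
    using m d by (cases m) (auto simp: algebra_simps)
  have "(D - 1) mod degree f = degree f - 1" "(D - 1) div degree f = m - 1"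
    unfolding * using d by (auto simp del: add_diff_assoc diff_Suc_eq_diff_pred add_diff_assoc2 One_nat_def)
  thus ?thesis using d poly_shift_degree[of f] Phi_D[OF f] by (simp add: blk_def)
qed

text \<open>Split \<open>t\<close> as \<open>t^Q + N\<close>. Multiplication by \<open>t^Q\<close>
  runs through the Horner polynomials and produces the companion column; multiplication by
  \<open>N\<close> raises its exponent by one and so moves to the same position in the previous
  block, which is the identity block.\<close>

lemma blk_congruence:
  assumes c: "c < D"
  shows "f ^ m dvd [:0, 1:] * E c - (\<Sum>r<D. Polynomial.smult (Jblock m f $$ (r, c)) (E r))"
proof -
  define d I j where "d = degree f" and "I = c div degree f" and "j = c mod degree f"
  let ?t = "[:0, 1:] :: 'a poly"
  define N where "N = ?t - ?t ^ Q"
  have d: "d > 0" using Phi_D[OF f] by (simp add: d_def)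
  have jd: "j < d" using d by (simp add: j_def d_def)
  have Im: "I < m" using c by (simp add: I_def less_mult_imp_div_less mult.commute)
  have dm: "(a * d + b) mod degree f = b" "(a * d + b) div degree f = a" if "b < d" for a b
    using that by (auto simp: d_def)
  have Ec: "E (a * d + b) = poly_shift (Suc b) f ^ Q * N ^ (m - 1 - a)" if "b < d" for a b
    unfolding blk_def dm[OF that] N_def ..
  have c_eq: "c = I * d + j" by (simp add: I_def j_def d_def)
  have Ed: "E (I * d + (d - 1)) = N ^ (m - 1 - I)"
    using d Ec[of "d - 1" I] poly_shift_degree[of f] Phi_D[OF f] by (simp add: d_def)
  have one: "?t ^ Q * E c = poly_shift j f ^ Q * N ^ (m - 1 - I) - Polynomial.smult (coeff f j) (E (I * d + (d - 1)))"
  proof -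
    have "poly_shift j f ^ Q - [:coeff f j:] = ?t ^ Q * poly_shift (Suc j) f ^ Q"
      using shift_power[of j] by simp
    hence "?t ^ Q * E c = (poly_shift j f ^ Q - [:coeff f j:]) * N ^ (m - 1 - I)"
      by (simp add: c_eq Ec[OF jd])
    thus ?thesis unfolding Ed by (simp add: left_diff_distrib)
  qed
  have two: "f ^ m dvd poly_shift j f ^ Q * N ^ (m - 1 - I) - (if j \<ge> 1 then E (I * d + (j - 1)) else 0)"
  proof (cases "j \<ge> 1")
    case True
    then show ?thesis using jd Ec[of "j - 1" I] by simp
  next
    case False
    \<comment> \<open>For \<open>j = 0\<close> the Horner polynomial is \<open>f\<close> itself,
      whose \<open>Q\<close>-th power vanishes modulo \<open>f^m\<close>.\<close>
    have "f ^ m dvd f ^ Q" using Q by (rule le_imp_power_dvd)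
    moreover have "j = 0" using False by simp
    ultimately show ?thesis by simp
  qed
  have three: "f ^ m dvd N * E c - (if I \<ge> 1 then E ((I - 1) * d + j) else 0)"
  proof (cases "I \<ge> 1")
    case True
    hence "Suc (m - 1 - I) = m - 1 - (I - 1)" using Im by simp
    hence "N * E c = E ((I - 1) * d + j)"
      unfolding c_eq Ec[OF jd] by (simp add: mult_ac flip: power_Suc)
    thus ?thesis using True by simp
  next
    case False
    hence "I = 0" by simp
    \<comment> \<open>In the first block the exponent of \<open>N\<close> reaches \<open>m\<close>,
      and \<open>N\<close> is divisible by \<open>f\<close>.\<close>
    have "f dvd N" using dvd_t dvd_diff_commute unfolding N_def by blast
    hence "f ^ m dvd N ^ m" by (rule dvd_power_same)
    moreover have "N * E c = poly_shift (Suc j) f ^ Q * N ^ m"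
      unfolding c_eq Ec[OF jd] \<open>I = 0\<close> using m by (cases m) (simp_all add: mult_ac)
    ultimately show ?thesis using False by simp
  qed
  have "?t * E c = ?t ^ Q * E c + N * E c" by (simp add: N_def algebra_simps)
  hence "?t * E c - (\<Sum>r<D. Polynomial.smult (Jblock m f $$ (r, c)) (E r)) =
     (poly_shift j f ^ Q * N ^ (m - 1 - I) - (if j \<ge> 1 then E (I * d + (j - 1)) else 0)) +
     (N * E c - (if I \<ge> 1 then E ((I - 1) * d + j) else 0))"
    unfolding Jblock_column_sum[OF c] one by (simp add: I_def j_def d_def)
  thus ?thesis using dvd_add[OF two three] by simp
qed

text \<open>Horner's scheme in the basis \<open>E\<close>: multiplication by \<open>t\<close> is the
  matrix \<open>Jblock m f\<close>, and a constant enters at position \<open>D - 1\<close> because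
  \<open>E (D - 1) = 1\<close>. The recursion refers to the matrix only, so it also serves any
  family of vectors on which an operator acts by this matrix.\<close>

fun coords :: "'a list \<Rightarrow> nat \<Rightarrow> 'a" where
  "coords [] = (\<lambda>r. 0)"
| "coords (b # p) = (\<lambda>r. (\<Sum>c<D. Jblock m f $$ (r, c) * coords p c) + (if r = D - 1 then b else 0))"

lemma coords_congruence:
  "f ^ m dvd Poly p - (\<Sum>c<D. Polynomial.smult (coords p c) (E c))"
proof (induction p)
  case (Cons b p)
  let ?t = "[:0, 1:] :: 'a poly"
  let ?S = "\<Sum>c<D. Polynomial.smult (coords p c) (E c)"
  let ?C = "\<lambda>c. \<Sum>r<D. Polynomial.smult (Jblock m f $$ (r, c)) (E r)"
  have a: "f ^ m dvd ?t * (Poly p - ?S)" using Cons by (rule dvd_mult)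
  have b: "f ^ m dvd (\<Sum>c<D. Polynomial.smult (coords p c) (?t * E c - ?C c))"
    by (intro dvd_sum dvd_smult blk_congruence) auto
  have "(\<Sum>c<D. Polynomial.smult (coords p c) (?t * E c - ?C c)) = ?t * ?S - (\<Sum>c<D. Polynomial.smult (coords p c) (?C c))"
    by (simp add: smult_diff_right sum_subtractf sum_distrib_left mult_smult_right del: mult_pCons_left)
  moreover have "(\<Sum>c<D. Polynomial.smult (coords p c) (?C c))
      = (\<Sum>r<D. Polynomial.smult (\<Sum>c<D. Jblock m f $$ (r, c) * coords p c) (E r))"
    unfolding poly_smult_sum smult_sum by (subst sum.swap) (simp add: mult.commute)
  moreover have "(\<Sum>r<D. Polynomial.smult (coords (b # p) r) (E r)) =
     (\<Sum>r<D. Polynomial.smult (\<Sum>c<D. Jblock m f $$ (r, c) * coords p c) (E r)) + [:b:]"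
  proof -
    have "(\<Sum>r<D. Polynomial.smult (if r = D - 1 then b else 0) (E r)) = (\<Sum>r<D. if r = D - 1 then Polynomial.smult b (E r) else 0)"
      by (intro sum.cong) auto
    also have "\<dots> = [:b:]" using D_pos by (simp add: blk_last del: One_nat_def)
    finally show ?thesis by (simp add: smult_add_left sum.distrib del: One_nat_def)
  qed
  moreover have "Poly (b # p) = [:b:] + ?t * Poly p" by simp
  ultimately have "Poly (b # p) - (\<Sum>r<D. Polynomial.smult (coords (b # p) r) (E r)) =
     ?t * (Poly p - ?S) + (\<Sum>c<D. Polynomial.smult (coords p c) (?t * E c - ?C c))"
    by (simp add: algebra_simps)
  then show ?case using dvd_add[OF a b] by simp
qed simp

text \<open>By counting: every residue modulo \<open>f^m\<close> has coordinates, so the map from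
  coordinate vectors to residues is surjective between sets of size \<open>CARD('a) ^ D\<close>,
  hence injective.\<close>

lemma blk_independent:
  assumes dv: "f ^ m dvd (\<Sum>c<D. Polynomial.smult (a c) (E c))" and c: "c < D"
  shows "a c = 0"
proof -
  let ?A = "{..<D} \<rightarrow>\<^sub>E (UNIV :: 'a set)"
  define \<Phi> where "\<Phi> = (\<lambda>a. (\<Sum>c<D. Polynomial.smult (a c) (E c)) mod f ^ m)"
  have fm: "f ^ m \<noteq> 0" using Phi_D[OF f] by simp
  have eq: "\<Phi> (restrict a {..<D}) = \<Phi> a" for a
    unfolding \<Phi>_def by (intro arg_cong[of _ _ "\<lambda>x. x mod f ^ m"] sum.cong) auto
  have "\<Phi> ` ?A = below_deg D"
  proof (intro equalityI subsetI)
    fix p assume "p \<in> \<Phi> ` ?A"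
    thus "p \<in> below_deg D" using mod_below_deg[OF fm] by (auto simp: \<Phi>_def degree_f_power)
  next
    fix p :: "'a poly" assume p: "p \<in> below_deg D"
    have "p = p mod f ^ m" using mod_below_deg_id[of p "f ^ m"] p by (simp add: degree_f_power)
    also have "\<dots> = \<Phi> (coords (coeffs p))"
      unfolding \<Phi>_def using coords_congruence[of "coeffs p"] by (simp add: mod_eq_dvd_iff)
    also have "\<dots> = \<Phi> (restrict (coords (coeffs p)) {..<D})" by (simp add: eq)
    finally show "p \<in> \<Phi> ` ?A" by auto
  qed
  moreover have "card ?A = CARD('a) ^ D" by (simp add: card_PiE)
  ultimately have "card (\<Phi> ` ?A) = card ?A" by (simp add: card_below_deg)
  hence inj: "inj_on \<Phi> ?A" by (intro eq_card_imp_inj_on finite_PiE) auto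
  have "\<Phi> (restrict a {..<D}) = \<Phi> (restrict (\<lambda>_. 0) {..<D})"
    unfolding eq using dv by (simp add: \<Phi>_def dvd_eq_mod_eq_0)
  hence "restrict a {..<D} = restrict (\<lambda>_. 0) {..<D}" by (rule inj_onD[OF inj]) auto
  from fun_cong[OF this, of c] c show ?thesis by simp
qed

text \<open>A vector in the kernel gives a combination of the \<open>E c\<close> that
  \<open>t\<close> annihilates modulo \<open>f^m\<close>. As \<open>f\<close> does not divide
  \<open>t\<close>, the combination itself vanishes. This is what makes the canonical forms
  invertible.\<close>

lemma Jblock_kernel:
  assumes J: "\<And>r. r < D \<Longrightarrow> (\<Sum>c<D. Jblock m f $$ (r, c) * a c) = 0" and c: "c < D"
  shows "a c = 0"
proof -
  let ?t = "[:0, 1:] :: 'a poly"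
  let ?C = "\<lambda>c. \<Sum>r<D. Polynomial.smult (Jblock m f $$ (r, c)) (E r)"
  have b: "f ^ m dvd (\<Sum>c<D. Polynomial.smult (a c) (?t * E c - ?C c))"
    by (intro dvd_sum dvd_smult blk_congruence) auto
  have "(\<Sum>c<D. Polynomial.smult (a c) (?t * E c - ?C c)) = ?t * (\<Sum>c<D. Polynomial.smult (a c) (E c)) - (\<Sum>c<D. Polynomial.smult (a c) (?C c))"
    by (simp add: smult_diff_right sum_subtractf sum_distrib_left mult_smult_right del: mult_pCons_left)
  moreover have "(\<Sum>c<D. Polynomial.smult (a c) (?C c)) = (\<Sum>r<D. Polynomial.smult (\<Sum>c<D. Jblock m f $$ (r, c) * a c) (E r))"
    unfolding poly_smult_sum smult_sum by (subst sum.swap) (simp add: mult.commute)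
  moreover have "\<dots> = 0" using J by simp
  ultimately have "f ^ m dvd ?t * (\<Sum>c<D. Polynomial.smult (a c) (E c))" using b by simp
  hence "f ^ m dvd (\<Sum>c<D. Polynomial.smult (a c) (E c))"
    by (rule irreducible_power_dvd_multD[OF Phi_D(1)[OF f] _ Phi_D(5)[OF f]])
  thus ?thesis using c by (rule blk_independent)
qed

end

lemma block_exponent_exists:
  assumes "f \<in> (Phi :: 'a::{field,finite} poly set)" "m \<ge> 1"
  shows "\<exists>Q. block_exponent f m Q"
proof -
  obtain Q where "Q \<ge> m" "\<And>p r :: 'a poly. (p + r) ^ Q = p ^ Q + r ^ Q"
    "\<And>c :: 'a. c ^ Q = c" "f dvd [:0, 1:] ^ Q - [:0, 1:]"
    using frobenius_exponent[OF Phi_D(1)[OF assms(1)], of m] by metis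
  thus ?thesis using assms by (intro exI[of _ Q]) (unfold_locales, auto)
qed

section \<open>Finite modules over the polynomial ring of a finite field\<close>

lemma below_deg_iff: "p \<in> below_deg k \<longleftrightarrow> p = 0 \<or> degree p < k"
  by (auto simp: below_deg_def intro: coeff_eq_0) (metis leI leading_coeff_0_iff)

lemma split_off_irreducible_power:
  fixes f p :: "'a::field poly"
  assumes f: "irreducible f" and p: "p \<noteq> 0"
  obtains a s where "p = f ^ a * s" "\<not> f dvd s"
  using p
proof (induction "degree p" arbitrary: p thesis rule: less_induct)
  case less
  show ?case
  proof (cases "f dvd p")
    case True
    then obtain r where r: "p = f * r" by (elim dvdE)
    with less(3) have "r \<noteq> 0" "degree p = degree f + degree r"
      using f by (auto intro!: degree_mult_eq)
    with degree_irreducible_pos[OF f] obtain a s where "r = f ^ a * s" "\<not> f dvd s"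
      using less(1)[of r] by auto
    thus ?thesis using less(2)[of "Suc a" s] r by (simp add: mult_ac)
  qed (use less(2)[of 0 p] in auto)
qed

text \<open>Counts the kernel of \<open>g^j\<close> on \<open>F[t]/(f^m)\<close>. A prime different
  from \<open>f\<close> acts invertibly; for \<open>g = f\<close> the kernel consists of the
  multiples of \<open>f ^ (m - min j m)\<close>, parametrized by their cofactors.\<close>

lemma card_power_annihilator:
  fixes f g :: "'a::{field,finite} poly"
  assumes f: "irreducible f" "lead_coeff f = 1" and g: "irreducible g" "lead_coeff g = 1"
  shows "card {p \<in> below_deg (degree f * m). f ^ m dvd g ^ j * p} =
    CARD('a) ^ (if f = g then degree g * min j m else 0)"
proof (cases "f = g")
  case False
  have "p = 0" if p: "p \<in> below_deg (degree f * m)" "f ^ m dvd g ^ j * p" for p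
  proof -
    have "\<not> f dvd g ^ j"
      using False monic_irreducible_dvd_imp_eq[OF f(1) g(1) f(2) g(2)] irreducible_dvd_powerD[OF f(1)] by blast
    hence "f ^ m dvd p" by (rule irreducible_power_dvd_multD[OF f(1) p(2)])
    moreover have "degree (f ^ m) = degree f * m" using f by (auto simp: degree_power_eq)
    ultimately show "p = 0" using p(1) dvd_imp_degree_le[of "f ^ m" p]
      by (cases "p = 0") (auto simp: below_deg_iff)
  qed
  hence "{p \<in> below_deg (degree f * m). f ^ m dvd g ^ j * p} = {0}"
    by (auto simp: below_deg_def)
  thus ?thesis using False by simp
next
  case True
  have f0: "f \<noteq> 0" using f by auto
  let ?k = "min j m"
  have iff: "f ^ m dvd f ^ j * p \<longleftrightarrow> f ^ (m - ?k) dvd p" for p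
  proof (cases "j \<le> m")
    case True
    hence "f ^ m = f ^ j * f ^ (m - j)" by (simp flip: power_add)
    thus ?thesis using True f0 by (simp add: min_def)
  next
    case False
    hence "f ^ m dvd f ^ j" by (intro le_imp_power_dvd) simp
    thus ?thesis using False by (simp add: min_def)
  qed
  have "{p \<in> below_deg (degree f * m). f ^ m dvd g ^ j * p} = (\<lambda>r. f ^ (m - ?k) * r) ` below_deg (degree f * ?k)"
  proof -
    have deg: "f ^ (m - ?k) * r \<in> below_deg (degree f * m) \<longleftrightarrow> r \<in> below_deg (degree f * ?k)" for r
    proof (cases "r = 0")
      case False
      have "degree (f ^ (m - ?k) * r) = degree f * (m - ?k) + degree r"
        using False f0 by (simp add: degree_mult_eq degree_power_eq mult.commute)
      moreover have "degree f * m = degree f * (m - ?k) + degree f * ?k"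
        by (simp flip: distrib_left)
      ultimately show ?thesis using False f0 by (simp add: below_deg_iff)
    qed (simp add: below_deg_def)
    show ?thesis unfolding True[symmetric] iff
    proof (intro equalityI subsetI)
      fix p assume p: "p \<in> {p \<in> below_deg (degree f * m). f ^ (m - ?k) dvd p}"
      then obtain r where r: "p = f ^ (m - ?k) * r" by (elim CollectE conjE dvdE)
      with p deg[of r] show "p \<in> (\<lambda>r. f ^ (m - ?k) * r) ` below_deg (degree f * ?k)" by blast
    next
      fix p assume "p \<in> (\<lambda>r. f ^ (m - ?k) * r) ` below_deg (degree f * ?k)"
      with deg show "p \<in> {p \<in> below_deg (degree f * m). f ^ (m - ?k) dvd p}" by auto
    qed
  qed
  moreover have "inj_on (\<lambda>r. f ^ (m - ?k) * r) A" for A using f0 by (intro inj_onI) simp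
  ultimately show ?thesis using True by (simp add: card_image card_below_deg)
qed

locale poly_module = Modules.module scale
  for scale :: "'a::{field,finite} poly \<Rightarrow> 'b::ab_group_add \<Rightarrow> 'b" (infixr "*s" 75)
begin

lemma scale_smult: "Polynomial.smult c p *s v = [:c:] *s p *s v"
  by simp

lemma const_scale_cancel: "c \<noteq> 0 \<Longrightarrow> [:inverse c:] *s [:c:] *s v = v"
  by (simp flip: one_pCons)

lemma dvd_annihilates: "p *s v = 0 \<Longrightarrow> p dvd r \<Longrightarrow> r *s v = 0"
  by (elim dvdE) (simp add: mult.commute[of p] flip: scale_scale)

lemma congruent_scale: "p *s v = 0 \<Longrightarrow> p dvd r - s \<Longrightarrow> r *s v = s *s v"
  using dvd_annihilates[of p v "r - s"] by (simp add: scale_left_diff_distrib)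

text \<open>Among all pairs of a nonconstant polynomial and an element of \<open>W\<close> outside
  \<open>U\<close> that it sends into \<open>U\<close>, take one of least degree. A proper
  factorization \<open>g = a * b\<close> would give a smaller pair, either \<open>b\<close> with
  \<open>y\<close> or \<open>a\<close> with \<open>b *s y\<close>.\<close>

lemma irreducible_torsion:
  assumes fin: "finite W" and W: "subspace W" and U: "subspace U" and UW: "U \<subseteq> W" "U \<noteq> W"
  obtains g y where "irreducible g" "lead_coeff g = 1" "y \<in> W" "y \<notin> U" "g *s y \<in> U"
proof -
  define T where "T = {(g, y). degree g > 0 \<and> y \<in> W \<and> y \<notin> U \<and> g *s y \<in> U}"
  obtain y0 where y0: "y0 \<in> W" "y0 \<notin> U" using UW by blast
  \<comment> \<open>Such pairs exist because infinitely many polynomials act on \<open>y0\<close>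
    with values in the finite \<open>W\<close>, so two of them agree.\<close>
  have "(\<lambda>p. p *s y0) ` UNIV \<subseteq> W" using subspace_scale[OF W y0(1)] by auto
  with fin have "finite (range (\<lambda>p. p *s y0))" by (rule finite_subset[rotated])
  moreover have "infinite (UNIV :: 'a poly set)"
  proof
    assume "finite (UNIV :: 'a poly set)"
    hence "finite (range (\<lambda>n. monom (1::'a) n))" by (rule finite_subset[rotated]) simp
    moreover have "inj (\<lambda>n. monom (1::'a) n)" by (intro injI) (simp add: monom_eq_iff')
    ultimately show False using finite_imageD infinite_UNIV_nat by blast
  qed
  ultimately have "\<not> inj (\<lambda>p. p *s y0)" using finite_imageD by blast
  then obtain p r where pr: "p \<noteq> r" "p *s y0 = r *s y0" by (auto simp: inj_def)
  have "(p - r) *s y0 \<in> U" using pr subspace_0[OF U] by (simp add: scale_left_diff_distrib)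
  moreover have "degree (p - r) > 0"
  proof (rule ccontr)
    assume "\<not> degree (p - r) > 0"
    then obtain c where c: "p - r = [:c:]" by (metis degree_eq_zeroE gr0I)
    with pr have "c \<noteq> 0" by auto
    with pr c const_scale_cancel[of c y0] have "y0 = 0"
      by (metis eq_iff_diff_eq_0 scale_left_diff_distrib scale_zero_right)
    thus False using y0 subspace_0[OF U] by simp
  qed
  ultimately have "(p - r, y0) \<in> T" using y0 by (simp add: T_def)
  then obtain gy where gy: "gy \<in> T" and min: "\<And>z. z \<in> T \<Longrightarrow> degree (fst gy) \<le> degree (fst z)"
    using arg_min_natI[of "\<lambda>h. h \<in> T" _ "\<lambda>z. degree (fst z)"]
      arg_min_nat_le[of "\<lambda>h. h \<in> T" _ "\<lambda>z. degree (fst z)"] by blast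
  obtain g y where gy_eq: "gy = (g, y)" by (cases gy)
  have g: "degree g > 0" "y \<in> W" "y \<notin> U" "g *s y \<in> U" using gy by (auto simp: T_def gy_eq)
  have "irreducible g"
  proof (rule irreducibleI)
    show "g \<noteq> 0" "\<not> g dvd 1" using g by (auto simp: is_unit_poly_iff)
    fix a b assume ab: "g = a * b"
    show "a dvd 1 \<or> b dvd 1"
    proof (rule ccontr)
      assume "\<not> (a dvd 1 \<or> b dvd 1)"
      moreover have "a \<noteq> 0" "b \<noteq> 0" using ab g by auto
      ultimately have d: "degree a > 0" "degree b > 0" "degree g = degree a + degree b"
        by (auto simp: is_unit_iff_degree ab degree_mult_eq)
      show False
      proof (cases "b *s y \<in> U")
        case True
        with g d have "(b, y) \<in> T" by (simp add: T_def)
        from min[OF this] d show False by (simp add: gy_eq)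
      next
        case False
        with g d have "(a, b *s y) \<in> T" using subspace_scale[OF W] by (simp add: T_def ab)
        from min[OF this] d show False by (simp add: gy_eq)
      qed
    qed
  qed
  moreover define c where "c = inverse (lead_coeff g)"
  moreover have c: "c \<noteq> 0" "c * lead_coeff g = 1" 
  proof -
    have "g \<noteq> 0" using g(1) by auto
    thus "c \<noteq> 0" "c * lead_coeff g = 1" by (simp_all add: c_def)
  qed
  moreover have "is_unit [:c:]" using c by (simp add: is_unit_const_poly_iff dvd_field_iff)
  ultimately have "irreducible (Polynomial.smult c g)" "lead_coeff (Polynomial.smult c g) = 1"
    using irreducible_mult_unit_left[of "[:c:]" g] by (simp_all add: lead_coeff_smult)
  moreover have "Polynomial.smult c g *s y \<in> U"
    unfolding scale_smult by (rule subspace_scale[OF U g(4)])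
  ultimately show ?thesis using g that by blast
qed

text \<open>Write \<open>q = f^a * s\<close> with \<open>s\<close> prime to \<open>f\<close>. If
  \<open>a < m\<close>, then \<open>f^(m-1) * s\<close> kills \<open>x\<close>, and a Bezout
  identity for \<open>s\<close> and \<open>f\<close> turns this into
  \<open>f^(m-1) *s x = 0\<close>, against the choice of \<open>m\<close>.\<close>

lemma exact_order_annihilator:
  assumes f: "irreducible f" and m: "f ^ m *s x = 0" "f ^ (m - 1) *s x \<noteq> 0" "m \<ge> 1"
  shows "q *s x = 0 \<longleftrightarrow> f ^ m dvd q"
proof
  assume q: "q *s x = 0"
  show "f ^ m dvd q"
  proof (cases "q = 0")
    case False
    then obtain a s where s: "q = f ^ a * s" "\<not> f dvd s" using split_off_irreducible_power[OF f] by blast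
    have "m \<le> a"
    proof (rule ccontr)
      assume "\<not> m \<le> a"
      hence "f ^ (m - 1) * s = f ^ (m - 1 - a) * q" by (simp add: s mult.assoc[symmetric] flip: power_add)
      hence 1: "(f ^ (m - 1) * s) *s x = 0" using q by (metis scale_scale scale_zero_right)
      obtain \<alpha> \<beta> where ab: "\<alpha> * s + \<beta> * f = 1" using bezout_irreducible[OF f s(2)] by blast
      have "f ^ (m - 1) = f ^ (m - 1) * (\<alpha> * s + \<beta> * f)" by (simp add: ab)
      also have "\<dots> = \<alpha> * (f ^ (m - 1) * s) + \<beta> * f ^ m"
        using m(3) by (cases m) (auto simp: algebra_simps)
      finally have "f ^ (m - 1) *s x = 0"
        using 1 m(1) by (metis scale_left_distrib scale_scale scale_zero_right add.right_neutral)
      with m(2) show False by simp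
    qed
    thus ?thesis by (simp add: s le_imp_power_dvd dvd_mult2)
  qed simp
qed (use dvd_annihilates m in blast)

lemma card_cyclic:
  assumes f: "irreducible f" and m: "f ^ m *s x = 0" "f ^ (m - 1) *s x \<noteq> 0" "m \<ge> 1"
  shows "card (span {x}) = CARD('a) ^ (m * degree f)"
proof -
  let ?A = "below_deg (m * degree f)"
  have f0: "f ^ m \<noteq> 0" using f by auto
  have deg: "degree (f ^ m) = m * degree f" using f by (auto simp: degree_power_eq)
  have "inj_on (\<lambda>p. p *s x) ?A"
  proof (rule inj_onI)
    fix p r assume p: "p \<in> ?A" and r: "r \<in> ?A" and eq: "p *s x = r *s x"
    hence "(p - r) *s x = 0" by (simp add: scale_left_diff_distrib)
    hence "f ^ m dvd p - r" using exact_order_annihilator[OF f m] by blast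
    hence "p mod f ^ m = r mod f ^ m" by (simp add: mod_eq_dvd_iff)
    thus "p = r" using mod_below_deg_id[of _ "f ^ m"] p r by (simp add: deg)
  qed
  moreover have "(\<lambda>p. p *s x) ` ?A = span {x}"
  proof -
    have "p *s x \<in> (\<lambda>p. p *s x) ` ?A" for p
    proof
      show "p *s x = (p mod f ^ m) *s x"
        by (rule congruent_scale[OF m(1)]) (simp add: mod_eq_dvd_iff flip: mod_eq_dvd_iff)
      show "p mod f ^ m \<in> ?A" using mod_below_deg[OF f0, of p] by (simp add: deg)
    qed
    thus ?thesis unfolding span_singleton by auto
  qed
  ultimately show ?thesis using card_image card_below_deg(2) by metis
qed

text \<open>The element \<open>x\<close> is of maximal order among the \<open>f\<close>-primary elements, and \<open>W'\<close> is a submodule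
  that is maximal with zero intersection with \<open>span {x}\<close>.\<close>

lemma split_off_cyclic:
  assumes fin: "finite W" and W: "subspace W" and nz: "W \<noteq> {0}"
  obtains f m x W' where "irreducible f" "lead_coeff f = 1" "m \<ge> 1" "x \<in> W" "f ^ m *s x = 0"
    "f ^ (m - 1) *s x \<noteq> 0" "subspace W'" "W' \<inter> span {x} = {0}" "W = span (insert x W')"
proof -
  have "{0} \<subseteq> W" using subspace_0[OF W] by simp
  then obtain f x0 where f: "irreducible f" "lead_coeff f = 1" and x0: "x0 \<in> W" "x0 \<noteq> 0" "f *s x0 = 0"
    using irreducible_torsion[OF fin W subspace_single_0] nz by (metis singletonD singletonI)
  define P where "P = {z \<in> W. \<exists>a. f ^ a *s z = 0}"
  define ord where "ord z = (LEAST a. f ^ a *s z = 0)" for z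
  have ord: "f ^ ord z *s z = 0" if "z \<in> P" for z
    using that unfolding ord_def P_def by (auto intro: LeastI)
  have "x0 \<in> P" using x0 by (auto simp: P_def intro: exI[of _ 1])
  moreover have "finite P" using fin by (simp add: P_def)
  ultimately have "Max (ord ` P) \<in> ord ` P" by (intro Max_in) auto
  then obtain x where x: "x \<in> P" "ord x = Max (ord ` P)" by auto
  define m where "m = ord x"
  have max: "f ^ m *s z = 0" if "z \<in> P" for z
  proof -
    have "ord z \<le> m" using that x \<open>finite P\<close> by (simp add: m_def)
    hence "f ^ ord z dvd f ^ m" by (rule le_imp_power_dvd)
    with ord[OF that] show ?thesis by (rule dvd_annihilates)
  qed
  have m1: "m \<ge> 1"
  proof (rule ccontr)
    assume "\<not> m \<ge> 1"
    hence "m = 0" by simp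
    with max[OF \<open>x0 \<in> P\<close>] x0 show False by simp
  qed
  have fm: "f ^ m *s x = 0" using ord[OF x(1)] by (simp add: m_def)
  have fm1: "f ^ (m - 1) *s x \<noteq> 0"
    using not_less_Least[of "m - 1" "\<lambda>a. f ^ a *s x = 0"] m1 unfolding m_def ord_def by auto
  have xW: "x \<in> W" using x by (simp add: P_def)
  define F where "F = {W'. subspace W' \<and> W' \<subseteq> W \<and> W' \<inter> span {x} = {0}}"
  have "finite F" by (rule finite_subset[of _ "Pow W"]) (use fin in \<open>auto simp: F_def\<close>)
  moreover have "{0} \<in> F" using subspace_0[OF W] span_zero by (auto simp: F_def)
  ultimately obtain W' where W': "W' \<in> F" and maxW: "\<And>B. B \<in> F \<Longrightarrow> W' \<subseteq> B \<Longrightarrow> W' = B"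
    using finite_has_maximal[of F] by blast
  have sW': "subspace W'" "W' \<subseteq> W" "W' \<inter> span {x} = {0}" using W' by (auto simp: F_def)
  define U where "U = span (insert x W')"
  have spW': "span W' = W'" using sW'(1) by (rule span_eq_iff[THEN iffD2])
  have U: "y \<in> U \<longleftrightarrow> (\<exists>k. y - k *s x \<in> W')" for y
    unfolding U_def span_insert spW' by simp
  have sU: "subspace U" by (simp add: U_def)
  have UW: "U \<subseteq> W" unfolding U_def using xW sW' W by (intro span_minimal) auto
  have W'U: "w \<in> U" if "w \<in> W'" for w using that by (simp add: U_def span_base)
  have xU: "x \<in> U" by (simp add: U_def span_base)
  have "U = W"
  proof (rule ccontr)
    assume "U \<noteq> W"
    then obtain g y where g: "irreducible g" "lead_coeff g = 1" and y: "y \<in> W" "y \<notin> U" "g *s y \<in> U"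
      using irreducible_torsion[OF fin W sU UW] by metis
    obtain p where p: "g *s y - p *s x \<in> W'" using y(3) U by blast
    \<comment> \<open>The heart of the argument: \<open>y\<close> can be corrected by a multiple of
      \<open>x\<close> so that \<open>g\<close> sends it into \<open>W'\<close>. For
      \<open>g = f\<close> the maximal order of \<open>x\<close> forces \<open>f\<close> to divide
      \<open>p\<close>; any other prime \<open>g\<close> is invertible modulo
      \<open>f^m\<close>.\<close>
    have "\<exists>p'. p *s x = (g * p') *s x"
    proof (cases "g = f")
      case True
      obtain P0 where P0: "P0 \<noteq> 0" "P0 *s y = 0"
      proof (cases "y = 0")
        case False
        have "finite (range (\<lambda>p. p *s y))"
          by (rule finite_subset[OF _ fin]) (use subspace_scale[OF W y(1)] in auto)
        moreover have "infinite (UNIV :: 'a poly set)"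
        proof
          assume "finite (UNIV :: 'a poly set)"
          hence "finite (range (\<lambda>n. monom (1::'a) n))" by (rule finite_subset[rotated]) simp
          moreover have "inj (\<lambda>n. monom (1::'a) n)" by (intro injI) (simp add: monom_eq_iff')
          ultimately show False using finite_imageD infinite_UNIV_nat by blast
        qed
        ultimately have "\<not> inj (\<lambda>p. p *s y)" using finite_imageD by blast
        then obtain p r where "p \<noteq> r" "p *s y = r *s y" by (auto simp: inj_def)
        thus ?thesis using that[of "p - r"] by (simp add: scale_left_diff_distrib)
      qed (use that[of 1] in simp)
      \<comment> \<open>Multiplying \<open>y\<close> by the part \<open>s\<close> of an annihilator
        that is prime to \<open>f\<close> yields an \<open>f\<close>-primary element, which
        \<open>f^m\<close> kills.\<close>
      obtain a s where s: "P0 = f ^ a * s" "\<not> f dvd s"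
        using split_off_irreducible_power[OF f(1) P0(1)] by blast
      have "s *s y \<in> P" using P0(2) y(1) subspace_scale[OF W] by (auto simp: P_def s)
      hence "f ^ m *s s *s y = 0" by (rule max)
      hence 0: "(f ^ (m - 1) * s) *s (f *s y) = 0"
        using m1 by (cases m) (simp_all add: mult_ac)
      have "(f ^ (m - 1) * s) *s (f *s y - p *s x) \<in> W'"
        using p True sW'(1) by (intro subspace_scale) auto
      hence "- ((f ^ (m - 1) * s) *s p *s x) \<in> W'" using 0 by (simp only: scale_right_diff_distrib diff_0)
      hence "(f ^ (m - 1) * s) *s p *s x \<in> W'" using subspace_neg[OF sW'(1)] by fastforce
      moreover have "(f ^ (m - 1) * s) *s p *s x \<in> span {x}" by (intro span_scale span_base) simp
      ultimately have "(f ^ (m - 1) * s * p) *s x = 0" using sW'(3) by auto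
      hence "f ^ m dvd f ^ (m - 1) * s * p" using exact_order_annihilator[OF f(1) fm fm1 m1] by blast
      moreover have "f ^ m = f ^ (m - 1) * f" using m1 by (cases m) auto
      ultimately have "f dvd s * p" using f by (auto simp: mult.assoc)
      hence "f dvd p" using irreducible_power_dvd_multD[OF f(1), of 1 s p] s(2) by simp
      thus ?thesis using True by (auto elim!: dvdE)
    next
      case False
      have "\<not> g dvd f ^ m"
        using False monic_irreducible_dvd_imp_eq[OF g(1) f(1) g(2) f(2)] irreducible_dvd_powerD[OF g(1)] by blast
      then obtain a b where ab: "a * f ^ m + b * g = 1" using bezout_irreducible[OF g(1)] by blast
      have "p = (a * p) * f ^ m + g * (b * p)" using arg_cong[OF ab, of "\<lambda>z. z * p"] by (simp add: algebra_simps)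
      hence "p *s x = (a * p) *s (f ^ m *s x) + (g * (b * p)) *s x" by (metis scale_left_distrib scale_scale)
      thus ?thesis using fm by auto
    qed
    then obtain p' where p': "p *s x = (g * p') *s x" by blast
    define y' where "y' = y - p' *s x"
    have gy': "g *s y' \<in> W'" using p by (simp add: y'_def scale_right_diff_distrib p')
    have y'U: "y' \<notin> U"
    proof
      assume "y' \<in> U"
      hence "y' + p' *s x \<in> U" using xU sU subspace_add subspace_scale by blast
      thus False using y(2) by (simp add: y'_def)
    qed
    \<comment> \<open>The larger \<open>W2\<close> still meets \<open>span {x}\<close> only in zero:
      a coefficient of \<open>y'\<close> divisible by \<open>g\<close> stays in \<open>W'\<close>,
      and any other one is invertible modulo \<open>g\<close> and would put \<open>y'\<close> into
      \<open>U\<close>. This contradicts the maximality of \<open>W'\<close>.\<close>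
    define W2 where "W2 = span (insert y' W')"
    have "W2 \<in> F"
    proof -
      have "y' \<in> W" using y(1) xW W by (simp add: y'_def subspace_diff subspace_scale)
      hence "W2 \<subseteq> W" unfolding W2_def using sW' W by (intro span_minimal) auto
      moreover have "v = 0" if v: "v \<in> W2" "v \<in> span {x}" for v
      proof -
        obtain k where k: "v - k *s y' \<in> W'"
          using v(1) unfolding W2_def span_insert spW' by auto
        show "v = 0"
        proof (cases "g dvd k")
          case True
          then obtain k' where "k = g * k'" by (rule dvdE)
          hence "k = k' * g" by (simp only: mult.commute)
          hence "k *s y' \<in> W'" using gy' sW'(1) subspace_scale by (metis scale_scale)
          hence "v \<in> W'" using k subspace_add[OF sW'(1)] by fastforce
          thus ?thesis using v(2) sW'(3) by auto
        next
          case False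
          then obtain a b where ab: "a * k + b * g = 1" using bezout_irreducible[OF g(1)] by blast
          obtain r where "v = r *s x" using v(2) by (auto simp: span_singleton)
          hence "v \<in> U" using xU sU subspace_scale by blast
          hence "v - (v - k *s y') \<in> U" using W'U[OF k] sU subspace_diff by blast
          hence 1: "k *s y' \<in> U" by simp
          have "y' = a *s k *s y' + b *s g *s y'" by (metis ab scale_left_distrib scale_one scale_scale)
          moreover have "\<dots> \<in> U"
            by (intro subspace_add[OF sU] subspace_scale[OF sU] 1 W'U[OF gy'])
          ultimately show ?thesis using y'U by simp
        qed
      qed
      ultimately show ?thesis unfolding F_def using span_zero by (auto simp: W2_def)
    qed
    moreover have "W' \<subseteq> W2" by (auto simp: W2_def span_base)
    ultimately have "W' = W2" by (rule maxW)
    moreover have "y' \<in> W2" by (simp add: W2_def span_base)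
    ultimately have "y' \<in> W'" by blast
    thus False using W'U y'U by blast
  qed
  thus ?thesis using that[OF f m1 xW fm fm1 sW'(1,3)] by (simp add: U_def)
qed

text \<open>Directness is encoded by the cardinality: the generators only satisfy
  \<open>f^m *s x = 0\<close>, so \<open>W\<close> is a quotient of the direct sum of the
  \<open>F[t]/(f^m)\<close>, and equality of sizes makes the quotient map an isomorphism.\<close>

definition decomp :: "'b set \<Rightarrow> ('b \<times> nat \<times> 'a poly) list \<Rightarrow> bool" where
  "decomp W D \<longleftrightarrow> (\<forall>(x, m, f) \<in> set D. m \<ge> 1 \<and> f \<in> Phi \<and> f ^ m *s x = 0) \<and>
     span (fst ` set D) = W \<and> card W = CARD('a) ^ (\<Sum>(x, m, f)\<leftarrow>D. m * degree f)"

lemma card_direct_sum: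
  assumes fin: "finite U" and U: "subspace U" and V: "subspace V" "finite V" and UV: "U \<inter> V = {0}"
  shows "card {u + v | u v. u \<in> U \<and> v \<in> V} = card U * card V"
proof -
  have "inj_on (\<lambda>(u, v). u + v) (U \<times> V)"
  proof (rule inj_onI, clarsimp)
    fix a b c d assume *: "a \<in> U" "b \<in> V" "c \<in> U" "d \<in> V" "a + b = c + d"
    hence "a - c = d - b" by (simp add: algebra_simps)
    moreover have "a - c \<in> U" "d - b \<in> V" using * U V by (auto intro: subspace_diff)
    ultimately have "a - c \<in> U \<inter> V" "d - b \<in> U \<inter> V" by auto
    hence "a - c = 0" "d - b = 0" unfolding UV by auto
    thus "a = c \<and> b = d" by simp
  qed
  moreover have "{u + v | u v. u \<in> U \<and> v \<in> V} = (\<lambda>(u, v). u + v) ` (U \<times> V)" by auto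
  ultimately show ?thesis by (simp add: card_image card_cartesian_product)
qed

text \<open>Induction on \<open>card W\<close>, splitting off a cyclic summand. Injectivity of
  \<open>t\<close> on \<open>W\<close> excludes the prime \<open>t\<close>, so that all primes lie
  in \<open>Phi\<close>.\<close>

theorem decomp_exists:
  assumes "finite W" "subspace W" "\<And>x. x \<in> W \<Longrightarrow> [:0, 1:] *s x = 0 \<Longrightarrow> x = 0"
  shows "\<exists>D. decomp W D"
  using assms
proof (induction "card W" arbitrary: W rule: less_induct)
  case less
  show ?case
  proof (cases "W = {0}")
    case True
    thus ?thesis by (intro exI[of _ "[]"]) (simp add: decomp_def)
  next
    case False
    then obtain f m x W' where f: "irreducible f" "lead_coeff f = 1" and m: "m \<ge> 1" and x: "x \<in> W"
      "f ^ m *s x = 0" "f ^ (m - 1) *s x \<noteq> 0" and W': "subspace W'" "W' \<inter> span {x} = {0}"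
      and WW: "W = span (insert x W')"
      using split_off_cyclic[OF less(2,3)] by metis
    have sub: "W' \<subseteq> W" using WW by (auto intro: span_base)
    have x0: "x \<noteq> 0" using x(3) by auto
    have "x \<notin> W'" using W'(2) x0 span_base[of x "{x}"] by auto
    hence "card W' < card W" using x sub less(2) by (intro psubset_card_mono) auto
    moreover have finW': "finite W'" using sub less(2) by (rule finite_subset)
    ultimately obtain D where D: "decomp W' D"
      using less(1)[OF _ _ W'(1)] less(4) sub by blast
    have fPhi: "f \<in> Phi"
    proof -
      have "f \<noteq> [:0, 1:]"
      proof
        assume t: "f = [:0, 1:]"
        have "f *s (f ^ (m - 1) *s x) = 0" using x(2) m by (cases m) auto
        moreover have "f ^ (m - 1) *s x \<in> W" using x(1) less(3) by (rule subspace_scale[rotated])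
        ultimately show False using less(4) x(3) t by blast
      qed
      thus ?thesis using f by (simp add: Phi_def)
    qed
    have spanx: "finite (span {x})" using x(1) less(2,3) by (intro finite_subset[OF span_minimal[of "{x}" W]]) auto
    have "W = {u + v | u v. u \<in> span {x} \<and> v \<in> W'}"
      unfolding WW using span_Un[of "{x}" W'] span_eq_iff[THEN iffD2, OF W'(1)] by simp
    hence "card W = card (span {x}) * card W'"
      using card_direct_sum[OF spanx _ W'(1) finW'] W'(2) by (simp add: Int_commute)
    also have "\<dots> = CARD('a) ^ (\<Sum>(x, m, f)\<leftarrow>(x, m, f) # D. m * degree f)"
      using card_cyclic[OF f(1) x(2,3) m] D by (simp add: decomp_def power_add)
    finally have card: "card W = CARD('a) ^ (\<Sum>(x, m, f)\<leftarrow>(x, m, f) # D. m * degree f)" .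
    have "span (fst ` set ((x, m, f) # D)) = W"
    proof -
      have "span (fst ` set D) = W'" using D by (simp add: decomp_def)
      moreover have "span W' = W'" using W'(1) by (rule span_eq_iff[THEN iffD2])
      ultimately show ?thesis unfolding WW by (simp only: span_insert list.simps image_insert fst_conv)
    qed
    hence "decomp W ((x, m, f) # D)"
      using D card fPhi m x(2) unfolding decomp_def by auto
    thus ?thesis by blast
  qed
qed

lemma decomp_mset:
  assumes "decomp W D" "mset D' = mset D"
  shows "decomp W D'"
proof -
  have "set D' = set D" using assms(2) by (metis set_mset_mset)
  moreover have "(\<Sum>(x, m, f)\<leftarrow>D'. m * degree f) = (\<Sum>(x, m, f)\<leftarrow>D. m * degree f)"
    by (simp only: sum_mset_sum_list[symmetric] mset_map assms(2))
  ultimately show ?thesis using assms(1) by (simp add: decomp_def)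
qed

lemma span_nth:
  assumes "v \<in> span (fst ` set D)"
  shows "\<exists>p. v = (\<Sum>i<length D. p i *s fst (D ! i))"
proof -
  let ?S = "range (\<lambda>p. \<Sum>i<length D. p i *s fst (D ! i))"
  have "subspace ?S"
  proof (rule subspaceI)
    show "0 \<in> ?S" by (rule range_eqI[of _ _ "\<lambda>_. 0"]) simp
    fix u v assume "u \<in> ?S" "v \<in> ?S"
    then obtain p r where "u = (\<Sum>i<length D. p i *s fst (D ! i))" "v = (\<Sum>i<length D. r i *s fst (D ! i))"
      by blast
    thus "u + v \<in> ?S"
      by (intro range_eqI[of _ _ "\<lambda>i. p i + r i"]) (simp add: scale_left_distrib sum.distrib)
  next
    fix c u assume "u \<in> ?S"
    then obtain p where "u = (\<Sum>i<length D. p i *s fst (D ! i))" by blast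
    thus "c *s u \<in> ?S" by (intro range_eqI[of _ _ "\<lambda>i. c * p i"]) (simp add: scale_sum_right)
  qed
  moreover have "fst ` set D \<subseteq> ?S"
  proof clarify
    fix x mf assume "(x, mf) \<in> set D"
    then obtain j where j: "j < length D" "D ! j = (x, mf)" by (auto simp: in_set_conv_nth)
    have "(\<Sum>i<length D. (if i = j then 1 else 0) *s fst (D ! i)) = (\<Sum>i<length D. if i = j then x else 0)"
      using j by (intro sum.cong) auto
    thus "fst (x, mf) \<in> ?S" using j by (intro range_eqI[of _ _ "\<lambda>i. if i = j then 1 else 0"]) simp
  qed
  ultimately have "span (fst ` set D) \<subseteq> ?S" by (intro span_minimal)
  thus ?thesis using assms by blast
qed

section \<open>Coordinates and counting with respect to a decomposition\<close>

context
  fixes W D assumes D: "decomp W D"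
begin

abbreviation "gen i \<equiv> fst (D ! i)"
abbreviation "expo i \<equiv> fst (snd (D ! i))"
abbreviation "prm i \<equiv> snd (snd (D ! i))"

lemma decomp_nth:
  assumes "i < length D"
  shows "expo i \<ge> 1" "prm i \<in> Phi" "prm i ^ expo i *s gen i = 0" "gen i \<in> W"
proof -
  have "D ! i \<in> set D" using assms by simp
  thus "expo i \<ge> 1" "prm i \<in> Phi" "prm i ^ expo i *s gen i = 0" "gen i \<in> W"
    using D unfolding decomp_def by (auto simp: split_beta intro: span_base)
qed

lemma decomp_subspace: "subspace W"
  using D unfolding decomp_def by (metis subspace_span)

lemma decomp_expand: "v \<in> W \<Longrightarrow> \<exists>p. v = (\<Sum>i<length D. p i *s gen i)"
  using D span_nth unfolding decomp_def by blast

definition coefficient_space :: "(nat \<Rightarrow> 'a poly) set" where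
  "coefficient_space = (\<Pi>\<^sub>E i\<in>{..<length D}. below_deg (degree (prm i) * expo i))"

lemma decomp_reduce:
  "\<exists>r\<in>coefficient_space. (\<forall>i<length D. r i = p i mod prm i ^ expo i) \<and>
     (\<Sum>i<length D. p i *s gen i) = (\<Sum>i<length D. r i *s gen i)"
proof -
  let ?r = "restrict (\<lambda>i. p i mod prm i ^ expo i) {..<length D}"
  have "?r \<in> coefficient_space" unfolding coefficient_space_def
  proof (rule restrict_PiE_iff[THEN iffD2], safe)
    fix i assume i: "i < length D"
    have "prm i ^ expo i \<noteq> 0" "degree (prm i ^ expo i) = degree (prm i) * expo i"
      using Phi_D[OF decomp_nth(2)[OF i]] by (auto simp: degree_power_eq)
    thus "p i mod prm i ^ expo i \<in> below_deg (degree (prm i) * expo i)"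
      using mod_below_deg by metis
  qed
  moreover have "p i *s gen i = ?r i *s gen i" if "i < length D" for i
  proof -
    have "prm i ^ expo i dvd p i - p i mod prm i ^ expo i"
      by (metis dvd_triv_right minus_mod_eq_div_mult)
    thus ?thesis using congruent_scale[OF decomp_nth(3)[OF that]] that by simp
  qed
  ultimately show ?thesis by (intro bexI[of _ ?r]) auto
qed

text \<open>Generation gives surjectivity; the cardinality clause of \<open>decomp\<close> then
  gives injectivity.\<close>

lemma decomp_bij:
  "bij_betw (\<lambda>p. \<Sum>i<length D. p i *s gen i) coefficient_space W"
proof -
  let ?f = "\<lambda>p. \<Sum>i<length D. p i *s gen i"
  have "?f ` coefficient_space = W"
  proof (intro equalityI subsetI)
    fix v assume "v \<in> ?f ` coefficient_space"
    thus "v \<in> W" using decomp_nth(4) decomp_subspace by (auto intro!: subspace_sum subspace_scale)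
  next
    fix v assume "v \<in> W"
    then obtain p where "v = ?f p" using decomp_expand by blast
    thus "v \<in> ?f ` coefficient_space" using decomp_reduce[of p] by auto
  qed
  moreover have "card coefficient_space = card W"
  proof -
    have "card coefficient_space = (\<Prod>i<length D. CARD('a) ^ (degree (prm i) * expo i))"
      unfolding coefficient_space_def by (simp add: card_PiE card_below_deg)
    also have "\<dots> = CARD('a) ^ (\<Sum>i<length D. expo i * degree (prm i))"
      by (simp add: power_sum mult.commute)
    also have "(\<Sum>i<length D. expo i * degree (prm i)) = (\<Sum>(x, m, f)\<leftarrow>D. m * degree f)"
      by (simp add: sum_list_sum_nth split_beta atLeast0LessThan)
    finally show ?thesis using D by (simp add: decomp_def)
  qed
  moreover have "finite coefficient_space"
    unfolding coefficient_space_def by (intro finite_PiE) (auto simp: card_below_deg)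
  ultimately show ?thesis by (auto simp: bij_betw_def intro: eq_card_imp_inj_on)
qed

lemma decomp_zero_iff:
  "(\<Sum>i<length D. p i *s gen i) = 0 \<longleftrightarrow> (\<forall>i<length D. prm i ^ expo i dvd p i)"
proof
  assume 0: "(\<Sum>i<length D. p i *s gen i) = 0"
  obtain r where r: "r \<in> coefficient_space" "\<And>i. i < length D \<Longrightarrow> r i = p i mod prm i ^ expo i"
    "(\<Sum>i<length D. p i *s gen i) = (\<Sum>i<length D. r i *s gen i)"
    using decomp_reduce[of p] by blast
  obtain z where z: "z \<in> coefficient_space" "\<And>i. i < length D \<Longrightarrow> z i = 0 mod prm i ^ expo i"
    "(\<Sum>i<length D. 0 *s gen i) = (\<Sum>i<length D. z i *s gen i)"
    using decomp_reduce[of "\<lambda>_. 0"] by blast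
  have "inj_on (\<lambda>p. \<Sum>i<length D. p i *s gen i) coefficient_space"
    using decomp_bij by (simp add: bij_betw_def)
  from inj_onD[OF this _ r(1) z(1)] have "r = z" using 0 r(3) z(3) by simp
  thus "\<forall>i<length D. prm i ^ expo i dvd p i" using r(2) z(2) by (auto simp: dvd_eq_mod_eq_0)
next
  assume "\<forall>i<length D. prm i ^ expo i dvd p i"
  thus "(\<Sum>i<length D. p i *s gen i) = 0"
    using dvd_annihilates[OF decomp_nth(3)] by (intro sum.neutral) auto
qed

text \<open>The kernel of \<open>g^j\<close> is the product of the kernels on the cyclic summands.
  The left side does not mention the decomposition, so these sizes determine the multiplicities of
  its blocks.\<close>

lemma card_kernel:
  assumes g: "irreducible g" "lead_coeff g = 1"
  shows "card {w \<in> W. g ^ j *s w = 0} = CARD('a) ^ (\<Sum>(x, m, f)\<leftarrow>D. if f = g then degree g * min j m else 0)"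
proof -
  let ?f = "\<lambda>p. \<Sum>i<length D. p i *s gen i"
  let ?K = "\<lambda>i. {p \<in> below_deg (degree (prm i) * expo i). prm i ^ expo i dvd g ^ j * p}"
  have ker: "g ^ j *s ?f p = 0 \<longleftrightarrow> (\<forall>i<length D. prm i ^ expo i dvd g ^ j * p i)" for p
    using decomp_zero_iff[of "\<lambda>i. g ^ j * p i"] by (simp add: scale_sum_right)
  have bij: "bij_betw ?f {p \<in> coefficient_space. g ^ j *s ?f p = 0} {w \<in> W. g ^ j *s w = 0}"
    using decomp_bij by (auto simp: bij_betw_def inj_on_def)
  have eq: "{p \<in> coefficient_space. g ^ j *s ?f p = 0} = (\<Pi>\<^sub>E i\<in>{..<length D}. ?K i)"
  proof (rule Set.set_eqI)
    fix p
    have "p \<in> {p \<in> coefficient_space. g ^ j *s ?f p = 0} \<longleftrightarrow>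
        p \<in> coefficient_space \<and> (\<forall>i<length D. prm i ^ expo i dvd g ^ j * p i)"
      unfolding mem_Collect_eq ker ..
    also have "\<dots> \<longleftrightarrow> p \<in> (\<Pi>\<^sub>E i\<in>{..<length D}. ?K i)"
      unfolding coefficient_space_def PiE_iff by blast
    finally show "p \<in> {p \<in> coefficient_space. g ^ j *s ?f p = 0} \<longleftrightarrow> p \<in> (\<Pi>\<^sub>E i\<in>{..<length D}. ?K i)" .
  qed
  have "card {w \<in> W. g ^ j *s w = 0} = card (\<Pi>\<^sub>E i\<in>{..<length D}. ?K i)"
    unfolding eq[symmetric] by (rule bij_betw_same_card[OF bij, symmetric])
  hence "card {w \<in> W. g ^ j *s w = 0} = (\<Prod>i<length D. card (?K i))"
    by (simp only: card_PiE[OF finite_lessThan])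
  also have "\<dots> = (\<Prod>i<length D. CARD('a) ^ (if prm i = g then degree g * min j (expo i) else 0))"
    by (rule prod.cong[OF refl], rule card_power_annihilator[OF Phi_D(1)[OF decomp_nth(2)]
          Phi_D(2)[OF decomp_nth(2)] g]) (simp_all only: lessThan_iff)
  also have "\<dots> = CARD('a) ^ (\<Sum>i<length D. if prm i = g then degree g * min j (expo i) else 0)"
    by (simp add: power_sum)
  also have "(\<Sum>i<length D. if prm i = g then degree g * min j (expo i) else 0) =
      (\<Sum>(x, m, f)\<leftarrow>D. if f = g then degree g * min j m else 0)"
    by (simp add: sum_list_sum_nth split_beta atLeast0LessThan)
  finally show ?thesis .
qed

text \<open>Adding an element of \<open>(t - 1) W\<close> changes the coefficient at the generator
  \<open>x\<close> into \<open>1 + (t - 1) p\<close>, which is prime to \<open>t - 1\<close>, so the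
  order cannot drop below that of \<open>x\<close>. This is the source of the uniqueness of
  \<open>k\<close>.\<close>

lemma generator_order:
  assumes x: "(x, k, tm1) \<in> set D" and w: "w \<in> W" and 0: "tm1 ^ j *s (x + tm1 *s w) = 0"
  shows "k \<le> j"
proof -
  obtain i0 where i0: "i0 < length D" "D ! i0 = (x, k, tm1)" using x by (auto simp: in_set_conv_nth)
  obtain p where p: "w = (\<Sum>i<length D. p i *s gen i)" using decomp_expand[OF w] by blast
  let ?r = "\<lambda>i. tm1 ^ j * ((if i = i0 then 1 else 0) + tm1 * p i)"
  have "(\<Sum>i<length D. (if i = i0 then 1 else 0) *s gen i) = (\<Sum>i<length D. if i = i0 then x else 0)"
    using i0 by (intro sum.cong) auto
  hence "x = (\<Sum>i<length D. (if i = i0 then 1 else 0) *s gen i)" using i0 by simp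
  hence "x + tm1 *s w = (\<Sum>i<length D. ((if i = i0 then 1 else 0) + tm1 * p i) *s gen i)"
    by (simp only: p scale_sum_right scale_left_distrib sum.distrib scale_scale)
  hence "(\<Sum>i<length D. ?r i *s gen i) = 0" using 0 by (simp only: scale_sum_right flip: scale_scale)
  hence dv: "tm1 ^ k dvd (1 + tm1 * p i0) * tm1 ^ j" using decomp_zero_iff[of ?r] i0 by (auto simp: mult.commute)
  have "\<not> tm1 dvd 1 + tm1 * p i0"
  proof
    assume "tm1 dvd 1 + tm1 * p i0"
    hence "tm1 dvd (1 :: 'a poly)" by (metis dvd_add_left_iff dvd_triv_left)
    thus False by (auto simp: is_unit_poly_iff)
  qed
  hence "tm1 ^ k dvd (tm1 :: 'a poly) ^ j"
    using irreducible_power_dvd_multD[OF Phi_D(1)[OF tm1_Phi] dv] by blast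
  hence "degree ((tm1 :: 'a poly) ^ k) \<le> degree ((tm1 :: 'a poly) ^ j)" by (intro dvd_imp_degree_le) auto
  thus ?thesis by (simp add: degree_power_eq)
qed

text \<open>Modulo \<open>(t - 1) W\<close> an element is a combination of the generators of \<open>(t - 1)\<close>-power
  order; if it is nonzero, it can replace a generator of maximal order that occurs in it.\<close>

lemma decomp_adapt:
  assumes \<alpha>: "\<alpha> \<in> W"
  shows "\<exists>w\<in>W. \<alpha> = tm1 *s w \<or>
    (\<exists>D' x k. decomp W D' \<and> mset (map snd D') = mset (map snd D) \<and> (x, k, tm1) \<in> set D' \<and> \<alpha> = tm1 *s w + x)"
proof -
  obtain p where p: "\<alpha> = (\<Sum>i<length D. p i *s gen i)" using decomp_expand[OF \<alpha>] by blast
  \<comment> \<open>At a generator of \<open>(t - 1)\<close>-power order the remainder of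
    \<open>p i\<close> modulo \<open>t - 1\<close> is a constant \<open>c\<close>; at any other
    generator \<open>t - 1\<close> acts invertibly, so the whole term is a multiple of
    \<open>t - 1\<close> and \<open>c = 0\<close>.\<close>
  have "\<exists>r c. p i *s gen i = tm1 *s r *s gen i + [:c:] *s gen i \<and> (c \<noteq> 0 \<longrightarrow> prm i = tm1)"
    if i: "i < length D" for i
  proof (cases "prm i = tm1")
    case True
    obtain c where c: "p i mod tm1 = [:c:]"
      using degree_mod_less[of tm1 "p i"] by (metis degree_eq_zeroE degree_0 degree_pCons_eq_if less_one one_neq_zero pCons_eq_0_iff One_nat_def)
    have "p i = tm1 * (p i div tm1) + [:c:]" unfolding c[symmetric] by (rule mult_div_mod_eq[symmetric])
    hence "p i *s gen i = tm1 *s (p i div tm1) *s gen i + [:c:] *s gen i"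
      by (metis scale_left_distrib scale_scale)
    thus ?thesis using True by blast
  next
    case False
    have "\<not> tm1 dvd prm i ^ expo i"
      using False monic_irreducible_dvd_imp_eq[OF Phi_D(1)[OF tm1_Phi] Phi_D(1)[OF decomp_nth(2)[OF i]]
          Phi_D(2)[OF tm1_Phi] Phi_D(2)[OF decomp_nth(2)[OF i]]]
        irreducible_dvd_powerD[OF Phi_D(1)[OF tm1_Phi]] by metis
    then obtain a b where ab: "a * prm i ^ expo i + b * tm1 = 1"
      using bezout_irreducible[OF Phi_D(1)[OF tm1_Phi]] by metis
    have "p i = (p i * a) * prm i ^ expo i + tm1 * (p i * b)"
      using arg_cong[OF ab, of "\<lambda>z. p i * z"] by (simp add: algebra_simps del: mult_pCons_left mult_pCons_right)
    hence "p i *s gen i = (p i * a) *s prm i ^ expo i *s gen i + tm1 *s (p i * b) *s gen i"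
      by (metis scale_left_distrib scale_scale)
    hence "p i *s gen i = tm1 *s (p i * b) *s gen i + [:0:] *s gen i" using decomp_nth(3)[OF i] by simp
    thus ?thesis by blast
  qed
  then obtain r c where rc: "\<And>i. i < length D \<Longrightarrow> p i *s gen i = tm1 *s r i *s gen i + [:c i:] *s gen i"
    and irr: "\<And>i. i < length D \<Longrightarrow> c i \<noteq> 0 \<Longrightarrow> prm i = tm1" by metis
  define w where "w = (\<Sum>i<length D. r i *s gen i)"
  have wW: "w \<in> W" unfolding w_def using decomp_nth(4) decomp_subspace by (auto intro!: subspace_sum subspace_scale)
  define S where "S = {i. i < length D \<and> c i \<noteq> 0}"
  define x where "x = (\<Sum>i\<in>S. [:c i:] *s gen i)"
  have "x = (\<Sum>i<length D. [:c i:] *s gen i)"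
    unfolding x_def S_def by (intro sum.mono_neutral_left) auto
  moreover have "\<alpha> = (\<Sum>i<length D. tm1 *s r i *s gen i + [:c i:] *s gen i)"
    unfolding p by (intro sum.cong refl) (simp only: rc lessThan_iff)
  ultimately have \<alpha>_eq: "\<alpha> = tm1 *s w + x"
    by (simp only: w_def scale_sum_right sum.distrib)
  show ?thesis
  proof (cases "S = {}")
    case True
    thus ?thesis using \<alpha>_eq wW by (auto simp: x_def)
  next
    case False
    have finS: "finite S" by (simp add: S_def)
    hence "Max (expo ` S) \<in> expo ` S" using False by (intro Max_in) auto
    \<comment> \<open>Maximality of the exponent among the occurring generators keeps
      \<open>x\<close> annihilated by \<open>tm1 ^ expo j\<close>, so the replacement leaves the
      list of blocks unchanged.\<close>
    then obtain j where j: "j \<in> S" "expo j = Max (expo ` S)" by auto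
    have max: "expo i \<le> expo j" if "i \<in> S" for i using that finS j by simp
    have jl: "j < length D" and cj: "c j \<noteq> 0" and irrj: "prm j = tm1" using j irr by (auto simp: S_def)
    define D' where "D' = D[j := (x, expo j, tm1)]"
    have snd: "map snd D' = map snd D"
      unfolding D'_def map_update using irrj jl by (metis list_update_id nth_map prod.collapse snd_conv)
    have xW: "x \<in> W" unfolding x_def S_def
      using decomp_nth(4) decomp_subspace by (auto intro!: subspace_sum subspace_scale)
    have x0: "tm1 ^ expo j *s x = 0" unfolding x_def scale_sum_right
    proof (intro sum.neutral ballI)
      fix i assume i: "i \<in> S"
      hence "prm i = tm1" using irr by (auto simp: S_def)
      moreover have "prm i ^ expo i *s gen i = 0" using i decomp_nth(3) by (simp add: S_def)
      ultimately have "tm1 ^ expo i *s gen i = 0" by metis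
      hence "tm1 ^ expo j *s gen i = 0"
        using max[OF i] by (metis dvd_annihilates le_imp_power_dvd)
      thus "tm1 ^ expo j *s [:c i:] *s gen i = 0" by (simp only: scale_left_commute[of _ "[:c i:]"] scale_zero_right)
    qed
    have len: "length D' = length D" by (simp add: D'_def)
    have gen: "gen i \<in> span (fst ` set D')" if i: "i < length D" "i \<noteq> j" for i
    proof -
      have "D' ! i = D ! i" using i by (simp add: D'_def)
      thus ?thesis using i len by (metis imageI nth_mem span_base)
    qed
    have xin: "(x, expo j, tm1) \<in> set D'" using jl by (simp add: D'_def set_update_memI)
    have xsp: "x \<in> span (fst ` set D')" using xin by (force intro: span_base)
    have genj: "gen j \<in> span (fst ` set D')"
    proof -
      have "x = [:c j:] *s gen j + (\<Sum>i\<in>S - {j}. [:c i:] *s gen i)"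
        unfolding x_def using finS j(1) by (rule sum.remove)
      hence "[:c j:] *s gen j = x - (\<Sum>i\<in>S - {j}. [:c i:] *s gen i)" by simp
      also have "\<dots> \<in> span (fst ` set D')"
        using xsp gen by (auto intro!: span_diff span_sum span_scale simp: S_def)
      finally have "[:inverse (c j):] *s [:c j:] *s gen j \<in> span (fst ` set D')" by (rule span_scale)
      thus ?thesis using const_scale_cancel[OF cj] by simp
    qed
    have "span (fst ` set D') = W"
    proof (rule subset_antisym)
      have "fst ` set D' \<subseteq> W"
      proof -
        have "fst ` set D' \<subseteq> insert x (fst ` set D)"
          using image_mono[OF set_update_subset_insert[of D j "(x, expo j, tm1)"], of fst] by (simp add: D'_def)
        moreover have "fst ` set D \<subseteq> W" using D span_superset[of "fst ` set D"] by (simp add: decomp_def)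
        ultimately show ?thesis using xW by blast
      qed
      thus "span (fst ` set D') \<subseteq> W" using decomp_subspace by (rule span_minimal)
      have "fst ` set D \<subseteq> span (fst ` set D')"
      proof
        fix y assume "y \<in> fst ` set D"
        then obtain i where "i < length D" "y = gen i" by (auto simp: in_set_conv_nth image_iff)
        thus "y \<in> span (fst ` set D')" using gen genj by metis
      qed
      hence "span (fst ` set D) \<subseteq> span (fst ` set D')" by (rule span_minimal) simp
      thus "W \<subseteq> span (fst ` set D')" using D by (simp add: decomp_def)
    qed
    moreover have "(\<Sum>(x, m, f)\<leftarrow>D'. m * degree f) = (\<Sum>(x, m, f)\<leftarrow>D. m * degree f)"
    proof -
      have "(\<Sum>(x, m, f)\<leftarrow>E. m * degree f) = sum_list (map (\<lambda>(m, f). m * degree f) (map snd E))"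
        for E :: "('b \<times> nat \<times> 'a poly) list" by (induction E) auto
      thus ?thesis by (simp only: snd)
    qed
    moreover have "m \<ge> 1 \<and> f \<in> Phi \<and> f ^ m *s z = 0" if "(z, m, f) \<in> set D'" for z m f
    proof (cases "(z, m, f) = (x, expo j, tm1)")
      case True
      thus ?thesis using x0 tm1_Phi decomp_nth(1)[OF jl] by simp
    next
      case False
      moreover have "(z, m, f) \<in> insert (x, expo j, tm1) (set D)"
        using that set_update_subset_insert[of D j "(x, expo j, tm1)"] unfolding D'_def by blast
      ultimately have "(z, m, f) \<in> set D" by blast
      thus ?thesis using D by (auto simp: decomp_def)
    qed
    ultimately have "decomp W D'" using D by (auto simp: decomp_def)
    thus ?thesis using wW \<alpha>_eq xin snd by metis
  qed
qed

end

end

section \<open>Cyclic modules and families on which t acts by a block\<close>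

context block_exponent
begin

lemma block_basis_action:
  assumes "poly_module scale" and x: "scale (f ^ m) x = 0" and c: "c < D"
  shows "scale [:0, 1:] (scale (E c) x) = (\<Sum>r<D. scale [:Jblock m f $$ (r, c):] (scale (E r) x))"
proof -
  interpret poly_module scale by fact
  have "scale ([:0, 1:] * E c) x = scale (\<Sum>r<D. Polynomial.smult (Jblock m f $$ (r, c)) (E r)) x"
    by (rule congruent_scale[OF x blk_congruence[OF c]])
  thus ?thesis by (simp only: scale_sum_left scale_smult scale_scale[symmetric])
qed

text \<open>Converse of \<open>block_basis_action\<close>. Since \<open>coords\<close> follows the
  matrix alone, any polynomial applied to the last vector is the combination of the
  \<open>v c\<close> with these coordinates. By \<open>blk_independent\<close> all of them vanish
  for \<open>f^m\<close>, and for \<open>E c\<close> they are those of a unit vector.\<close>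

lemma block_basis_cyclic:
  assumes "poly_module scale"
    and v: "\<And>c. c < D \<Longrightarrow> scale [:0, 1:] (v c) = (\<Sum>r<D. scale [:Jblock m f $$ (r, c):] (v r))"
  shows "scale (f ^ m) (v (D - 1)) = 0" "c < D \<Longrightarrow> v c = scale (E c) (v (D - 1))"
proof -
  interpret poly_module scale by fact
  let ?x = "v (D - 1)" and ?t = "[:0, 1:] :: 'a poly"
  have P: "scale (Poly p) ?x = (\<Sum>c<D. scale [:coords p c:] (v c))" for p
  proof (induction p)
    case (Cons b p)
    have "scale (Poly (b # p)) ?x = scale [:b:] ?x + scale ?t (scale (Poly p) ?x)"
      by (simp flip: scale_scale scale_left_distrib del: scale_scale) (simp flip: scale_left_distrib)
    also have "scale ?t (scale (Poly p) ?x) = (\<Sum>c<D. scale [:coords p c:] (scale ?t (v c)))"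
      unfolding Cons scale_sum_right by (simp only: scale_left_commute[of ?t])
    also have "\<dots> = (\<Sum>c<D. \<Sum>r<D. scale [:Jblock m f $$ (r, c) * coords p c:] (v r))"
      by (intro sum.cong refl) (simp add: v scale_sum_right mult.commute)
    also have "\<dots> = (\<Sum>r<D. scale [:\<Sum>c<D. Jblock m f $$ (r, c) * coords p c:] (v r))"
      by (subst sum.swap) (simp flip: scale_sum_left add: sum_to_poly)
    also have "scale [:b:] ?x = (\<Sum>r<D. scale [:if r = D - 1 then b else 0:] (v r))"
    proof -
      have "(\<Sum>r<D. scale [:if r = D - 1 then b else 0:] (v r)) = (\<Sum>r<D. if r = D - 1 then scale [:b:] (v r) else 0)"
        by (intro sum.cong) auto
      thus ?thesis using D_pos by (simp del: One_nat_def)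
    qed
    finally show ?case
      by (simp add: sum.distrib[symmetric] scale_left_distrib[symmetric] add.commute del: One_nat_def)
  qed simp
  have P': "scale p ?x = (\<Sum>c<D. scale [:coords (coeffs p) c:] (v c))" for p
    using P[of "coeffs p"] by simp
  have fm: "f ^ m dvd (\<Sum>c<D. Polynomial.smult (coords (coeffs (f ^ m)) c) (E c))"
    using coords_congruence[of "coeffs (f ^ m)"] by (metis Poly_coeffs dvd_diff_right_iff dvd_refl)
  have "coords (coeffs (f ^ m)) c = 0" if "c < D" for c by (rule blk_independent[OF fm that])
  thus "scale (f ^ m) ?x = 0" unfolding P' by simp
  assume c: "c < D"
  have "(\<Sum>r<D. Polynomial.smult (if r = c then 1 else 0) (E r)) = (\<Sum>r<D. if r = c then E r else 0)"
    by (intro sum.cong) auto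
  hence Ec: "E c = (\<Sum>r<D. Polynomial.smult (if r = c then 1 else 0) (E r))" using c by simp
  have "f ^ m dvd E c - (\<Sum>r<D. Polynomial.smult (coords (coeffs (E c)) r) (E r))"
    using coords_congruence[of "coeffs (E c)"] by simp
  hence "f ^ m dvd (\<Sum>r<D. Polynomial.smult ((if r = c then 1 else 0) - coords (coeffs (E c)) r) (E r))"
    by (subst (asm) (1) Ec) (simp only: smult_diff_left sum_subtractf)
  from blk_independent[OF this] have "coords (coeffs (E c)) r = (if r = c then 1 else 0)" if "r < D" for r
    using that by fastforce
  hence "scale (E c) ?x = (\<Sum>r<D. scale [:if r = c then 1 else 0:] (v r))" unfolding P' by simp
  also have "\<dots> = (\<Sum>r<D. if r = c then v r else 0)" by (intro sum.cong) (auto simp flip: one_pCons)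
  finally show "v c = scale (E c) ?x" using c by simp
qed

end

section \<open>Matrices as operators\<close>

text \<open>Matrices act on the functions \<open>nat \<Rightarrow> 'a\<close>, trivially on the coordinates beyond their size, so
  that a matrix and its extension by an identity block are the same operator.\<close>

definition vscale :: "'a::comm_ring_1 \<Rightarrow> (nat \<Rightarrow> 'a) \<Rightarrow> nat \<Rightarrow> 'a" where
  "vscale c v = (\<lambda>i. c * v i)"

lemma vscale_simps [simp]:
  "vscale c (u + v) = vscale c u + vscale c v" "vscale (c + d) v = vscale c v + vscale d v"
  "vscale c (vscale d v) = vscale (c * d) v" "vscale 1 v = v" "vscale 0 v = 0" "vscale c 0 = 0"
  by (auto simp: vscale_def fun_eq_iff algebra_simps)

lemma fun_sum_apply: "(\<Sum>i\<in>I. (g i :: 'x \<Rightarrow> 'y::comm_monoid_add)) x = (\<Sum>i\<in>I. g i x)"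
  by (induction I rule: infinite_finite_induct) auto

lemma vscale_sum: "vscale c (\<Sum>i\<in>I. g i) = (\<Sum>i\<in>I. vscale c (g i))"
  by (rule Modules.additive.sum[where f = "vscale c"]) (simp add: Modules.additive_def)

text \<open>The value \<open>p(T) v\<close> by Horner's scheme. It makes the space of all functions
  an \<open>F[t]\<close>-module for any linear operator; the finite modules arise as submodules such
  as \<open>vecs0 n\<close>.\<close>

definition op_scale :: "((nat \<Rightarrow> 'a) \<Rightarrow> nat \<Rightarrow> 'a) \<Rightarrow> 'a::field poly \<Rightarrow> (nat \<Rightarrow> 'a) \<Rightarrow> nat \<Rightarrow> 'a" where
  "op_scale T p v = fold_coeffs (\<lambda>c w. vscale c v + T w) p 0"

locale linear_operator =
  fixes T :: "(nat \<Rightarrow> 'a) \<Rightarrow> nat \<Rightarrow> 'a::{field,finite}"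
  assumes T_add: "T (u + v) = T u + T v" and T_vscale: "T (vscale c v) = vscale c (T v)"
begin

lemma T_zero: "T 0 = 0"
  using T_vscale[of 0 0] by simp

lemma T_sum: "T (\<Sum>i\<in>I. g i) = (\<Sum>i\<in>I. T (g i))"
  by (rule Modules.additive.sum[where f = T]) (simp add: Modules.additive_def T_add)

lemma op_scale_pCons: "op_scale T (pCons c p) v = vscale c v + T (op_scale T p v)"
  by (cases "p = 0 \<and> c = 0") (auto simp: op_scale_def T_zero)

lemma op_scale_0: "op_scale T 0 v = 0"
  by (simp add: op_scale_def)

sublocale poly_module "op_scale T"
proof unfold_locales
  fix p r :: "'a poly" and u v
  show "op_scale T p (u + v) = op_scale T p u + op_scale T p v"
    by (rule pCons_induct[where P = "\<lambda>p. op_scale T p (u + v) = op_scale T p u + op_scale T p v"])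
      (auto simp: op_scale_0 op_scale_pCons T_add add_ac)
  show add: "op_scale T (p + r) v = op_scale T p v + op_scale T r v" for p r v
    by (rule poly_induct2[where P = "\<lambda>p r. op_scale T (p + r) v = op_scale T p v + op_scale T r v"])
      (auto simp: op_scale_0 op_scale_pCons T_add add_ac)
  have smult: "op_scale T (Polynomial.smult c p) v = vscale c (op_scale T p v)" for c p v
    by (rule pCons_induct[where P = "\<lambda>p. op_scale T (Polynomial.smult c p) v = vscale c (op_scale T p v)"])
      (auto simp: op_scale_0 op_scale_pCons T_vscale)
  show "op_scale T p (op_scale T r v) = op_scale T (p * r) v"
    by (rule pCons_induct[where P = "\<lambda>p. op_scale T p (op_scale T r v) = op_scale T (p * r) v"])
      (auto simp: op_scale_0 op_scale_pCons add smult)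
  show "op_scale T 1 v = v"
    by (simp add: one_pCons op_scale_pCons op_scale_0 T_zero)
qed

lemma op_scale_const: "op_scale T [:c:] v = vscale c v"
  by (simp add: op_scale_pCons op_scale_0 T_zero)

lemma op_scale_t: "op_scale T [:0, 1:] v = T v"
  by (simp add: op_scale_pCons op_scale_0 T_zero)

lemma op_scale_tm1: "op_scale T tm1 v = T v - v"
  by (simp add: op_scale_pCons op_scale_0 T_zero vscale_def fun_eq_iff)

lemma subspace_op:
  assumes "0 \<in> S" "\<And>u v. u \<in> S \<Longrightarrow> v \<in> S \<Longrightarrow> u + v \<in> S" "\<And>c v. v \<in> S \<Longrightarrow> vscale c v \<in> S"
    "\<And>v. v \<in> S \<Longrightarrow> T v \<in> S"
  shows "subspace S"
proof (rule subspaceI)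
  fix p v assume v: "v \<in> S"
  show "op_scale T p v \<in> S"
    by (rule pCons_induct[where P = "\<lambda>p. op_scale T p v \<in> S"])
      (use assms v in \<open>auto simp: op_scale_0 op_scale_pCons\<close>)
qed (use assms in auto)

end

definition act :: "nat \<Rightarrow> 'a::comm_ring_1 mat \<Rightarrow> (nat \<Rightarrow> 'a) \<Rightarrow> nat \<Rightarrow> 'a" where
  "act n A v = (\<lambda>i. if i < n then \<Sum>j<n. A $$ (i, j) * v j else v i)"

interpretation act: linear_operator "act n A" for n and A :: "'a::{field,finite} mat"
  by unfold_locales
    (auto simp: act_def vscale_def fun_eq_iff sum_distrib_left algebra_simps simp flip: sum.distrib)

abbreviation "mod_scale n A \<equiv> op_scale (act n A)"

lemma act_mult:
  assumes "A \<in> carrier_mat n n" "B \<in> carrier_mat n n"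
  shows "act n (A * B) v = act n A (act n B v)"
proof
  fix i
  show "act n (A * B) v i = act n A (act n B v) i"
  proof (cases "i < n")
    case True
    have "act n (A * B) v i = (\<Sum>j<n. \<Sum>k<n. A $$ (i, k) * B $$ (k, j) * v j)"
      using True assms by (auto simp: act_def scalar_prod_def sum_distrib_right atLeast0LessThan intro!: sum.cong)
    also have "\<dots> = (\<Sum>k<n. A $$ (i, k) * (\<Sum>j<n. B $$ (k, j) * v j))"
      by (subst sum.swap) (simp add: sum_distrib_left mult.assoc)
    finally show ?thesis using True by (simp add: act_def)
  qed (simp add: act_def)
qed

lemma act_one: "act n (1\<^sub>m n) v = v"
proof
  fix i
  have "(\<Sum>j<n. 1\<^sub>m n $$ (i, j) * v j) = (\<Sum>j<n. if j = i then v j else 0)" if "i < n"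
    using that by (intro sum.cong) auto
  thus "act n (1\<^sub>m n) v i = v i" by (simp add: act_def)
qed

definition unitv :: "nat \<Rightarrow> nat \<Rightarrow> 'a::comm_ring_1" where
  "unitv j = (\<lambda>i. if i = j then 1 else 0)"

lemma act_unitv: "j < n \<Longrightarrow> i < n \<Longrightarrow> act n A (unitv j) i = A $$ (i, j)"
proof -
  assume "j < n" "i < n"
  moreover have "(\<Sum>l<n. A $$ (i, l) * (if l = j then 1 else 0)) = (\<Sum>l<n. if l = j then A $$ (i, l) else 0)"
    by (intro sum.cong) auto
  ultimately show ?thesis by (simp add: act_def unitv_def)
qed

lemma act_inj:
  assumes "A \<in> carrier_mat n n" "B \<in> carrier_mat n n" "\<And>v. act n A v = act n B v"
  shows "A = B"
proof (rule eq_matI)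
  fix i j assume "i < dim_row B" "j < dim_col B"
  hence "i < n" "j < n" using assms by auto
  thus "A $$ (i, j) = B $$ (i, j)" using act_unitv[of j n i A] act_unitv[of j n i B] assms(3) by simp
qed (use assms in auto)

section \<open>The affine group\<close>

lemma invertible_mat_iff_det:
  assumes A: "(A :: 'a::field mat) \<in> carrier_mat n n"
  shows "invertible_mat A \<longleftrightarrow> det A \<noteq> 0"
proof
  assume "invertible_mat A"
  then obtain B where AB: "A * B = 1\<^sub>m n" "B * A = 1\<^sub>m (dim_row B)"
    using A by (auto simp: invertible_mat_def inverts_mat_def)
  have "dim_col (A * B) = n" "dim_col (B * A) = dim_row B" unfolding AB by simp_all
  hence "B \<in> carrier_mat n n" using A by auto
  hence "det A * det B = 1" using det_mult[OF A, of B] AB(1) by simp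
  thus "det A \<noteq> 0" by auto
next
  assume "det A \<noteq> 0"
  from det_non_zero_imp_unit[OF A this] obtain B where "B \<in> carrier_mat n n" "A * B = 1\<^sub>m n" "B * A = 1\<^sub>m n"
    by (auto simp: Units_def ring_mat_def)
  thus "invertible_mat A" using A by (auto simp: invertible_mat_def inverts_mat_def)
qed

lemma GA_simps [simp]: "\<one>\<^bsub>GA n\<^esub> = 1\<^sub>m n" "A \<otimes>\<^bsub>GA n\<^esub> B = A * B"
  by (simp_all add: GA_def)

text \<open>Replaces the block form by conditions on the first row and the determinant, which are
  easily verified for products, inverses and matrices assembled from columns.\<close>

lemma GA_iff:
  assumes n: "n \<ge> 1"
  shows "A \<in> carrier (GA n) \<longleftrightarrow>
    A \<in> carrier_mat n n \<and> (\<forall>j<n. A $$ (0, j) = (if j = 0 then 1 else 0)) \<and> det A \<noteq> 0"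
proof
  assume "A \<in> carrier (GA n)"
  then obtain \<alpha> g where A: "A = four_block_mat (1\<^sub>m 1) (0\<^sub>m 1 (n - 1)) \<alpha> g"
    and \<alpha>: "\<alpha> \<in> carrier_mat (n - 1) 1" and g: "g \<in> carrier_mat (n - 1) (n - 1)" "invertible_mat g"
    by (auto simp: GA_def)
  have "det A = det (1\<^sub>m 1 :: 'a mat) * det g"
    unfolding A by (rule det_four_block_mat_upper_right_zero[OF _ _ \<alpha> g(1)]) auto
  moreover have "A \<in> carrier_mat (1 + (n - 1)) (1 + (n - 1))" unfolding A using g by (intro four_block_carrier_mat) auto
  moreover have "A $$ (0, j) = (if j = 0 then 1 else 0)" if "j < n" for j
    using that n g \<alpha> by (subst A, subst index_mat_four_block) auto
  ultimately show "A \<in> carrier_mat n n \<and> (\<forall>j<n. A $$ (0, j) = (if j = 0 then 1 else 0)) \<and> det A \<noteq> 0"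
    using n g invertible_mat_iff_det[OF g(1)] by simp
next
  assume A: "A \<in> carrier_mat n n \<and> (\<forall>j<n. A $$ (0, j) = (if j = 0 then 1 else 0)) \<and> det A \<noteq> 0"
  define \<alpha> where "\<alpha> = mat (n - 1) 1 (\<lambda>(i, _). A $$ (i + 1, 0))"
  define g where "g = mat (n - 1) (n - 1) (\<lambda>(i, j). A $$ (i + 1, j + 1))"
  have car: "\<alpha> \<in> carrier_mat (n - 1) 1" "g \<in> carrier_mat (n - 1) (n - 1)" by (auto simp: \<alpha>_def g_def)
  have eq: "A = four_block_mat (1\<^sub>m 1) (0\<^sub>m 1 (n - 1)) \<alpha> g"
  proof (rule eq_matI)
    show "dim_row A = dim_row (four_block_mat (1\<^sub>m 1) (0\<^sub>m 1 (n - 1)) \<alpha> g)"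
      "dim_col A = dim_col (four_block_mat (1\<^sub>m 1) (0\<^sub>m 1 (n - 1)) \<alpha> g)" using A n car by auto
    fix i j assume "i < dim_row (four_block_mat (1\<^sub>m 1) (0\<^sub>m 1 (n - 1)) \<alpha> g)"
      "j < dim_col (four_block_mat (1\<^sub>m 1) (0\<^sub>m 1 (n - 1)) \<alpha> g)"
    hence ij: "i < n" "j < n" using n car by auto
    thus "A $$ (i, j) = four_block_mat (1\<^sub>m 1) (0\<^sub>m 1 (n - 1)) \<alpha> g $$ (i, j)"
      using A n car by (cases i; cases j) (auto simp: \<alpha>_def g_def)
  qed
  have "det A = det (1\<^sub>m 1 :: 'a mat) * det g"
    unfolding eq by (rule det_four_block_mat_upper_right_zero[OF _ _ car]) auto
  hence "invertible_mat g" using A invertible_mat_iff_det[OF car(2)] by simp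
  thus "A \<in> carrier (GA n)" using car eq by (auto simp: GA_def)
qed

lemma GA_D:
  assumes "n \<ge> 1" "A \<in> carrier (GA n)"
  shows "A \<in> carrier_mat n n" "\<And>j. j < n \<Longrightarrow> A $$ (0, j) = (if j = 0 then 1 else 0)" "det A \<noteq> 0"
  using assms GA_iff by blast+

lemma row0_mult:
  assumes "n \<ge> 1" "A \<in> carrier_mat n n" "B \<in> carrier_mat n n"
    "\<And>j. j < n \<Longrightarrow> A $$ (0, j) = (if j = 0 then 1 else 0)" "j < n"
  shows "(A * B) $$ (0, j) = (B $$ (0, j) :: 'a::comm_ring_1)"
proof -
  have "(A * B) $$ (0, j) = (\<Sum>k<n. (if k = 0 then 1 else 0) * B $$ (k, j))"
    using assms by (auto simp: scalar_prod_def atLeast0LessThan intro!: sum.cong)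
  also have "\<dots> = (\<Sum>k<n. if k = 0 then B $$ (k, j) else 0)" by (intro sum.cong) auto
  finally show ?thesis using assms by simp
qed

lemma GA_group: assumes n: "n \<ge> 1" shows "group (GA n :: 'a::field mat monoid)"
proof (rule groupI)
  show "\<one>\<^bsub>GA n\<^esub> \<in> carrier (GA n :: 'a mat monoid)" using n by (simp add: GA_iff)
  fix x y z :: "'a mat" assume x: "x \<in> carrier (GA n)"
  note xD = GA_D[OF n x]
  show "\<one>\<^bsub>GA n\<^esub> \<otimes>\<^bsub>GA n\<^esub> x = x" using xD by simp
  show "\<exists>y\<in>carrier (GA n). y \<otimes>\<^bsub>GA n\<^esub> x = \<one>\<^bsub>GA n\<^esub>"
  proof -
    from det_non_zero_imp_unit[OF xD(1,3)] obtain B where B: "B \<in> carrier_mat n n" "x * B = 1\<^sub>m n" "B * x = 1\<^sub>m n"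
      by (auto simp: Units_def ring_mat_def)
    have "det x * det B = 1" using det_mult[OF xD(1) B(1)] B(2) by simp
    moreover have "B $$ (0, j) = (if j = 0 then 1 else 0)" if "j < n" for j
      using row0_mult[OF n xD(1) B(1) xD(2) that] B(2) that n by simp
    ultimately have "B \<in> carrier (GA n)" using n B by (auto simp: GA_iff)
    thus ?thesis using B by auto
  qed
  assume y: "y \<in> carrier (GA n)"
  note yD = GA_D[OF n y]
  show "x \<otimes>\<^bsub>GA n\<^esub> y \<in> carrier (GA n)"
    using n xD yD row0_mult[OF n xD(1) yD(1) xD(2)] det_mult[OF xD(1) yD(1)] by (simp add: GA_iff)
  assume z: "z \<in> carrier (GA n)"
  show "x \<otimes>\<^bsub>GA n\<^esub> y \<otimes>\<^bsub>GA n\<^esub> z = x \<otimes>\<^bsub>GA n\<^esub> (y \<otimes>\<^bsub>GA n\<^esub> z)"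
    using xD yD GA_D[OF n z] by (simp add: assoc_mult_mat)
qed

lemma finite_GA: "n \<ge> 1 \<Longrightarrow> finite (carrier (GA n :: 'a::{field,finite} mat monoid))"
proof -
  assume n: "n \<ge> 1"
  let ?F = "\<lambda>g. mat n n (\<lambda>ij. g ij) :: 'a mat"
  have "A \<in> ?F ` (({..<n} \<times> {..<n}) \<rightarrow>\<^sub>E UNIV)" if "A \<in> carrier (GA n)" for A :: "'a mat"
  proof
    show "restrict (\<lambda>ij. A $$ ij) ({..<n} \<times> {..<n}) \<in> ({..<n} \<times> {..<n}) \<rightarrow>\<^sub>E UNIV" by auto
    show "A = ?F (restrict (\<lambda>ij. A $$ ij) ({..<n} \<times> {..<n}))"
      using GA_D(1)[OF n that] by (intro eq_matI) auto
  qed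
  hence "carrier (GA n) \<subseteq> ?F ` (({..<n} \<times> {..<n}) \<rightarrow>\<^sub>E (UNIV :: 'a set))" by blast
  thus ?thesis by (rule finite_subset) (intro finite_imageI finite_PiE, auto)
qed

section \<open>Column vectors and the invariant hyperplane\<close>

definition vecs :: "nat \<Rightarrow> (nat \<Rightarrow> 'a::zero) set" where
  "vecs n = {v. \<forall>i\<ge>n. v i = 0}"

text \<open>The hyperplane invariant under \<open>GA n\<close>. A matrix acts on it through its
  lower right block in \<open>GL_{n-1}\<close>, so the partition part of the type is read off from
  the module \<open>vecs0 n\<close>.\<close>

definition vecs0 :: "nat \<Rightarrow> (nat \<Rightarrow> 'a::zero) set" where
  "vecs0 n = {v \<in> vecs n. v 0 = 0}"

lemma card_vecs: "finite (vecs n :: (nat \<Rightarrow> 'a::{field,finite}) set)"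
  "card (vecs n :: (nat \<Rightarrow> 'a::{field,finite}) set) = CARD('a) ^ n"
proof -
  have "vecs n = coeff ` (below_deg n :: 'a poly set)"
  proof (intro equalityI subsetI)
    fix v :: "nat \<Rightarrow> 'a" assume v: "v \<in> vecs n"
    have "coeff (\<Sum>i<n. monom (v i) i) j = v j" for j
      using v by (cases "j < n") (auto simp: coeff_sum vecs_def)
    hence "v = coeff (\<Sum>i<n. monom (v i) i)" by auto
    with v show "v \<in> coeff ` (below_deg n)"
      unfolding below_deg_def vecs_def by (intro image_eqI[of _ _ "\<Sum>i<n. monom (v i) i"]) auto
  qed (auto simp: vecs_def below_deg_def)
  moreover have "inj_on coeff (below_deg n :: 'a poly set)" by (meson coeff_inject inj_onI)
  ultimately show "finite (vecs n :: (nat \<Rightarrow> 'a) set)" "card (vecs n :: (nat \<Rightarrow> 'a) set) = CARD('a) ^ n"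
    using card_below_deg[of n, where 'a = 'a] by (simp_all add: card_image)
qed

lemma card_vecs0:
  assumes "n \<ge> 1"
  shows "finite (vecs0 n :: (nat \<Rightarrow> 'a::{field,finite}) set)"
    "card (vecs0 n :: (nat \<Rightarrow> 'a::{field,finite}) set) = CARD('a) ^ (n - 1)"
proof -
  let ?s = "\<lambda>(v :: nat \<Rightarrow> 'a) i. case i of 0 \<Rightarrow> 0 | Suc i \<Rightarrow> v i"
  have "vecs0 n = ?s ` vecs (n - 1)"
  proof (intro equalityI subsetI)
    fix v :: "nat \<Rightarrow> 'a" assume v: "v \<in> vecs0 n"
    have "v = ?s (\<lambda>i. v (Suc i))" using v by (auto simp: vecs0_def fun_eq_iff split: nat.split)
    moreover have "(\<lambda>i. v (Suc i)) \<in> vecs (n - 1)" using v by (auto simp: vecs0_def vecs_def)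
    ultimately show "v \<in> ?s ` vecs (n - 1)" by blast
  qed (use assms in \<open>auto simp: vecs0_def vecs_def split: nat.split\<close>)
  moreover have "inj_on ?s (vecs (n - 1))"
  proof (rule inj_onI)
    fix u v assume "?s u = ?s v"
    from fun_cong[OF this, of "Suc _"] show "u = v" by auto
  qed
  ultimately show "finite (vecs0 n :: (nat \<Rightarrow> 'a) set)" "card (vecs0 n :: (nat \<Rightarrow> 'a) set) = CARD('a) ^ (n - 1)"
    using card_vecs[of "n - 1", where 'a = 'a] by (simp_all add: card_image)
qed

lemma act_vecs: "v \<in> vecs n \<Longrightarrow> act n A v \<in> vecs n"
  by (auto simp: act_def vecs_def)

lemma act_row0:
  assumes "n \<ge> 1" "A \<in> carrier (GA n)"
  shows "act n A v 0 = v 0"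
proof -
  have "(\<Sum>j<n. A $$ (0, j) * v j) = (\<Sum>j<n. if j = 0 then v j else 0)"
    using GA_D(2)[OF assms] by (intro sum.cong) auto
  thus ?thesis using assms(1) by (simp add: act_def)
qed

lemma act_injective:
  fixes A :: "'a::{field,finite} mat"
  assumes "n \<ge> 1" "A \<in> carrier (GA n)" "act n A v = 0" shows "v = 0"
proof -
  interpret group "GA n" by (rule GA_group[OF assms(1)])
  have "inv\<^bsub>GA n\<^esub> A \<in> carrier (GA n)" "inv\<^bsub>GA n\<^esub> A * A = 1\<^sub>m n"
    using assms(2) l_inv[OF assms(2)] by auto
  hence v: "v = act n (inv\<^bsub>GA n\<^esub> A) (act n A v)"
    using act_mult[OF GA_D(1)[OF assms(1)] GA_D(1)[OF assms(1)], of "inv\<^bsub>GA n\<^esub> A" A v] assms(2)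
    by (simp add: act_one)
  show ?thesis by (subst v) (simp add: assms(3) act.T_zero)
qed

lemma vecs0_subspace: "n \<ge> 1 \<Longrightarrow> A \<in> carrier (GA n) \<Longrightarrow> act.subspace n A (vecs0 n)"
  by (rule act.subspace_op) (auto simp: vecs0_def act_row0 act_vecs, auto simp: vecs_def vscale_def)

section \<open>Types as lists of blocks\<close>

definition type_of :: "(nat \<times> 'a poly) list \<Rightarrow> 'a::field ptype" where
  "type_of L = (\<lambda>f. image_mset fst (filter_mset (\<lambda>p. snd p = f) (mset L)))"

lemma type_of_Nil: "type_of [] f = {#}"
  by (simp add: type_of_def)

lemma type_of_Cons: "type_of ((m, g) # L) f = (if g = f then add_mset m (type_of L f) else type_of L f)"
  by (simp add: type_of_def)

lemma count_type_of: "count (type_of L f) m = count (mset L) (m, f)"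
  by (induction L) (auto simp: type_of_Nil type_of_Cons split: if_splits)

lemma type_of_eq_iff: "type_of L = type_of L' \<longleftrightarrow> mset L = mset L'"
proof
  assume "type_of L = type_of L'"
  hence "count (mset L) (m, f) = count (mset L') (m, f)" for m f
    by (simp flip: count_type_of)
  thus "mset L = mset L'" by (intro multiset_eqI) auto
qed (simp add: type_of_def)

lemma in_type_of: "m \<in># type_of L f \<longleftrightarrow> (m, f) \<in> set L"
  by (metis count_type_of count_greater_zero_iff set_mset_mset)

lemma finite_type_of: "finite {f. type_of L f \<noteq> {#}}" "{f. type_of L f \<noteq> {#}} \<subseteq> snd ` set L"
proof -
  show s: "{f. type_of L f \<noteq> {#}} \<subseteq> snd ` set L"
  proof
    fix f assume "f \<in> {f. type_of L f \<noteq> {#}}"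
    then obtain m where "m \<in># type_of L f" by (auto elim: multiset_nonemptyE)
    thus "f \<in> snd ` set L" unfolding in_type_of by force
  qed
  show "finite {f. type_of L f \<noteq> {#}}" by (rule finite_subset[OF s]) simp
qed

lemma pnorm_superset:
  assumes "finite S" "{f. lam f \<noteq> {#}} \<subseteq> S"
  shows "pnorm lam = (\<Sum>f\<in>S. degree f * sum_mset (lam f))"
  unfolding pnorm_def by (rule sum.mono_neutral_left) (use assms in auto)

lemma pnorm_type_of: "pnorm (type_of L) = (\<Sum>(m, f)\<leftarrow>L. m * degree f)"
proof -
  have "(\<Sum>f\<in>S. degree f * sum_mset (type_of L f)) = (\<Sum>(m, f)\<leftarrow>L. m * degree f)"
    if "finite S" "snd ` set L \<subseteq> S" for S
    using that(2)
  proof (induction L)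
    case (Cons p L)
    obtain m g where p: "p = (m, g)" by (cases p)
    have "(\<Sum>f\<in>S. degree f * sum_mset (type_of (p # L) f)) =
      (\<Sum>f\<in>S. (if f = g then m * degree g else 0) + degree f * sum_mset (type_of L f))"
      by (intro sum.cong) (auto simp: p type_of_Cons algebra_simps)
    also have "\<dots> = m * degree g + (\<Sum>f\<in>S. degree f * sum_mset (type_of L f))"
      using Cons.prems that(1) by (simp add: sum.distrib p)
    finally show ?case using Cons p by simp
  qed (simp add: type_of_Nil)
  from this[of "snd ` set L"] show ?thesis
    using pnorm_superset[OF _ finite_type_of(2), of L] by simp
qed

lemma type_of_PPhi: "(\<And>m f. (m, f) \<in> set L \<Longrightarrow> m \<ge> 1 \<and> f \<in> Phi) \<Longrightarrow> type_of L \<in> PPhi"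
  unfolding PPhi_def using finite_type_of[of L]
  by (auto simp: in_type_of)

text \<open>The blocks of \<open>Jmat lam\<close> in their actual order, including the same choice
  of enumeration, so that the canonical form can be matched with an ordered list of
  generators.\<close>

definition blocks :: "'a::field ptype \<Rightarrow> (nat \<times> 'a poly) list" where
  "blocks lam =
    concat (map (\<lambda>i. replicate (count (lam tm1) i) (i, tm1)) [1..<Suc (Max (insert 0 (set_mset (lam tm1))))]) @
    concat (map (\<lambda>f. map (\<lambda>m. (m, f)) (rev (sorted_list_of_multiset (lam f))))
      (SOME fs. distinct fs \<and> set fs = {f. f \<noteq> tm1 \<and> lam f \<noteq> {#}}))"

lemma diag_block_mat_append':
  "diag_block_mat (As @ [diag_block_mat Bs]) = diag_block_mat (As @ Bs)"
  by (simp only: diag_block_mat_append diag_block_mat_singleton)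

lemma diag_block_mat_concat:
  "diag_block_mat (map diag_block_mat Ass @ Cs) = diag_block_mat (concat Ass @ Cs)"
proof (induction Ass)
  case (Cons As Ass)
  thus ?case
    by (simp add: diag_block_mat_append[of As] Let_def)
qed simp

lemma Jmat_blocks: "Jmat lam = diag_block_mat (map (\<lambda>(m, f). Jblock m f) (blocks lam))"
proof -
  let ?r = "Max (insert 0 (set_mset (lam tm1)))"
  have "Jmat lam = diag_block_mat (map diag_block_mat
      (map (\<lambda>i. replicate (count (lam tm1) i) (Jblock i tm1)) [1..<Suc ?r]) @ [Jminus lam])"
    by (simp add: Jmat_def Let_def Eblock_def[abs_def] o_def)
  also have "\<dots> = diag_block_mat (map (\<lambda>(m, f). Jblock m f) (blocks lam))"
    unfolding diag_block_mat_concat Jminus_def Let_def diag_block_mat_append' blocks_def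
    by (simp add: map_concat o_def)
  finally show ?thesis .
qed

lemma type_of_blocks:
  assumes lam: "lam \<in> PPhi"
  shows "type_of (blocks lam) = lam"
proof (rule ext)
  fix f
  let ?M = "Max (insert 0 (set_mset (lam tm1)))"
  define fs where "fs = (SOME fs. distinct fs \<and> set fs = {f. f \<noteq> tm1 \<and> lam f \<noteq> {#}})"
  have "finite {f. f \<noteq> tm1 \<and> lam f \<noteq> {#}}"
    by (rule finite_subset[of _ "{f. lam f \<noteq> {#}}"]) (use lam in \<open>auto simp: PPhi_def\<close>)
  from finite_distinct_list[OF this] have fs: "distinct fs" "set fs = {f. f \<noteq> tm1 \<and> lam f \<noteq> {#}}"
    unfolding fs_def by (metis (mono_tags, lifting) someI_ex)+
  have c1: "count (mset (concat (map (\<lambda>i. replicate (c i) (i, tm1)) [1..<r]))) (m, f) =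
      (if f = tm1 \<and> 1 \<le> m \<and> m < r then c m else 0)" for c :: "nat \<Rightarrow> nat" and r m and f :: "'a poly"
    by (induction r) auto
  have c3: "count (mset (map (\<lambda>m. (m, g)) ys)) (m, f) = (if f = g then count (mset ys) m else 0)"
    for m ys and f g :: "'a poly" by (induction ys) auto
  have c2: "count (mset (concat (map (\<lambda>f. map (\<lambda>m. (m, f)) (ys f)) fs))) (m, f) =
      (if f \<in> set fs then count (mset (ys f)) m else 0)" if "distinct fs"
    for ys m fs and f :: "'a poly"
    using that by (induction fs) (auto simp: c3 simp del: mset_map)
  show "type_of (blocks lam) f = lam f"
  proof (rule multiset_eqI)
    fix m
    have *: "count (type_of (blocks lam) f) m =
      (if f = tm1 \<and> 1 \<le> m \<and> m < Suc ?M then count (lam tm1) m else 0) +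
      (if f \<in> set fs then count (mset (rev (sorted_list_of_multiset (lam f)))) m else 0)"
      unfolding count_type_of blocks_def fs_def[symmetric] mset_append count_union c1 c2[OF fs(1)] ..
    show "count (type_of (blocks lam) f) m = count (lam f) m"
    proof (cases "f = tm1")
      case True
      hence 1: "f \<notin> set fs" using fs(2) by simp
      have 2: "\<not> (1 \<le> m \<and> m < Suc ?M) \<Longrightarrow> m \<notin># lam tm1"
      proof
        assume *: "\<not> (1 \<le> m \<and> m < Suc ?M)" and m: "m \<in># lam tm1"
        have "m \<le> ?M" using m by (intro Max_ge) auto
        with * have "m = 0" by linarith
        with m lam show False by (simp add: PPhi_def)
      qed
      show ?thesis
      proof (cases "1 \<le> m \<and> m < Suc ?M")
        case True thus ?thesis unfolding * using 1 \<open>f = tm1\<close> by simp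
      next
        case False thus ?thesis unfolding * using 1 \<open>f = tm1\<close> 2 by (simp add: not_in_iff)
      qed
    next
      case False
      show ?thesis
      proof (cases "f \<in> set fs")
        case True thus ?thesis unfolding * using False by simp
      next
        case nfs: False
        hence "lam f = {#}" using fs(2) False by auto
        thus ?thesis unfolding * using False nfs by simp
      qed
    qed
  qed
qed

lemma in_blocks:
  assumes "lam \<in> PPhi" "(m, f) \<in> set (blocks lam)"
  shows "m \<ge> 1" "f \<in> Phi"
proof -
  have m: "m \<in># lam f" using assms in_type_of[of m "blocks lam" f] type_of_blocks[of lam] by simp
  hence "lam f \<noteq> {#}" by auto
  thus "f \<in> Phi" using assms(1) by (simp add: PPhi_def)
  show "m \<ge> 1" using m assms(1) by (cases m) (auto simp: PPhi_def)
qed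

text \<open>Singles out the last block of size \<open>k\<close> at \<open>t - 1\<close>. The sum on
  the right is the position, counted from 1, of the entry 1 in \<open>eps lam k\<close>, that is, of
  the last row of this block.\<close>

lemma blocks_split:
  assumes lam: "lam \<in> PPhi" and k: "k \<in># lam tm1"
  shows "\<exists>L1 L2. blocks lam = L1 @ (k, tm1) # L2 \<and>
    (\<Sum>(m, f)\<leftarrow>L1. m * degree f) + k = (\<Sum>j = 1..k. j * count (lam tm1) j)"
proof -
  let ?M = "Max (insert 0 (set_mset (lam tm1)))"
  let ?R = "\<lambda>i. replicate (count (lam tm1) i) (i, tm1 :: 'a poly)"
  have k1: "k \<ge> 1" using lam k by (cases k) (auto simp: PPhi_def)
  have "k \<le> ?M" using k by (intro Max_ge) auto
  hence "[1..<Suc ?M] = [1..<k] @ [k..<Suc ?M]"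
    using k1 upt_add_eq_append[of 1 k "Suc ?M - k"] by (simp del: upt_Suc)
  moreover have "[k..<Suc ?M] = k # [Suc k..<Suc ?M]" using \<open>k \<le> ?M\<close> by (intro upt_conv_Cons) simp
  ultimately have upt: "[1..<Suc ?M] = [1..<k] @ k # [Suc k..<Suc ?M]" by (simp only:)
  obtain c where c: "count (lam tm1) k = Suc c" using k by (metis count_greater_zero_iff gr0_implies_Suc)
  let ?L1 = "concat (map ?R [1..<k]) @ replicate c (k, tm1)"
  have "?R k = replicate c (k, tm1) @ [(k, tm1)]" by (simp add: c replicate_append_same)
  hence "\<exists>L2. blocks lam = ?L1 @ (k, tm1) # L2"
    unfolding blocks_def upt by simp
  then obtain L2 where L2: "blocks lam = ?L1 @ (k, tm1) # L2" by blast
  have "(\<Sum>(m, f)\<leftarrow>concat (map ?R [1..<k]). m * degree f) = (\<Sum>j = 1..<k. j * count (lam tm1) j)"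
    by (induction k) (auto simp: sum_list_replicate)
  hence L1: "(\<Sum>(m, f)\<leftarrow>?L1. m * degree f) + k = (\<Sum>j = 1..<k. j * count (lam tm1) j) + k * count (lam tm1) k"
    by (simp add: c sum_list_replicate)
  have "{1..k} = insert k {1..<k}" using k1 by auto
  hence "(\<Sum>j = 1..k. j * count (lam tm1) j) = k * count (lam tm1) k + (\<Sum>j = 1..<k. j * count (lam tm1) j)"
    by simp
  with L1 have "(\<Sum>(m, f)\<leftarrow>?L1. m * degree f) + k = (\<Sum>j = 1..k. j * count (lam tm1) j)" by simp
  with L2 show ?thesis by blast
qed

section \<open>Lists of vectors on which an operator acts by a matrix\<close>

definition acts :: "((nat \<Rightarrow> 'a) \<Rightarrow> nat \<Rightarrow> 'a) \<Rightarrow> (nat \<Rightarrow> 'a) list \<Rightarrow> 'a::comm_ring_1 mat \<Rightarrow> bool" where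
  "acts T vs J \<longleftrightarrow> (\<forall>c<length vs. T (vs ! c) = (\<Sum>r<length vs. vscale (J $$ (r, c)) (vs ! r)))"

lemma sum_lessThan_add: fixes a b :: nat shows "(\<Sum>i<a + b. g i) = (\<Sum>i<a. g i) + (\<Sum>i<b. g (a + i) :: 'x::comm_monoid_add)"
  by (induction b) (auto simp: add_ac)

lemma acts_append:
  assumes J: "J \<in> carrier_mat (length vs) (length vs)" and K: "K \<in> carrier_mat (length ws) (length ws)"
  shows "acts T (vs @ ws) (four_block_mat J (0\<^sub>m (dim_row J) (dim_col K)) (0\<^sub>m (dim_row K) (dim_col J)) K)
    \<longleftrightarrow> acts T vs J \<and> acts T ws K" (is "acts T _ ?B \<longleftrightarrow> _")
proof -
  let ?a = "length vs" and ?b = "length ws"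
  have sum: "(\<Sum>r<length (vs @ ws). vscale (?B $$ (r, c)) ((vs @ ws) ! r)) =
     (\<Sum>r<?a. vscale (?B $$ (r, c)) (vs ! r)) + (\<Sum>r<?b. vscale (?B $$ (?a + r, c)) (ws ! r))" for c
    unfolding length_append sum_lessThan_add by (simp add: nth_append)
  have s1: "(\<Sum>r<length (vs @ ws). vscale (?B $$ (r, c)) ((vs @ ws) ! r)) = (\<Sum>r<?a. vscale (J $$ (r, c)) (vs ! r))"
    if c: "c < ?a" for c
  proof -
    have "(\<Sum>r<?a. vscale (?B $$ (r, c)) (vs ! r)) = (\<Sum>r<?a. vscale (J $$ (r, c)) (vs ! r))"
      using J K c by (intro sum.cong refl) simp
    moreover have "(\<Sum>r<?b. vscale (?B $$ (?a + r, c)) (ws ! r)) = 0"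
      using J K c by (intro sum.neutral) auto
    ultimately show ?thesis unfolding sum by (simp only: add.right_neutral)
  qed
  have s2: "(\<Sum>r<length (vs @ ws). vscale (?B $$ (r, ?a + c)) ((vs @ ws) ! r)) = (\<Sum>r<?b. vscale (K $$ (r, c)) (ws ! r))"
    if c: "c < ?b" for c
  proof -
    have "(\<Sum>r<?a. vscale (?B $$ (r, ?a + c)) (vs ! r)) = 0"
      using J K c by (intro sum.neutral) auto
    moreover have "(\<Sum>r<?b. vscale (?B $$ (?a + r, ?a + c)) (ws ! r)) = (\<Sum>r<?b. vscale (K $$ (r, c)) (ws ! r))"
      using J K c by (intro sum.cong refl) simp
    ultimately show ?thesis unfolding sum by (simp only: add.left_neutral)
  qed
  have split: "(\<forall>c<length (vs @ ws). P c) \<longleftrightarrow> (\<forall>c<?a. P c) \<and> (\<forall>c<?b. P (?a + c))" for P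
  proof safe
    fix c assume *: "\<forall>c<?a. P c" "\<forall>c<?b. P (?a + c)" "c < length (vs @ ws)"
    show "P c"
    proof (cases "c < ?a")
      case False
      hence "P (?a + (c - ?a))" using * by (intro *(2)[rule_format]) simp
      thus ?thesis using False by simp
    qed (use * in auto)
  qed auto
  show ?thesis unfolding acts_def split using s1 s2 by (simp add: nth_append)
qed

lemma carrier_diag_block_mat:
  "list_all2 (\<lambda>vs J. J \<in> carrier_mat (length vs) (length vs)) vss Js \<Longrightarrow>
    diag_block_mat Js \<in> carrier_mat (length (concat vss)) (length (concat vss))"
  by (induction rule: list_all2_induct) (auto simp: Let_def)

lemma acts_diag:
  assumes "list_all2 (\<lambda>vs J. J \<in> carrier_mat (length vs) (length vs)) vss Js"
  shows "acts T (concat vss) (diag_block_mat Js) \<longleftrightarrow> list_all2 (acts T) vss Js"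
  using assms
proof (induction rule: list_all2_induct)
  case Nil
  thus ?case by (simp add: acts_def)
next
  case (Cons vs vss J Js)
  thus ?case using acts_append[OF Cons(1) carrier_diag_block_mat[OF Cons(2)]] by (simp add: Let_def)
qed

lemma split_by_dims:
  assumes "\<And>J. J \<in> set Js \<Longrightarrow> square_mat J" "length bs = sum_list (map dim_row Js)"
  shows "\<exists>vss. concat vss = bs \<and> list_all2 (\<lambda>vs J. J \<in> carrier_mat (length vs) (length vs)) vss Js"
  using assms
proof (induction Js arbitrary: bs)
  case (Cons J Js)
  have "\<exists>vss. concat vss = drop (dim_row J) bs \<and>
      list_all2 (\<lambda>vs J. J \<in> carrier_mat (length vs) (length vs)) vss Js"
    by (rule Cons.IH) (use Cons.prems in auto)
  then obtain vss where vss: "concat vss = drop (dim_row J) bs"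
    "list_all2 (\<lambda>vs J. J \<in> carrier_mat (length vs) (length vs)) vss Js" by blast
  have "J \<in> carrier_mat (length (take (dim_row J) bs)) (length (take (dim_row J) bs))"
  proof -
    have "length (take (dim_row J) bs) = dim_row J" using Cons.prems(2) by simp
    moreover have "dim_col J = dim_row J" using Cons.prems(1)[of J] by simp
    ultimately show ?thesis by (intro carrier_matI) simp_all
  qed
  hence "list_all2 (\<lambda>vs J. J \<in> carrier_mat (length vs) (length vs)) (take (dim_row J) bs # vss) (J # Js)"
    using vss(2) by (simp only: list_all2_Cons)
  moreover have "concat (take (dim_row J) bs # vss) = bs" by (simp add: vss(1))
  ultimately show ?case by blast
qed simp

definition vspan :: "(nat \<Rightarrow> 'a::comm_ring_1) list \<Rightarrow> (nat \<Rightarrow> 'a) set" where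
  "vspan bs = range (\<lambda>a. \<Sum>r<length bs. vscale (a r) (bs ! r))"

lemma vspanI: "(\<Sum>r<length bs. vscale (a r) (bs ! r)) \<in> vspan bs"
  unfolding vspan_def by (rule rangeI)

lemma vspanE:
  assumes "v \<in> vspan bs" obtains a where "v = (\<Sum>r<length bs. vscale (a r) (bs ! r))"
  using assms unfolding vspan_def by blast

lemma vspan_base: "v \<in> set bs \<Longrightarrow> v \<in> vspan bs"
proof -
  assume "v \<in> set bs"
  then obtain j where j: "j < length bs" "bs ! j = v" by (auto simp: in_set_conv_nth)
  have "(\<Sum>r<length bs. vscale (if r = j then 1 else 0) (bs ! r)) = (\<Sum>r<length bs. if r = j then v else 0)"
    using j by (intro sum.cong) auto
  hence "(\<Sum>r<length bs. vscale (if r = j then 1 else 0) (bs ! r)) = v" using j by simp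
  thus ?thesis using vspanI[of "\<lambda>r. if r = j then 1 else 0" bs] by metis
qed

context linear_operator
begin

lemma acts_vspan_subspace:
  assumes "acts T bs J" shows "subspace (vspan bs)"
proof (rule subspace_op)
  have "(\<Sum>r<length bs. vscale 0 (bs ! r)) = 0" by (intro sum.neutral) simp
  thus "0 \<in> vspan bs" using vspanI[of "\<lambda>_. 0" bs] by metis
  fix u v assume "u \<in> vspan bs" "v \<in> vspan bs"
  then obtain a b where uv: "u = (\<Sum>r<length bs. vscale (a r) (bs ! r))" "v = (\<Sum>r<length bs. vscale (b r) (bs ! r))"
    by (elim vspanE)
  have "u + v = (\<Sum>r<length bs. vscale (a r + b r) (bs ! r))"
    unfolding uv sum.distrib[symmetric] by (intro sum.cong refl) simp
  thus "u + v \<in> vspan bs" using vspanI[of "\<lambda>r. a r + b r" bs] by metis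
next
  fix c v assume "v \<in> vspan bs"
  then obtain a where v: "v = (\<Sum>r<length bs. vscale (a r) (bs ! r))" by (elim vspanE)
  have "vscale c v = (\<Sum>r<length bs. vscale (c * a r) (bs ! r))"
    unfolding v vscale_sum by (intro sum.cong refl) simp
  thus "vscale c v \<in> vspan bs" using vspanI[of "\<lambda>r. c * a r" bs] by metis
next
  fix v assume "v \<in> vspan bs"
  then obtain a where v: "v = (\<Sum>c<length bs. vscale (a c) (bs ! c))" by (elim vspanE)
  have "T v = (\<Sum>c<length bs. vscale (a c) (T (bs ! c)))" unfolding v by (simp only: T_sum T_vscale)
  also have "\<dots> = (\<Sum>c<length bs. \<Sum>r<length bs. vscale (a c * J $$ (r, c)) (bs ! r))"
    using assms unfolding acts_def by (intro sum.cong refl) (simp add: vscale_sum)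
  also have "\<dots> = (\<Sum>r<length bs. vscale (\<Sum>c<length bs. a c * J $$ (r, c)) (bs ! r))"
  proof (subst sum.swap, intro sum.cong refl)
    fix r
    show "(\<Sum>c<length bs. vscale (a c * J $$ (r, c)) (bs ! r)) = vscale (\<Sum>c<length bs. a c * J $$ (r, c)) (bs ! r)"
      by (rule ext) (simp add: fun_sum_apply vscale_def sum_distrib_right)
  qed
  finally show "T v \<in> vspan bs" using vspanI[of "\<lambda>r. \<Sum>c<length bs. a c * J $$ (r, c)" bs] by metis
qed

definition block_vectors :: "(nat \<Rightarrow> 'a) \<times> nat \<times> 'a poly \<Rightarrow> (nat \<Rightarrow> 'a) list" where
  "block_vectors = (\<lambda>(x, m, f). map (\<lambda>c. op_scale T (blk f m (SOME Q. block_exponent f m Q) c) x) [0..<degree f * m])"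

lemma length_block_vectors: "length (block_vectors (x, m, f)) = degree f * m"
  by (simp add: block_vectors_def)

lemma block_vectors:
  assumes f: "f \<in> Phi" "m \<ge> 1" and x: "op_scale T (f ^ m) x = 0"
  shows "acts T (block_vectors (x, m, f)) (Jblock m f)" "block_vectors (x, m, f) ! (degree f * m - 1) = x"
    "degree f * m > 0"
proof -
  define Q where "Q = (SOME Q. block_exponent f m Q)"
  have "block_exponent f m Q" unfolding Q_def using block_exponent_exists[OF f] by (rule someI_ex)
  then interpret block_exponent f m Q .
  show D: "degree f * m > 0" by (rule D_pos)
  have nth: "block_vectors (x, m, f) ! c = op_scale T (blk f m Q c) x" if "c < degree f * m" for c
    using that by (simp add: block_vectors_def Q_def)
  show "acts T (block_vectors (x, m, f)) (Jblock m f)"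
    unfolding acts_def length_block_vectors
  proof (intro allI impI)
    fix c assume c: "c < degree f * m"
    have "op_scale T [:0, 1:] (op_scale T (blk f m Q c) x) =
        (\<Sum>r<degree f * m. op_scale T [:Jblock m f $$ (r, c):] (op_scale T (blk f m Q r) x))"
      by (rule block_basis_action[OF poly_module_axioms x c])
    thus "T (block_vectors (x, m, f) ! c) =
        (\<Sum>r<degree f * m. vscale (Jblock m f $$ (r, c)) (block_vectors (x, m, f) ! r))"
      unfolding op_scale_t op_scale_const using nth[OF c] by (simp add: nth)
  qed
  show "block_vectors (x, m, f) ! (degree f * m - 1) = x"
    using nth[of "degree f * m - 1"] D by (simp add: blk_last[unfolded One_nat_def])
qed

lemma acts_Jblock:
  assumes f: "f \<in> Phi" "m \<ge> 1" and len: "length vs = degree f * m" and vs: "acts T vs (Jblock m f)"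
  shows "op_scale T (f ^ m) (last vs) = 0" "set vs \<subseteq> span {last vs}" "vs \<noteq> []"
proof -
  obtain Q where "block_exponent f m Q" using block_exponent_exists[OF f] by blast
  then interpret block_exponent f m Q .
  show ne: "vs \<noteq> []" using D_pos len by auto
  have l: "last vs = vs ! (degree f * m - 1)" using ne len by (simp add: last_conv_nth)
  have v: "op_scale T [:0, 1:] (vs ! c) = (\<Sum>r<degree f * m. op_scale T [:Jblock m f $$ (r, c):] (vs ! r))"
    if "c < degree f * m" for c
    unfolding op_scale_t op_scale_const using vs that by (simp add: acts_def len)
  note cyc = block_basis_cyclic[OF poly_module_axioms, of "\<lambda>c. vs ! c", OF v]
  show "op_scale T (f ^ m) (last vs) = 0" unfolding l using cyc(1) by simp
  show "set vs \<subseteq> span {last vs}"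
  proof
    fix y assume "y \<in> set vs"
    then obtain c where c: "c < degree f * m" "y = vs ! c" using len by (auto simp: in_set_conv_nth)
    have "vs ! c = op_scale T (blk f m Q c) (vs ! (degree f * m - 1))" using cyc(2)[OF _ c(1)] by simp
    thus "y \<in> span {last vs}" unfolding c(2) l span_singleton by blast
  qed
qed

text \<open>The bases of the cyclic summands are concatenated. As there are exactly as many vectors
  as the dimension of \<open>W\<close>, spanning is enough to make them a basis.\<close>

lemma decomp_basis:
  assumes D: "decomp W D"
  defines "bs \<equiv> concat (map block_vectors D)"
  shows "acts T bs (diag_block_mat (map (\<lambda>(x, m, f). Jblock m f) D))"
    "length bs = (\<Sum>(x, m, f)\<leftarrow>D. m * degree f)" "set bs \<subseteq> W" "W \<subseteq> vspan bs"
proof -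
  have D': "m \<ge> 1" "f \<in> Phi" "op_scale T (f ^ m) x = 0" "x \<in> W" if "(x, m, f) \<in> set D" for x m f
    using D that unfolding decomp_def by (auto intro: span_base simp: image_iff) (force intro: span_base)
  have car: "list_all2 (\<lambda>vs J. J \<in> carrier_mat (length vs) (length vs)) (map block_vectors D)
      (map (\<lambda>(x, m, f). Jblock m f) D)"
    using dim_Jblock by (auto simp: list_all2_conv_all_nth length_block_vectors split: prod.split)
  show acts: "acts T bs (diag_block_mat (map (\<lambda>(x, m, f). Jblock m f) D))"
    unfolding bs_def acts_diag[OF car] list_all2_conv_all_nth
  proof (intro conjI allI impI)
    fix i assume "i < length (map block_vectors D)"
    hence i: "i < length D" by simp
    obtain x m f where xmf: "D ! i = (x, m, f)" by (metis prod.exhaust)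
    hence "(x, m, f) \<in> set D" using i by (metis nth_mem)
    thus "acts T (map block_vectors D ! i) (map (\<lambda>(x, m, f). Jblock m f) D ! i)"
      using i xmf block_vectors(1) D'(1-3) by simp
  qed simp
  show "length bs = (\<Sum>(x, m, f)\<leftarrow>D. m * degree f)" unfolding bs_def length_concat map_map
    by (intro arg_cong[of _ _ sum_list] map_cong refl) (auto simp: length_block_vectors)
  have sub: "subspace W" by (rule decomp_subspace[OF D])
  show "set bs \<subseteq> W"
    unfolding bs_def using D'(4) by (auto simp: block_vectors_def intro: subspace_scale[OF sub])
  have "fst ` set D \<subseteq> vspan bs"
  proof clarify
    fix x m f assume xmf: "(x, m, f) \<in> set D"
    hence "x = block_vectors (x, m, f) ! (degree f * m - 1)" "degree f * m > 0"
      using block_vectors D' by metis+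
    hence "x \<in> set (block_vectors (x, m, f))" 
      using nth_mem[of "degree f * m - 1" "block_vectors (x, m, f)"] length_block_vectors[of x m f] by simp
    hence "x \<in> set bs" using xmf by (auto simp: bs_def)
    thus "fst (x, m, f) \<in> vspan bs" by (simp add: vspan_base)
  qed
  hence "span (fst ` set D) \<subseteq> vspan bs" by (rule span_minimal[OF _ acts_vspan_subspace[OF acts]])
  thus "W \<subseteq> vspan bs" using D by (simp add: decomp_def)
qed

end

section \<open>Types of affine matrices and module decompositions\<close>

lemma one_less_card_field: "1 < CARD('a::{field,finite})"
proof -
  have "card {0, 1 :: 'a} \<le> CARD('a)" by (intro card_mono) auto
  thus ?thesis by simp
qed

text \<open>Intrinsic form of \<open>has_type\<close>. The vector \<open>e\<close> is the first
  column of a conjugating matrix, and its displacement corresponds to the column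
  \<open>eps lam k\<close>, which points to the last vector of a block of size \<open>k\<close>,
  that is, to its cyclic generator.\<close>

definition module_type :: "nat \<Rightarrow> 'a::{field,finite} mat \<Rightarrow> 'a ptype \<Rightarrow> nat \<Rightarrow> bool" where
  "module_type n A lam k \<longleftrightarrow> (\<exists>D e. act.decomp n A (vecs0 n) D \<and> type_of (map snd D) = lam \<and>
     e \<in> vecs n \<and> e 0 = 1 \<and>
     (if k = 0 then act n A e = e else \<exists>x. (x, k, tm1) \<in> set D \<and> act n A e = e + x))"

lemma mult_eq_iff_columns:
  assumes A: "A \<in> carrier_mat n n" and J: "J \<in> carrier_mat n n"
    and g: "\<And>c. c < n \<Longrightarrow> g c \<in> vecs n"
  shows "A * mat n n (\<lambda>(i, c). g c i) = mat n n (\<lambda>(i, c). g c i) * J \<longleftrightarrow>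
    (\<forall>c<n. act n A (g c) = (\<Sum>r<n. vscale (J $$ (r, c)) (g r)))"
proof -
  let ?h = "mat n n (\<lambda>(i, c). g c i)"
  have l: "(A * ?h) $$ (i, c) = act n A (g c) i" if "i < n" "c < n" for i c
    using that A by (simp add: act_def scalar_prod_def atLeast0LessThan)
  have r: "(?h * J) $$ (i, c) = (\<Sum>r<n. vscale (J $$ (r, c)) (g r)) i" if "i < n" "c < n" for i c
    using that J by (simp add: fun_sum_apply vscale_def scalar_prod_def atLeast0LessThan mult.commute)
  have out: "act n A (g c) i = (\<Sum>r<n. vscale (J $$ (r, c)) (g r)) i" if "\<not> i < n" "c < n" for i c
  proof -
    have "(\<Sum>r<n. vscale (J $$ (r, c)) (g r)) i = 0"
      using that g by (auto simp: fun_sum_apply vscale_def vecs_def intro!: sum.neutral)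
    thus ?thesis using that g by (auto simp: act_def vecs_def)
  qed
  show ?thesis
  proof
    assume eq: "A * ?h = ?h * J"
    show "\<forall>c<n. act n A (g c) = (\<Sum>r<n. vscale (J $$ (r, c)) (g r))"
    proof (intro allI impI ext)
      fix c i assume c: "c < n"
      show "act n A (g c) i = (\<Sum>r<n. vscale (J $$ (r, c)) (g r)) i"
        using l[of i c] r[of i c] out[of i c] c eq by (cases "i < n") simp_all
    qed
  next
    assume eq: "\<forall>c<n. act n A (g c) = (\<Sum>r<n. vscale (J $$ (r, c)) (g r))"
    show "A * ?h = ?h * J"
    proof (rule eq_matI)
      fix i j assume "i < dim_row (?h * J)" "j < dim_col (?h * J)"
      hence "i < n" "j < n" using J by auto
      thus "(A * ?h) $$ (i, j) = (?h * J) $$ (i, j)" using l r eq by simp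
    qed (use A J in auto)
  qed
qed

lemma length_sum_blocks:
  "sum_list (map dim_row (map (\<lambda>(m, f). Jblock m f) L)) = (\<Sum>(m, f)\<leftarrow>L. m * degree f)"
  "sum_list (map dim_col (map (\<lambda>(m, f). Jblock m f) L)) = (\<Sum>(m, f)\<leftarrow>L. m * degree f)"
  by (induction L) (auto simp: Jblock_def Let_def mult.commute)

lemma Jmat_carrier: "lam \<in> PPhi \<Longrightarrow> Jmat lam \<in> carrier_mat (pnorm lam) (pnorm lam)"
  using pnorm_type_of[of "blocks lam"] type_of_blocks[of lam]
  unfolding Jmat_blocks by (intro carrier_matI) (simp_all only: dim_diag_block_mat length_sum_blocks)

lemma Jaff_carrier: "lam \<in> PPhi \<Longrightarrow> Jaff lam k \<in> carrier_mat (Suc (pnorm lam)) (Suc (pnorm lam))"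
  using Jmat_carrier[of lam] unfolding Jaff_def by (intro carrier_matI) (auto simp: index_mat_four_block)

lemma Jaff_entries:
  assumes "lam \<in> PPhi" "r < pnorm lam" "c < pnorm lam"
  shows "Jaff lam k $$ (0, 0) = 1" "Jaff lam k $$ (0, Suc c) = 0"
    "Jaff lam k $$ (Suc r, 0) = eps lam k $$ (r, 0)" "Jaff lam k $$ (Suc r, Suc c) = Jmat lam $$ (r, c)"
  using assms Jmat_carrier[of lam] by (auto simp: Jaff_def eps_def)

lemma Jaff_00: "Jaff lam k $$ (0, 0) = 1"
  by (auto simp: Jaff_def index_mat_four_block)

text \<open>Used in both directions to pass between conjugating matrices and adapted bases: the
  first column of \<open>h\<close> is the affine vector \<open>e\<close>, the others are vectors of
  the hyperplane.\<close>

lemma conjugates_to_Jaff_iff: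
  assumes lam: "lam \<in> PPhi" and A: "A \<in> carrier_mat (Suc p) (Suc p)" and p: "p = pnorm lam"
    and bs: "length bs = p" "set bs \<subseteq> vecs (Suc p)" and e: "e \<in> vecs (Suc p)"
  defines "h \<equiv> mat (Suc p) (Suc p) (\<lambda>(i, c). ((e # bs) ! c) i)"
  shows "A * h = h * Jaff lam k \<longleftrightarrow>
    act (Suc p) A e = e + (\<Sum>r<p. vscale (eps lam k $$ (r, 0)) (bs ! r)) \<and> acts (act (Suc p) A) bs (Jmat lam)"
proof -
  have J: "Jaff lam k \<in> carrier_mat (Suc p) (Suc p)" using Jaff_carrier[OF lam] p by simp
  have in_vecs: "(e # bs) ! c \<in> vecs (Suc p)" if "c < Suc p" for c
    using that bs e by (cases c) (auto dest: nth_mem)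
  have split: "(\<forall>c<Suc p. P c) \<longleftrightarrow> P 0 \<and> (\<forall>c<p. P (Suc c))" for P
    using less_Suc_eq_0_disj by auto
  have c0: "(\<Sum>r<Suc p. vscale (Jaff lam k $$ (r, 0)) ((e # bs) ! r)) =
      e + (\<Sum>r<p. vscale (eps lam k $$ (r, 0)) (bs ! r))"
    unfolding sum.lessThan_Suc_shift using Jaff_entries[OF lam] p by (simp add: Jaff_00)
  have c1: "(\<Sum>r<Suc p. vscale (Jaff lam k $$ (r, Suc c)) ((e # bs) ! r)) =
      (\<Sum>r<p. vscale (Jmat lam $$ (r, c)) (bs ! r))" if "c < p" for c
    unfolding sum.lessThan_Suc_shift using Jaff_entries[OF lam] p that by simp
  have col: "(\<forall>c<p. act (Suc p) A (bs ! c) = (\<Sum>r<Suc p. vscale (Jaff lam k $$ (r, Suc c)) ((e # bs) ! r))) \<longleftrightarrow>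
      (\<forall>c<p. act (Suc p) A (bs ! c) = (\<Sum>r<p. vscale (Jmat lam $$ (r, c)) (bs ! r)))"
    by (intro all_cong1 imp_cong refl) (simp only: c1)
  have "A * h = h * Jaff lam k \<longleftrightarrow> (\<forall>c<Suc p. act (Suc p) A ((e # bs) ! c) =
      (\<Sum>r<Suc p. vscale (Jaff lam k $$ (r, c)) ((e # bs) ! r)))"
    unfolding h_def by (rule mult_eq_iff_columns[OF A J in_vecs])
  thus ?thesis unfolding split c0 acts_def bs(1) nth_Cons_0 nth_Cons_Suc col .
qed

lemma sum_eps:
  assumes "k \<ge> 1" "pos = (\<Sum>j = 1..k. j * count (lam tm1) j)" "1 \<le> pos" "pos \<le> pnorm lam"
  shows "(\<Sum>r<pnorm lam. vscale (eps lam k $$ (r, 0)) (g r)) = g (pos - 1)"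
proof -
  have "(\<Sum>r<pnorm lam. vscale (eps lam k $$ (r, 0)) (g r)) = (\<Sum>r<pnorm lam. if r = pos - 1 then g r else 0)"
    using assms by (intro sum.cong refl) (auto simp: eps_def)
  thus ?thesis using assms by simp
qed

lemma sum_eps_0: "(\<Sum>r<pnorm lam. vscale (eps lam 0 $$ (r, 0)) (g r)) = 0"
  by (intro sum.neutral) (auto simp: eps_def)

lemma reorder_map:
  assumes "mset (map g xs) = mset ys"
  shows "\<exists>xs'. mset xs' = mset xs \<and> map g xs' = ys"
  using assms
proof (induction ys arbitrary: xs)
  case (Cons y ys)
  have "y \<in># mset (map g xs)" unfolding Cons.prems by simp
  then obtain x where x: "x \<in> set xs" "g x = y" by auto
  then obtain us vs where xs: "xs = us @ x # vs" by (meson split_list)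
  have "mset (map g (us @ vs)) = mset ys" using Cons.prems x(2) unfolding xs by simp
  from Cons.IH[OF this] obtain xs' where "mset xs' = mset (us @ vs)" "map g xs' = ys" by blast
  hence r: "mset (x # xs') = mset xs" "map g (x # xs') = y # ys" unfolding xs using x(2) by (simp_all only: mset.simps mset_append list.map union_mset_add_mset_right)
  show ?case by (rule exI[of _ "x # xs'"], rule conjI) (rule r)+
next
  case Nil
  thus ?case by (intro exI[of _ "[]"]) simp
qed

lemma power_card_inject: "CARD('a::{field,finite}) ^ a = CARD('a) ^ b \<Longrightarrow> a = b"
  using one_less_card_field[where 'a = 'a] by simp

lemma vecs0_subset: "vecs0 n \<subseteq> vecs n"
  by (auto simp: vecs0_def)

lemma sum_map_snd: "(\<Sum>(x, m, f)\<leftarrow>D. m * degree f) = (\<Sum>(m, f)\<leftarrow>map snd D. m * degree f)"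
  by (induction D) auto

text \<open>The vector \<open>e\<close> and the block bases of the cyclic summands, in the order of
  \<open>blocks lam\<close>, form the columns of a conjugating matrix. Its first row is that of an
  affine matrix because the block bases lie in the hyperplane.\<close>

lemma module_type_imp_has_type:
  fixes A :: "'a::{field,finite} mat"
  assumes n: "n \<ge> 1" and A: "A \<in> carrier (GA n)" and mt: "module_type n A lam k"
  shows "has_type n A (lam, k)"
proof -
  let ?T = "act n A"
  obtain D e where D: "act.decomp n A (vecs0 n) D" and lam: "type_of (map snd D) = lam"
    and e: "e \<in> vecs n" "e 0 = 1"
    and k: "if k = 0 then ?T e = e else \<exists>x. (x, k, tm1) \<in> set D \<and> ?T e = e + x"
    using mt unfolding module_type_def by blast
  have PPhi: "lam \<in> PPhi" unfolding lam[symmetric]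
    by (rule type_of_PPhi) (use D in \<open>auto simp: act.decomp_def\<close>)
  have pn: "pnorm lam = n - 1"
  proof -
    have "CARD('a) ^ (n - 1) = CARD('a) ^ (\<Sum>(x, m, f)\<leftarrow>D. m * degree f)"
      using D card_vecs0(2)[OF n, where 'a = 'a] by (simp add: act.decomp_def)
    hence "n - 1 = (\<Sum>(x, m, f)\<leftarrow>D. m * degree f)" by (rule power_card_inject)
    thus ?thesis unfolding lam[symmetric] pnorm_type_of sum_map_snd by simp
  qed
  have ms: "mset (map snd D) = mset (blocks lam)"
    using lam type_of_blocks[OF PPhi] by (metis type_of_eq_iff)
  \<comment> \<open>Summands with equal blocks may be permuted freely, but the canonical form puts
    the 1 of \<open>eps lam k\<close> in the last block of size \<open>k\<close>, so the generator
    \<open>x\<close> is moved there.\<close>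
  have "\<exists>D'. mset D' = mset D \<and> map snd D' = blocks lam \<and> (k \<noteq> 0 \<longrightarrow> (\<exists>x E1 E2. D' = E1 @ (x, k, tm1) # E2 \<and>
      ?T e = e + x \<and> (\<Sum>(m, f)\<leftarrow>map snd E1. m * degree f) + k = (\<Sum>j = 1..k. j * count (lam tm1) j)))"
  proof (cases "k = 0")
    case True
    thus ?thesis using reorder_map[OF ms] by blast
  next
    case False
    then obtain x where x: "(x, k, tm1) \<in> set D" "?T e = e + x" using k by auto
    have "k \<in># lam tm1" unfolding lam[symmetric] in_type_of using x(1) by force
    from blocks_split[OF PPhi this] obtain L1 L2 where L: "blocks lam = L1 @ (k, tm1) # L2"
      "(\<Sum>(m, f)\<leftarrow>L1. m * degree f) + k = (\<Sum>j = 1..k. j * count (lam tm1) j)" by blast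
    obtain U V where UV: "D = U @ (x, k, tm1) # V" using x(1) by (meson split_list)
    have "mset (map snd (U @ V)) = mset (L1 @ L2)" using ms unfolding UV L(1) by simp
    from reorder_map[OF this] obtain E where E: "mset E = mset (U @ V)" "map snd E = L1 @ L2" by blast
    from E(2) obtain E1 E2 where E12: "E = E1 @ E2" "map snd E1 = L1" "map snd E2 = L2"
      by (auto simp: map_eq_append_conv)
    have 1: "mset (E1 @ (x, k, tm1) # E2) = mset D" using E(1) unfolding UV E12(1) by simp
    have 2: "map snd (E1 @ (x, k, tm1) # E2) = blocks lam" unfolding L(1) using E12 by simp
    have 3: "(\<Sum>(m, f)\<leftarrow>map snd E1. m * degree f) + k = (\<Sum>j = 1..k. j * count (lam tm1) j)"
      unfolding E12 by (rule L(2))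
    show ?thesis
      by (rule exI[of _ "E1 @ (x, k, tm1) # E2"]) (use 1 2 3 x(2) in blast)
  qed
  then obtain D' where D': "mset D' = mset D" "map snd D' = blocks lam"
    and kD': "k \<noteq> 0 \<Longrightarrow> \<exists>x E1 E2. D' = E1 @ (x, k, tm1) # E2 \<and>
      ?T e = e + x \<and> (\<Sum>(m, f)\<leftarrow>map snd E1. m * degree f) + k = (\<Sum>j = 1..k. j * count (lam tm1) j)"
    by blast
  have dec: "act.decomp n A (vecs0 n) D'" by (rule act.decomp_mset[OF D D'(1)])
  define bs where "bs = concat (map (act.block_vectors n A) D')"
  note basis = act.decomp_basis[OF dec, folded bs_def]
  have Js: "map (\<lambda>(x, m, f). Jblock m f) D' = map (\<lambda>(m, f). Jblock m f) (map snd D')" by auto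
  have acts: "acts ?T bs (Jmat lam)" using basis(1) unfolding Jmat_blocks D'(2)[symmetric] Js .
  have len: "length bs = n - 1" unfolding basis(2) sum_map_snd D'(2) pn[symmetric]
    using pnorm_type_of[of "blocks lam"] type_of_blocks[OF PPhi] by simp
  have nS: "n = Suc (pnorm lam)" using n pn by simp
  have bsv: "set bs \<subseteq> vecs n" using basis(3) vecs0_subset by blast
  have col0: "?T e = e + (\<Sum>r<pnorm lam. vscale (eps lam k $$ (r, 0)) (bs ! r))"
  proof (cases "k = 0")
    case True
    thus ?thesis using k by (simp only: sum_eps_0 add.right_neutral if_True)
  next
    case False
    then obtain x E1 E2 where E: "D' = E1 @ (x, k, tm1) # E2" "?T e = e + x"
      and pos: "(\<Sum>(m, f)\<leftarrow>map snd E1. m * degree f) + k = (\<Sum>j = 1..k. j * count (lam tm1) j)"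
      using kD' by blast
    let ?l = "length (concat (map (act.block_vectors n A) E1))"
    have l: "?l = (\<Sum>(m, f)\<leftarrow>map snd E1. m * degree f)"
      unfolding length_concat map_map sum_map_snd[symmetric]
      by (intro arg_cong[of _ _ sum_list] map_cong refl) (auto simp: act.length_block_vectors)
    have xin: "(x, k, tm1) \<in> set D'" unfolding E(1) by simp
    have all: "\<forall>(x, m, f)\<in>set D'. m \<ge> 1 \<and> f \<in> Phi \<and> mod_scale n A (f ^ m) x = 0"
      using dec unfolding act.decomp_def by blast
    have "k \<ge> 1 \<and> (tm1 :: 'a poly) \<in> Phi \<and> mod_scale n A (tm1 ^ k) x = 0"
      using bspec[OF all xin] unfolding prod.case .
    hence x: "(tm1 :: 'a poly) \<in> Phi" "k \<ge> 1" "mod_scale n A (tm1 ^ k) x = 0" by blast+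
    have lv: "length (act.block_vectors n A (x, k, tm1)) = k" by (simp add: act.length_block_vectors)
    have bs_eq: "bs = concat (map (act.block_vectors n A) E1) @ act.block_vectors n A (x, k, tm1) @
        concat (map (act.block_vectors n A) E2)" unfolding bs_def E(1) by simp
    have "bs ! (?l + (k - 1)) = act.block_vectors n A (x, k, tm1) ! (k - 1)"
      unfolding bs_eq nth_append_length_plus using lv x(2) by (simp add: nth_append)
    also have "\<dots> = x" using act.block_vectors(2)[OF x] by simp
    finally have bx: "bs ! (?l + (k - 1)) = x" .
    have "?l + k \<le> length bs" unfolding bs_eq length_append lv by simp
    hence le: "?l + k \<le> pnorm lam" using len pn by simp
    have "(\<Sum>r<pnorm lam. vscale (eps lam k $$ (r, 0)) (bs ! r)) = bs ! (?l + k - 1)"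
      by (rule sum_eps[OF x(2)]) (use l pos x(2) le in auto)
    also have "?l + k - 1 = ?l + (k - 1)" using x(2) by simp
    finally show ?thesis unfolding bx E(2) by simp
  qed
  define h where "h = mat n n (\<lambda>(i, c). ((e # bs) ! c) i)"
  have Ac: "A \<in> carrier_mat n n" using GA_D[OF n A] by simp
  have Ah: "A * h = h * Jaff lam k"
    using conjugates_to_Jaff_iff[OF PPhi, of A "pnorm lam" bs e k] Ac bsv e len pn col0 acts
    unfolding h_def nS[symmetric] by simp
  have h: "h \<in> carrier (GA n)" unfolding GA_iff[OF n]
  proof (intro conjI allI impI)
    show hc: "h \<in> carrier_mat n n" by (simp add: h_def)
    fix j assume j: "j < n"
    show "h $$ (0, j) = (if j = 0 then 1 else 0)"
    proof (cases j)
      case 0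
      thus ?thesis using n e by (simp add: h_def)
    next
      case (Suc c)
      hence "bs ! c \<in> vecs0 n" using basis(3) j len by (auto dest: nth_mem)
      thus ?thesis using n j Suc by (simp add: h_def vecs0_def)
    qed
  next
    \<comment> \<open>A right inverse of \<open>h\<close> is assembled from coordinates of the unit
      vectors: subtracting \<open>unitv j 0\<close> times \<open>e\<close> brings
      \<open>unitv j\<close> into the hyperplane, which \<open>bs\<close> spans.\<close>
    have "\<exists>a. \<forall>i<n. (\<Sum>r<n. ((e # bs) ! r) i * a r) = unitv j i" if j: "j < n" for j
    proof -
      define w where "w = unitv j - vscale (unitv j 0) e"
      have "w \<in> vecs0 n" using j e by (auto simp: w_def vecs0_def vecs_def unitv_def vscale_def)
      hence "w \<in> vspan bs" using basis(4) by blast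
      then obtain a where a: "w = (\<Sum>r<length bs. vscale (a r) (bs ! r))" by (rule vspanE)
      have w': "unitv j i = unitv j 0 * e i + w i" for i by (simp add: w_def vscale_def)
      have "(\<Sum>r<n. ((e # bs) ! r) i * (case r of 0 \<Rightarrow> unitv j 0 | Suc r \<Rightarrow> a r)) = unitv j i" for i
        unfolding w'[of i] a nS sum.lessThan_Suc_shift using len pn
        by (simp add: fun_sum_apply vscale_def mult.commute)
      thus ?thesis by (intro exI[of _ "\<lambda>r. case r of 0 \<Rightarrow> unitv j 0 | Suc r \<Rightarrow> a r"]) blast
    qed
    then obtain a where a: "\<And>j i. j < n \<Longrightarrow> i < n \<Longrightarrow> (\<Sum>r<n. ((e # bs) ! r) i * a j r) = unitv j i" by metis
    define M where "M = mat n n (\<lambda>(r, j). a j r)"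
    have "h * M = 1\<^sub>m n"
    proof (rule eq_matI)
      fix i j assume "i < dim_row (1\<^sub>m n)" "j < dim_col (1\<^sub>m n)"
      hence ij: "i < n" "j < n" by auto
      hence "(h * M) $$ (i, j) = (\<Sum>r<n. ((e # bs) ! r) i * a j r)"
        by (simp add: h_def M_def scalar_prod_def atLeast0LessThan)
      thus "(h * M) $$ (i, j) = 1\<^sub>m n $$ (i, j)" using a ij by (simp add: unitv_def)
    qed (auto simp: h_def M_def)
    moreover have "h \<in> carrier_mat n n" "M \<in> carrier_mat n n" by (auto simp: h_def M_def)
    ultimately have "det h * det M = 1" using det_mult[of h n M] by simp
    thus "det h \<noteq> 0" by auto
  qed
  interpret group "GA n :: 'a mat monoid" by (rule GA_group[OF n])
  have inv: "inv\<^bsub>GA n\<^esub> h \<in> carrier (GA n)" "h * inv\<^bsub>GA n\<^esub> h = 1\<^sub>m n" using h r_inv[OF h] by auto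
  have "A = A * (h * inv\<^bsub>GA n\<^esub> h)" using inv Ac by simp
  also have "\<dots> = A * h * inv\<^bsub>GA n\<^esub> h"
    using Ac GA_D(1)[OF n h] GA_D(1)[OF n inv(1)] by (simp add: assoc_mult_mat)
  finally have "A = h \<otimes>\<^bsub>GA n\<^esub> Jaff lam k \<otimes>\<^bsub>GA n\<^esub> inv\<^bsub>GA n\<^esub> h" unfolding Ah by simp
  moreover have "k = 0 \<or> k \<in># lam tm1"
    using k unfolding lam[symmetric] in_type_of by (cases "k = 0") force+
  ultimately show ?thesis using PPhi pn h unfolding has_type_def by blast
qed

text \<open>The columns of the conjugating matrix after the first are cut into pieces by block
  sizes; the last vector of each piece generates it by \<open>acts_Jblock\<close>. Invertibility
  gives spanning, and the cardinality clause of \<open>decomp\<close> follows from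
  \<open>pnorm lam = n - 1\<close>.\<close>

lemma has_type_imp_module_type:
  fixes A :: "'a::{field,finite} mat"
  assumes n: "n \<ge> 1" and A: "A \<in> carrier (GA n)" and ht: "has_type n A (lam, k)"
  shows "module_type n A lam k"
proof -
  let ?T = "act n A"
  interpret group "GA n :: 'a mat monoid" by (rule GA_group[OF n])
  obtain h where PPhi: "lam \<in> PPhi" and pn: "pnorm lam = n - 1" and k: "k = 0 \<or> k \<in># lam tm1"
    and h: "h \<in> carrier (GA n)" and A_eq: "A = h * Jaff lam k * inv\<^bsub>GA n\<^esub> h"
    using ht unfolding has_type_def by auto
  have nS: "n = Suc (pnorm lam)" using n pn by simp
  have inv: "inv\<^bsub>GA n\<^esub> h \<in> carrier (GA n)" "inv\<^bsub>GA n\<^esub> h * h = 1\<^sub>m n" "h * inv\<^bsub>GA n\<^esub> h = 1\<^sub>m n"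
    using h l_inv[OF h] r_inv[OF h] by auto
  note hc = GA_D(1)[OF n h] and ic = GA_D(1)[OF n inv(1)]
  have Jc: "Jaff lam k \<in> carrier_mat n n" using Jaff_carrier[OF PPhi] nS by simp
  have Ah: "A * h = h * Jaff lam k"
    unfolding A_eq using assoc_mult_mat[OF mult_carrier_mat[OF hc Jc] ic hc] inv(2) hc Jc by simp
  define g where "g c = (\<lambda>i. if i < n then h $$ (i, c) else 0)" for c
  define e where "e = g 0"
  define bs where "bs = map (\<lambda>c. g (Suc c)) [0..<n - 1]"
  have gv: "g c \<in> vecs n" for c by (simp add: g_def vecs_def)
  have len: "length bs = n - 1" by (simp add: bs_def)
  have ebs: "(e # bs) ! c = g c" if "c < n" for c
    using that by (cases c) (auto simp: e_def bs_def)
  have h_eq: "h = mat n n (\<lambda>(i, c). ((e # bs) ! c) i)"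
  proof (rule eq_matI)
    fix i j assume "i < dim_row (mat n n (\<lambda>(i, c). ((e # bs) ! c) i))" "j < dim_col (mat n n (\<lambda>(i, c). ((e # bs) ! c) i))"
    thus "h $$ (i, j) = mat n n (\<lambda>(i, c). ((e # bs) ! c) i) $$ (i, j)" by (simp add: ebs) (simp add: g_def)
  qed (use hc in auto)
  have bsv0: "set bs \<subseteq> vecs0 n"
    using gv GA_D(2)[OF n h] by (auto simp: bs_def vecs0_def) (auto simp: g_def)
  have ev: "e \<in> vecs n" "e 0 = 1" using gv n GA_D(2)[OF n h, of 0] by (auto simp: e_def) (auto simp: g_def)
  have cols: "?T e = e + (\<Sum>r<pnorm lam. vscale (eps lam k $$ (r, 0)) (bs ! r))" "acts ?T bs (Jmat lam)"
  proof -
    have "set bs \<subseteq> vecs n" using bsv0 vecs0_subset by blast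
    hence "?T e = e + (\<Sum>r<pnorm lam. vscale (eps lam k $$ (r, 0)) (bs ! r)) \<and> acts ?T bs (Jmat lam)"
      using conjugates_to_Jaff_iff[OF PPhi, of A "pnorm lam" bs e k] GA_D(1)[OF n A] ev(1) len pn Ah
      unfolding h_eq nS[symmetric] by simp
    thus "?T e = e + (\<Sum>r<pnorm lam. vscale (eps lam k $$ (r, 0)) (bs ! r))" "acts ?T bs (Jmat lam)" by auto
  qed
  have W: "vecs0 n \<subseteq> vspan bs"
  proof
    fix v :: "nat \<Rightarrow> 'a" assume v: "v \<in> vecs0 n"
    define u where "u = act n (inv\<^bsub>GA n\<^esub> h) v"
    have u0: "u 0 = 0" unfolding u_def act_row0[OF n inv(1)] using v by (simp add: vecs0_def)
    have "v = act n h u" unfolding u_def act_mult[OF hc ic, symmetric] inv(3) act_one ..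
    moreover have "act n h u i = (\<Sum>r<length bs. vscale (u (Suc r)) (bs ! r)) i" if "i < n" for i
    proof -
      have "act n h u i = (\<Sum>r<Suc (pnorm lam). h $$ (i, r) * u r)" using that unfolding act_def nS[symmetric] by simp
      also have "\<dots> = (\<Sum>r<pnorm lam. h $$ (i, Suc r) * u (Suc r))" unfolding sum.lessThan_Suc_shift u0 by simp
      finally show ?thesis using that len pn by (simp add: fun_sum_apply vscale_def bs_def g_def mult.commute)
    qed
    moreover have "v i = (\<Sum>r<length bs. vscale (u (Suc r)) (bs ! r)) i" if "\<not> i < n" for i
    proof -
      have "(\<Sum>r<length bs. vscale (u (Suc r)) (bs ! r)) i = 0"
        using that by (simp add: fun_sum_apply vscale_def bs_def g_def)
      thus ?thesis using v that by (simp add: vecs0_def vecs_def)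
    qed
    ultimately have "v = (\<Sum>r<length bs. vscale (u (Suc r)) (bs ! r))" by (intro ext) metis
    thus "v \<in> vspan bs" using vspanI[of "\<lambda>r. u (Suc r)" bs] by metis
  qed
  let ?Js = "map (\<lambda>(m, f). Jblock m f) (blocks lam)"
  have "\<exists>vss. concat vss = bs \<and> list_all2 (\<lambda>vs J. J \<in> carrier_mat (length vs) (length vs)) vss ?Js"
  proof (rule split_by_dims)
    show "square_mat J" if "J \<in> set ?Js" for J using that by (auto simp: Jblock_def Let_def)
    show "length bs = sum_list (map dim_row ?Js)"
      unfolding length_sum_blocks(1) len pn[symmetric] pnorm_type_of[symmetric] type_of_blocks[OF PPhi] ..
  qed
  then obtain vss where vss: "concat vss = bs"
    and car: "list_all2 (\<lambda>vs J. J \<in> carrier_mat (length vs) (length vs)) vss ?Js" by blast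
  have "list_all2 (acts ?T) vss ?Js"
    using cols(2) acts_diag[OF car] unfolding Jmat_blocks vss by blast
  hence acts_nth: "acts ?T (vss ! i) (?Js ! i)" if "i < length (blocks lam)" for i
    using that by (auto simp: list_all2_conv_all_nth)
  have lvss: "length vss = length (blocks lam)" using list_all2_lengthD[OF car] by simp
  have block: "mod_scale n A (f ^ m) (last (vss ! i)) = 0" "set (vss ! i) \<subseteq> act.span n A {last (vss ! i)}"
    "vss ! i \<noteq> []" "m \<ge> 1" "f \<in> Phi" "length (vss ! i) = degree f * m"
    if i: "i < length (blocks lam)" and mf: "blocks lam ! i = (m, f)" for i m f
  proof -
    have "(m, f) \<in> set (blocks lam)" using i mf nth_mem by metis
    from in_blocks[OF PPhi this] show 1: "m \<ge> 1" "f \<in> Phi" by auto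
    have Ji: "?Js ! i = Jblock m f" using i mf by simp
    have "?Js ! i \<in> carrier_mat (length (vss ! i)) (length (vss ! i))"
      using car i by (auto simp: list_all2_conv_all_nth)
    thus l: "length (vss ! i) = degree f * m" using Ji dim_Jblock[of m f] by auto
    show "mod_scale n A (f ^ m) (last (vss ! i)) = 0" "set (vss ! i) \<subseteq> act.span n A {last (vss ! i)}" "vss ! i \<noteq> []"
      using act.acts_Jblock[OF 1(2) 1(1) l] acts_nth[OF i] Ji by auto
  qed
  define D where "D = map (\<lambda>i. (last (vss ! i), blocks lam ! i)) [0..<length (blocks lam)]"
  have sndD: "map snd D = blocks lam" by (simp add: D_def o_def map_nth)
  have inD: "\<exists>i<length (blocks lam). y = last (vss ! i) \<and> blocks lam ! i = (m, f)" if "(y, m, f) \<in> set D" for y m f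
    using that by (auto simp: D_def)
  have sub: "act.subspace n A (vecs0 n)" by (rule vecs0_subspace[OF n A])
  have "act.decomp n A (vecs0 n) D" unfolding act.decomp_def
  proof (intro conjI ballI)
    fix y assume "y \<in> set D"
    moreover obtain x m f where y: "y = (x, m, f)" by (metis prod.exhaust)
    ultimately obtain i where i: "i < length (blocks lam)" "blocks lam ! i = (m, f)" "x = last (vss ! i)"
      using inD by blast
    show "case y of (x, m, f) \<Rightarrow> m \<ge> 1 \<and> f \<in> Phi \<and> mod_scale n A (f ^ m) x = 0"
      unfolding y prod.case i(3) using block(1,4,5)[OF i(1,2)] by blast
  next
    show "act.span n A (fst ` set D) = vecs0 n"
    proof (rule subset_antisym)
      have "fst ` set D \<subseteq> vecs0 n"
      proof clarify
        fix y m f assume "(y, m, f) \<in> set D"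
        then obtain i where i: "i < length (blocks lam)" "y = last (vss ! i)" "blocks lam ! i = (m, f)" using inD by blast
        hence "y \<in> set (vss ! i)" using block(3)[OF i(1,3)] by simp
        moreover have "vss ! i \<in> set vss" using i(1) lvss by simp
        hence "set (vss ! i) \<subseteq> set bs" unfolding vss[symmetric] by auto
        ultimately show "fst (y, m, f) \<in> vecs0 n" using bsv0 by auto
      qed
      thus "act.span n A (fst ` set D) \<subseteq> vecs0 n" using sub by (rule act.span_minimal)
      have bs_span: "set bs \<subseteq> act.span n A (fst ` set D)"
      proof
        fix v assume "v \<in> set bs"
        then obtain vs where vs: "vs \<in> set vss" "v \<in> set vs" unfolding vss[symmetric] by auto
        then obtain i where i: "i < length (blocks lam)" "v \<in> set (vss ! i)"
          unfolding in_set_conv_nth[of vs] lvss by blast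
        obtain m f where mf: "blocks lam ! i = (m, f)" by (metis prod.exhaust)
        have "last (vss ! i) \<in> fst ` set D" using i(1) by (force simp: D_def)
        hence "act.span n A {last (vss ! i)} \<subseteq> act.span n A (fst ` set D)" by (intro act.span_mono) simp
        thus "v \<in> act.span n A (fst ` set D)" using block(2)[OF i(1) mf] i(2) by blast
      qed
      have "vspan bs \<subseteq> act.span n A (fst ` set D)"
      proof
        fix v assume "v \<in> vspan bs"
        then obtain a where v: "v = (\<Sum>r<length bs. vscale (a r) (bs ! r))" by (rule vspanE)
        show "v \<in> act.span n A (fst ` set D)" unfolding v
        proof (rule act.span_sum)
          fix r assume "r \<in> {..<length bs}"
          hence "bs ! r \<in> act.span n A (fst ` set D)" using bs_span by auto
          from act.span_scale[OF this, of "[:a r:]"]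
          show "vscale (a r) (bs ! r) \<in> act.span n A (fst ` set D)" by (simp only: act.op_scale_const)
        qed
      qed
      with W show "vecs0 n \<subseteq> act.span n A (fst ` set D)" by blast
    qed
    have "(\<Sum>(x, m, f)\<leftarrow>D. m * degree f) = (\<Sum>(m, f)\<leftarrow>map snd D. m * degree f)"
      by (rule sum_map_snd)
    also have "\<dots> = n - 1" unfolding sndD pnorm_type_of[symmetric] type_of_blocks[OF PPhi] by (rule pn)
    finally show "card (vecs0 n :: (nat \<Rightarrow> 'a) set) = CARD('a) ^ (\<Sum>(x, m, f)\<leftarrow>D. m * degree f)"
      using card_vecs0(2)[OF n] by metis
  qed
  moreover have "type_of (map snd D) = lam" unfolding sndD by (rule type_of_blocks[OF PPhi])
  moreover have "if k = 0 then ?T e = e else \<exists>x. (x, k, tm1) \<in> set D \<and> ?T e = e + x"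
  proof (cases "k = 0")
    case True
    show ?thesis unfolding if_P[OF True] using cols(1) unfolding True sum_eps_0 add.right_neutral .
  next
    case False
    hence kk: "k \<in># lam tm1" using k by simp
    from blocks_split[OF PPhi this] obtain L1 L2 where L: "blocks lam = L1 @ (k, tm1) # L2"
      "(\<Sum>(m, f)\<leftarrow>L1. m * degree f) + k = (\<Sum>j = 1..k. j * count (lam tm1) j)" by blast
    let ?i = "length L1"
    have i: "?i < length (blocks lam)" "blocks lam ! ?i = (k, tm1)" by (simp_all add: L(1))
    have lv: "length (vss ! ?i) = k" using block(6)[OF i] by simp
    have dec: "vss = take ?i vss @ vss ! ?i # drop (Suc ?i) vss" using i(1) lvss by (simp add: id_take_nth_drop)
    have "map length (take ?i vss) = map (\<lambda>(m, f). m * degree f) L1"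
    proof (rule nth_equalityI)
      fix j assume "j < length (map length (take ?i vss))"
      hence j: "j < ?i" by simp
      obtain m f where mf: "L1 ! j = (m, f)" by (metis prod.exhaust)
      have bj: "blocks lam ! j = (m, f)" using j mf by (simp add: L(1) nth_append)
      have "j < length (blocks lam)" using j i(1) by simp
      from block(6)[OF this bj] show "map length (take ?i vss) ! j = map (\<lambda>(m, f). m * degree f) L1 ! j"
        using j mf lvss i(1) by (simp add: mult.commute)
    qed (use i(1) lvss in simp)
    hence l1: "length (concat (take ?i vss)) = (\<Sum>(m, f)\<leftarrow>L1. m * degree f)" by (simp add: length_concat)
    let ?pos = "\<Sum>j = 1..k. j * count (lam tm1) j"
    have bs_eq: "bs = concat (take ?i vss) @ vss ! ?i @ concat (drop (Suc ?i) vss)"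
      unfolding vss[symmetric] by (subst dec) simp
    \<comment> \<open>The zero-based index of the last vector in the piece that belongs to the
      chosen block.\<close>
    have pos: "?pos - 1 = length (concat (take ?i vss)) + (k - 1)" using L(2) l1 False by simp
    have "bs ! (?pos - 1) = vss ! ?i ! (k - 1)"
    proof -
      have "bs ! (?pos - 1) = (vss ! ?i @ concat (drop (Suc ?i) vss)) ! (k - 1)"
        unfolding pos by (subst bs_eq) (rule nth_append_length_plus)
      thus ?thesis using lv False by (simp add: nth_append)
    qed
    also have "\<dots> = last (vss ! ?i)" using block(3)[OF i] lv by (simp add: last_conv_nth)
    finally have b: "bs ! (?pos - 1) = last (vss ! ?i)" .
    have "?pos \<le> length bs" unfolding L(2)[symmetric] l1[symmetric] using arg_cong[OF bs_eq, of length] lv by simp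
    hence "(\<Sum>r<pnorm lam. vscale (eps lam k $$ (r, 0)) (bs ! r)) = last (vss ! ?i)"
      unfolding b[symmetric] using L(2) False len pn by (intro sum_eps[OF _ refl]) auto
    hence "?T e = e + last (vss ! ?i)" using cols(1) by simp
    moreover have "(last (vss ! ?i), k, tm1) \<in> set D" using i by (force simp: D_def)
    ultimately show ?thesis using False by auto
  qed
  ultimately show ?thesis unfolding module_type_def using ev by blast
qed

lemma has_type_iff:
  "n \<ge> 1 \<Longrightarrow> A \<in> carrier (GA n) \<Longrightarrow> has_type n A (lam, k) \<longleftrightarrow> module_type n A lam k"
  using module_type_imp_has_type has_type_imp_module_type by blast

section \<open>Existence and uniqueness of types\<close>

lemma e0_vecs: assumes "n \<ge> 1" shows "(unitv 0 :: nat \<Rightarrow> 'a::comm_ring_1) \<in> vecs n" "unitv 0 0 = (1 :: 'a)"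
  using assms by (auto simp: vecs_def unitv_def)

text \<open>The displacement of \<open>unitv 0\<close> lies in the hyperplane, and
  \<open>decomp_adapt\<close> writes it as \<open>(t - 1) w\<close> plus zero or a generator.
  Replacing the vector by \<open>unitv 0 - w\<close> removes the first term.\<close>

lemma has_type_exists:
  fixes A :: "'a::{field,finite} mat"
  assumes n: "n \<ge> 1" and A: "A \<in> carrier (GA n)"
  shows "\<exists>lam k. has_type n A (lam, k)"
proof -
  let ?T = "act n A" and ?e = "unitv 0 :: nat \<Rightarrow> 'a"
  have "\<exists>D. act.decomp n A (vecs0 n) D"
    using act_injective[OF n A]
    by (intro act.decomp_exists card_vecs0 n vecs0_subspace A) (simp only: act.op_scale_t)
  then obtain D where D: "act.decomp n A (vecs0 n) D" by blast
  have \<alpha>: "?T ?e - ?e \<in> vecs0 n"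
    using act_vecs[OF e0_vecs(1)[OF n], of A] act_row0[OF n A, of ?e] e0_vecs[OF n]
    by (simp add: vecs0_def vecs_def)
  obtain w where w: "w \<in> vecs0 n" and cases: "?T ?e - ?e = mod_scale n A tm1 w \<or>
    (\<exists>D' x k. act.decomp n A (vecs0 n) D' \<and> mset (map snd D') = mset (map snd D) \<and> (x, k, tm1) \<in> set D' \<and>
      ?T ?e - ?e = mod_scale n A tm1 w + x)"
    using act.decomp_adapt[OF D \<alpha>] by blast
  define e where "e = ?e - w"
  have e: "e \<in> vecs n" "e 0 = 1"
    using w e0_vecs[OF n, where 'a = 'a] by (auto simp: e_def vecs0_def vecs_def)
  have Te: "?T e = ?T ?e - ?T w"
    using act.T_add[of n A e w] by (simp add: e_def)
  have "\<exists>lam k. module_type n A lam k"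
    using cases
  proof
    assume "?T ?e - ?e = mod_scale n A tm1 w"
    hence "?T e = e" unfolding Te unfolding act.op_scale_tm1 e_def by (simp add: algebra_simps)
    hence "module_type n A (type_of (map snd D)) 0" unfolding module_type_def using D e by auto
    thus ?thesis by blast
  next
    assume "\<exists>D' x k. act.decomp n A (vecs0 n) D' \<and> mset (map snd D') = mset (map snd D) \<and> (x, k, tm1) \<in> set D' \<and>
      ?T ?e - ?e = mod_scale n A tm1 w + x"
    then obtain D' x k where D': "act.decomp n A (vecs0 n) D'" and x: "(x, k, tm1) \<in> set D'"
      and eq: "?T ?e - ?e = mod_scale n A tm1 w + x" by blast
    have "?T e = e + x" using eq unfolding Te unfolding act.op_scale_tm1 e_def by (simp add: algebra_simps)
    moreover have "k \<noteq> 0" using D' x unfolding act.decomp_def by force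
    ultimately have "module_type n A (type_of (map snd D')) k"
      unfolding module_type_def using D' e x by auto
    thus ?thesis by blast
  qed
  thus ?thesis using module_type_imp_has_type[OF n A] by blast
qed

text \<open>The increment of the sum from \<open>j\<close> to \<open>j + 1\<close> is the number of
  parts larger than \<open>j\<close>; a second difference gives the multiplicity of
  \<open>j + 1\<close>. The multiplicity of 0 is invisible to these sums, whence the side
  conditions.\<close>

lemma min_sum_determines:
  fixes M N :: "nat multiset"
  assumes eq: "\<And>j. (\<Sum>m\<in>#M. min j m) = (\<Sum>m\<in>#N. min j m)" and 0: "0 \<notin># M" "0 \<notin># N"
  shows "M = N"
proof (rule multiset_eqI)
  fix m
  have step: "(\<Sum>m\<in>#M. min (Suc j) m) = (\<Sum>m\<in>#M. min j m) + size (filter_mset (\<lambda>m. m > j) M)" for M j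
    by (induction M) auto
  have size: "size (filter_mset (\<lambda>m. m > j) M) = size (filter_mset (\<lambda>m. m > j) N)" for j
    using step[of j M] step[of j N] eq[of j] eq[of "Suc j"] by linarith
  have count: "size (filter_mset (\<lambda>m. m > j) M) = size (filter_mset (\<lambda>m. m > Suc j) M) + count M (Suc j)" for M j
    by (induction M) auto
  show "count M m = count N m"
  proof (cases m)
    case 0
    thus ?thesis using \<open>0 \<notin># M\<close> \<open>0 \<notin># N\<close> by (simp add: not_in_iff)
  next
    case (Suc j)
    show ?thesis unfolding Suc using count[of j M] count[of j N] size[of j] size[of "Suc j"] by linarith
  qed
qed

lemma sum_decomp_type_of:
  "(\<Sum>(x, m, f)\<leftarrow>D. if f = g then degree g * min j m else 0) = degree g * (\<Sum>m\<in>#type_of (map snd D) g. min j m)"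
  by (induction D) (auto simp: type_of_Nil type_of_Cons algebra_simps)

lemma decomp_card_kernel:
  fixes A :: "'a::{field,finite} mat"
  assumes "act.decomp n A W D" "g \<in> Phi"
  shows "card {w \<in> W. mod_scale n A (g ^ j) w = 0} =
    CARD('a) ^ (degree g * (\<Sum>m\<in>#type_of (map snd D) g. min j m))"
  using act.card_kernel[OF assms(1) Phi_D(1,2)[OF assms(2)], of j] unfolding sum_decomp_type_of .

lemma decomp_PPhi: "act.decomp n A W D \<Longrightarrow> type_of (map snd D) \<in> PPhi"
  by (rule type_of_PPhi) (auto simp: act.decomp_def)

lemma module_type_PPhi: "module_type n A lam k \<Longrightarrow> lam \<in> PPhi"
  unfolding module_type_def using decomp_PPhi by blast

text \<open>The kernel sizes of all powers \<open>g^j\<close> on the hyperplane depend on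
  \<open>A\<close> alone, and by \<open>min_sum_determines\<close> they fix the parts at
  \<open>g\<close>.\<close>

lemma module_type_unique_partition:
  fixes A :: "'a::{field,finite} mat"
  assumes "module_type n A lam k" "module_type n A lam' k'"
  shows "lam = lam'"
proof
  fix g
  obtain D D' where D: "act.decomp n A (vecs0 n) D" "type_of (map snd D) = lam"
    and D': "act.decomp n A (vecs0 n) D'" "type_of (map snd D') = lam'"
    using assms unfolding module_type_def by blast
  have P: "lam \<in> PPhi" "lam' \<in> PPhi" using assms module_type_PPhi by blast+
  show "lam g = lam' g"
  proof (cases "g \<in> Phi")
    case True
    show ?thesis
    proof (rule min_sum_determines)
      fix j
      have "CARD('a) ^ (degree g * (\<Sum>m\<in>#lam g. min j m)) = CARD('a) ^ (degree g * (\<Sum>m\<in>#lam' g. min j m))"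
        using decomp_card_kernel[OF D(1) True, of j] decomp_card_kernel[OF D'(1) True, of j] D(2) D'(2) by simp
      hence "degree g * (\<Sum>m\<in>#lam g. min j m) = degree g * (\<Sum>m\<in>#lam' g. min j m)" by (rule power_card_inject)
      thus "(\<Sum>m\<in>#lam g. min j m) = (\<Sum>m\<in>#lam' g. min j m)" using Phi_D(3)[OF True] by (simp only: nat_mult_eq_cancel1)
    qed (use P in \<open>auto simp: PPhi_def\<close>)
  next
    case False
    hence "lam g = {#}" "lam' g = {#}" using P by (auto simp: PPhi_def)
    thus ?thesis by simp
  qed
qed

text \<open>Two vectors of first coordinate 1 differ by some \<open>w\<close> in the hyperplane, so
  their displacements differ by \<open>(t - 1) w\<close>. That of \<open>e'\<close> is killed by
  \<open>tm1 ^ k'\<close>, and \<open>generator_order\<close> bounds \<open>k\<close> by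
  \<open>k'\<close>. Exchanging the roles later gives equality.\<close>

lemma module_type_unique_le:
  fixes A :: "'a::{field,finite} mat"
  assumes "module_type n A lam k" "module_type n A lam' k'"
  shows "k \<le> k'"
proof (cases "k = 0")
  case False
  obtain D e where D: "act.decomp n A (vecs0 n) D" and e: "e \<in> vecs n" "e 0 = 1"
    and "if k = 0 then act n A e = e else \<exists>x. (x, k, tm1) \<in> set D \<and> act n A e = e + x"
    using assms(1) unfolding module_type_def by blast
  then obtain x where x: "(x, k, tm1) \<in> set D" "act n A e = e + x" using False by auto
  obtain D' e' where D': "act.decomp n A (vecs0 n) D'" and e': "e' \<in> vecs n" "e' 0 = 1"
    and k': "if k' = 0 then act n A e' = e' else \<exists>x. (x, k', tm1) \<in> set D' \<and> act n A e' = e' + x"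
    using assms(2) unfolding module_type_def by blast
  define w where "w = e' - e"
  have w: "w \<in> vecs0 n" using e e' by (auto simp: w_def vecs0_def vecs_def)
  have "act n A (e + w) = e + x + act n A w" using act.T_add[of n A e w] x(2) by simp
  hence "act n A (e + w) - (e + w) = x + (act n A w - w)" by (simp add: algebra_simps)
  moreover have "e + w = e'" by (simp add: w_def)
  ultimately have eq: "act n A e' - e' = x + mod_scale n A tm1 w" by (simp only: act.op_scale_tm1)
  have "mod_scale n A (tm1 ^ k') (act n A e' - e') = 0"
  proof (cases "k' = 0")
    case True
    hence "act n A e' - e' = 0" using k' by simp
    thus ?thesis by (simp only: act.scale_zero_right)
  next
    case False
    then obtain y where y: "(y, k', tm1) \<in> set D'" "act n A e' = e' + y" using k' by auto
    have all: "\<forall>(x, m, f)\<in>set D'. m \<ge> 1 \<and> f \<in> Phi \<and> mod_scale n A (f ^ m) x = 0"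
      using D' unfolding act.decomp_def by blast
    have "k' \<ge> 1 \<and> (tm1 :: 'a poly) \<in> Phi \<and> mod_scale n A (tm1 ^ k') y = 0"
      using bspec[OF all y(1)] unfolding prod.case .
    moreover have "act n A e' - e' = y" unfolding y(2) by simp
    ultimately show ?thesis by (simp only:)
  qed
  thus ?thesis unfolding eq by (rule act.generator_order[OF D x(1) w])
qed simp

lemma module_type_unique:
  "module_type n A lam k \<Longrightarrow> module_type n A lam' k' \<Longrightarrow> lam = lam' \<and> k = k'"
  using module_type_unique_partition module_type_unique_le by (metis le_antisym)

section \<open>Modified types\<close>

lemma modify_other: "f \<noteq> tm1 \<Longrightarrow> modify lam f = lam f"
  by (simp add: modify_def)

lemma modify_tm1: "modify lam tm1 = filter_mset (\<lambda>i. i > 0) (image_mset (\<lambda>i. i - 1) (lam tm1))"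
  by (simp add: modify_def)

lemma decrement_parts:
  assumes "0 \<notin># M"
  shows "M = image_mset Suc (filter_mset (\<lambda>i. i > 0) (image_mset (\<lambda>i. i - 1) M)) + replicate_mset (count M 1) 1"
    "sum_mset (filter_mset (\<lambda>i. i > 0) (image_mset (\<lambda>i. i - 1) M)) + size M = sum_mset M"
  using assms by (induction M) (auto simp: le_Suc_eq)

lemma PPhi_0: "lam \<in> PPhi \<Longrightarrow> 0 \<notin># lam f"
  by (simp add: PPhi_def)

lemma modify_PPhi: assumes "lam \<in> PPhi" shows "modify lam \<in> PPhi"
proof -
  have "{f. modify lam f \<noteq> {#}} \<subseteq> insert tm1 {f. lam f \<noteq> {#}}" by (auto simp: modify_def)
  moreover have "finite (insert tm1 {f. lam f \<noteq> {#}})" using assms by (simp add: PPhi_def)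
  ultimately have "finite {f. modify lam f \<noteq> {#}}" by (rule finite_subset)
  moreover have "0 \<notin># modify lam f" for f using PPhi_0[OF assms] by (auto simp: modify_def)
  moreover have "f \<in> Phi" if "modify lam f \<noteq> {#}" for f
    using that assms tm1_Phi by (cases "f = tm1") (auto simp: modify_other PPhi_def)
  ultimately show ?thesis unfolding PPhi_def by blast
qed

lemma pnorm_split:
  assumes "lam \<in> PPhi"
  shows "pnorm lam = sum_mset (lam tm1) + (\<Sum>f \<in> {f. lam f \<noteq> {#}} - {tm1}. degree f * sum_mset (lam f))"
proof -
  have fin: "finite {f. lam f \<noteq> {#}}" using assms by (simp add: PPhi_def)
  have "pnorm lam = (\<Sum>f \<in> insert tm1 {f. lam f \<noteq> {#}}. degree f * sum_mset (lam f))"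
    by (rule pnorm_superset) (use fin in auto)
  also have "\<dots> = degree (tm1 :: 'a poly) * sum_mset (lam tm1) + (\<Sum>f \<in> {f. lam f \<noteq> {#}} - {tm1}. degree f * sum_mset (lam f))"
    using fin by (rule sum.insert_remove)
  finally show ?thesis by simp
qed

lemma modify_support: "{f. modify lam f \<noteq> {#}} - {tm1} = {f. lam f \<noteq> {#}} - {tm1}"
  by (auto simp: modify_other)

lemma pnorm_modify:
  assumes "lam \<in> PPhi" shows "pnorm (modify lam) + size (lam tm1) = pnorm lam"
proof -
  have "(\<Sum>f \<in> {f. lam f \<noteq> {#}} - {tm1}. degree f * sum_mset (modify lam f)) =
      (\<Sum>f \<in> {f. lam f \<noteq> {#}} - {tm1}. degree f * sum_mset (lam f))"
    by (intro sum.cong refl) (auto simp: modify_other)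
  thus ?thesis
    unfolding pnorm_split[OF assms] pnorm_split[OF modify_PPhi[OF assms]] modify_support modify_tm1
    using decrement_parts(2)[OF PPhi_0[OF assms], of tm1] by linarith
qed

text \<open>Subtracting 1 forgets only how many parts at \<open>t - 1\<close> equal 1. The total
  norm restores this number, because through \<open>pnorm_modify\<close> it determines the number of
  parts.\<close>

lemma modify_inject:
  assumes lam: "lam \<in> PPhi" "lam' \<in> PPhi" and eq: "modify lam = modify lam'" "pnorm lam = pnorm lam'"
  shows "lam = lam'"
proof
  fix f
  show "lam f = lam' f"
  proof (cases "f = tm1")
    case True
    have "size (lam tm1) = size (lam' tm1)" using pnorm_modify[OF lam(1)] pnorm_modify[OF lam(2)] eq by simp
    moreover have "lam tm1 = image_mset Suc (modify lam tm1) + replicate_mset (count (lam tm1) 1) 1"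
      "lam' tm1 = image_mset Suc (modify lam' tm1) + replicate_mset (count (lam' tm1) 1) 1"
      unfolding modify_tm1 using decrement_parts(1) PPhi_0 lam by blast+
    ultimately show ?thesis unfolding True eq(1)
      by (metis add_left_cancel eq(1) size_replicate_mset size_union)
  next
    case False
    thus ?thesis using fun_cong[OF eq(1), of f] by (simp add: modify_other)
  qed
qed

section \<open>The modified type as a function on the group, and its fibres\<close>

definition mtype :: "nat \<Rightarrow> 'a::{field,finite} mat \<Rightarrow> 'a ptype \<times> nat" where
  "mtype n A = (THE x. has_modified_type n A x)"

lemma has_modified_type_iff:
  fixes A :: "'a::{field,finite} mat"
  assumes n: "n \<ge> 1" and A: "A \<in> carrier (GA n)"
  shows "has_modified_type n A x \<longleftrightarrow> mtype n A = x"
proof -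
  have ex: "\<exists>x. has_modified_type n A x"
    using has_type_exists[OF n A] unfolding has_modified_type_def by blast
  have uniq: "x = y" if x0: "has_modified_type n A x" and y0: "has_modified_type n A y" for x y
  proof -
    obtain a i b j where xy: "x = (a, i)" "y = (b, j)" by (metis prod.exhaust)
    obtain lam where x: "has_type n A (lam, i)" "modify lam = a"
      using x0 unfolding xy has_modified_type_def prod.case by blast
    obtain lam' where y: "has_type n A (lam', j)" "modify lam' = b"
      using y0 unfolding xy has_modified_type_def prod.case by blast
    have "lam = lam' \<and> i = j"
      using x(1) y(1) unfolding has_type_iff[OF n A] by (rule module_type_unique)
    thus "x = y" using x(2) y(2) xy by simp
  qed
  show ?thesis
  proof
    assume "has_modified_type n A x"
    thus "mtype n A = x" unfolding mtype_def using uniq by (intro the_equality)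
  next
    assume "mtype n A = x"
    moreover have "has_modified_type n A (mtype n A)"
      unfolding mtype_def by (rule theI') (use ex uniq in blast)
    ultimately show "has_modified_type n A x" by simp
  qed
qed

lemma mtypeE:
  fixes A :: "'a::{field,finite} mat"
  assumes n: "n \<ge> 1" and A: "A \<in> carrier (GA n)"
  obtains lam k where "has_type n A (lam, k)" "mtype n A = (modify lam, k)"
proof -
  have "has_modified_type n A (mtype n A)" using has_modified_type_iff[OF n A] by simp
  then obtain lam where "has_type n A (lam, snd (mtype n A))" "modify lam = fst (mtype n A)"
    unfolding has_modified_type_def by (auto simp: split_beta)
  thus ?thesis using that by (metis prod.collapse)
qed

lemma mtypeI:
  fixes A :: "'a::{field,finite} mat"
  assumes "n \<ge> 1" "A \<in> carrier (GA n)" "has_type n A (lam, k)"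
  shows "mtype n A = (modify lam, k)"
  using has_modified_type_iff[OF assms(1,2), of "(modify lam, k)"] assms(3)
  unfolding has_modified_type_def by auto

lemma mtype_Phat:
  fixes A :: "'a::{field,finite} mat"
  assumes n: "n \<ge> 1" and A: "A \<in> carrier (GA n)"
  shows "mtype n A \<in> Phat"
proof -
  obtain lam k where ht: "has_type n A (lam, k)" and eq: "mtype n A = (modify lam, k)" by (rule mtypeE[OF n A])
  have lam: "lam \<in> PPhi" "k = 0 \<or> k \<in># lam tm1" using ht by (auto simp: has_type_def)
  have "k - 1 = 0 \<or> k - 1 \<in># modify lam tm1" if "k \<ge> 1"
    using lam(2) that unfolding modify_tm1 by (cases "k - 1 = 0") auto
  thus ?thesis unfolding eq Phat_def using modify_PPhi[OF lam(1)] by auto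
qed

lemma has_type_conj:
  fixes A :: "'a::{field,finite} mat"
  assumes n: "n \<ge> 1" and g: "g \<in> carrier (GA n)" and J: "Jaff lam k \<in> carrier (GA n)" and ht: "has_type n A (lam, k)"
  shows "has_type n (g * A * inv\<^bsub>GA n\<^esub> g) (lam, k)"
proof -
  interpret group "GA n :: 'a mat monoid" by (rule GA_group[OF n])
  obtain h where h: "h \<in> carrier (GA n)" "A = h \<otimes>\<^bsub>GA n\<^esub> Jaff lam k \<otimes>\<^bsub>GA n\<^esub> inv\<^bsub>GA n\<^esub> h"
    using ht unfolding has_type_def by auto
  have "g \<otimes>\<^bsub>GA n\<^esub> A \<otimes>\<^bsub>GA n\<^esub> inv\<^bsub>GA n\<^esub> g =
      (g \<otimes>\<^bsub>GA n\<^esub> h) \<otimes>\<^bsub>GA n\<^esub> Jaff lam k \<otimes>\<^bsub>GA n\<^esub> inv\<^bsub>GA n\<^esub> (g \<otimes>\<^bsub>GA n\<^esub> h)"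
    unfolding h(2) inv_mult_group[OF g h(1)] using g h(1) J by (simp add: m_assoc del: GA_simps)
  moreover have "g \<otimes>\<^bsub>GA n\<^esub> h \<in> carrier (GA n)" using g h(1) by (rule m_closed)
  ultimately have "\<exists>h\<in>carrier (GA n). g * A * inv\<^bsub>GA n\<^esub> g = h \<otimes>\<^bsub>GA n\<^esub> Jaff lam k \<otimes>\<^bsub>GA n\<^esub> inv\<^bsub>GA n\<^esub> h"
    unfolding GA_simps(2) by blast
  thus ?thesis using ht unfolding has_type_def by auto
qed

lemma det_diag_block_nonzero:
  assumes "\<And>J. J \<in> set Js \<Longrightarrow> square_mat J \<and> det J \<noteq> (0 :: 'a::field)"
  shows "det (diag_block_mat Js) \<noteq> 0"
  using assms
proof (induction Js)
  case (Cons J Js)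
  have sq: "square_mat (diag_block_mat Js)" using Cons.prems by (intro diag_block_mat_square) auto
  define B where "B = diag_block_mat Js"
  have dims: "dim_col B = dim_row B" "dim_col J = dim_row J" using sq Cons.prems[of J] by (auto simp: B_def)
  have B: "B \<in> carrier_mat (dim_row B) (dim_row B)" by (rule carrier_matI) (simp_all only: dims)
  have J: "J \<in> carrier_mat (dim_row J) (dim_row J)" by (rule carrier_matI) (simp_all only: dims)
  have "det (diag_block_mat (J # Js)) = det J * det B"
    unfolding diag_block_mat.simps Let_def B_def[symmetric] dims
    by (rule det_four_block_mat_upper_right_zero[OF J _ _ B]) auto
  moreover have "det B \<noteq> 0" unfolding B_def using Cons by auto
  ultimately show ?case using Cons.prems[of J] by simp
qed simp

lemma det_Jblock_nonzero:
  assumes "f \<in> (Phi :: 'a::{field,finite} poly set)" "m \<ge> 1"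
  shows "det (Jblock m f) \<noteq> 0"
proof
  assume 0: "det (Jblock m f) = 0"
  obtain Q where "block_exponent f m Q" using block_exponent_exists[OF assms] by blast
  then interpret block_exponent f m Q .
  obtain v where v: "v \<in> carrier_vec (degree f * m)" "v \<noteq> 0\<^sub>v (degree f * m)" "Jblock m f *\<^sub>v v = 0\<^sub>v (degree f * m)"
    using 0 det_0_iff_vec_prod_zero_field[OF dim_Jblock] by blast
  have "v $ c = 0" if c: "c < degree f * m" for c
  proof (rule Jblock_kernel[OF _ c])
    fix r assume r: "r < degree f * m"
    have "(Jblock m f *\<^sub>v v) $ r = (\<Sum>c<degree f * m. Jblock m f $$ (r, c) * v $ c)"
      using r v(1) dim_Jblock[of m f] by (simp add: scalar_prod_def atLeast0LessThan)
    thus "(\<Sum>c<degree f * m. Jblock m f $$ (r, c) * v $ c) = 0" unfolding v(3) using r by simp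
  qed
  hence "v = 0\<^sub>v (degree f * m)" using v(1) by (intro eq_vecI) auto
  with v(2) show False by simp
qed

lemma Jaff_GA:
  assumes "lam \<in> (PPhi :: 'a::{field,finite} ptype set)"
  shows "Jaff lam k \<in> carrier (GA (Suc (pnorm lam)))"
proof -
  have Jm: "Jmat lam \<in> carrier_mat (pnorm lam) (pnorm lam)" by (rule Jmat_carrier[OF assms])
  have "det (Jmat lam) \<noteq> 0" unfolding Jmat_blocks
  proof (rule det_diag_block_nonzero)
    fix J assume "J \<in> set (map (\<lambda>(m, f). Jblock m f) (blocks lam))"
    then obtain m f where J: "J = Jblock m f" "(m, f) \<in> set (blocks lam)" by auto
    have "det J \<noteq> 0" unfolding J(1) using in_blocks[OF assms J(2)] by (intro det_Jblock_nonzero)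
    moreover have "square_mat J" unfolding J(1) by (simp add: Jblock_def Let_def)
    ultimately show "square_mat J \<and> det J \<noteq> 0" by blast
  qed
  hence "invertible_mat (Jmat lam)" using invertible_mat_iff_det[OF Jm] by simp
  moreover have "eps lam k \<in> carrier_mat (pnorm lam) 1" by (simp add: eps_def)
  ultimately show ?thesis using Jm unfolding GA_def Jaff_def by auto
qed

lemma has_type_Jaff:
  assumes "lam \<in> (PPhi :: 'a::{field,finite} ptype set)" "k = 0 \<or> k \<in># lam tm1"
  shows "has_type (Suc (pnorm lam)) (Jaff lam k) (lam, k)"
proof -
  interpret group "GA (Suc (pnorm lam)) :: 'a mat monoid" by (rule GA_group) simp
  have "Jaff lam k = \<one>\<^bsub>GA (Suc (pnorm lam))\<^esub> \<otimes>\<^bsub>GA (Suc (pnorm lam))\<^esub> Jaff lam k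
      \<otimes>\<^bsub>GA (Suc (pnorm lam))\<^esub> inv\<^bsub>GA (Suc (pnorm lam))\<^esub> \<one>\<^bsub>GA (Suc (pnorm lam))\<^esub>"
    using Jaff_GA[OF assms(1), of k] by (simp del: GA_simps)
  thus ?thesis unfolding has_type_def using assms one_closed by auto
qed

lemma has_type_D:
  assumes "n \<ge> 1" "has_type n A (lam, k)"
  shows "lam \<in> PPhi" "n = Suc (pnorm lam)" "k = 0 \<or> k \<in># lam tm1"
  using assms by (auto simp: has_type_def)

lemma mtype_conj:
  fixes A :: "'a::{field,finite} mat"
  assumes n: "n \<ge> 1" and A: "A \<in> carrier (GA n)" and g: "g \<in> carrier (GA n)"
  shows "mtype n (g * A * inv\<^bsub>GA n\<^esub> g) = mtype n A"
proof -
  interpret group "GA n :: 'a mat monoid" by (rule GA_group[OF n])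
  obtain lam k where ht: "has_type n A (lam, k)" "mtype n A = (modify lam, k)" by (rule mtypeE[OF n A])
  have "Jaff lam k \<in> carrier (GA n)" using Jaff_GA has_type_D[OF n ht(1)] by metis
  hence "has_type n (g * A * inv\<^bsub>GA n\<^esub> g) (lam, k)" using has_type_conj[OF n g _ ht(1)] by blast
  moreover have "g * A * inv\<^bsub>GA n\<^esub> g \<in> carrier (GA n)"
    using m_closed[OF m_closed[OF g A] inv_closed[OF g]] by simp
  ultimately show ?thesis using mtypeI[OF n] ht(2) by metis
qed

text \<open>In a fixed \<open>GA n\<close> the modified type determines the type by
  \<open>modify_inject\<close>, so both matrices are conjugate to the same
  \<open>Jaff lam k\<close>.\<close>

lemma conjugate_of_mtype:
  fixes A :: "'a::{field,finite} mat"
  assumes n: "n \<ge> 1" and A: "A \<in> carrier (GA n)" and B: "B \<in> carrier (GA n)" and eq: "mtype n A = mtype n B"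
  shows "\<exists>g\<in>carrier (GA n). B = g * A * inv\<^bsub>GA n\<^esub> g"
proof -
  interpret group "GA n :: 'a mat monoid" by (rule GA_group[OF n])
  obtain lam k where a: "has_type n A (lam, k)" "mtype n A = (modify lam, k)" by (rule mtypeE[OF n A])
  obtain lam' k' where b: "has_type n B (lam', k')" "mtype n B = (modify lam', k')" by (rule mtypeE[OF n B])
  have "lam = lam'"
    using modify_inject has_type_D[OF n a(1)] has_type_D[OF n b(1)] a(2) b(2) eq by (metis Suc_inject fst_conv)
  moreover have "k = k'" using a(2) b(2) eq by simp
  ultimately have b': "has_type n B (lam, k)" using b(1) by simp
  let ?J = "Jaff lam k"
  have J: "?J \<in> carrier (GA n)" using Jaff_GA has_type_D[OF n a(1)] by metis
  obtain h where h: "h \<in> carrier (GA n)" "A = h \<otimes>\<^bsub>GA n\<^esub> ?J \<otimes>\<^bsub>GA n\<^esub> inv\<^bsub>GA n\<^esub> h"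
    using a(1) unfolding has_type_def by auto
  obtain h' where h': "h' \<in> carrier (GA n)" "B = h' \<otimes>\<^bsub>GA n\<^esub> ?J \<otimes>\<^bsub>GA n\<^esub> inv\<^bsub>GA n\<^esub> h'"
    using b' unfolding has_type_def by auto
  let ?g = "h' \<otimes>\<^bsub>GA n\<^esub> inv\<^bsub>GA n\<^esub> h"
  have inv_g: "inv\<^bsub>GA n\<^esub> ?g = h \<otimes>\<^bsub>GA n\<^esub> inv\<^bsub>GA n\<^esub> h'"
    using h h' by (simp add: inv_mult_group del: GA_simps)
  have cancel: "inv\<^bsub>GA n\<^esub> h \<otimes>\<^bsub>GA n\<^esub> (h \<otimes>\<^bsub>GA n\<^esub> y) = y" if "y \<in> carrier (GA n)" for y
    using that h(1) by (simp add: m_assoc[symmetric] del: GA_simps)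
  have "?g \<otimes>\<^bsub>GA n\<^esub> A \<otimes>\<^bsub>GA n\<^esub> inv\<^bsub>GA n\<^esub> ?g = B"
    unfolding inv_g h(2) h'(2) using h(1) h'(1) J by (simp add: m_assoc cancel del: GA_simps)
  moreover have "?g \<in> carrier (GA n)" using h(1) h'(1) by (simp del: GA_simps)
  ultimately show ?thesis unfolding GA_simps(2) by metis
qed

text \<open>Adding 1 to all parts at \<open>t - 1\<close> undoes the modification, and an extra part
  1 provides the part that \<open>k = 1\<close> calls for. The number of parts of \<open>mu\<close>
  at \<open>t - 1\<close> is at most its norm, which bounds \<open>n\<close>; the bound later makes
  each degree of the stable algebra finite.\<close>

lemma class_nonempty:
  assumes "x \<in> (Phat :: ('a::{field,finite} ptype \<times> nat) set)"
  shows "\<exists>n\<ge>1. n \<le> 2 * anorm x + 2 \<and> (\<exists>A\<in>carrier (GA n). mtype n A = x)"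
proof -
  obtain mu k where x: "x = (mu, k)" "mu \<in> PPhi" "k \<ge> 1 \<longrightarrow> k - 1 = 0 \<or> k - 1 \<in># mu tm1"
    using assms by (auto simp: Phat_def)
  define lam where "lam = mu(tm1 := add_mset 1 (image_mset Suc (mu tm1)))"
  have "{f. lam f \<noteq> {#}} \<subseteq> insert tm1 {f. mu f \<noteq> {#}}" by (auto simp: lam_def)
  moreover have "finite (insert tm1 {f. mu f \<noteq> {#}})" using x(2) by (simp add: PPhi_def)
  ultimately have "finite {f. lam f \<noteq> {#}}" by (rule finite_subset)
  hence lam: "lam \<in> PPhi" using x(2) tm1_Phi by (auto simp: PPhi_def lam_def)
  have "filter_mset (\<lambda>i. 0 < i) (mu tm1) = mu tm1"
    using PPhi_0[OF x(2)] by (subst filter_mset_eq_conv) (auto intro: gr0I)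
  hence m: "modify lam = mu" by (auto simp: modify_def lam_def image_mset.compositionality o_def)
  have "k = 0 \<or> k \<in># lam tm1" using x(3) by (cases k) (auto simp: lam_def)
  hence "has_type (Suc (pnorm lam)) (Jaff lam k) (lam, k)" by (rule has_type_Jaff[OF lam])
  hence J: "mtype (Suc (pnorm lam)) (Jaff lam k) = x"
    using mtypeI[OF _ Jaff_GA[OF lam]] m x(1) by simp
  have "size M \<le> sum_mset M" if "0 \<notin># M" for M :: "nat multiset"
    using that by (induction M) auto
  from this[OF PPhi_0[OF x(2)], of tm1] have "size (mu tm1) \<le> pnorm mu"
    unfolding pnorm_split[OF x(2)] by linarith
  moreover have "size (lam tm1) = Suc (size (mu tm1))" by (simp add: lam_def)
  moreover have "pnorm mu \<le> anorm x" by (simp add: x(1) anorm_def)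
  ultimately have "Suc (pnorm lam) \<le> 2 * anorm x + 2" using pnorm_modify[OF lam] unfolding m by linarith
  thus ?thesis using J Jaff_GA[OF lam, of k] by (intro exI[of _ "Suc (pnorm lam)"]) auto
qed

section \<open>The norm of a modified type as a rank\<close>

text \<open>The image of \<open>A - 1\<close>; its cardinality stands for the rank.\<close>

definition displacement :: "nat \<Rightarrow> 'a::{field,finite} mat \<Rightarrow> (nat \<Rightarrow> 'a) set" where
  "displacement n A = (\<lambda>v. act n A v - v) ` vecs n"

lemma card_kernel_times_image:
  fixes \<phi> :: "'x::ab_group_add \<Rightarrow> 'y::ab_group_add"
  assumes fin: "finite V" and V: "\<And>u v. u \<in> V \<Longrightarrow> v \<in> V \<Longrightarrow> u + v \<in> V" "\<And>u v. u \<in> V \<Longrightarrow> v \<in> V \<Longrightarrow> u - v \<in> V"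
    and \<phi>: "\<And>u v. \<phi> (u + v) = \<phi> u + \<phi> v"
  shows "card V = card {v \<in> V. \<phi> v = 0} * card (\<phi> ` V)"
proof -
  have diff: "\<phi> (u - v) = \<phi> u - \<phi> v" for u v using \<phi>[of "u - v" v] by simp
  have fiber: "card {v \<in> V. \<phi> v = y} = card {v \<in> V. \<phi> v = 0}" if "y \<in> \<phi> ` V" for y
  proof -
    obtain v0 where v0: "v0 \<in> V" "y = \<phi> v0" using \<open>y \<in> \<phi> ` V\<close> by blast
    have bij: "bij_betw (\<lambda>u. u + v0) {v \<in> V. \<phi> v = 0} {v \<in> V. \<phi> v = y}"
    proof (rule bij_betw_byWitness[where f' = "\<lambda>u. u - v0"])
      show "(\<lambda>u. u + v0) ` {v \<in> V. \<phi> v = 0} \<subseteq> {v \<in> V. \<phi> v = y}"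
      proof clarify
        fix u assume "u \<in> V" "\<phi> u = 0"
        thus "u + v0 \<in> V \<and> \<phi> (u + v0) = y" using V(1)[OF _ v0(1)] \<phi>[of u v0] v0(2) by simp
      qed
      show "(\<lambda>u. u - v0) ` {v \<in> V. \<phi> v = y} \<subseteq> {v \<in> V. \<phi> v = 0}"
      proof clarify
        fix u assume "u \<in> V" "y = \<phi> u"
        thus "u - v0 \<in> V \<and> \<phi> (u - v0) = 0" using V(2)[OF _ v0(1)] diff[of u v0] v0(2) by simp
      qed
    qed simp_all
    show ?thesis by (rule bij_betw_same_card[OF bij, symmetric])
  qed
  have "card V = (\<Sum>v\<in>V. 1)" by simp
  also have "\<dots> = (\<Sum>y\<in>\<phi> ` V. \<Sum>v\<in>{v \<in> V. \<phi> v = y}. 1)" by (rule sum.image_gen[OF fin])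
  also have "\<dots> = (\<Sum>y\<in>\<phi> ` V. card {v \<in> V. \<phi> v = 0})" using fiber by (intro sum.cong) auto
  finally show ?thesis by simp
qed

text \<open>On the hyperplane each block at \<open>t - 1\<close> contributes a one-dimensional fixed
  space. A fixed vector with nonzero first coordinate could be rescaled to an \<open>e\<close> that
  witnesses \<open>k = 0\<close>, so by uniqueness of the type it exists only then, and it adds one
  dimension.\<close>

lemma card_fixed_space:
  fixes A :: "'a::{field,finite} mat"
  assumes mt: "module_type n A lam k" and n: "n \<ge> 1" and A: "A \<in> carrier (GA n)"
  shows "card {v \<in> vecs n. act n A v - v = 0} = CARD('a) ^ (size (lam tm1) + (if k = 0 then 1 else 0))"
proof -
  let ?T = "act n A" and ?K = "{v \<in> vecs n. act n A v - v = 0}"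
  let ?Kw = "{w \<in> vecs0 n. mod_scale n A (tm1 ^ 1) w = 0}"
  obtain D e where D: "act.decomp n A (vecs0 n) D" "type_of (map snd D) = lam" and e: "e \<in> vecs n" "e 0 = 1"
    and k: "if k = 0 then ?T e = e else \<exists>x. (x, k, tm1) \<in> set D \<and> ?T e = e + x"
    using mt unfolding module_type_def by blast
  have "(\<Sum>m\<in>#M. min 1 m) = size M" if "0 \<notin># M" for M :: "nat multiset"
    using that by (induction M) (auto simp: Suc_le_eq)
  from this[OF PPhi_0[OF module_type_PPhi[OF mt]], of tm1]
  have "degree (tm1 :: 'a poly) * (\<Sum>m\<in>#lam tm1. min 1 m) = size (lam tm1)" by simp
  hence card0: "card ?Kw = CARD('a) ^ size (lam tm1)"
    using decomp_card_kernel[OF D(1) tm1_Phi, of 1] unfolding D(2) by (simp only:)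
  have K0: "?Kw = {w \<in> vecs0 n. ?T w - w = 0}" unfolding power_one_right act.op_scale_tm1 ..
  show ?thesis
  proof (cases "k = 0")
    case False
    have "v 0 = 0" if v: "v \<in> vecs n" "?T v - v = 0" for v
    proof (rule ccontr)
      assume v0: "v 0 \<noteq> 0"
      let ?v = "vscale (inverse (v 0)) v"
      have "?v \<in> vecs n" "?v 0 = 1" using v(1) v0 by (auto simp: vecs_def vscale_def)
      moreover have "?T ?v = ?v" using v(2) by (simp add: act.T_vscale)
      ultimately have "module_type n A lam 0" unfolding module_type_def using D by auto
      with module_type_unique[OF mt this] False show False by simp
    qed
    hence K: "?K = ?Kw" unfolding K0 using vecs0_subset by (auto simp: vecs0_def)
    have c: "card ?K = card ?Kw" by (simp only: K)
    have "card ?K = CARD('a) ^ size (lam tm1)" unfolding c by (rule card0)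
    thus ?thesis using False by (simp only: if_False add.right_neutral)
  next
    case True
    have fix_e: "?T e = e" using k True by simp
    have bij: "bij_betw (\<lambda>(c, w). vscale c e + w) (UNIV \<times> ?Kw) ?K"
    proof (rule bij_betw_byWitness[where f' = "\<lambda>v. (v 0, v - vscale (v 0) e)"])
      show "\<forall>a\<in>UNIV \<times> ?Kw. (\<lambda>v. (v 0, v - vscale (v 0) e)) ((\<lambda>(c, w). vscale c e + w) a) = a"
        using e(2) by (auto simp: vecs0_def vscale_def fun_eq_iff)
      show "\<forall>v\<in>?K. (\<lambda>(c, w). vscale c e + w) ((\<lambda>v. (v 0, v - vscale (v 0) e)) v) = v" by auto
      show "(\<lambda>(c, w). vscale c e + w) ` (UNIV \<times> ?Kw) \<subseteq> ?K"
      proof (rule image_subsetI)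
        fix a :: "'a \<times> (nat \<Rightarrow> 'a)" assume "a \<in> UNIV \<times> ?Kw"
        then obtain c w where a: "a = (c, w)" and w: "w \<in> vecs0 n" "mod_scale n A (tm1 ^ 1) w = 0" by blast
        hence Tw: "?T w = w" unfolding power_one_right act.op_scale_tm1 by simp
        have "vscale c e + w \<in> vecs n" using w e by (auto simp: vecs0_def vecs_def vscale_def)
        moreover have "?T (vscale c e + w) - (vscale c e + w) = 0"
          unfolding act.T_add act.T_vscale fix_e Tw by (rule diff_self)
        ultimately show "(\<lambda>(c, w). vscale c e + w) a \<in> ?K" unfolding a prod.case by blast
      qed
      show "(\<lambda>v. (v 0, v - vscale (v 0) e)) ` ?K \<subseteq> UNIV \<times> ?Kw"
      proof (rule image_subsetI)
        fix v assume "v \<in> ?K"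
        hence v: "v \<in> vecs n" "?T v - v = 0" by auto
        define w where "w = v - vscale (v 0) e"
        have "v = vscale (v 0) e + w" by (simp add: w_def)
        hence "?T v = vscale (v 0) e + ?T w" using act.T_add act.T_vscale fix_e by metis
        moreover have "?T v = v" using v(2) by simp
        ultimately have "vscale (v 0) e + ?T w = v" by simp
        hence "?T w = v - vscale (v 0) e" by (metis add_diff_cancel_left')
        hence "?T w - w = 0" unfolding w_def[symmetric] by simp
        hence "mod_scale n A (tm1 ^ 1) w = 0" unfolding power_one_right act.op_scale_tm1 .
        moreover have "w \<in> vecs0 n" using v(1) e by (auto simp: w_def vecs0_def vecs_def vscale_def)
        ultimately show "(v 0, v - vscale (v 0) e) \<in> UNIV \<times> ?Kw"
          unfolding w_def by blast
      qed
    qed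
    have c: "card ?K = CARD('a) * card ?Kw"
      unfolding bij_betw_same_card[OF bij, symmetric] by (rule card_cartesian_product)
    show ?thesis unfolding c card0 using True by simp
  qed
qed

text \<open>Kernel and image of \<open>A - 1\<close> share out the \<open>n\<close> dimensions. The
  kernel takes one per block at \<open>t - 1\<close>, which is what \<open>pnorm_modify\<close>
  subtracts, and the dimension transversal to the hyperplane goes to the kernel for
  \<open>k = 0\<close> and to the image otherwise.\<close>

lemma card_displacement:
  fixes A :: "'a::{field,finite} mat"
  assumes n: "n \<ge> 1" and A: "A \<in> carrier (GA n)"
  shows "card (displacement n A) = CARD('a) ^ anorm (mtype n A)"
proof -
  obtain lam k where ht: "has_type n A (lam, k)" "mtype n A = (modify lam, k)" by (rule mtypeE[OF n A])
  note lam = has_type_D[OF n ht(1)]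
  let ?c = "size (lam tm1) + (if k = 0 then 1 else 0)"
  have mt: "module_type n A lam k" using ht(1) has_type_iff[OF n A] by simp
  have "card (vecs n :: (nat \<Rightarrow> 'a) set) = card {v \<in> vecs n. act n A v - v = 0} * card (displacement n A)"
    unfolding displacement_def
    by (rule card_kernel_times_image[OF card_vecs(1)]) (auto simp: vecs_def act.T_add)
  hence "CARD('a) ^ n = CARD('a) ^ ?c * card (displacement n A)"
    unfolding card_vecs(2) card_fixed_space[OF mt n A] .
  moreover have "anorm (modify lam, k) = pnorm (modify lam) + (if k = 0 then 0 else 1)" by (simp add: anorm_def)
  hence "n = ?c + anorm (mtype n A)"
    unfolding ht(2) using pnorm_modify[OF lam(1)] lam(2) by (cases "k = 0") simp_all
  hence "CARD('a) ^ n = CARD('a) ^ ?c * CARD('a) ^ anorm (mtype n A)" by (metis power_add)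
  ultimately show ?thesis by simp
qed

text \<open>From the identity \<open>A B v - v = (A - 1) (B v) + (B - 1) v\<close>.\<close>

lemma displacement_mult:
  assumes "A \<in> carrier_mat n n" "B \<in> carrier_mat n n"
  shows "displacement n (A * B) \<subseteq> (\<lambda>(x, y). x + y) ` (displacement n A \<times> displacement n B)"
proof
  fix z assume "z \<in> displacement n (A * B)"
  then obtain v where v: "v \<in> vecs n" "z = act n (A * B) v - v" by (auto simp: displacement_def)
  have "z = (act n A (act n B v) - act n B v) + (act n B v - v)" unfolding v(2) act_mult[OF assms] by simp
  moreover have "act n A (act n B v) - act n B v \<in> displacement n A" "act n B v - v \<in> displacement n B"
    using v(1) act_vecs by (auto simp: displacement_def)
  ultimately show "z \<in> (\<lambda>(x, y). x + y) ` (displacement n A \<times> displacement n B)"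
    by (intro image_eqI[of _ _ "(act n A (act n B v) - act n B v, act n B v - v)"]) auto
qed

lemma finite_displacement: "finite (displacement n A)"
  unfolding displacement_def by (intro finite_imageI card_vecs)

lemma GA_mult_closed: "n \<ge> 1 \<Longrightarrow> A \<in> carrier (GA n) \<Longrightarrow> B \<in> carrier (GA n) \<Longrightarrow> A * B \<in> carrier (GA n)"
  using monoid.m_closed[OF group.is_monoid[OF GA_group]] by fastforce

lemma anorm_mtype_mult:
  fixes A :: "'a::{field,finite} mat"
  assumes n: "n \<ge> 1" and A: "A \<in> carrier (GA n)" and B: "B \<in> carrier (GA n)"
  shows "anorm (mtype n (A * B)) \<le> anorm (mtype n A) + anorm (mtype n B)"
proof -
  have "card (displacement n (A * B)) \<le> card ((\<lambda>(x, y). x + y) ` (displacement n A \<times> displacement n B))"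
    using displacement_mult[OF GA_D(1)[OF n A] GA_D(1)[OF n B]]
    by (intro card_mono finite_imageI finite_cartesian_product finite_displacement)
  also have "\<dots> \<le> card (displacement n A \<times> displacement n B)"
    by (intro card_image_le finite_cartesian_product finite_displacement)
  finally have "CARD('a) ^ anorm (mtype n (A * B)) \<le> CARD('a) ^ (anorm (mtype n A) + anorm (mtype n B))"
    using card_displacement[OF n A] card_displacement[OF n B] card_displacement[OF n GA_mult_closed[OF n A B]]
    by (simp add: card_cartesian_product power_add)
  thus ?thesis by (rule power_le_imp_le_exp[OF one_less_card_field])
qed

section \<open>Extension by a fixed vector\<close>

definition ext_mat :: "nat \<Rightarrow> 'a::comm_ring_1 mat \<Rightarrow> 'a mat" where
  "ext_mat n A = mat (Suc n) (Suc n) (\<lambda>(i, j). if i < n \<and> j < n then A $$ (i, j) else if i = j then 1 else 0)"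

lemma ext_mat_carrier: "ext_mat n A \<in> carrier_mat (Suc n) (Suc n)"
  by (simp add: ext_mat_def)

lemma act_ext_mat: "act (Suc n) (ext_mat n A) = act n A"
proof (intro ext)
  fix v i
  consider "i < n" | "i = n" | "i > n" by linarith
  thus "act (Suc n) (ext_mat n A) v i = act n A v i"
  proof cases
    case 1
    thus ?thesis by (simp add: act_def ext_mat_def)
  next
    case 2
    thus ?thesis by (simp add: act_def ext_mat_def)
  qed (simp add: act_def)
qed

lemma ext_mat_mult:
  assumes "A \<in> carrier_mat n n" "B \<in> carrier_mat n n"
  shows "ext_mat n (A * B) = ext_mat n A * ext_mat n B"
  by (rule act_inj[OF ext_mat_carrier mult_carrier_mat[OF ext_mat_carrier ext_mat_carrier]])
    (simp add: act_ext_mat act_mult[OF assms] act_mult[OF ext_mat_carrier ext_mat_carrier])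

lemma ext_mat_one: "ext_mat n (1\<^sub>m n) = 1\<^sub>m (Suc n)"
  by (rule act_inj[OF ext_mat_carrier one_carrier_mat]) (simp add: act_ext_mat act_one)

lemma ext_mat_inject:
  assumes "A \<in> carrier_mat n n" "B \<in> carrier_mat n n" "ext_mat n A = ext_mat n B"
  shows "A = B"
  by (rule act_inj[OF assms(1,2)]) (metis act_ext_mat assms(3))

lemma ext_mat_GA:
  fixes A :: "'a::{field,finite} mat"
  assumes n: "n \<ge> 1" and A: "A \<in> carrier (GA n)"
  shows "ext_mat n A \<in> carrier (GA (Suc n))"
proof -
  interpret group "GA n :: 'a mat monoid" by (rule GA_group[OF n])
  let ?B = "inv\<^bsub>GA n\<^esub> A"
  have B: "?B \<in> carrier (GA n)" "A * ?B = 1\<^sub>m n" using A r_inv[OF A] by auto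
  have "ext_mat n A * ext_mat n ?B = 1\<^sub>m (Suc n)"
    using ext_mat_mult[OF GA_D(1)[OF n A] GA_D(1)[OF n B(1)]] B(2) by (simp add: ext_mat_one)
  hence "det (ext_mat n A) * det (ext_mat n ?B) = 1"
    using det_mult[OF ext_mat_carrier ext_mat_carrier, of n A ?B] by simp
  hence "det (ext_mat n A) \<noteq> 0" by auto
  moreover have "ext_mat n A $$ (0, j) = (if j = 0 then 1 else 0)" if "j < Suc n" for j
    using that n GA_D(2)[OF n A] by (auto simp: ext_mat_def)
  ultimately show ?thesis unfolding GA_iff[of "Suc n", simplified] using ext_mat_carrier by blast
qed

lemma act_unitv_fixed: "act n A (unitv n) = unitv n"
  by (auto simp: act_def unitv_def fun_eq_iff)

text \<open>The operator stays the same; only the space grows, by the fixed vector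
  \<open>unitv n\<close>, a new generator with block \<open>(1, tm1)\<close>. The vector
  \<open>e\<close> keeps its role, so \<open>k\<close> does not change, and the new part 1 will
  disappear in the modified type.\<close>

lemma module_type_ext_mat:
  fixes A :: "'a::{field,finite} mat"
  assumes n: "n \<ge> 1" and A: "A \<in> carrier (GA n)" and mt: "module_type n A lam k"
  shows "module_type (Suc n) (ext_mat n A) (lam(tm1 := add_mset 1 (lam tm1))) k"
proof -
  obtain D e where D: "act.decomp n A (vecs0 n) D" "type_of (map snd D) = lam" and e: "e \<in> vecs n" "e 0 = 1"
    and k: "if k = 0 then act n A e = e else \<exists>x. (x, k, tm1) \<in> set D \<and> act n A e = e + x"
    using mt unfolding module_type_def by blast
  let ?u = "unitv n :: nat \<Rightarrow> 'a" and ?D = "(unitv n, 1, tm1) # D"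
  have 0: "mod_scale n A (tm1 ^ 1) ?u = 0"
    unfolding power_one_right act.op_scale_tm1 act_unitv_fixed by (rule diff_self)
  have vecs: "vecs0 n \<subseteq> vecs0 (Suc n)" "?u \<in> vecs0 (Suc n)" using n by (auto simp: vecs0_def vecs_def unitv_def)
  have sub: "act.subspace n A (vecs0 (Suc n))"
    using vecs0_subspace[OF _ ext_mat_GA[OF n A]] unfolding act_ext_mat by simp
  have span_D: "act.span n A (fst ` set D) = vecs0 n" using D(1) by (simp add: act.decomp_def)
  have "act.span n A (fst ` set ?D) = vecs0 (Suc n)"
  proof (rule subset_antisym)
    have "fst ` set D \<subseteq> vecs0 n" unfolding span_D[symmetric] by (rule act.span_superset)
    thus "act.span n A (fst ` set ?D) \<subseteq> vecs0 (Suc n)"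
      using vecs by (intro act.span_minimal sub) auto
    show "vecs0 (Suc n) \<subseteq> act.span n A (fst ` set ?D)"
    proof
      fix v :: "nat \<Rightarrow> 'a" assume v: "v \<in> vecs0 (Suc n)"
      have "v - vscale (v n) ?u \<in> vecs0 n"
      proof -
        define w where "w = v - vscale (v n) ?u"
        have wi: "w i = v i - v n * unitv n i" for i by (simp add: w_def vscale_def)
        have "w i = 0" if "i \<ge> n" for i
          unfolding wi using that v by (cases "i = n") (auto simp: vecs0_def vecs_def unitv_def)
        moreover have "w 0 = 0" unfolding wi using v n by (simp add: vecs0_def unitv_def)
        ultimately have "w \<in> vecs0 n" by (simp add: vecs0_def vecs_def)
        thus ?thesis unfolding w_def .
      qed
      hence "v - mod_scale n A [:v n:] ?u \<in> act.span n A (fst ` set D)" unfolding span_D act.op_scale_const .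
      hence "\<exists>p. v - mod_scale n A p ?u \<in> act.span n A (fst ` set D)" by blast
      hence "v \<in> act.span n A (insert ?u (fst ` set D))" unfolding act.span_breakdown_eq .
      thus "v \<in> act.span n A (fst ` set ?D)" by simp
    qed
  qed
  moreover have "card (vecs0 (Suc n) :: (nat \<Rightarrow> 'a) set) = CARD('a) ^ (\<Sum>(x, m, f)\<leftarrow>?D. m * degree f)"
  proof -
    have "CARD('a) ^ (n - 1) = CARD('a) ^ (\<Sum>(x, m, f)\<leftarrow>D. m * degree f)"
      using D(1) card_vecs0(2)[OF n, where 'a = 'a] by (simp add: act.decomp_def)
    hence "n - 1 = (\<Sum>(x, m, f)\<leftarrow>D. m * degree f)" by (rule power_card_inject)
    hence "(\<Sum>(x, m, f)\<leftarrow>?D. m * degree f) = n" using n by simp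
    thus ?thesis using card_vecs0(2)[of "Suc n", where 'a = 'a] by (simp only: diff_Suc_1)
  qed
  moreover have "\<forall>y\<in>set ?D. case y of (x, m, f) \<Rightarrow> m \<ge> 1 \<and> f \<in> Phi \<and> mod_scale n A (f ^ m) x = 0"
  proof (rule ballI)
    fix y assume y: "y \<in> set ?D"
    show "case y of (x, m, f) \<Rightarrow> m \<ge> 1 \<and> f \<in> Phi \<and> mod_scale n A (f ^ m) x = 0"
    proof (cases "y = (unitv n, 1, tm1)")
      case True
      show ?thesis unfolding True prod.case using 0 tm1_Phi by blast
    next
      case False
      hence "y \<in> set D" using y by simp
      thus ?thesis using D(1) unfolding act.decomp_def by blast
    qed
  qed
  ultimately have dec: "act.decomp (Suc n) (ext_mat n A) (vecs0 (Suc n)) ?D"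
    unfolding act.decomp_def act_ext_mat by blast
  moreover have "type_of (map snd ?D) = lam(tm1 := add_mset 1 (lam tm1))"
    unfolding D(2)[symmetric] by (auto simp: type_of_Cons fun_eq_iff)
  moreover have "e \<in> vecs (Suc n)" using e by (auto simp: vecs_def)
  moreover have "if k = 0 then act n A e = e else \<exists>x. (x, k, tm1) \<in> set ?D \<and> act n A e = e + x"
    using k by (auto split: if_splits)
  ultimately show ?thesis unfolding module_type_def act_ext_mat using e(2) by blast
qed

lemma mtype_ext_mat:
  fixes A :: "'a::{field,finite} mat"
  assumes n: "n \<ge> 1" and A: "A \<in> carrier (GA n)"
  shows "mtype (Suc n) (ext_mat n A) = mtype n A"
proof -
  obtain lam k where ht: "has_type n A (lam, k)" "mtype n A = (modify lam, k)" by (rule mtypeE[OF n A])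
  have "module_type (Suc n) (ext_mat n A) (lam(tm1 := add_mset 1 (lam tm1))) k"
    using module_type_ext_mat[OF n A] ht(1) has_type_iff[OF n A] by blast
  hence "has_type (Suc n) (ext_mat n A) (lam(tm1 := add_mset 1 (lam tm1)), k)"
    using has_type_iff[OF _ ext_mat_GA[OF n A]] by simp
  from mtypeI[OF _ ext_mat_GA[OF n A] this] show ?thesis unfolding ht(2) by (simp add: modify_def)
qed

lemma fixes_last_imp_ext_mat:
  assumes A: "A \<in> carrier_mat (Suc n) (Suc n)" and col: "act (Suc n) A (unitv n) = unitv n"
    and row: "\<And>v. v \<in> vecs (Suc n) \<Longrightarrow> act (Suc n) A v n = v n"
  shows "A = ext_mat n (mat n n (\<lambda>ij. A $$ ij))"
proof (rule eq_matI)
  fix i j assume "i < dim_row (ext_mat n (mat n n (\<lambda>ij. A $$ ij)))" "j < dim_col (ext_mat n (mat n n (\<lambda>ij. A $$ ij)))"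
  hence ij: "i < Suc n" "j < Suc n" by (auto simp: ext_mat_def)
  have "A $$ (i, n) = unitv n i" using act_unitv[of n "Suc n" i A] ij fun_cong[OF col, of i] by simp
  moreover have "A $$ (n, j) = unitv j n"
    using act_unitv[of j "Suc n" n A] ij row[of "unitv j"] by (auto simp: vecs_def unitv_def)
  ultimately show "A $$ (i, j) = ext_mat n (mat n n (\<lambda>ij. A $$ ij)) $$ (i, j)"
    using ij by (auto simp: ext_mat_def unitv_def less_Suc_eq)
qed (use A in \<open>auto simp: ext_mat_def\<close>)

text \<open>When the ranks add up, the displacement of a product is the direct sum of those of the
  factors, so the factors fix what the product fixes and move vectors only within its image.\<close>

lemma factors_of_ext_mat:
  fixes A B :: "'a::{field,finite} mat"
  assumes n: "n \<ge> 1" and A: "A \<in> carrier (GA (Suc n))" and B: "B \<in> carrier (GA (Suc n))" and C: "C \<in> carrier (GA n)"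
    and AB: "A * B = ext_mat n C"
    and norm: "anorm (mtype n C) = anorm (mtype (Suc n) A) + anorm (mtype (Suc n) B)"
  obtains A' B' where "A' \<in> carrier (GA n)" "B' \<in> carrier (GA n)" "A = ext_mat n A'" "B = ext_mat n B'" "A' * B' = C"
proof -
  let ?N = "Suc n"
  have N: "?N \<ge> 1" by simp
  note Ac = GA_D(1)[OF N A] and Bc = GA_D(1)[OF N B]
  let ?X = "displacement ?N A" and ?Y = "displacement ?N B" and ?Z = "displacement ?N (A * B)"
  let ?P = "(\<lambda>(x, y). x + y) ` (?X \<times> ?Y)"
  \<comment> \<open>Norm additivity enters here: \<open>?Z\<close> lies in the set of sums of
    \<open>?X\<close> and \<open>?Y\<close> and has as many elements as there are pairs, so addition
    is injective on pairs and its values fill exactly \<open>?Z\<close>.\<close>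
  have "card ?Z = card (?X \<times> ?Y)"
    using card_displacement[OF N A] card_displacement[OF N B] card_displacement[OF N ext_mat_GA[OF n C]]
      mtype_ext_mat[OF n C] norm by (simp add: AB card_cartesian_product power_add)
  moreover have finP: "finite (?X \<times> ?Y)" by (intro finite_cartesian_product finite_displacement)
  moreover have ZP: "?Z \<subseteq> ?P" by (rule displacement_mult[OF Ac Bc])
  ultimately have "card ?P = card (?X \<times> ?Y)" "card ?P \<le> card ?Z"
    using card_image_le[OF finP, of "\<lambda>(x, y). x + y"] card_mono[OF finite_imageI[OF finP] ZP] by auto
  hence inj: "inj_on (\<lambda>(x, y). x + y) (?X \<times> ?Y)" and Z: "?Z = ?P"
    using finP card_seteq[OF finite_imageI[OF finP] ZP] by (auto intro: eq_card_imp_inj_on)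
  have zero: "0 \<in> displacement ?N M" for M :: "'a mat"
  proof -
    have "act ?N M 0 - 0 = 0" by (simp add: act.T_zero)
    moreover have "0 \<in> vecs ?N" by (simp add: vecs_def)
    ultimately show ?thesis unfolding displacement_def by (metis (no_types, lifting) image_eqI)
  qed
  have Zn: "z n = 0" if "z \<in> ?Z" for z
    using that unfolding displacement_def AB act_ext_mat by (auto simp: act_def)
  \<comment> \<open>Each of \<open>?X\<close> and \<open>?Y\<close> contains zero, so both lie
    inside \<open>?Z\<close>, and \<open>ext_mat n C\<close> does not move coordinate
    \<open>n\<close>. Hence neither factor changes this coordinate.\<close>
  have Xn: "x n = 0" if "x \<in> ?X" for x
    using Zn[of x] that zero[of B] unfolding Z by (force intro: image_eqI[of _ _ "(x, 0)"])
  have Yn: "y n = 0" if "y \<in> ?Y" for y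
    using Zn[of y] that zero[of A] unfolding Z by (force intro: image_eqI[of _ _ "(0, y)"])
  let ?u = "unitv n :: nat \<Rightarrow> 'a"
  have u: "?u \<in> vecs ?N" by (auto simp: vecs_def unitv_def)
  \<comment> \<open>The product fixes \<open>unitv n\<close>, so an element of \<open>?X\<close> and
    one of \<open>?Y\<close> add up to zero; uniqueness of such sums makes both vanish.\<close>
  have "act ?N A (act ?N B ?u) = ?u"
    unfolding act_mult[OF Ac Bc, symmetric] AB act_ext_mat act_unitv_fixed ..
  hence sum0: "(act ?N A (act ?N B ?u) - act ?N B ?u) + (act ?N B ?u - ?u) = 0 + 0" by simp
  have in1: "act ?N A (act ?N B ?u) - act ?N B ?u \<in> ?X" and in2: "act ?N B ?u - ?u \<in> ?Y"
    using u act_vecs by (auto simp: displacement_def)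
  have pair: "(act ?N A (act ?N B ?u) - act ?N B ?u, act ?N B ?u - ?u) = (0, 0)"
    by (rule inj_onD[OF inj]) (use sum0 in1 in2 zero in auto)
  hence Bu: "act ?N B ?u = ?u" and Au: "act ?N A ?u = ?u" by auto
  have rowA: "act ?N A v n = v n" if "v \<in> vecs ?N" for v
    using Xn[of "act ?N A v - v"] that by (auto simp: displacement_def)
  have rowB: "act ?N B v n = v n" if "v \<in> vecs ?N" for v
    using Yn[of "act ?N B v - v"] that by (auto simp: displacement_def)
  define A' where "A' = mat n n (\<lambda>ij. A $$ ij)"
  define B' where "B' = mat n n (\<lambda>ij. B $$ ij)"
  have A': "A = ext_mat n A'" unfolding A'_def by (rule fixes_last_imp_ext_mat[OF Ac Au rowA])
  have B': "B = ext_mat n B'" unfolding B'_def by (rule fixes_last_imp_ext_mat[OF Bc Bu rowB])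
  have c: "A' \<in> carrier_mat n n" "B' \<in> carrier_mat n n" by (auto simp: A'_def B'_def)
  have AB': "A' * B' = C"
  proof (rule ext_mat_inject[OF mult_carrier_mat[OF c] GA_D(1)[OF n C]])
    show "ext_mat n (A' * B') = ext_mat n C" unfolding ext_mat_mult[OF c] A'[symmetric] B'[symmetric] by (rule AB)
  qed
  hence "det A' * det B' = det C" using det_mult[OF c] by simp
  hence det: "det A' \<noteq> 0" "det B' \<noteq> 0" using GA_D(3)[OF n C] by auto
  have "A' $$ (0, j) = (if j = 0 then 1 else 0)" "B' $$ (0, j) = (if j = 0 then 1 else 0)" if "j < n" for j
    using that n GA_D(2)[OF N A, of j] GA_D(2)[OF N B, of j] by (auto simp: A'_def B'_def)
  hence "A' \<in> carrier (GA n)" "B' \<in> carrier (GA n)" using det c unfolding GA_iff[OF n] by blast+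
  thus ?thesis using that A' B' AB' by blast
qed

section \<open>Stable numbers of factorizations\<close>

definition factorizations ::
  "nat \<Rightarrow> 'a::{field,finite} mat \<Rightarrow> 'a ptype \<times> nat \<Rightarrow> 'a ptype \<times> nat \<Rightarrow> ('a mat \<times> 'a mat) set" where
  "factorizations n C x y = {(A, B). A \<in> carrier (GA n) \<and> B \<in> carrier (GA n) \<and> A * B = C \<and>
     mtype n A = x \<and> mtype n B = y}"

lemma finite_factorizations: "n \<ge> 1 \<Longrightarrow> finite (factorizations n C x y)"
  by (rule finite_subset[of _ "carrier (GA n) \<times> carrier (GA n)"])
    (auto simp: factorizations_def finite_GA)

lemma card_factorizations_conj_le:
  fixes C :: "'a::{field,finite} mat"
  assumes n: "n \<ge> 1" and C: "C \<in> carrier (GA n)" and C': "C' \<in> carrier (GA n)" and eq: "mtype n C = mtype n C'"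
  shows "card (factorizations n C x y) \<le> card (factorizations n C' x y)"
proof -
  interpret group "GA n :: 'a mat monoid" by (rule GA_group[OF n])
  obtain g where g: "g \<in> carrier (GA n)" "C' = g * C * inv\<^bsub>GA n\<^esub> g"
    using conjugate_of_mtype[OF n C C' eq] by blast
  let ?c = "\<lambda>A. g * A * inv\<^bsub>GA n\<^esub> g"
  have closed: "?c A \<in> carrier (GA n)" if "A \<in> carrier (GA n)" for A
    using m_closed[OF m_closed[OF g(1) that] inv_closed[OF g(1)]] by simp
  have cancel: "inv\<^bsub>GA n\<^esub> g \<otimes>\<^bsub>GA n\<^esub> (g \<otimes>\<^bsub>GA n\<^esub> z) = z" if "z \<in> carrier (GA n)" for z
    using that g(1) by (simp add: m_assoc[symmetric] del: GA_simps)
  have mult: "?c A * ?c B = ?c (A * B)" if "A \<in> carrier (GA n)" "B \<in> carrier (GA n)" for A B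
  proof -
    have "(g \<otimes>\<^bsub>GA n\<^esub> A \<otimes>\<^bsub>GA n\<^esub> inv\<^bsub>GA n\<^esub> g) \<otimes>\<^bsub>GA n\<^esub> (g \<otimes>\<^bsub>GA n\<^esub> B \<otimes>\<^bsub>GA n\<^esub> inv\<^bsub>GA n\<^esub> g) =
      g \<otimes>\<^bsub>GA n\<^esub> (A \<otimes>\<^bsub>GA n\<^esub> B) \<otimes>\<^bsub>GA n\<^esub> inv\<^bsub>GA n\<^esub> g"
      using that g(1) by (simp add: m_assoc cancel del: GA_simps)
    thus ?thesis by simp
  qed
  have inj: "A = B" if "A \<in> carrier (GA n)" "B \<in> carrier (GA n)" "?c A = ?c B" for A B
  proof -
    have "g \<otimes>\<^bsub>GA n\<^esub> A \<otimes>\<^bsub>GA n\<^esub> inv\<^bsub>GA n\<^esub> g = g \<otimes>\<^bsub>GA n\<^esub> B \<otimes>\<^bsub>GA n\<^esub> inv\<^bsub>GA n\<^esub> g" using that by simp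
    thus ?thesis using that g(1) by (simp del: GA_simps)
  qed
  show ?thesis
  proof (rule card_inj_on_le[of "\<lambda>(A, B). (?c A, ?c B)"])
    show "inj_on (\<lambda>(A, B). (?c A, ?c B)) (factorizations n C x y)"
      by (rule inj_onI) (auto simp: factorizations_def dest: inj)
    show "(\<lambda>(A, B). (?c A, ?c B)) ` factorizations n C x y \<subseteq> factorizations n C' x y"
      using g closed mult mtype_conj[OF n _ g(1)] by (auto simp: factorizations_def)
  qed (rule finite_factorizations[OF n])
qed

lemma card_factorizations_conj:
  fixes C :: "'a::{field,finite} mat"
  assumes "n \<ge> 1" "C \<in> carrier (GA n)" "C' \<in> carrier (GA n)" "mtype n C = mtype n C'"
  shows "card (factorizations n C x y) = card (factorizations n C' x y)"
  using card_factorizations_conj_le assms by (metis le_antisym)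

text \<open>Extending both factors is injective in any case; norm additivity is what makes it onto,
  through \<open>factors_of_ext_mat\<close>.\<close>

lemma card_factorizations_ext_mat:
  fixes C :: "'a::{field,finite} mat"
  assumes n: "n \<ge> 1" and C: "C \<in> carrier (GA n)" and norm: "anorm (mtype n C) = anorm x + anorm y"
  shows "card (factorizations (Suc n) (ext_mat n C) x y) = card (factorizations n C x y)"
proof -
  have "bij_betw (\<lambda>(A, B). (ext_mat n A, ext_mat n B)) (factorizations n C x y) (factorizations (Suc n) (ext_mat n C) x y)"
  proof (rule bij_betw_imageI)
    show "inj_on (\<lambda>(A, B). (ext_mat n A, ext_mat n B)) (factorizations n C x y)"
      by (rule inj_onI) (auto simp: factorizations_def dest: GA_D(1)[OF n] ext_mat_inject)
    show "(\<lambda>(A, B). (ext_mat n A, ext_mat n B)) ` factorizations n C x y = factorizations (Suc n) (ext_mat n C) x y"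
    proof (intro equalityI subsetI)
      fix z assume "z \<in> (\<lambda>(A, B). (ext_mat n A, ext_mat n B)) ` factorizations n C x y"
      then obtain A B where "(A, B) \<in> factorizations n C x y" "z = (ext_mat n A, ext_mat n B)" by auto
      thus "z \<in> factorizations (Suc n) (ext_mat n C) x y"
        using ext_mat_GA[OF n] mtype_ext_mat[OF n] ext_mat_mult[OF GA_D(1)[OF n] GA_D(1)[OF n], symmetric]
        by (auto simp: factorizations_def)
    next
      fix z assume "z \<in> factorizations (Suc n) (ext_mat n C) x y"
      then obtain A B where z: "z = (A, B)" and AB: "A \<in> carrier (GA (Suc n))" "B \<in> carrier (GA (Suc n))"
        "A * B = ext_mat n C" "mtype (Suc n) A = x" "mtype (Suc n) B = y" by (auto simp: factorizations_def)
      have "anorm (mtype n C) = anorm (mtype (Suc n) A) + anorm (mtype (Suc n) B)" using AB norm by simp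
      then obtain A' B' where AB': "A' \<in> carrier (GA n)" "B' \<in> carrier (GA n)" "A = ext_mat n A'" "B = ext_mat n B'" "A' * B' = C"
        using factors_of_ext_mat[OF n AB(1,2) C AB(3)] by metis
      have "mtype n A' = x" "mtype n B' = y"
        using AB(4,5) mtype_ext_mat[OF n AB'(1)] mtype_ext_mat[OF n AB'(2)] AB'(3,4) by simp_all
      with AB' show "z \<in> (\<lambda>(A, B). (ext_mat n A, ext_mat n B)) ` factorizations n C x y"
        unfolding z by (intro image_eqI[of _ _ "(A', B')"]) (auto simp: factorizations_def)
    qed
  qed
  thus ?thesis using bij_betw_same_card by metis
qed

lemma ext_mat_iterate:
  fixes C :: "'a::{field,finite} mat"
  assumes n: "n \<ge> 1" and C: "C \<in> carrier (GA n)"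
  shows "\<exists>C'\<in>carrier (GA (n + d)). mtype (n + d) C' = mtype n C \<and>
    (\<forall>x y. anorm (mtype n C) = anorm x + anorm y \<longrightarrow>
      card (factorizations (n + d) C' x y) = card (factorizations n C x y))"
proof (induction d)
  case (Suc d)
  then obtain C' where C': "C' \<in> carrier (GA (n + d))" "mtype (n + d) C' = mtype n C"
    "\<And>x y. anorm (mtype n C) = anorm x + anorm y \<Longrightarrow>
      card (factorizations (n + d) C' x y) = card (factorizations n C x y)" by blast
  have nd: "n + d \<ge> 1" using n by simp
  show ?case
    using ext_mat_GA[OF nd C'(1)] mtype_ext_mat[OF nd C'(1)] card_factorizations_ext_mat[OF nd C'(1)] C'(2,3)
    by (intro bexI[of _ "ext_mat (n + d) C'"]) auto
qed (use C in auto)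

text \<open>The element of the smaller group is extended step by step into the larger one. There it
  has the same modified type as the other element and is therefore conjugate to it.\<close>

lemma card_factorizations_stable:
  fixes C :: "'a::{field,finite} mat"
  assumes n: "n \<ge> 1" "C \<in> carrier (GA n)" and m: "m \<ge> 1" "C' \<in> carrier (GA m)"
    and eq: "mtype n C = mtype m C'" and norm: "anorm (mtype n C) = anorm x + anorm y"
  shows "card (factorizations n C x y) = card (factorizations m C' x y)"
proof -
  have *: "card (factorizations n C x y) = card (factorizations m C' x y)"
    if le: "n \<le> m" and n: "n \<ge> 1" "C \<in> carrier (GA n)" and m: "m \<ge> 1" "C' \<in> carrier (GA m)"
      and eq: "mtype n C = mtype m C'" and norm: "anorm (mtype n C) = anorm x + anorm y" for n m and C C' :: "'a mat"
  proof -
    have "n + (m - n) = m" using le by simp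
    with ext_mat_iterate[OF n, of "m - n"] have "\<exists>C2\<in>carrier (GA m). mtype m C2 = mtype n C \<and>
      (\<forall>x y. anorm (mtype n C) = anorm x + anorm y \<longrightarrow>
        card (factorizations m C2 x y) = card (factorizations n C x y))" by (simp only:)
    then obtain C2 where C2: "C2 \<in> carrier (GA m)" "mtype m C2 = mtype n C"
      "card (factorizations m C2 x y) = card (factorizations n C x y)"
      using norm by blast
    show ?thesis using card_factorizations_conj[OF m(1) C2(1) m(2)] C2(2,3) eq by simp
  qed
  show ?thesis
  proof (cases "n \<le> m")
    case False
    thus ?thesis using *[of m n C' C] assms by simp
  qed (use * assms in blast)
qed

section \<open>Norm zero and the finiteness of each degree\<close>

lemma mtype_one: "n \<ge> 1 \<Longrightarrow> anorm (mtype n (1\<^sub>m n :: 'a::{field,finite} mat)) = 0"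
proof -
  assume n: "n \<ge> 1"
  interpret group "GA n :: 'a mat monoid" by (rule GA_group[OF n])
  have "(\<lambda>_. 0) \<in> (vecs n :: (nat \<Rightarrow> 'a) set)" by (simp add: vecs_def)
  hence "displacement n (1\<^sub>m n :: 'a mat) = {0}" unfolding displacement_def act_one by auto
  hence "CARD('a) ^ anorm (mtype n (1\<^sub>m n :: 'a mat)) = CARD('a) ^ 0"
    using card_displacement[OF n one_closed] by simp
  thus ?thesis by (rule power_card_inject)
qed

lemma mtype_eq_one:
  fixes A :: "'a::{field,finite} mat"
  assumes n: "n \<ge> 1" and A: "A \<in> carrier (GA n)" and eq: "mtype n A = mtype n (1\<^sub>m n)"
  shows "A = 1\<^sub>m n"
proof -
  interpret group "GA n :: 'a mat monoid" by (rule GA_group[OF n])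
  have "(1\<^sub>m n :: 'a mat) \<in> carrier (GA n)" using one_closed by simp
  then obtain g where g: "g \<in> carrier (GA n)" "A = g * 1\<^sub>m n * inv\<^bsub>GA n\<^esub> g"
    using conjugate_of_mtype[OF n _ A eq[symmetric]] by blast
  have "g \<otimes>\<^bsub>GA n\<^esub> inv\<^bsub>GA n\<^esub> g = \<one>\<^bsub>GA n\<^esub>" using g(1) by (rule r_inv)
  thus ?thesis using g GA_D(1)[OF n g(1)] by simp
qed

text \<open>Serves to recognize the class of the identity matrix as the unit symbol. All parts and
  all degrees of primes in \<open>Phi\<close> are positive, so norm zero leaves only empty
  partitions.\<close>

lemma anorm_eq_0:
  assumes x: "x \<in> Phat" and 0: "anorm x = 0"
  shows "x = (\<lambda>_. {#}, 0)"
proof -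
  obtain mu k where xk: "x = (mu, k)" "mu \<in> PPhi" using x by (auto simp: Phat_def)
  have k: "k = 0" "pnorm mu = 0" using 0 by (auto simp: xk anorm_def split: if_splits)
  have "mu f = {#}" for f
  proof (rule ccontr)
    assume f: "mu f \<noteq> {#}"
    have "degree f * sum_mset (mu f) = 0"
      using k(2) f xk(2) unfolding pnorm_def by (subst (asm) sum_eq_0_iff) (auto simp: PPhi_def)
    moreover have "degree f > 0" using f xk(2) Phi_D(3) by (auto simp: PPhi_def)
    ultimately have "sum_mset (mu f) = 0" by simp
    moreover obtain m where "m \<in># mu f" using f by (auto elim: multiset_nonemptyE)
    ultimately have "m = 0" by simp
    with \<open>m \<in># mu f\<close> PPhi_0[OF xk(2)] show False by auto
  qed
  thus ?thesis using xk k by auto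
qed

lemma unit_Phat: "(\<lambda>_. {#}, 0) \<in> Phat" "anorm (\<lambda>_. {#}, 0) = 0"
  by (auto simp: Phat_def PPhi_def anorm_def pnorm_def)

lemma mtype_one_eq: "n \<ge> 1 \<Longrightarrow> mtype n (1\<^sub>m n :: 'a::{field,finite} mat) = (\<lambda>_. {#}, 0)"
proof -
  assume n: "n \<ge> 1"
  interpret group "GA n :: 'a mat monoid" by (rule GA_group[OF n])
  have "mtype n (1\<^sub>m n :: 'a mat) \<in> Phat" using mtype_Phat[OF n one_closed] by simp
  thus ?thesis using mtype_one[OF n] by (rule anorm_eq_0)
qed

text \<open>By \<open>class_nonempty\<close> every such type occurs in a group \<open>GA n\<close>
  with \<open>n\<close> bounded in terms of \<open>d\<close>, and these groups are finite. The sums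
  in the product of the stable algebra are thereby genuine finite sums.\<close>

lemma finite_anorm: "finite {z \<in> (Phat :: ('a::{field,finite} ptype \<times> nat) set). anorm z = d}"
proof -
  have "{z \<in> (Phat :: ('a ptype \<times> nat) set). anorm z = d} \<subseteq> (\<Union>n\<in>{1..2 * d + 2}. mtype n ` carrier (GA n))"
  proof
    fix z :: "'a ptype \<times> nat" assume "z \<in> {z \<in> Phat. anorm z = d}"
    hence "z \<in> Phat" "anorm z = d" by auto
    with class_nonempty[of z] show "z \<in> (\<Union>n\<in>{1..2 * d + 2}. mtype n ` carrier (GA n))" by force
  qed
  moreover have "finite (\<Union>n\<in>{1..2 * d + 2}. mtype n ` carrier (GA n :: 'a mat monoid))"
    by (intro finite_UN_I finite_imageI finite_GA) auto
  ultimately show ?thesis by (rule finite_subset)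
qed

section \<open>Class functions in the group ring\<close>

lemma lookup_frag_extend:
  "Poly_Mapping.lookup (frag_extend b x) k = (\<Sum>i\<in>Poly_Mapping.keys x. Poly_Mapping.lookup x i * Poly_Mapping.lookup (b i) k)"
  by (simp add: frag_extend_def lookup_sum)

lemma sum_keys:
  fixes g :: "'x \<Rightarrow> int"
  assumes "finite S" "Poly_Mapping.keys u \<subseteq> S"
  shows "(\<Sum>i\<in>Poly_Mapping.keys u. Poly_Mapping.lookup u i * g i) = (\<Sum>i\<in>S. Poly_Mapping.lookup u i * g i)"
  by (rule sum.mono_neutral_left) (use assms in \<open>auto simp: in_keys_iff\<close>)

lemma group_ring_simps [simp]:
  "monoid.mult (Aring n) = monoid.mult (group_ring (GA n))" "ring.add (Aring n) = (+)"
  "\<zero>\<^bsub>Aring n\<^esub> = 0" "\<one>\<^bsub>Aring n\<^esub> = frag_of (1\<^sub>m n)"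
  "carrier (Aring n) = ring_center (group_ring (GA n))"
  by (simp_all add: Aring_def group_ring_def)

lemma lookup_group_ring_mult:
  fixes u v :: "'a::{field,finite} mat \<Rightarrow>\<^sub>0 int"
  assumes n: "n \<ge> 1" and u: "Poly_Mapping.keys u \<subseteq> carrier (GA n)" and v: "Poly_Mapping.keys v \<subseteq> carrier (GA n)"
  shows "Poly_Mapping.lookup (u \<otimes>\<^bsub>group_ring (GA n)\<^esub> v) C =
    (\<Sum>A\<in>carrier (GA n). \<Sum>B\<in>carrier (GA n). if A * B = C then Poly_Mapping.lookup u A * Poly_Mapping.lookup v B else 0)"
proof -
  have "Poly_Mapping.lookup (u \<otimes>\<^bsub>group_ring (GA n)\<^esub> v) C =
    (\<Sum>A\<in>Poly_Mapping.keys u. Poly_Mapping.lookup u A * (\<Sum>B\<in>Poly_Mapping.keys v. Poly_Mapping.lookup v B * (if C = A * B then 1 else 0)))"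
    by (simp add: group_ring_def lookup_frag_extend)
  also have "\<dots> = (\<Sum>A\<in>carrier (GA n). Poly_Mapping.lookup u A * (\<Sum>B\<in>carrier (GA n). Poly_Mapping.lookup v B * (if C = A * B then 1 else 0)))"
    unfolding sum_keys[OF finite_GA[OF n] u] sum_keys[OF finite_GA[OF n] v] ..
  also have "\<dots> = (\<Sum>A\<in>carrier (GA n). \<Sum>B\<in>carrier (GA n). if A * B = C then Poly_Mapping.lookup u A * Poly_Mapping.lookup v B else 0)"
    unfolding sum_distrib_left by (intro sum.cong refl) auto
  finally show ?thesis .
qed

definition class_function :: "nat \<Rightarrow> ('a::{field,finite} mat \<Rightarrow>\<^sub>0 int) \<Rightarrow> bool" where
  "class_function n u \<longleftrightarrow> Poly_Mapping.keys u \<subseteq> carrier (GA n) \<and>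
     (\<forall>A\<in>carrier (GA n). \<forall>B\<in>carrier (GA n). mtype n A = mtype n B \<longrightarrow> Poly_Mapping.lookup u A = Poly_Mapping.lookup u B)"

lemma class_functionD:
  assumes "class_function n u" "A \<in> carrier (GA n)" "B \<in> carrier (GA n)" "mtype n A = mtype n B"
  shows "Poly_Mapping.lookup u A = Poly_Mapping.lookup u B"
  using assms unfolding class_function_def by blast

lemma class_function_keys: "class_function n u \<Longrightarrow> Poly_Mapping.keys u \<subseteq> carrier (GA n)"
  unfolding class_function_def by blast

lemma lookup_outside: "Poly_Mapping.keys u \<subseteq> S \<Longrightarrow> k \<notin> S \<Longrightarrow> Poly_Mapping.lookup u k = 0"
  by (auto simp: in_keys_iff)

lemma keys_group_ring_mult:
  fixes u v :: "'a::{field,finite} mat \<Rightarrow>\<^sub>0 int"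
  assumes n: "n \<ge> 1" and u: "Poly_Mapping.keys u \<subseteq> carrier (GA n)" and v: "Poly_Mapping.keys v \<subseteq> carrier (GA n)"
    and C: "C \<in> Poly_Mapping.keys (u \<otimes>\<^bsub>group_ring (GA n)\<^esub> v)"
  shows "\<exists>A\<in>Poly_Mapping.keys u. \<exists>B\<in>Poly_Mapping.keys v. A * B = C"
proof (rule ccontr)
  assume *: "\<not> ?thesis"
  have "Poly_Mapping.lookup (u \<otimes>\<^bsub>group_ring (GA n)\<^esub> v) C = 0"
    unfolding lookup_group_ring_mult[OF n u v]
  proof (intro sum.neutral ballI)
    fix A B
    show "(if A * B = C then Poly_Mapping.lookup u A * Poly_Mapping.lookup v B else 0) = 0"
    proof (cases "A * B = C")
      case True
      hence "A \<notin> Poly_Mapping.keys u \<or> B \<notin> Poly_Mapping.keys v" using * by blast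
      thus ?thesis by (auto simp: in_keys_iff)
    qed simp
  qed
  thus False using C by (simp add: in_keys_iff)
qed

definition conj_by :: "nat \<Rightarrow> 'a::field mat \<Rightarrow> 'a mat \<Rightarrow> 'a mat" where
  "conj_by n g A = g * A * inv\<^bsub>GA n\<^esub> g"

lemma conj_bij:
  fixes g :: "'a::{field,finite} mat"
  assumes n: "n \<ge> 1" and g: "g \<in> carrier (GA n)"
  defines "c \<equiv> conj_by n g"
  shows "bij_betw c (carrier (GA n)) (carrier (GA n))"
    "\<And>A B. A \<in> carrier (GA n) \<Longrightarrow> B \<in> carrier (GA n) \<Longrightarrow> c A * c B = c (A * B)"
    "\<And>A. A \<in> carrier (GA n) \<Longrightarrow> c A \<in> carrier (GA n)"
proof -
  interpret group "GA n :: 'a mat monoid" by (rule GA_group[OF n])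
  have c: "c A = g \<otimes>\<^bsub>GA n\<^esub> A \<otimes>\<^bsub>GA n\<^esub> inv\<^bsub>GA n\<^esub> g" for A by (simp add: c_def conj_by_def)
  show closed: "c A \<in> carrier (GA n)" if "A \<in> carrier (GA n)" for A
    unfolding c using that g by (simp del: GA_simps)
  have cancel: "inv\<^bsub>GA n\<^esub> g \<otimes>\<^bsub>GA n\<^esub> (g \<otimes>\<^bsub>GA n\<^esub> z) = z" if "z \<in> carrier (GA n)" for z
    using that g by (simp add: m_assoc[symmetric] del: GA_simps)
  show "c A * c B = c (A * B)" if "A \<in> carrier (GA n)" "B \<in> carrier (GA n)" for A B
  proof -
    have "c A \<otimes>\<^bsub>GA n\<^esub> c B = c (A \<otimes>\<^bsub>GA n\<^esub> B)"
      unfolding c using that g by (simp add: m_assoc cancel del: GA_simps)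
    thus ?thesis by simp
  qed
  have "inj_on c (carrier (GA n))"
    by (rule inj_onI) (use g in \<open>simp add: c del: GA_simps\<close>)
  moreover have "c ` carrier (GA n) = carrier (GA n)"
    using endo_inj_surj[OF finite_GA[OF n] _ \<open>inj_on c _\<close>] closed by blast
  ultimately show "bij_betw c (carrier (GA n)) (carrier (GA n))" by (simp add: bij_betw_def)
qed

lemma class_function_mult:
  fixes u v :: "'a::{field,finite} mat \<Rightarrow>\<^sub>0 int"
  assumes n: "n \<ge> 1" and u: "class_function n u" and v: "class_function n v"
  shows "class_function n (u \<otimes>\<^bsub>group_ring (GA n)\<^esub> v)"
  unfolding class_function_def
proof (intro conjI ballI impI)
  have ku: "Poly_Mapping.keys u \<subseteq> carrier (GA n)" and kv: "Poly_Mapping.keys v \<subseteq> carrier (GA n)"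
    using u v by (auto simp: class_function_def)
  show "Poly_Mapping.keys (u \<otimes>\<^bsub>group_ring (GA n)\<^esub> v) \<subseteq> carrier (GA n)"
    using keys_group_ring_mult[OF n ku kv] ku kv GA_mult_closed[OF n] by blast
  fix C C' :: "'a mat" assume C: "C \<in> carrier (GA n)" "C' \<in> carrier (GA n)" "mtype n C = mtype n C'"
  obtain g where g: "g \<in> carrier (GA n)" "C' = g * C * inv\<^bsub>GA n\<^esub> g" using conjugate_of_mtype[OF n C] by blast
  define c where "c = conj_by n g"
  note cb = conj_bij[OF n g(1), folded c_def]
  have C'_eq: "C' = c C" using g(2) by (simp add: c_def conj_by_def)
  let ?h = "\<lambda>C A B. if A * B = C then Poly_Mapping.lookup u A * Poly_Mapping.lookup v B else 0"
  have "(\<Sum>A\<in>carrier (GA n). \<Sum>B\<in>carrier (GA n). ?h C' A B) = (\<Sum>A\<in>carrier (GA n). \<Sum>B\<in>carrier (GA n). ?h C' (c A) (c B))"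
    by (subst sum.reindex_bij_betw[OF cb(1), symmetric], intro sum.cong refl sum.reindex_bij_betw[OF cb(1), symmetric])
  also have "\<dots> = (\<Sum>A\<in>carrier (GA n). \<Sum>B\<in>carrier (GA n). ?h C A B)"
  proof (intro sum.cong refl)
    fix A B :: "'a mat" assume A: "A \<in> carrier (GA n)" and B: "B \<in> carrier (GA n)"
    have "c A * c B = C' \<longleftrightarrow> A * B = C"
      unfolding cb(2)[OF A B] C'_eq
      by (rule inj_on_eq_iff[OF bij_betw_imp_inj_on[OF cb(1)] GA_mult_closed[OF n A B] C(1)])
    moreover have "mtype n (c A) = mtype n A" "mtype n (c B) = mtype n B"
      unfolding c_def conj_by_def using mtype_conj[OF n A g(1)] mtype_conj[OF n B g(1)] by auto
    hence "Poly_Mapping.lookup u (c A) = Poly_Mapping.lookup u A" "Poly_Mapping.lookup v (c B) = Poly_Mapping.lookup v B"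
      using class_functionD[OF u cb(3)[OF A] A] class_functionD[OF v cb(3)[OF B] B] by blast+
    ultimately show "?h C' (c A) (c B) = ?h C A B" by simp
  qed
  finally show "Poly_Mapping.lookup (u \<otimes>\<^bsub>group_ring (GA n)\<^esub> v) C = Poly_Mapping.lookup (u \<otimes>\<^bsub>group_ring (GA n)\<^esub> v) C'"
    unfolding lookup_group_ring_mult[OF n ku kv] ..
qed

text \<open>The substitution of \<open>B A B^{-1}\<close> for \<open>A\<close>, under which
  \<open>u\<close> is invariant, turns the condition \<open>A B = C\<close> into
  \<open>B A = C\<close>, so the two convolution sums agree.\<close>

lemma class_function_center:
  fixes u :: "'a::{field,finite} mat \<Rightarrow>\<^sub>0 int"
  assumes n: "n \<ge> 1" and u: "class_function n u"
  shows "u \<in> ring_center (group_ring (GA n))"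
  unfolding ring_center_def
proof (intro CollectI conjI ballI)
  interpret group "GA n :: 'a mat monoid" by (rule GA_group[OF n])
  have ku: "Poly_Mapping.keys u \<subseteq> carrier (GA n)" using u by (simp add: class_function_def)
  thus "u \<in> carrier (group_ring (GA n))" by (simp add: group_ring_def)
  fix a assume "a \<in> carrier (group_ring (GA n :: 'a mat monoid))"
  hence ka: "Poly_Mapping.keys a \<subseteq> carrier (GA n)" by (simp add: group_ring_def)
  show "u \<otimes>\<^bsub>group_ring (GA n)\<^esub> a = a \<otimes>\<^bsub>group_ring (GA n)\<^esub> u"
  proof (rule poly_mapping_eqI)
    fix C
    let ?G = "carrier (GA n :: 'a mat monoid)"
    have inner: "(\<Sum>A\<in>?G. if A * B = C then Poly_Mapping.lookup u A * x else 0) =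
        (\<Sum>A\<in>?G. if B * A = C then x * Poly_Mapping.lookup u A else 0)" if B: "B \<in> ?G" for B x
    proof -
      define c where "c = conj_by n B"
      note cb = conj_bij[OF n B, folded c_def]
      have "(\<Sum>A\<in>?G. if A * B = C then Poly_Mapping.lookup u A * x else 0) =
          (\<Sum>A\<in>?G. if c A * B = C then Poly_Mapping.lookup u (c A) * x else 0)"
        by (rule sum.reindex_bij_betw[OF cb(1), symmetric])
      also have "\<dots> = (\<Sum>A\<in>?G. if B * A = C then x * Poly_Mapping.lookup u A else 0)"
      proof (intro sum.cong refl)
        fix A assume A: "A \<in> ?G"
        have "(B \<otimes>\<^bsub>GA n\<^esub> A \<otimes>\<^bsub>GA n\<^esub> inv\<^bsub>GA n\<^esub> B) \<otimes>\<^bsub>GA n\<^esub> B = B \<otimes>\<^bsub>GA n\<^esub> A"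
          using A B by (simp add: m_assoc del: GA_simps)
        hence "c A * B = B * A" by (simp add: c_def conj_by_def)
        moreover have "Poly_Mapping.lookup u (c A) = Poly_Mapping.lookup u A"
          by (rule class_functionD[OF u cb(3)[OF A] A]) (simp add: c_def conj_by_def mtype_conj[OF n A B])
        ultimately show "(if c A * B = C then Poly_Mapping.lookup u (c A) * x else 0) =
            (if B * A = C then x * Poly_Mapping.lookup u A else 0)" by simp
      qed
      finally show ?thesis .
    qed
    have "Poly_Mapping.lookup (u \<otimes>\<^bsub>group_ring (GA n)\<^esub> a) C =
      (\<Sum>B\<in>?G. \<Sum>A\<in>?G. if A * B = C then Poly_Mapping.lookup u A * Poly_Mapping.lookup a B else 0)"
      unfolding lookup_group_ring_mult[OF n ku ka] by (rule sum.swap)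
    also have "\<dots> = Poly_Mapping.lookup (a \<otimes>\<^bsub>group_ring (GA n)\<^esub> u) C"
      unfolding lookup_group_ring_mult[OF n ka ku] by (rule sum.cong[OF refl]) (rule inner)
    finally show "Poly_Mapping.lookup (u \<otimes>\<^bsub>group_ring (GA n)\<^esub> a) C = Poly_Mapping.lookup (a \<otimes>\<^bsub>group_ring (GA n)\<^esub> u) C" .
  qed
qed

section \<open>Class sums and structure constants\<close>

lemma lookup_class_sum:
  fixes x :: "'a::{field,finite} ptype \<times> nat"
  assumes n: "n \<ge> 1"
  shows "Poly_Mapping.lookup (class_sum n x) A = (if A \<in> carrier (GA n) \<and> mtype n A = x then 1 else 0)"
proof -
  let ?S = "{A \<in> carrier (GA n). has_modified_type n A x}"
  have "finite ?S" by (rule finite_subset[OF _ finite_GA[OF n]]) auto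
  hence "Poly_Mapping.lookup (class_sum n x) A = (if A \<in> ?S then 1 else 0)"
    by (simp add: class_sum_def lookup_sum)
  thus ?thesis by (cases "A \<in> carrier (GA n)") (simp_all add: has_modified_type_iff[OF n])
qed

lemma class_sum_nonzero_iff:
  fixes x :: "'a::{field,finite} ptype \<times> nat"
  assumes n: "n \<ge> 1"
  shows "class_sum n x \<noteq> 0 \<longleftrightarrow> (\<exists>A\<in>carrier (GA n). mtype n A = x)"
proof
  assume "class_sum n x \<noteq> 0"
  then obtain A where "Poly_Mapping.lookup (class_sum n x) A \<noteq> 0" by (metis lookup_zero poly_mapping_eqI)
  thus "\<exists>A\<in>carrier (GA n). mtype n A = x" unfolding lookup_class_sum[OF n] by (auto split: if_splits)
next
  assume "\<exists>A\<in>carrier (GA n). mtype n A = x"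
  then obtain A where "Poly_Mapping.lookup (class_sum n x) A = 1" unfolding lookup_class_sum[OF n] by auto
  thus "class_sum n x \<noteq> 0" by auto
qed

lemma class_function_class_sum:
  fixes x :: "'a::{field,finite} ptype \<times> nat"
  assumes n: "n \<ge> 1" shows "class_function n (class_sum n x)"
  unfolding class_function_def using lookup_class_sum[OF n, of x]
  by (auto simp: in_keys_iff split: if_splits)

lemma lookup_frag_extend_class_sum:
  fixes c :: "('a::{field,finite} ptype \<times> nat) \<Rightarrow>\<^sub>0 int"
  assumes n: "n \<ge> 1" and A: "A \<in> carrier (GA n)"
  shows "Poly_Mapping.lookup (frag_extend (class_sum n) c) A = Poly_Mapping.lookup c (mtype n A)"
proof -
  have "Poly_Mapping.lookup (frag_extend (class_sum n) c) A =
      (\<Sum>i\<in>Poly_Mapping.keys c. if i = mtype n A then Poly_Mapping.lookup c i else 0)"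
    unfolding lookup_frag_extend lookup_class_sum[OF n] by (intro sum.cong refl) (use A in auto)
  thus ?thesis by (simp add: in_keys_iff)
qed

lemma lookup_class_sum_mult:
  fixes x y :: "'a::{field,finite} ptype \<times> nat"
  assumes n: "n \<ge> 1"
  shows "Poly_Mapping.lookup (class_sum n x \<otimes>\<^bsub>group_ring (GA n)\<^esub> class_sum n y) C = int (card (factorizations n C x y))"
proof -
  let ?G = "carrier (GA n :: 'a mat monoid)"
  have k: "Poly_Mapping.keys (class_sum n z) \<subseteq> ?G" for z :: "'a ptype \<times> nat"
    using class_function_class_sum[OF n, of z] by (simp add: class_function_def)
  have "Poly_Mapping.lookup (class_sum n x \<otimes>\<^bsub>group_ring (GA n)\<^esub> class_sum n y) C =
     (\<Sum>A\<in>?G. \<Sum>B\<in>?G. if (A, B) \<in> factorizations n C x y then 1 else 0)"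
    unfolding lookup_group_ring_mult[OF n k k] lookup_class_sum[OF n]
    by (intro sum.cong refl) (auto simp: factorizations_def)
  also have "\<dots> = (\<Sum>p\<in>?G \<times> ?G. if p \<in> factorizations n C x y then 1 else 0)"
    by (simp add: sum.cartesian_product split_beta)
  also have "\<dots> = (\<Sum>p\<in>(?G \<times> ?G) \<inter> factorizations n C x y. 1)"
    by (rule sum.inter_restrict[symmetric]) (use finite_GA[OF n] in auto)
  also have "(?G \<times> ?G) \<inter> factorizations n C x y = factorizations n C x y" by (auto simp: factorizations_def)
  finally show ?thesis by simp
qed

text \<open>The product is a class function, hence it expands in class sums with coefficients read
  off at representatives. Distinct class sums have disjoint supports, so the expansion is unique and
  the definite description in \<open>struct_const\<close> denotes it.\<close>

lemma struct_const_eq: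
  fixes C :: "'a::{field,finite} mat"
  assumes n: "n \<ge> 1" and C: "C \<in> carrier (GA n)"
  shows "struct_const n x y (mtype n C) = int (card (factorizations n C x y))"
proof -
  let ?G = "carrier (GA n :: 'a mat monoid)"
  let ?p = "class_sum n x \<otimes>\<^bsub>group_ring (GA n)\<^esub> class_sum n y"
  let ?Q = "\<lambda>c. Poly_Mapping.keys c \<subseteq> {v \<in> Phat. class_sum n v \<noteq> 0} \<and>
             class_sum n x \<otimes>\<^bsub>Aring n\<^esub> class_sum n y = frag_extend (class_sum n) c"
  define rep where "rep z = (SOME A. A \<in> ?G \<and> mtype n A = z)" for z
  have rep: "rep (mtype n A) \<in> ?G \<and> mtype n (rep (mtype n A)) = mtype n A" if "A \<in> ?G" for A
    unfolding rep_def by (rule someI[of _ A]) (use that in simp)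
  define c0 where "c0 = (\<Sum>z\<in>mtype n ` ?G. frag_cmul (Poly_Mapping.lookup ?p (rep z)) (frag_of z))"
  have lc0: "Poly_Mapping.lookup c0 z = (if z \<in> mtype n ` ?G then Poly_Mapping.lookup ?p (rep z) else 0)" for z
    using finite_GA[OF n, where 'a = 'a] by (simp add: c0_def lookup_sum if_distrib cong: if_cong)
  have pc: "class_function n ?p" by (intro class_function_mult n class_function_class_sum)
  have Q0: "?Q c0"
  proof
    show "Poly_Mapping.keys c0 \<subseteq> {v \<in> Phat. class_sum n v \<noteq> 0}"
    proof
      fix z assume "z \<in> Poly_Mapping.keys c0"
      hence "z \<in> mtype n ` ?G" by (auto simp: in_keys_iff lc0 split: if_splits)
      thus "z \<in> {v \<in> Phat. class_sum n v \<noteq> 0}" using mtype_Phat[OF n] class_sum_nonzero_iff[OF n] by blast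
    qed
    have "?p = frag_extend (class_sum n) c0"
    proof (rule poly_mapping_eqI)
      fix A
      show "Poly_Mapping.lookup ?p A = Poly_Mapping.lookup (frag_extend (class_sum n) c0) A"
      proof (cases "A \<in> ?G")
        case True
        have "Poly_Mapping.lookup ?p A = Poly_Mapping.lookup ?p (rep (mtype n A))"
          using class_functionD[OF pc True] rep[OF True] by metis
        thus ?thesis unfolding lookup_frag_extend_class_sum[OF n True] lc0 using True by simp
      next
        case False
        have "Poly_Mapping.lookup ?p A = 0" by (rule lookup_outside[OF class_function_keys[OF pc] False])
        moreover have "Poly_Mapping.lookup (frag_extend (class_sum n) c0) A = 0"
          unfolding lookup_frag_extend lookup_class_sum[OF n] using False by simp
        ultimately show ?thesis by simp
      qed
    qed
    thus "class_sum n x \<otimes>\<^bsub>Aring n\<^esub> class_sum n y = frag_extend (class_sum n) c0" by simp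
  qed
  have uniq: "c = c0" if c: "?Q c" for c
  proof (rule poly_mapping_eqI)
    fix z
    show "Poly_Mapping.lookup c z = Poly_Mapping.lookup c0 z"
    proof (cases "\<exists>A\<in>?G. mtype n A = z")
      case True
      then obtain A where A: "A \<in> ?G" "mtype n A = z" by blast
      have "frag_extend (class_sum n) c = frag_extend (class_sum n) c0" using c Q0 by simp
      hence "Poly_Mapping.lookup (frag_extend (class_sum n) c) A = Poly_Mapping.lookup (frag_extend (class_sum n) c0) A"
        by simp
      thus ?thesis unfolding lookup_frag_extend_class_sum[OF n A(1)] A(2) .
    next
      case False
      hence "z \<notin> Poly_Mapping.keys c" "z \<notin> Poly_Mapping.keys c0"
        using c Q0 class_sum_nonzero_iff[OF n, of z] by auto
      thus ?thesis by (simp add: in_keys_iff)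
    qed
  qed
  have "(THE c. ?Q c) = c0" by (rule the_equality[where P = ?Q]) (rule Q0, rule uniq)
  hence "struct_const n x y (mtype n C) = Poly_Mapping.lookup c0 (mtype n C)"
    unfolding struct_const_def by simp
  also have "\<dots> = Poly_Mapping.lookup ?p C"
    unfolding lc0 using class_functionD[OF pc _ C, of "rep (mtype n C)"] rep[OF C] C by simp
  finally show ?thesis unfolding lookup_class_sum_mult[OF n] .
qed

text \<open>The common value exists by \<open>card_factorizations_stable\<close>. For the
  description to pick it out, its condition must not be vacuous: some single group must contain all
  three classes.\<close>

lemma stable_const_eq:
  fixes C :: "'a::{field,finite} mat"
  assumes n: "n \<ge> 1" and C: "C \<in> carrier (GA n)" and x: "x \<in> Phat" and y: "y \<in> Phat"
    and norm: "anorm (mtype n C) = anorm x + anorm y"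
  shows "stable_const x y (mtype n C) = int (card (factorizations n C x y))"
  unfolding stable_const_def
proof (rule the_equality)
  let ?z = "mtype n C"
  show stab: "\<forall>m\<ge>1. class_sum m x \<noteq> 0 \<and> class_sum m y \<noteq> 0 \<and> class_sum m ?z \<noteq> 0 \<longrightarrow>
      struct_const m x y ?z = int (card (factorizations n C x y))"
  proof (intro allI impI)
    fix m :: nat assume m: "1 \<le> m" and nz: "class_sum m x \<noteq> 0 \<and> class_sum m y \<noteq> 0 \<and> class_sum m ?z \<noteq> 0"
    then obtain C' where C': "C' \<in> carrier (GA m)" "mtype m C' = ?z" using class_sum_nonzero_iff[OF m] by blast
    show "struct_const m x y ?z = int (card (factorizations n C x y))"
      using struct_const_eq[OF m C'(1), of x y] card_factorizations_stable[OF n C m C'(1)] C'(2) norm by simp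
  qed
  fix c assume c: "\<forall>m\<ge>1. class_sum m x \<noteq> 0 \<and> class_sum m y \<noteq> 0 \<and> class_sum m ?z \<noteq> 0 \<longrightarrow> struct_const m x y ?z = c"
  obtain i A where A: "i \<ge> 1" "A \<in> carrier (GA i)" "mtype i A = x" using class_nonempty[OF x] by blast
  obtain j B where B: "j \<ge> 1" "B \<in> carrier (GA j)" "mtype j B = y" using class_nonempty[OF y] by blast
  \<comment> \<open>Extension by fixed vectors carries a class into every larger group, so the sum
    of the three sizes is large enough for all of them.\<close>
  define N where "N = n + i + j"
  have N: "N \<ge> 1" "n + (i + j) = N" "i + (n + j) = N" "j + (n + i) = N" using n by (auto simp: N_def)
  have "class_sum N x \<noteq> 0" unfolding class_sum_nonzero_iff[OF N(1)]
    using ext_mat_iterate[OF A(1,2), of "n + j"] A(3) unfolding N by blast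
  moreover have "class_sum N y \<noteq> 0" unfolding class_sum_nonzero_iff[OF N(1)]
    using ext_mat_iterate[OF B(1,2), of "n + i"] B(3) unfolding N by blast
  moreover have "class_sum N ?z \<noteq> 0" unfolding class_sum_nonzero_iff[OF N(1)]
    using ext_mat_iterate[OF n C, of "i + j"] unfolding N by blast
  ultimately show "c = int (card (factorizations n C x y))" using c stab N(1) by metis
qed

section \<open>The stable graded algebra is a ring\<close>

text \<open>An element of the stable algebra is determined by the class functions it defines on the groups
  \<open>GA n\<close>.  In terms of these, its product is the convolution restricted to factorizations
  \<open>C = A B\<close> along which the norm is additive.\<close>

definition class_value :: "nat \<Rightarrow> (('a::{field,finite} ptype \<times> nat) \<Rightarrow>\<^sub>0 int) \<Rightarrow> 'a mat \<Rightarrow> int" where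
  "class_value n u A = Poly_Mapping.lookup u (mtype n A)"

definition mnorm :: "nat \<Rightarrow> 'a::{field,finite} mat \<Rightarrow> nat" where
  "mnorm n A = anorm (mtype n A)"

lemma G_ring_simps [simp]:
  "carrier G_ring = {u. Poly_Mapping.keys u \<subseteq> Phat}" "\<one>\<^bsub>G_ring\<^esub> = frag_of (\<lambda>_. {#}, 0)"
  "\<zero>\<^bsub>G_ring\<^esub> = 0" "ring.add G_ring = (+)"
  by (simp_all add: G_ring_def)

lemma lookup_G_ring_mult:
  fixes u v :: "('a::{field,finite} ptype \<times> nat) \<Rightarrow>\<^sub>0 int"
  shows "Poly_Mapping.lookup (u \<otimes>\<^bsub>G_ring\<^esub> v) z =
   (\<Sum>x\<in>Poly_Mapping.keys u. \<Sum>y\<in>Poly_Mapping.keys v. if z \<in> Phat \<and> anorm z = anorm x + anorm y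
      then Poly_Mapping.lookup u x * Poly_Mapping.lookup v y * stable_const x y z else 0)"
proof -
  have l: "Poly_Mapping.lookup (\<Sum>w\<in>{w \<in> Phat. anorm w = d}. frag_cmul (c w) (frag_of w)) z =
      (if z \<in> Phat \<and> anorm z = d then c z else 0)" for d and c :: "'a ptype \<times> nat \<Rightarrow> int"
  proof -
    have "Poly_Mapping.lookup (\<Sum>w\<in>{w \<in> Phat. anorm w = d}. frag_cmul (c w) (frag_of w)) z =
        (\<Sum>w\<in>{w \<in> Phat. anorm w = d}. if w = z then c w else 0)"
      unfolding lookup_sum by (intro sum.cong refl) simp
    also have "\<dots> = (if z \<in> Phat \<and> anorm z = d then c z else 0)"
      using finite_anorm[of d, where 'a = 'a] by (simp only: sum.delta) simp
    finally show ?thesis .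
  qed
  have m: "u \<otimes>\<^bsub>G_ring\<^esub> v = frag_extend (\<lambda>x. frag_extend (\<lambda>y.
      \<Sum>w\<in>{w \<in> Phat. anorm w = anorm x + anorm y}. frag_cmul (stable_const x y w) (frag_of w)) v) u"
    by (simp only: G_ring_def monoid.select_convs)
  show ?thesis
    unfolding m lookup_frag_extend l sum_distrib_left by (intro sum.cong refl) simp
qed

lemma value_mult:
  fixes u v :: "('a::{field,finite} ptype \<times> nat) \<Rightarrow>\<^sub>0 int"
  assumes n: "n \<ge> 1" and C: "C \<in> carrier (GA n)" and u: "u \<in> carrier G_ring" and v: "v \<in> carrier G_ring"
  shows "class_value n (u \<otimes>\<^bsub>G_ring\<^esub> v) C = (\<Sum>A\<in>carrier (GA n). \<Sum>B\<in>carrier (GA n).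
    if A * B = C \<and> mnorm n C = mnorm n A + mnorm n B then class_value n u A * class_value n v B else 0)"
proof -
  let ?G = "carrier (GA n :: 'a mat monoid)" and ?u = "Poly_Mapping.lookup u" and ?v = "Poly_Mapping.lookup v"
  let ?t = "\<lambda>x y (A, B). if A * B = C \<and> mtype n A = x \<and> mtype n B = y \<and> mnorm n C = anorm x + anorm y then ?u x * ?v y else 0"
  have fin: "finite (?G \<times> ?G)" using finite_GA[OF n] by auto
  have "class_value n (u \<otimes>\<^bsub>G_ring\<^esub> v) C = (\<Sum>x\<in>Poly_Mapping.keys u. \<Sum>y\<in>Poly_Mapping.keys v. \<Sum>p\<in>?G \<times> ?G. ?t x y p)"
    unfolding class_value_def lookup_G_ring_mult
  proof (intro sum.cong refl)
    fix x y assume x: "x \<in> Poly_Mapping.keys u" and y: "y \<in> Poly_Mapping.keys v"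
    hence xy: "x \<in> Phat" "y \<in> Phat" using u v by auto
    show "(if mtype n C \<in> Phat \<and> anorm (mtype n C) = anorm x + anorm y
       then ?u x * ?v y * stable_const x y (mtype n C) else 0) = (\<Sum>p\<in>?G \<times> ?G. ?t x y p)"
    proof (cases "anorm (mtype n C) = anorm x + anorm y")
      case True
      \<comment> \<open>The stable constant is spread out as a sum over the factorizations of
        \<open>C\<close> in the given group.\<close>
      have "(\<Sum>p\<in>?G \<times> ?G. ?t x y p) = (\<Sum>p\<in>?G \<times> ?G. if p \<in> factorizations n C x y then ?u x * ?v y else 0)"
      proof (intro sum.cong refl)
        fix p assume p: "p \<in> ?G \<times> ?G"
        obtain A B where pAB: "p = (A, B)" by (cases p)
        have "p \<in> factorizations n C x y \<longleftrightarrow> A * B = C \<and> mtype n A = x \<and> mtype n B = y \<and> mnorm n C = anorm x + anorm y"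
          using p by (auto simp: pAB factorizations_def mnorm_def True)
        thus "?t x y p = (if p \<in> factorizations n C x y then ?u x * ?v y else 0)" by (simp add: pAB)
      qed
      also have "\<dots> = (\<Sum>p\<in>(?G \<times> ?G) \<inter> factorizations n C x y. ?u x * ?v y)"
        by (rule sum.inter_restrict[OF fin, symmetric])
      also have "(?G \<times> ?G) \<inter> factorizations n C x y = factorizations n C x y" by (auto simp: factorizations_def)
      finally show ?thesis
        using stable_const_eq[OF n C xy True] mtype_Phat[OF n C] True by simp
    next
      case False
      have "?t x y p = 0" for p
      proof (cases p)
        case (Pair A B)
        have "\<not> mnorm n C = anorm x + anorm y" using False by (simp add: mnorm_def)
        thus ?thesis unfolding Pair by simp
      qed
      hence "(\<Sum>p\<in>?G \<times> ?G. ?t x y p) = 0" by (intro sum.neutral ballI)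
      thus ?thesis using False by simp
    qed
  qed
  also have "\<dots> = (\<Sum>p\<in>?G \<times> ?G. \<Sum>x\<in>Poly_Mapping.keys u. \<Sum>y\<in>Poly_Mapping.keys v. ?t x y p)"
    by (simp only: sum.swap[of _ "?G \<times> ?G"])
  also have "\<dots> = (\<Sum>(A, B)\<in>?G \<times> ?G. if A * B = C \<and> mnorm n C = mnorm n A + mnorm n B then class_value n u A * class_value n v B else 0)"
  proof (intro sum.cong refl)
    fix p assume "p \<in> ?G \<times> ?G"
    obtain A B where pAB: "p = (A, B)" by (cases p)
    have "(\<Sum>x\<in>Poly_Mapping.keys u. \<Sum>y\<in>Poly_Mapping.keys v. ?t x y (A, B)) =
      (if A * B = C \<and> mnorm n C = mnorm n A + mnorm n B then class_value n u A * class_value n v B else 0)"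
    proof (cases "A * B = C \<and> mnorm n C = mnorm n A + mnorm n B")
      case True
      have "(\<Sum>x\<in>Poly_Mapping.keys u. \<Sum>y\<in>Poly_Mapping.keys v. ?t x y (A, B)) =
        (\<Sum>x\<in>Poly_Mapping.keys u. \<Sum>y\<in>Poly_Mapping.keys v. (if x = mtype n A then ?u x else 0) * (if y = mtype n B then ?v y else 0))"
        by (intro sum.cong refl) (use True in \<open>auto simp: mnorm_def\<close>)
      also have "\<dots> = (\<Sum>x\<in>Poly_Mapping.keys u. if x = mtype n A then ?u x else 0) * (\<Sum>y\<in>Poly_Mapping.keys v. if y = mtype n B then ?v y else 0)"
        by (rule sum_product[symmetric])
      also have "\<dots> = class_value n u A * class_value n v B" by (simp add: class_value_def in_keys_iff)
      finally show ?thesis using True by simp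
    next
      case False
      have "?t x y (A, B) = 0" for x y using False by (auto simp: mnorm_def)
      thus ?thesis unfolding if_not_P[OF False] by (simp only: sum.neutral_const)
    qed
    thus "(\<Sum>x\<in>Poly_Mapping.keys u. \<Sum>y\<in>Poly_Mapping.keys v. ?t x y p) =
      (case p of (A, B) \<Rightarrow> if A * B = C \<and> mnorm n C = mnorm n A + mnorm n B then class_value n u A * class_value n v B else 0)"
      unfolding pAB by simp
  qed
  also have "\<dots> = (\<Sum>A\<in>?G. \<Sum>B\<in>?G. if A * B = C \<and> mnorm n C = mnorm n A + mnorm n B then class_value n u A * class_value n v B else 0)"
    by (rule sum.cartesian_product[symmetric])
  finally show ?thesis .
qed

text \<open>Every element of \<open>Phat\<close> is realized in some \<open>GA n\<close>, so the
  values detect all coefficients. Identities in the stable algebra can thus be checked group by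
  group.\<close>

lemma value_eqI:
  fixes u v :: "('a::{field,finite} ptype \<times> nat) \<Rightarrow>\<^sub>0 int"
  assumes "u \<in> carrier G_ring" "v \<in> carrier G_ring"
    "\<And>n C. n \<ge> 1 \<Longrightarrow> C \<in> carrier (GA n) \<Longrightarrow> class_value n u C = class_value n v C"
  shows "u = v"
proof (rule poly_mapping_eqI)
  fix z
  show "Poly_Mapping.lookup u z = Poly_Mapping.lookup v z"
  proof (cases "z \<in> Phat")
    case True
    then obtain n C where "n \<ge> 1" "C \<in> carrier (GA n)" "mtype n C = z" using class_nonempty by blast
    thus ?thesis using assms(3)[of n C] by (simp add: class_value_def)
  next
    case False
    thus ?thesis using assms(1,2) lookup_outside[of u Phat z] lookup_outside[of v Phat z] by simp
  qed
qed

lemma G_ring_mult_closed: "u \<otimes>\<^bsub>G_ring\<^esub> v \<in> carrier G_ring"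
proof -
  have "Poly_Mapping.lookup (u \<otimes>\<^bsub>G_ring\<^esub> v) z = 0" if "z \<notin> Phat" for z
    unfolding lookup_G_ring_mult using that by simp
  thus ?thesis by (auto simp: in_keys_iff)
qed

lemma norm_mult:
  "n \<ge> 1 \<Longrightarrow> A \<in> carrier (GA n) \<Longrightarrow> B \<in> carrier (GA n) \<Longrightarrow> mnorm n (A * B) \<le> mnorm n A + mnorm n B"
  unfolding mnorm_def by (rule anorm_mtype_mult)

text \<open>Both sides equal the sum over all triples with \<open>A B E = C\<close> whose norms add
  up to the norm of \<open>C\<close>.\<close>

lemma G_ring_assoc:
  fixes u v t :: "('a::{field,finite} ptype \<times> nat) \<Rightarrow>\<^sub>0 int"
  assumes u: "u \<in> carrier G_ring" and v: "v \<in> carrier G_ring" and t: "t \<in> carrier G_ring"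
  shows "u \<otimes>\<^bsub>G_ring\<^esub> v \<otimes>\<^bsub>G_ring\<^esub> t = u \<otimes>\<^bsub>G_ring\<^esub> (v \<otimes>\<^bsub>G_ring\<^esub> t)"
proof (rule value_eqI[OF G_ring_mult_closed G_ring_mult_closed])
  fix n and C :: "'a mat" assume n: "n \<ge> 1" and C: "C \<in> carrier (GA n)"
  let ?G = "carrier (GA n :: 'a mat monoid)"
  let ?s = "\<lambda>A B E. if A * B * E = C \<and> mnorm n C = mnorm n A + mnorm n B + mnorm n E
    then class_value n u A * class_value n v B * class_value n t E else 0"
  have "class_value n (u \<otimes>\<^bsub>G_ring\<^esub> v \<otimes>\<^bsub>G_ring\<^esub> t) C = (\<Sum>F\<in>?G. \<Sum>E\<in>?G.
      if F * E = C \<and> mnorm n C = mnorm n F + mnorm n E then (\<Sum>A\<in>?G. \<Sum>B\<in>?G.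
        if A * B = F \<and> mnorm n F = mnorm n A + mnorm n B then class_value n u A * class_value n v B else 0) * class_value n t E else 0)"
    unfolding value_mult[OF n C G_ring_mult_closed t] by (intro sum.cong refl) (simp add: value_mult[OF n _ u v])
  also have "\<dots> = (\<Sum>F\<in>?G. \<Sum>E\<in>?G. \<Sum>A\<in>?G. \<Sum>B\<in>?G. if F = A * B then ?s A B E else 0)"
  proof (intro sum.cong refl)
    fix F E assume F: "F \<in> ?G" and E: "E \<in> ?G"
    have eq: "(if F * E = C \<and> mnorm n C = mnorm n F + mnorm n E then
        (if A * B = F \<and> mnorm n F = mnorm n A + mnorm n B then class_value n u A * class_value n v B else 0) * class_value n t E else 0) =
        (if F = A * B then ?s A B E else 0)" if A: "A \<in> ?G" and B: "B \<in> ?G" for A B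
    proof (cases "F = A * B \<and> A * B * E = C")
      case True
      \<comment> \<open>By subadditivity, additivity over the triple is equivalent to additivity in
        both successive products: a loss in one step cannot be made up in the other.\<close>
      have "mnorm n C \<le> mnorm n F + mnorm n E" "mnorm n F \<le> mnorm n A + mnorm n B"
        using True norm_mult[OF n F E] norm_mult[OF n A B] by auto
      thus ?thesis using True by auto
    qed auto
    show "(if F * E = C \<and> mnorm n C = mnorm n F + mnorm n E then (\<Sum>A\<in>?G. \<Sum>B\<in>?G.
        if A * B = F \<and> mnorm n F = mnorm n A + mnorm n B then class_value n u A * class_value n v B else 0) * class_value n t E else 0) =
        (\<Sum>A\<in>?G. \<Sum>B\<in>?G. if F = A * B then ?s A B E else 0)"
    proof -
      have "(\<Sum>A\<in>?G. \<Sum>B\<in>?G. if F = A * B then ?s A B E else 0) = (\<Sum>A\<in>?G. \<Sum>B\<in>?G. if F * E = C \<and> mnorm n C = mnorm n F + mnorm n E then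
        (if A * B = F \<and> mnorm n F = mnorm n A + mnorm n B then class_value n u A * class_value n v B else 0) * class_value n t E else 0)"
        by (intro sum.cong refl eq[symmetric])
      thus ?thesis by (cases "F * E = C \<and> mnorm n C = mnorm n F + mnorm n E") (simp_all only: if_True if_False sum_distrib_right sum.neutral_const simp_thms)
    qed
  qed
  also have "\<dots> = (\<Sum>E\<in>?G. \<Sum>A\<in>?G. \<Sum>B\<in>?G. \<Sum>F\<in>?G. if F = A * B then ?s A B E else 0)"
    by (rule trans[OF sum.swap sum.cong[OF refl trans[OF sum.swap sum.cong[OF refl sum.swap]]]])
  also have "\<dots> = (\<Sum>E\<in>?G. \<Sum>A\<in>?G. \<Sum>B\<in>?G. ?s A B E)"
    by (intro sum.cong refl) (use finite_GA[OF n, where 'a = 'a] GA_mult_closed[OF n, where 'a = 'a] in simp)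
  also have "\<dots> = (\<Sum>A\<in>?G. \<Sum>B\<in>?G. \<Sum>E\<in>?G. ?s A B E)"
    by (rule trans[OF sum.swap sum.cong[OF refl sum.swap]])
  finally have left: "class_value n (u \<otimes>\<^bsub>G_ring\<^esub> v \<otimes>\<^bsub>G_ring\<^esub> t) C = (\<Sum>A\<in>?G. \<Sum>B\<in>?G. \<Sum>E\<in>?G. ?s A B E)" .
  have "class_value n (u \<otimes>\<^bsub>G_ring\<^esub> (v \<otimes>\<^bsub>G_ring\<^esub> t)) C = (\<Sum>A\<in>?G. \<Sum>F\<in>?G.
      if A * F = C \<and> mnorm n C = mnorm n A + mnorm n F then class_value n u A * (\<Sum>B\<in>?G. \<Sum>E\<in>?G.
        if B * E = F \<and> mnorm n F = mnorm n B + mnorm n E then class_value n v B * class_value n t E else 0) else 0)"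
    unfolding value_mult[OF n C u G_ring_mult_closed] by (intro sum.cong refl) (simp add: value_mult[OF n _ v t])
  also have "\<dots> = (\<Sum>A\<in>?G. \<Sum>F\<in>?G. \<Sum>B\<in>?G. \<Sum>E\<in>?G. if F = B * E then ?s A B E else 0)"
  proof (intro sum.cong refl)
    fix A F assume A: "A \<in> ?G" and F: "F \<in> ?G"
    have eq: "(if A * F = C \<and> mnorm n C = mnorm n A + mnorm n F then class_value n u A *
        (if B * E = F \<and> mnorm n F = mnorm n B + mnorm n E then class_value n v B * class_value n t E else 0) else 0) =
        (if F = B * E then ?s A B E else 0)" if B: "B \<in> ?G" and E: "E \<in> ?G" for B E
    proof (cases "F = B * E \<and> A * F = C")
      case True
      have assoc: "A * B * E = A * (B * E)"
        using GA_D(1)[OF n A] GA_D(1)[OF n B] GA_D(1)[OF n E] by (rule assoc_mult_mat)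
      have "mnorm n C \<le> mnorm n A + mnorm n F" "mnorm n F \<le> mnorm n B + mnorm n E"
        using True norm_mult[OF n A F] norm_mult[OF n B E] by auto
      thus ?thesis using True assoc by auto
    next
      case False
      have assoc: "A * B * E = A * (B * E)"
        using GA_D(1)[OF n A] GA_D(1)[OF n B] GA_D(1)[OF n E] by (rule assoc_mult_mat)
      show ?thesis using False assoc by auto
    qed
    show "(if A * F = C \<and> mnorm n C = mnorm n A + mnorm n F then class_value n u A * (\<Sum>B\<in>?G. \<Sum>E\<in>?G.
        if B * E = F \<and> mnorm n F = mnorm n B + mnorm n E then class_value n v B * class_value n t E else 0) else 0) =
        (\<Sum>B\<in>?G. \<Sum>E\<in>?G. if F = B * E then ?s A B E else 0)"
    proof -
      have "(\<Sum>B\<in>?G. \<Sum>E\<in>?G. if F = B * E then ?s A B E else 0) = (\<Sum>B\<in>?G. \<Sum>E\<in>?G. if A * F = C \<and> mnorm n C = mnorm n A + mnorm n F then class_value n u A *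
        (if B * E = F \<and> mnorm n F = mnorm n B + mnorm n E then class_value n v B * class_value n t E else 0) else 0)"
        by (intro sum.cong refl eq[symmetric])
      thus ?thesis by (cases "A * F = C \<and> mnorm n C = mnorm n A + mnorm n F") (simp_all only: if_True if_False sum_distrib_left sum.neutral_const simp_thms)
    qed
  qed
  also have "\<dots> = (\<Sum>A\<in>?G. \<Sum>B\<in>?G. \<Sum>E\<in>?G. \<Sum>F\<in>?G. if F = B * E then ?s A B E else 0)"
    by (rule sum.cong[OF refl trans[OF sum.swap sum.cong[OF refl sum.swap]]])
  also have "\<dots> = (\<Sum>A\<in>?G. \<Sum>B\<in>?G. \<Sum>E\<in>?G. ?s A B E)"
    by (intro sum.cong refl) (use finite_GA[OF n, where 'a = 'a] GA_mult_closed[OF n, where 'a = 'a] in simp)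
  finally show "class_value n (u \<otimes>\<^bsub>G_ring\<^esub> v \<otimes>\<^bsub>G_ring\<^esub> t) C = class_value n (u \<otimes>\<^bsub>G_ring\<^esub> (v \<otimes>\<^bsub>G_ring\<^esub> t)) C"
    using left by simp
qed

lemma one_GA:
  assumes "n \<ge> 1" shows "(1\<^sub>m n :: 'a::{field,finite} mat) \<in> carrier (GA n)"
  using monoid.one_closed[OF group.is_monoid[OF GA_group[OF assms, where 'a = 'a]]] by simp

lemma value_one:
  fixes A :: "'a::{field,finite} mat"
  assumes n: "n \<ge> 1" and A: "A \<in> carrier (GA n)"
  shows "class_value n (frag_of (\<lambda>_. {#}, 0)) A = (if A = 1\<^sub>m n then 1 else 0)"
proof (cases "A = 1\<^sub>m n")
  case True
  thus ?thesis using mtype_one_eq[OF n, where 'a = 'a] by (simp add: class_value_def)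
next
  case False
  hence "(\<lambda>_. {#}, 0) \<noteq> mtype n A" using mtype_eq_one[OF n A] mtype_one_eq[OF n, where 'a = 'a] by metis
  thus ?thesis using False by (simp add: class_value_def)
qed

lemma value_add: "class_value n (u + v) A = class_value n u A + class_value n v A"
  by (simp add: class_value_def lookup_add)

lemma G_ring_add_closed: "u \<in> carrier G_ring \<Longrightarrow> v \<in> carrier G_ring \<Longrightarrow> u + v \<in> carrier G_ring"
  using Poly_Mapping.keys_add[of u v] by auto

lemma G_ring_ring: "ring (G_ring :: ('a::{field,finite} ptype \<times> nat \<Rightarrow>\<^sub>0 int) ring)"
proof (rule ringI)
  let ?R = "G_ring :: ('a ptype \<times> nat \<Rightarrow>\<^sub>0 int) ring"
  show "abelian_group ?R"
  proof (rule abelian_groupI)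
    fix x assume "x \<in> carrier ?R"
    thus "\<exists>y\<in>carrier ?R. y \<oplus>\<^bsub>?R\<^esub> x = \<zero>\<^bsub>?R\<^esub>" by (intro bexI[of _ "- x"]) auto
  next
    fix x y assume "x \<in> carrier ?R" "y \<in> carrier ?R"
    thus "x \<oplus>\<^bsub>?R\<^esub> y \<in> carrier ?R" unfolding G_ring_simps(4) by (rule G_ring_add_closed)
  qed (simp_all add: add_ac)
  have one: "\<one>\<^bsub>?R\<^esub> \<in> carrier ?R" using unit_Phat by simp
  have norm1: "mnorm n (1\<^sub>m n :: 'a mat) = 0" if "n \<ge> 1" for n using mtype_one[OF that] by (simp add: mnorm_def)
  show "monoid ?R"
  proof (rule monoidI)
    show "x \<otimes>\<^bsub>?R\<^esub> y \<in> carrier ?R" for x y by (rule G_ring_mult_closed)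
    show "\<one>\<^bsub>?R\<^esub> \<in> carrier ?R" by (rule one)
    show "x \<otimes>\<^bsub>?R\<^esub> y \<otimes>\<^bsub>?R\<^esub> z = x \<otimes>\<^bsub>?R\<^esub> (y \<otimes>\<^bsub>?R\<^esub> z)"
      if "x \<in> carrier ?R" "y \<in> carrier ?R" "z \<in> carrier ?R" for x y z using that by (rule G_ring_assoc)
    fix x assume x: "x \<in> carrier ?R"
    show "\<one>\<^bsub>?R\<^esub> \<otimes>\<^bsub>?R\<^esub> x = x"
    proof (rule value_eqI[OF G_ring_mult_closed x])
      fix n and C :: "'a mat" assume n: "n \<ge> 1" and C: "C \<in> carrier (GA n)"
      let ?G = "carrier (GA n :: 'a mat monoid)"
      have "class_value n (\<one>\<^bsub>?R\<^esub> \<otimes>\<^bsub>?R\<^esub> x) C = (\<Sum>A\<in>?G. \<Sum>B\<in>?G. if A = 1\<^sub>m n then (if B = C then class_value n x B else 0) else 0)"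
        unfolding value_mult[OF n C one x]
      proof (intro sum.cong refl)
        fix A B assume A: "A \<in> ?G" and B: "B \<in> ?G"
        show "(if A * B = C \<and> mnorm n C = mnorm n A + mnorm n B then class_value n \<one>\<^bsub>?R\<^esub> A * class_value n x B else 0) =
            (if A = 1\<^sub>m n then (if B = C then class_value n x B else 0) else 0)"
        proof (cases "A = 1\<^sub>m n")
          case True
          have "A * B = B" using GA_D(1)[OF n B] True by simp
          thus ?thesis using value_one[OF n A] norm1[OF n] True by auto
        next
          case False
          thus ?thesis using value_one[OF n A] by simp
        qed
      qed
      also have "\<dots> = (\<Sum>A\<in>?G. if A = 1\<^sub>m n then (\<Sum>B\<in>?G. if B = C then class_value n x B else 0) else 0)"
        by (intro sum.cong refl) auto
      also have "\<dots> = class_value n x C" using finite_GA[OF n, where 'a = 'a] one_GA[OF n, where 'a = 'a] C by simp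
      finally show "class_value n (\<one>\<^bsub>?R\<^esub> \<otimes>\<^bsub>?R\<^esub> x) C = class_value n x C" .
    qed
    show "x \<otimes>\<^bsub>?R\<^esub> \<one>\<^bsub>?R\<^esub> = x"
    proof (rule value_eqI[OF G_ring_mult_closed x])
      fix n and C :: "'a mat" assume n: "n \<ge> 1" and C: "C \<in> carrier (GA n)"
      let ?G = "carrier (GA n :: 'a mat monoid)"
      have "class_value n (x \<otimes>\<^bsub>?R\<^esub> \<one>\<^bsub>?R\<^esub>) C = (\<Sum>A\<in>?G. \<Sum>B\<in>?G. if B = 1\<^sub>m n then (if A = C then class_value n x A else 0) else 0)"
        unfolding value_mult[OF n C x one]
      proof (intro sum.cong refl)
        fix A B assume A: "A \<in> ?G" and B: "B \<in> ?G"
        show "(if A * B = C \<and> mnorm n C = mnorm n A + mnorm n B then class_value n x A * class_value n \<one>\<^bsub>?R\<^esub> B else 0) =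
            (if B = 1\<^sub>m n then (if A = C then class_value n x A else 0) else 0)"
        proof (cases "B = 1\<^sub>m n")
          case True
          have "A * B = A" using GA_D(1)[OF n A] True by simp
          thus ?thesis using value_one[OF n B] norm1[OF n] True by auto
        next
          case False
          thus ?thesis using value_one[OF n B] by simp
        qed
      qed
      also have "\<dots> = class_value n x C" using finite_GA[OF n, where 'a = 'a] one_GA[OF n, where 'a = 'a] C by simp
      finally show "class_value n (x \<otimes>\<^bsub>?R\<^esub> \<one>\<^bsub>?R\<^esub>) C = class_value n x C" .
    qed
  qed
  fix x y z assume x: "x \<in> carrier ?R" and y: "y \<in> carrier ?R" and z: "z \<in> carrier ?R"
  have xy: "x + y \<in> carrier ?R" by (rule G_ring_add_closed[OF x y])
  have if_add: "(if P then a + b else 0) = (if P then a else 0) + (if P then b else (0 :: int))" for P a b by simp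
  show "(x \<oplus>\<^bsub>?R\<^esub> y) \<otimes>\<^bsub>?R\<^esub> z = x \<otimes>\<^bsub>?R\<^esub> z \<oplus>\<^bsub>?R\<^esub> y \<otimes>\<^bsub>?R\<^esub> z"
    unfolding G_ring_simps(4)
  proof (rule value_eqI[OF G_ring_mult_closed G_ring_add_closed[OF G_ring_mult_closed G_ring_mult_closed]])
    fix n and C :: "'a mat" assume n: "n \<ge> 1" and C: "C \<in> carrier (GA n)"
    show "class_value n ((x + y) \<otimes>\<^bsub>?R\<^esub> z) C = class_value n (x \<otimes>\<^bsub>?R\<^esub> z + y \<otimes>\<^bsub>?R\<^esub> z) C"
      unfolding value_add value_mult[OF n C xy z] value_mult[OF n C x z] value_mult[OF n C y z] sum.distrib[symmetric]
        if_add[symmetric] distrib_right ..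
  qed
  show "z \<otimes>\<^bsub>?R\<^esub> (x \<oplus>\<^bsub>?R\<^esub> y) = z \<otimes>\<^bsub>?R\<^esub> x \<oplus>\<^bsub>?R\<^esub> z \<otimes>\<^bsub>?R\<^esub> y"
    unfolding G_ring_simps(4)
  proof (rule value_eqI[OF G_ring_mult_closed G_ring_add_closed[OF G_ring_mult_closed G_ring_mult_closed]])
    fix n and C :: "'a mat" assume n: "n \<ge> 1" and C: "C \<in> carrier (GA n)"
    show "class_value n (z \<otimes>\<^bsub>?R\<^esub> (x + y)) C = class_value n (z \<otimes>\<^bsub>?R\<^esub> x + z \<otimes>\<^bsub>?R\<^esub> y) C"
      unfolding value_add value_mult[OF n C z xy] value_mult[OF n C z x] value_mult[OF n C z y] sum.distrib[symmetric]
        if_add[symmetric] distrib_left ..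
  qed
qed

section \<open>The associated graded ring of the centre\<close>

lemma class_function_iff:
  "class_function n u \<longleftrightarrow> (\<forall>A. A \<notin> carrier (GA n) \<longrightarrow> Poly_Mapping.lookup u A = 0) \<and>
     (\<forall>A\<in>carrier (GA n). \<forall>B\<in>carrier (GA n). mtype n A = mtype n B \<longrightarrow> Poly_Mapping.lookup u A = Poly_Mapping.lookup u B)"
  unfolding class_function_def by (auto simp: subset_iff in_keys_iff)

text \<open>The bound is strict, so that index 0 gives the zero group: \<open>norm_below n m\<close>
  is the group that is divided out in degree \<open>m\<close>, and
  \<open>norm_below n (Suc m)\<close> is step \<open>m\<close> of the filtration.\<close>

definition norm_below :: "nat \<Rightarrow> nat \<Rightarrow> ('a::{field,finite} mat \<Rightarrow>\<^sub>0 int) set" where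
  "norm_below n m = {u. class_function n u \<and> (\<forall>A. m \<le> mnorm n A \<longrightarrow> Poly_Mapping.lookup u A = 0)}"

lemma norm_below_0: "norm_below n 0 = {0}"
  by (auto simp: norm_below_def class_function_iff intro: poly_mapping_eqI)

lemma norm_below_mono: "m \<le> m' \<Longrightarrow> norm_below n m \<subseteq> norm_below n m'"
  by (auto simp: norm_below_def)

lemma norm_below_zero: "0 \<in> norm_below n m"
  by (simp add: norm_below_def class_function_iff)

lemma class_functionI:
  assumes "\<And>A. A \<notin> carrier (GA n) \<Longrightarrow> Poly_Mapping.lookup u A = 0"
    and "\<And>A B. A \<in> carrier (GA n) \<Longrightarrow> B \<in> carrier (GA n) \<Longrightarrow> mtype n A = mtype n B \<Longrightarrow>
      Poly_Mapping.lookup u A = Poly_Mapping.lookup u B"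
  shows "class_function n u"
  unfolding class_function_iff by (intro conjI allI ballI impI assms)

lemma class_function_outside: "class_function n u \<Longrightarrow> A \<notin> carrier (GA n) \<Longrightarrow> Poly_Mapping.lookup u A = 0"
  unfolding class_function_iff by blast

lemma norm_below_add:
  fixes u v :: "'a::{field,finite} mat \<Rightarrow>\<^sub>0 int"
  assumes "u \<in> norm_below n m" "v \<in> norm_below n m" shows "u + v \<in> norm_below n m"
proof -
  have c: "class_function n u" "class_function n v" using assms by (auto simp: norm_below_def)
  have "class_function n (u + v)"
  proof (rule class_functionI)
    fix A B :: "'a mat" assume AB: "A \<in> carrier (GA n)" "B \<in> carrier (GA n)" "mtype n A = mtype n B"
    show "Poly_Mapping.lookup (u + v) A = Poly_Mapping.lookup (u + v) B"
      unfolding lookup_add class_functionD[OF c(1) AB] class_functionD[OF c(2) AB] ..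
  qed (simp add: lookup_add class_function_outside[OF c(1)] class_function_outside[OF c(2)])
  thus ?thesis using assms by (simp add: norm_below_def lookup_add)
qed

lemma norm_below_uminus:
  fixes u :: "'a::{field,finite} mat \<Rightarrow>\<^sub>0 int"
  assumes "u \<in> norm_below n m" shows "- u \<in> norm_below n m"
proof -
  have c: "class_function n u" using assms by (simp add: norm_below_def)
  have "class_function n (- u)"
  proof (rule class_functionI)
    fix A B :: "'a mat" assume AB: "A \<in> carrier (GA n)" "B \<in> carrier (GA n)" "mtype n A = mtype n B"
    show "Poly_Mapping.lookup (- u) A = Poly_Mapping.lookup (- u) B"
      unfolding lookup_uminus class_functionD[OF c AB] ..
  qed (simp add: class_function_outside[OF c])
  thus ?thesis using assms by (simp add: norm_below_def)
qed

lemma norm_below_diff: "u \<in> norm_below n m \<Longrightarrow> v \<in> norm_below n m \<Longrightarrow> u - v \<in> norm_below n m"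
  using norm_below_add[of u n m "- v"] norm_below_uminus[of v n m] by simp

lemma norm_below_sum: "(\<And>i. i \<in> S \<Longrightarrow> f i \<in> norm_below n m) \<Longrightarrow> sum f S \<in> norm_below n m"
  by (induction S rule: infinite_finite_induct) (auto intro: norm_below_zero norm_below_add)

lemma norm_below_keys: "u \<in> norm_below n m \<Longrightarrow> Poly_Mapping.keys u \<subseteq> carrier (GA n)"
  by (simp add: norm_below_def class_function_def)

lemma group_ring_mult_add:
  fixes u v w :: "'a::{field,finite} mat \<Rightarrow>\<^sub>0 int"
  assumes n: "n \<ge> 1" and k: "Poly_Mapping.keys u \<subseteq> carrier (GA n)" "Poly_Mapping.keys v \<subseteq> carrier (GA n)" "Poly_Mapping.keys w \<subseteq> carrier (GA n)"
  shows "(u + v) \<otimes>\<^bsub>group_ring (GA n)\<^esub> w = u \<otimes>\<^bsub>group_ring (GA n)\<^esub> w + v \<otimes>\<^bsub>group_ring (GA n)\<^esub> w"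
    "w \<otimes>\<^bsub>group_ring (GA n)\<^esub> (u + v) = w \<otimes>\<^bsub>group_ring (GA n)\<^esub> u + w \<otimes>\<^bsub>group_ring (GA n)\<^esub> v"
proof -
  have kuv: "Poly_Mapping.keys (u + v) \<subseteq> carrier (GA n)"
    using Poly_Mapping.keys_add[of u v] k by blast
  have if_add: "(if P then a + b else 0) = (if P then a else 0) + (if P then b else (0 :: int))" for P a b by simp
  show "(u + v) \<otimes>\<^bsub>group_ring (GA n)\<^esub> w = u \<otimes>\<^bsub>group_ring (GA n)\<^esub> w + v \<otimes>\<^bsub>group_ring (GA n)\<^esub> w"
    by (rule poly_mapping_eqI) (simp only: lookup_add lookup_group_ring_mult[OF n kuv k(3)]
      lookup_group_ring_mult[OF n k(1,3)] lookup_group_ring_mult[OF n k(2,3)] distrib_right if_add sum.distrib)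
  show "w \<otimes>\<^bsub>group_ring (GA n)\<^esub> (u + v) = w \<otimes>\<^bsub>group_ring (GA n)\<^esub> u + w \<otimes>\<^bsub>group_ring (GA n)\<^esub> v"
    by (rule poly_mapping_eqI) (simp only: lookup_add lookup_group_ring_mult[OF n k(3) kuv]
      lookup_group_ring_mult[OF n k(3,1)] lookup_group_ring_mult[OF n k(3,2)] distrib_left if_add sum.distrib)
qed

lemma group_ring_mult_uminus:
  fixes u w :: "'a::{field,finite} mat \<Rightarrow>\<^sub>0 int"
  assumes n: "n \<ge> 1" and k: "Poly_Mapping.keys u \<subseteq> carrier (GA n)" "Poly_Mapping.keys w \<subseteq> carrier (GA n)"
  shows "(- u) \<otimes>\<^bsub>group_ring (GA n)\<^esub> w = - (u \<otimes>\<^bsub>group_ring (GA n)\<^esub> w)"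
    "w \<otimes>\<^bsub>group_ring (GA n)\<^esub> (- u) = - (w \<otimes>\<^bsub>group_ring (GA n)\<^esub> u)"
proof -
  have ku: "Poly_Mapping.keys (- u) \<subseteq> carrier (GA n)" using k by (simp add: subset_iff in_keys_iff)
  have if_minus: "(if P then - a else 0) = - (if P then a else (0 :: int))" for P a by simp
  show "(- u) \<otimes>\<^bsub>group_ring (GA n)\<^esub> w = - (u \<otimes>\<^bsub>group_ring (GA n)\<^esub> w)"
    by (rule poly_mapping_eqI) (simp only: lookup_uminus lookup_group_ring_mult[OF n ku k(2)]
      lookup_group_ring_mult[OF n k] mult_minus_left if_minus sum_negf)
  show "w \<otimes>\<^bsub>group_ring (GA n)\<^esub> (- u) = - (w \<otimes>\<^bsub>group_ring (GA n)\<^esub> u)"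
    by (rule poly_mapping_eqI) (simp only: lookup_uminus lookup_group_ring_mult[OF n k(2) ku]
      lookup_group_ring_mult[OF n k(2,1)] mult_minus_right if_minus sum_negf)
qed

lemma carrier_group_ring: "carrier (group_ring G) = {u. Poly_Mapping.keys u \<subseteq> carrier G}"
  by (simp add: group_ring_def)

section \<open>The filtration of the centre by the norm\<close>

lemma Aring_comm_group:
  assumes n: "n \<ge> 1" shows "comm_group (add_monoid (Aring n :: ('a::{field,finite} mat \<Rightarrow>\<^sub>0 int) ring))"
proof -
  let ?Z = "ring_center (group_ring (GA n)) :: ('a mat \<Rightarrow>\<^sub>0 int) set"
  have c: "u \<in> ?Z \<longleftrightarrow> Poly_Mapping.keys u \<subseteq> carrier (GA n) \<and> (\<forall>a. Poly_Mapping.keys a \<subseteq> carrier (GA n) \<longrightarrow>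
      u \<otimes>\<^bsub>group_ring (GA n)\<^esub> a = a \<otimes>\<^bsub>group_ring (GA n)\<^esub> u)" for u
    by (auto simp: ring_center_def carrier_group_ring)
  have add: "u + v \<in> ?Z" if "u \<in> ?Z" "v \<in> ?Z" for u v
    using that Poly_Mapping.keys_add[of u v] unfolding c by (auto simp: group_ring_mult_add[OF n])
  have uminus: "- u \<in> ?Z" if "u \<in> ?Z" for u
    using that unfolding c by (simp add: group_ring_mult_uminus[OF n] subset_iff in_keys_iff)
  have zero: "0 \<in> ?Z"
  proof -
    have k0: "Poly_Mapping.keys (0 :: 'a mat \<Rightarrow>\<^sub>0 int) \<subseteq> carrier (GA n)" by simp
    have "0 \<otimes>\<^bsub>group_ring (GA n)\<^esub> a = a \<otimes>\<^bsub>group_ring (GA n)\<^esub> (0 :: 'a mat \<Rightarrow>\<^sub>0 int)"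
      if a: "Poly_Mapping.keys a \<subseteq> carrier (GA n)" for a
      by (rule poly_mapping_eqI) (simp add: lookup_group_ring_mult[OF n k0 a] lookup_group_ring_mult[OF n a k0] cong: if_cong)
    thus ?thesis unfolding c by simp
  qed
  show ?thesis
  proof (rule comm_groupI)
    fix u assume "u \<in> carrier (add_monoid (Aring n :: ('a mat \<Rightarrow>\<^sub>0 int) ring))"
    thus "\<exists>v\<in>carrier (add_monoid (Aring n)). v \<otimes>\<^bsub>add_monoid (Aring n)\<^esub> u = \<one>\<^bsub>add_monoid (Aring n :: ('a mat \<Rightarrow>\<^sub>0 int) ring)\<^esub>"
      using uminus by (intro bexI[of _ "- u"]) simp_all
  qed (simp_all add: add zero add_ac)
qed

lemma norm_below_carrier:
  assumes n: "n \<ge> 1" shows "norm_below n m \<subseteq> ring_center (group_ring (GA n :: 'a::{field,finite} mat monoid))"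
  by (auto simp: norm_below_def intro: class_function_center[OF n])

lemma norm_below_subgroup:
  assumes n: "n \<ge> 1"
  shows "subgroup (norm_below n m) (add_monoid (Aring n :: ('a::{field,finite} mat \<Rightarrow>\<^sub>0 int) ring))"
proof -
  interpret comm_group "add_monoid (Aring n :: ('a mat \<Rightarrow>\<^sub>0 int) ring)" by (rule Aring_comm_group[OF n])
  have sub: "norm_below n m \<subseteq> carrier (add_monoid (Aring n :: ('a mat \<Rightarrow>\<^sub>0 int) ring))"
    using norm_below_carrier[OF n] by simp
  show ?thesis
  proof (rule subgroupI[OF sub])
    show "norm_below n m \<noteq> ({} :: ('a mat \<Rightarrow>\<^sub>0 int) set)" using norm_below_zero by blast
  next
    fix a :: "'a mat \<Rightarrow>\<^sub>0 int" assume a: "a \<in> norm_below n m"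
    have "inv\<^bsub>add_monoid (Aring n)\<^esub> a = - a"
      using a sub norm_below_uminus[OF a] by (intro inv_equality) auto
    thus "inv\<^bsub>add_monoid (Aring n)\<^esub> a \<in> norm_below n m" using norm_below_uminus[OF a] by simp
  next
    fix a b :: "'a mat \<Rightarrow>\<^sub>0 int" assume "a \<in> norm_below n m" "b \<in> norm_below n m"
    thus "a \<otimes>\<^bsub>add_monoid (Aring n)\<^esub> b \<in> norm_below n m" by (simp add: norm_below_add)
  qed
qed

lemma class_sum_norm_below:
  fixes x :: "'a::{field,finite} ptype \<times> nat"
  assumes "n \<ge> 1" "anorm x < m" shows "class_sum n x \<in> norm_below n m"
  using class_function_class_sum[OF assms(1), of x] assms(2)
  by (auto simp: norm_below_def lookup_class_sum[OF assms(1)] mnorm_def)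

text \<open>For the nontrivial inclusion, a class function is the integer combination of the class
  sums of the types in its support, with its values at representatives as coefficients.\<close>

lemma Afilt_eq:
  assumes n: "n \<ge> 1"
  shows "Afilt n m = (norm_below n (Suc m) :: ('a::{field,finite} mat \<Rightarrow>\<^sub>0 int) set)"
proof
  interpret comm_group "add_monoid (Aring n :: ('a mat \<Rightarrow>\<^sub>0 int) ring)" by (rule Aring_comm_group[OF n])
  let ?G = "carrier (GA n :: 'a mat monoid)"
  let ?S = "class_sum n ` {x \<in> (Phat :: ('a ptype \<times> nat) set). anorm x \<le> m}"
  let ?K = "Afilt n m :: ('a mat \<Rightarrow>\<^sub>0 int) set"
  have S: "?S \<subseteq> norm_below n (Suc m)"
  proof (rule image_subsetI)
    fix x :: "'a ptype \<times> nat" assume "x \<in> {x \<in> Phat. anorm x \<le> m}"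
    thus "class_sum n x \<in> norm_below n (Suc m)" by (intro class_sum_norm_below[OF n]) simp
  qed
  show "?K \<subseteq> norm_below n (Suc m)"
    unfolding Afilt_def by (rule generate_subgroup_incl[OF S norm_below_subgroup[OF n]])
  have S': "?S \<subseteq> carrier (add_monoid (Aring n))" using S norm_below_carrier[OF n] by auto
  have sg: "subgroup ?K (add_monoid (Aring n))" unfolding Afilt_def by (rule generate_is_subgroup[OF S'])
  have add: "a + b \<in> ?K" if "a \<in> ?K" "b \<in> ?K" for a b
    using subgroup.m_closed[OF sg that] by simp
  have zero: "0 \<in> ?K" using subgroup.one_closed[OF sg] by simp
  have uminus: "- a \<in> ?K" if a: "a \<in> ?K" for a
  proof -
    have ac: "a \<in> norm_below n (Suc m)" using a \<open>?K \<subseteq> _\<close> by blast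
    have "inv\<^bsub>add_monoid (Aring n)\<^esub> a = - a"
      using ac norm_below_uminus[OF ac] norm_below_carrier[OF n] by (intro inv_equality) auto
    thus ?thesis using subgroup.m_inv_closed[OF sg a] by simp
  qed
  have nat_mul: "frag_cmul (int k) a \<in> ?K" if a: "a \<in> ?K" for a k
  proof (induction k)
    case (Suc k)
    have "frag_cmul (int (Suc k)) a = frag_cmul (int k) a + a"
      by (simp add: frag_cmul_distrib add.commute)
    thus ?case using add[OF Suc a] by simp
  qed (simp add: zero)
  have mul: "frag_cmul k a \<in> ?K" if a: "a \<in> ?K" for a k
  proof (cases k rule: int_cases2)
    case (nonneg j) thus ?thesis using nat_mul[OF a] by simp
  next
    case (nonpos j) thus ?thesis using uminus[OF nat_mul[OF a, of j]] by simp
  qed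
  have sum: "sum f T \<in> ?K" if "\<And>i. i \<in> T \<Longrightarrow> f i \<in> ?K" for f and T :: "('a ptype \<times> nat) set"
    using that by (induction T rule: infinite_finite_induct) (auto intro: zero add)
  show "norm_below n (Suc m) \<subseteq> ?K"
  proof
    fix u :: "'a mat \<Rightarrow>\<^sub>0 int" assume u: "u \<in> norm_below n (Suc m)"
    let ?T = "mtype n ` Poly_Mapping.keys u"
    define rep where "rep z = (SOME A. A \<in> Poly_Mapping.keys u \<and> mtype n A = z)" for z
    have rep: "rep z \<in> Poly_Mapping.keys u \<and> mtype n (rep z) = z" if z: "z \<in> ?T" for z
    proof -
      obtain A where "A \<in> Poly_Mapping.keys u \<and> mtype n A = z" using z by blast
      thus ?thesis unfolding rep_def by (rule someI)
    qed
    have cf: "class_function n u" using u by (simp add: norm_below_def)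
    have kG: "Poly_Mapping.keys u \<subseteq> ?G" by (rule norm_below_keys[OF u])
    have "u = (\<Sum>z\<in>?T. frag_cmul (Poly_Mapping.lookup u (rep z)) (class_sum n z))"
    proof (rule poly_mapping_eqI)
      fix A
      have "Poly_Mapping.lookup (\<Sum>z\<in>?T. frag_cmul (Poly_Mapping.lookup u (rep z)) (class_sum n z)) A =
          (\<Sum>z\<in>?T. if z = mtype n A then (if A \<in> ?G then Poly_Mapping.lookup u (rep z) else 0) else 0)"
        unfolding lookup_sum by (intro sum.cong refl) (simp add: lookup_class_sum[OF n])
      also have "\<dots> = (if mtype n A \<in> ?T then (if A \<in> ?G then Poly_Mapping.lookup u (rep (mtype n A)) else 0) else 0)"
        by (rule sum.delta) simp
      also have "\<dots> = Poly_Mapping.lookup u A"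
      proof (cases "A \<in> ?G \<and> mtype n A \<in> ?T")
        case True
        have "Poly_Mapping.lookup u (rep (mtype n A)) = Poly_Mapping.lookup u A"
          by (rule class_functionD[OF cf]) (use True rep[of "mtype n A"] kG in auto)
        thus ?thesis using True by simp
      next
        case False
        hence "A \<notin> Poly_Mapping.keys u" using kG by blast
        thus ?thesis using False by (auto simp: in_keys_iff)
      qed
      finally show "Poly_Mapping.lookup u A = Poly_Mapping.lookup (\<Sum>z\<in>?T. frag_cmul (Poly_Mapping.lookup u (rep z)) (class_sum n z)) A" ..
    qed
    also have "\<dots> \<in> ?K"
    proof (intro sum mul)
      fix z assume "z \<in> ?T"
      then obtain A where A: "A \<in> Poly_Mapping.keys u" "mtype n A = z" by blast
      have "\<not> Suc m \<le> mnorm n A" using u A(1) by (auto simp: norm_below_def in_keys_iff)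
      hence "z \<in> Phat \<and> anorm z \<le> m" using A mtype_Phat[OF n subsetD[OF kG A(1)]] by (simp add: mnorm_def)
      thus "class_sum n z \<in> ?K" unfolding Afilt_def by (intro generate.incl imageI) simp
    qed
    finally show "u \<in> ?K" .
  qed
qed

lemma below_Afilt:
  assumes n: "n \<ge> 1"
  shows "below (Aring n) (Afilt n) m = (norm_below n m :: ('a::{field,finite} mat \<Rightarrow>\<^sub>0 int) set)"
  by (cases m) (simp_all add: below_def Afilt_eq[OF n] norm_below_0)

text \<open>If the norm of \<open>A B\<close> is at least \<open>m\<close>, subadditivity and
  \<open>i + j \<le> Suc m\<close> leave \<open>A\<close> of norm at least \<open>i\<close> or
  \<open>B\<close> of norm at least \<open>j\<close>. The strict bounds on both factors account for
  the \<open>Suc\<close>.\<close>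

lemma norm_below_mult:
  fixes u v :: "'a::{field,finite} mat \<Rightarrow>\<^sub>0 int"
  assumes n: "n \<ge> 1" and u: "u \<in> norm_below n i" and v: "v \<in> norm_below n j" and m: "i + j \<le> Suc m"
  shows "u \<otimes>\<^bsub>group_ring (GA n)\<^esub> v \<in> norm_below n m"
proof -
  let ?G = "carrier (GA n :: 'a mat monoid)"
  have cf: "class_function n u" "class_function n v" using u v by (auto simp: norm_below_def)
  have "Poly_Mapping.lookup (u \<otimes>\<^bsub>group_ring (GA n)\<^esub> v) C = 0" if C: "m \<le> mnorm n C" for C
    unfolding lookup_group_ring_mult[OF n norm_below_keys[OF u] norm_below_keys[OF v]]
  proof (intro sum.neutral ballI)
    fix A B assume AB: "A \<in> ?G" "B \<in> ?G"
    show "(if A * B = C then Poly_Mapping.lookup u A * Poly_Mapping.lookup v B else 0) = 0"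
    proof (cases "A * B = C")
      case True
      hence "i \<le> mnorm n A \<or> j \<le> mnorm n B" using norm_mult[OF n AB] C m by auto
      thus ?thesis using u v by (auto simp: norm_below_def)
    qed simp
  qed
  thus ?thesis using class_function_mult[OF n cf] by (simp add: norm_below_def)
qed

section \<open>Homogeneous parts of elements of the stable algebra\<close>

definition homog :: "nat \<Rightarrow> (('a::{field,finite} ptype \<times> nat) \<Rightarrow>\<^sub>0 int) \<Rightarrow> nat \<Rightarrow> ('a mat \<Rightarrow>\<^sub>0 int)" where
  "homog n u m = (\<Sum>A\<in>carrier (GA n). frag_cmul (if mnorm n A = m then class_value n u A else 0) (frag_of A))"

lemma lookup_homog:
  fixes A :: "'a::{field,finite} mat"
  assumes n: "n \<ge> 1"
  shows "Poly_Mapping.lookup (homog n u m) A =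
    (if A \<in> carrier (GA n) \<and> mnorm n A = m then class_value n u A else 0)"
proof -
  have "Poly_Mapping.lookup (homog n u m) A =
      (\<Sum>B\<in>carrier (GA n). if B = A then (if mnorm n B = m then class_value n u B else 0) else 0)"
    unfolding homog_def lookup_sum by (intro sum.cong refl) simp
  also have "\<dots> = (if A \<in> carrier (GA n) then (if mnorm n A = m then class_value n u A else 0) else 0)"
    by (rule sum.delta) (rule finite_GA[OF n])
  finally show ?thesis by simp
qed

lemma homog_norm_below:
  fixes u :: "('a::{field,finite} ptype \<times> nat) \<Rightarrow>\<^sub>0 int"
  assumes n: "n \<ge> 1" shows "homog n u m \<in> norm_below n (Suc m)"
proof -
  have "class_function n (homog n u m)"
    by (rule class_functionI) (simp_all add: lookup_homog[OF n] mnorm_def class_value_def)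
  thus ?thesis by (simp add: norm_below_def lookup_homog[OF n])
qed

lemma homog_add: "n \<ge> 1 \<Longrightarrow> homog n (u + v) m = homog n u m + homog n v m"
  by (rule poly_mapping_eqI) (simp add: lookup_homog lookup_add value_add)

text \<open>Covers also a type that does not occur in \<open>GA n\<close>: then the class sum is
  zero, and so is every value of \<open>frag_of x\<close> on the group.\<close>

lemma homog_frag_of:
  fixes x :: "'a::{field,finite} ptype \<times> nat"
  assumes n: "n \<ge> 1"
  shows "homog n (frag_of x) m = (if m = anorm x then class_sum n x else 0)"
  by (rule poly_mapping_eqI)
    (auto simp: lookup_homog[OF n] lookup_class_sum[OF n] class_value_def mnorm_def)

lemma homog_one:
  assumes n: "n \<ge> 1"
  shows "homog n (frag_of (\<lambda>_. {#}, 0)) m = (if m = 0 then frag_of (1\<^sub>m n :: 'a::{field,finite} mat) else 0)"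
proof (rule poly_mapping_eqI)
  fix A :: "'a mat"
  have "mnorm n (1\<^sub>m n :: 'a mat) = 0" using mtype_one[OF n] by (simp add: mnorm_def)
  thus "Poly_Mapping.lookup (homog n (frag_of (\<lambda>_. {#}, 0)) m) A =
      Poly_Mapping.lookup (if m = 0 then frag_of (1\<^sub>m n) else 0) A"
    unfolding lookup_homog[OF n] using value_one[OF n, of A] one_GA[OF n, where 'a = 'a] by (cases "A = 1\<^sub>m n") auto
qed

text \<open>Up to elements of norm below \<open>m\<close>, the degree \<open>m\<close> part of a product in the stable algebra is
  given by the products of the homogeneous parts: in both, a factorization \<open>C = A B\<close> counts only if
  the norms of \<open>A\<close> and \<open>B\<close> add up to \<open>m\<close>.\<close>

lemma homog_mult:
  fixes u v :: "('a::{field,finite} ptype \<times> nat) \<Rightarrow>\<^sub>0 int"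
  assumes n: "n \<ge> 1" and u: "u \<in> carrier G_ring" and v: "v \<in> carrier G_ring"
  shows "(\<Sum>i\<le>m. homog n u i \<otimes>\<^bsub>group_ring (GA n)\<^esub> homog n v (m - i)) - homog n (u \<otimes>\<^bsub>G_ring\<^esub> v) m \<in> norm_below n m"
proof -
  let ?G = "carrier (GA n :: 'a mat monoid)"
  let ?d = "(\<Sum>i\<le>m. homog n u i \<otimes>\<^bsub>group_ring (GA n)\<^esub> homog n v (m - i)) - homog n (u \<otimes>\<^bsub>G_ring\<^esub> v) m"
  have "homog n u i \<otimes>\<^bsub>group_ring (GA n)\<^esub> homog n v (m - i) \<in> norm_below n (Suc m)" if "i \<le> m" for i
    by (rule norm_below_mult[OF n homog_norm_below[OF n] homog_norm_below[OF n]]) (use that in simp)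
  hence d: "?d \<in> norm_below n (Suc m)"
    by (intro norm_below_diff norm_below_sum homog_norm_below[OF n]) simp
  have "Poly_Mapping.lookup ?d C = 0" if C: "C \<in> ?G" "m \<le> mnorm n C" for C
  proof -
    have kh: "Poly_Mapping.keys (homog n w i) \<subseteq> ?G" for w i by (rule norm_below_keys[OF homog_norm_below[OF n]])
    let ?t = "\<lambda>A B. if A * B = C \<and> m = mnorm n A + mnorm n B then class_value n u A * class_value n v B else 0"
    \<comment> \<open>The index \<open>i\<close> can only be the norm of \<open>A\<close>, so the
      sum over \<open>i\<close> will disappear.\<close>
    have "Poly_Mapping.lookup (\<Sum>i\<le>m. homog n u i \<otimes>\<^bsub>group_ring (GA n)\<^esub> homog n v (m - i)) C =
        (\<Sum>i\<le>m. \<Sum>A\<in>?G. \<Sum>B\<in>?G. if i = mnorm n A then ?t A B else 0)"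
      unfolding lookup_sum lookup_group_ring_mult[OF n kh kh]
      by (intro sum.cong refl) (auto simp: lookup_homog[OF n])
    also have "\<dots> = (\<Sum>A\<in>?G. \<Sum>B\<in>?G. \<Sum>i\<le>m. if i = mnorm n A then ?t A B else 0)"
      by (rule trans[OF sum.swap sum.cong[OF refl sum.swap]])
    also have "\<dots> = (\<Sum>A\<in>?G. \<Sum>B\<in>?G. ?t A B)"
      by (intro sum.cong refl) (simp only: sum.delta finite_atMost, auto)
    also have "\<dots> = Poly_Mapping.lookup (homog n (u \<otimes>\<^bsub>G_ring\<^esub> v) m) C"
    proof (cases "mnorm n C = m")
      case True
      thus ?thesis using C by (simp add: lookup_homog[OF n] value_mult[OF n C(1) u v])
    next
      case False
      \<comment> \<open>The norm of \<open>C\<close> exceeds \<open>m\<close> here, so by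
        subadditivity its factors cannot have norms adding up to \<open>m\<close>.\<close>
      have "?t A B = 0" if "A \<in> ?G" "B \<in> ?G" for A B
      proof -
        have "A * B = C \<Longrightarrow> m \<noteq> mnorm n A + mnorm n B" using norm_mult[OF n that] C False by auto
        thus ?thesis by auto
      qed
      hence "(\<Sum>A\<in>?G. \<Sum>B\<in>?G. ?t A B) = 0" by (intro sum.neutral ballI)
      thus ?thesis using False by (simp add: lookup_homog[OF n])
    qed
    finally show ?thesis by (simp add: lookup_minus)
  qed
  moreover have "Poly_Mapping.lookup ?d C = 0" if "C \<notin> ?G" for C
    using d that unfolding norm_below_def by (blast intro: class_function_outside)
  ultimately show ?thesis using d unfolding norm_below_def by blast
qed

section \<open>The homomorphism onto the graded ring\<close>

lemma coset_iff:
  fixes a c :: "'a::{field,finite} mat \<Rightarrow>\<^sub>0 int"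
  assumes n: "n \<ge> 1"
  shows "c \<in> below (Aring n) (Afilt n) m +>\<^bsub>Aring n\<^esub> a \<longleftrightarrow> c - a \<in> norm_below n m"
proof -
  have "(\<exists>h\<in>norm_below n m. c = h + a) \<longleftrightarrow> c - a \<in> norm_below n m"
    by (metis add_diff_cancel_right' diff_add_cancel)
  thus ?thesis unfolding a_r_coset_def' below_Afilt[OF n] by auto
qed

lemma coset_eqI:
  fixes a b :: "'a::{field,finite} mat \<Rightarrow>\<^sub>0 int"
  assumes n: "n \<ge> 1" and ab: "a - b \<in> norm_below n m"
  shows "below (Aring n) (Afilt n) m +>\<^bsub>Aring n\<^esub> a = below (Aring n) (Afilt n) m +>\<^bsub>Aring n\<^esub> b"
proof (rule Set.set_eqI)
  fix c
  have "c - b = (c - a) + (a - b)" "c - a = (c - b) - (a - b)" by simp_all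
  hence "c - a \<in> norm_below n m \<longleftrightarrow> c - b \<in> norm_below n m"
    using norm_below_add[OF _ ab, of "c - a"] norm_below_diff[OF _ ab, of "c - b"] by metis
  thus "c \<in> below (Aring n) (Afilt n) m +>\<^bsub>Aring n\<^esub> a \<longleftrightarrow> c \<in> below (Aring n) (Afilt n) m +>\<^bsub>Aring n\<^esub> b"
    unfolding coset_iff[OF n] .
qed

lemma coset_zero:
  assumes n: "n \<ge> 1"
  shows "below (Aring n) (Afilt n) m +>\<^bsub>Aring n\<^esub> (0 :: 'a::{field,finite} mat \<Rightarrow>\<^sub>0 int) = below (Aring n) (Afilt n) m"
  by (rule Set.set_eqI) (simp add: coset_iff[OF n], simp add: below_Afilt[OF n])

abbreviation graded_part :: "nat \<Rightarrow> nat \<Rightarrow> ('a::{field,finite} mat \<Rightarrow>\<^sub>0 int) set monoid" where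
  "graded_part n m \<equiv> (add_monoid (Aring n))\<lparr>carrier := Afilt n m\<rparr> Mod below (Aring n) (Afilt n) m"

lemma below_normal:
  assumes n: "n \<ge> 1"
  shows "below (Aring n) (Afilt n) m \<lhd> (add_monoid (Aring n :: ('a::{field,finite} mat \<Rightarrow>\<^sub>0 int) ring))\<lparr>carrier := Afilt n m\<rparr>"
proof -
  let ?M = "add_monoid (Aring n :: ('a mat \<Rightarrow>\<^sub>0 int) ring)"
  interpret M: comm_group ?M by (rule Aring_comm_group[OF n])
  have F: "subgroup (Afilt n m) ?M" unfolding Afilt_eq[OF n] by (rule norm_below_subgroup[OF n])
  have B: "subgroup (below (Aring n) (Afilt n) m) (?M\<lparr>carrier := Afilt n m\<rparr>)"
    unfolding below_Afilt[OF n] Afilt_eq[OF n]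
    by (rule M.subgroup_incl[OF norm_below_subgroup[OF n] norm_below_subgroup[OF n] norm_below_mono]) simp
  interpret FM: comm_group "?M\<lparr>carrier := Afilt n m\<rparr>"
  proof (rule group.group_comm_groupI[OF M.subgroup_imp_group[OF F]])
    fix a b assume "a \<in> carrier (?M\<lparr>carrier := Afilt n m\<rparr>)" "b \<in> carrier (?M\<lparr>carrier := Afilt n m\<rparr>)"
    show "a \<otimes>\<^bsub>?M\<lparr>carrier := Afilt n m\<rparr>\<^esub> b = b \<otimes>\<^bsub>?M\<lparr>carrier := Afilt n m\<rparr>\<^esub> a" by (simp add: add.commute)
  qed
  show ?thesis by (rule FM.subgroup_imp_normal[OF B])
qed

lemma graded_part_group: "n \<ge> 1 \<Longrightarrow> group (graded_part n m :: ('a::{field,finite} mat \<Rightarrow>\<^sub>0 int) set monoid)"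
  by (rule normal.factorgroup_is_group[OF below_normal])

lemma graded_part_coset:
  "r_coset ((add_monoid (Aring n))\<lparr>carrier := F\<rparr>) H a = H +>\<^bsub>Aring n\<^esub> a"
  by (simp add: r_coset_def a_r_coset_def')

lemma carrier_graded_part:
  "carrier (graded_part n m) = (\<lambda>a. below (Aring n) (Afilt n) m +>\<^bsub>Aring n\<^esub> a) ` Afilt n m"
  unfolding carrier_FactGroup graded_part_coset by simp

lemma mult_graded_part:
  fixes a b :: "'a::{field,finite} mat \<Rightarrow>\<^sub>0 int"
  assumes n: "n \<ge> 1" and ab: "a \<in> Afilt n m" "b \<in> Afilt n m"
  shows "(below (Aring n) (Afilt n) m +>\<^bsub>Aring n\<^esub> a) \<otimes>\<^bsub>graded_part n m\<^esub> (below (Aring n) (Afilt n) m +>\<^bsub>Aring n\<^esub> b) =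
    below (Aring n) (Afilt n) m +>\<^bsub>Aring n\<^esub> (a + b)"
  using normal.rcos_sum[OF below_normal[OF n, of m], of a b] ab unfolding graded_part_coset by simp

lemma carrier_graded_group:
  assumes n: "n \<ge> 1"
  shows "carrier (graded_group (Aring n) (Afilt n) :: (nat \<Rightarrow> ('a::{field,finite} mat \<Rightarrow>\<^sub>0 int) set) monoid) =
    {x. (\<forall>m. x m \<in> carrier (graded_part n m)) \<and> finite {m. x m \<noteq> below (Aring n) (Afilt n) m}}"
proof -
  have "carrier (graded_group (Aring n) (Afilt n) :: (nat \<Rightarrow> ('a mat \<Rightarrow>\<^sub>0 int) set) monoid) =
    {x \<in> \<Pi>\<^sub>E m\<in>UNIV. carrier (graded_part n m). finite {m \<in> UNIV. x m \<noteq> \<one>\<^bsub>graded_part n m\<^esub>}}"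
    unfolding graded_group_def by (rule carrier_sum_group) (rule graded_part_group[OF n])
  thus ?thesis by (auto simp: PiE_UNIV_domain)
qed

definition graded_map :: "nat \<Rightarrow> (('a::{field,finite} ptype \<times> nat) \<Rightarrow>\<^sub>0 int) \<Rightarrow> nat \<Rightarrow> ('a mat \<Rightarrow>\<^sub>0 int) set" where
  "graded_map n u = (\<lambda>m. below (Aring n) (Afilt n) m +>\<^bsub>Aring n\<^esub> homog n u m)"

text \<open>Almost all components are trivial because only finitely many norms occur in the finite
  group.\<close>

lemma graded_map_carrier:
  fixes u :: "('a::{field,finite} ptype \<times> nat) \<Rightarrow>\<^sub>0 int"
  assumes n: "n \<ge> 1" shows "graded_map n u \<in> carrier (graded_group (Aring n) (Afilt n))"
proof -
  have "{m. graded_map n u m \<noteq> below (Aring n) (Afilt n) m} \<subseteq> mnorm n ` carrier (GA n :: 'a mat monoid)"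
  proof
    fix m assume "m \<in> {m. graded_map n u m \<noteq> below (Aring n) (Afilt n) m}"
    hence ne: "graded_map n u m \<noteq> below (Aring n) (Afilt n) m" by (rule CollectD)
    have "homog n u m \<noteq> 0"
    proof
      assume h: "homog n u m = 0"
      show False using ne unfolding graded_map_def h coset_zero[OF n] by (rule notE) (rule refl)
    qed
    then obtain A where "Poly_Mapping.lookup (homog n u m) A \<noteq> 0" by (metis lookup_zero poly_mapping_eqI)
    hence "A \<in> carrier (GA n) \<and> mnorm n A = m" unfolding lookup_homog[OF n] by (metis (full_types))
    thus "m \<in> mnorm n ` carrier (GA n :: 'a mat monoid)" by blast
  qed
  hence "finite {m. graded_map n u m \<noteq> below (Aring n) (Afilt n) m}"
    by (rule finite_subset) (rule finite_imageI[OF finite_GA[OF n]])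
  thus ?thesis unfolding carrier_graded_group[OF n] carrier_graded_part
  proof (intro CollectI conjI allI)
    fix m show "graded_map n u m \<in> (\<lambda>a. below (Aring n) (Afilt n) m +>\<^bsub>Aring n\<^esub> a) ` Afilt n m"
      unfolding graded_map_def Afilt_eq[OF n] by (rule imageI) (rule homog_norm_below[OF n])
  qed
qed

lemma graded_map_add:
  fixes u v :: "('a::{field,finite} ptype \<times> nat) \<Rightarrow>\<^sub>0 int"
  assumes n: "n \<ge> 1"
  shows "graded_map n (u + v) = graded_map n u \<otimes>\<^bsub>graded_group (Aring n) (Afilt n)\<^esub> graded_map n v"
proof
  fix m
  have "homog n u m \<in> Afilt n m" "homog n v m \<in> Afilt n m"
    using homog_norm_below[OF n] by (auto simp: Afilt_eq[OF n])
  from mult_graded_part[OF n this]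
  show "graded_map n (u + v) m = (graded_map n u \<otimes>\<^bsub>graded_group (Aring n) (Afilt n)\<^esub> graded_map n v) m"
    by (simp add: graded_group_def graded_map_def homog_add[OF n])
qed

lemma finsum_Aring:
  fixes f :: "nat \<Rightarrow> 'a::{field,finite} mat \<Rightarrow>\<^sub>0 int"
  assumes n: "n \<ge> 1" and "finite S" and "\<And>i. i \<in> S \<Longrightarrow> f i \<in> carrier (Aring n)"
  shows "finsum (Aring n) f S = sum f S"
proof -
  interpret comm_group "add_monoid (Aring n :: ('a mat \<Rightarrow>\<^sub>0 int) ring)" by (rule Aring_comm_group[OF n])
  show ?thesis using assms(2,3)
  proof (induction S rule: finite_induct)
    case empty
    thus ?case using finprod_empty by (simp add: finsum_def)
  next
    case (insert i S)
    have "finprod (add_monoid (Aring n)) f (insert i S) = f i \<otimes>\<^bsub>add_monoid (Aring n)\<^esub> finprod (add_monoid (Aring n)) f S"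
      by (rule finprod_insert) (use insert in \<open>simp_all add: Pi_def\<close>)
    thus ?case using insert by (simp add: finsum_def)
  qed
qed

lemma group_ring_mult_diff:
  fixes u v w :: "'a::{field,finite} mat \<Rightarrow>\<^sub>0 int"
  assumes n: "n \<ge> 1" and u: "Poly_Mapping.keys u \<subseteq> carrier (GA n)" and v: "Poly_Mapping.keys v \<subseteq> carrier (GA n)"
    and w: "Poly_Mapping.keys w \<subseteq> carrier (GA n)"
  shows "(u - v) \<otimes>\<^bsub>group_ring (GA n)\<^esub> w = u \<otimes>\<^bsub>group_ring (GA n)\<^esub> w - v \<otimes>\<^bsub>group_ring (GA n)\<^esub> w"
    "w \<otimes>\<^bsub>group_ring (GA n)\<^esub> (u - v) = w \<otimes>\<^bsub>group_ring (GA n)\<^esub> u - w \<otimes>\<^bsub>group_ring (GA n)\<^esub> v"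
proof -
  have nv: "Poly_Mapping.keys (- v) \<subseteq> carrier (GA n)" using v by (simp add: subset_iff in_keys_iff)
  show "(u - v) \<otimes>\<^bsub>group_ring (GA n)\<^esub> w = u \<otimes>\<^bsub>group_ring (GA n)\<^esub> w - v \<otimes>\<^bsub>group_ring (GA n)\<^esub> w"
    using group_ring_mult_add(1)[OF n u nv w] group_ring_mult_uminus(1)[OF n v w] by simp
  show "w \<otimes>\<^bsub>group_ring (GA n)\<^esub> (u - v) = w \<otimes>\<^bsub>group_ring (GA n)\<^esub> u - w \<otimes>\<^bsub>group_ring (GA n)\<^esub> v"
    using group_ring_mult_add(2)[OF n u nv w] group_ring_mult_uminus(2)[OF n v w] by simp
qed

text \<open>All choices of representatives give the same coset, so the union that defines the
  product collapses to it. The choice by homogeneous parts identifies this coset through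
  \<open>homog_mult\<close>.\<close>

lemma graded_map_mult:
  fixes u v :: "('a::{field,finite} ptype \<times> nat) \<Rightarrow>\<^sub>0 int"
  assumes n: "n \<ge> 1" and u: "u \<in> carrier G_ring" and v: "v \<in> carrier G_ring"
  shows "graded_map n (u \<otimes>\<^bsub>G_ring\<^esub> v) = graded_map n u \<otimes>\<^bsub>Gn_ring n\<^esub> graded_map n v"
proof
  fix m
  let ?R = "Aring n :: ('a mat \<Rightarrow>\<^sub>0 int) ring"
  let ?c = "\<lambda>a. below ?R (Afilt n) m +>\<^bsub>?R\<^esub> a"
  let ?P = "\<lambda>a b. \<forall>i\<le>m. a i \<in> graded_map n u i \<and> b i \<in> graded_map n v i"
  let ?s = "\<lambda>a b. \<Oplus>\<^bsub>?R\<^esub>i\<in>{..m}. a i \<otimes>\<^bsub>?R\<^esub> b (m - i)"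
  have h: "homog n w i \<in> norm_below n (Suc i)" for w :: "('a ptype \<times> nat) \<Rightarrow>\<^sub>0 int" and i
    by (rule homog_norm_below[OF n])
  have coset: "?c (?s a b) = ?c (homog n (u \<otimes>\<^bsub>G_ring\<^esub> v) m)" if P: "?P a b" for a b
  proof (rule coset_eqI[OF n])
    have da: "a i - homog n u i \<in> norm_below n i" and db: "b i - homog n v i \<in> norm_below n i" if "i \<le> m" for i
      using P that by (auto simp: graded_map_def coset_iff[OF n])
    have a: "a i \<in> norm_below n (Suc i)" if "i \<le> m" for i
      using norm_below_add[OF subsetD[OF norm_below_mono da[OF that]] h[of u i]] by simp
    have b: "b i \<in> norm_below n (Suc i)" if "i \<le> m" for i
      using norm_below_add[OF subsetD[OF norm_below_mono db[OF that]] h[of v i]] by simp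
    have ab: "a i \<otimes>\<^bsub>group_ring (GA n)\<^esub> b (m - i) \<in> norm_below n (Suc m)" if "i \<le> m" for i
      by (rule norm_below_mult[OF n a[OF that] b]) (use that in auto)
    have "?s a b = (\<Sum>i\<le>m. a i \<otimes>\<^bsub>group_ring (GA n)\<^esub> b (m - i))"
      using ab norm_below_carrier[OF n] by (subst finsum_Aring[OF n]) auto
    moreover have "(\<Sum>i\<le>m. a i \<otimes>\<^bsub>group_ring (GA n)\<^esub> b (m - i)) -
        (\<Sum>i\<le>m. homog n u i \<otimes>\<^bsub>group_ring (GA n)\<^esub> homog n v (m - i)) \<in> norm_below n m"
      unfolding sum_subtractf[symmetric]
    proof (rule norm_below_sum)
      fix i assume "i \<in> {..m}"
      hence i: "i \<le> m" and mi: "m - i \<le> m" by auto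
      \<comment> \<open>One factor is changed at a time: each term on the right has a factor whose
        norm bound is lower by one, which is enough to land in
        \<open>norm_below n m\<close>.\<close>
      have e: "a i \<otimes>\<^bsub>group_ring (GA n)\<^esub> b (m - i) - homog n u i \<otimes>\<^bsub>group_ring (GA n)\<^esub> homog n v (m - i) =
          (a i - homog n u i) \<otimes>\<^bsub>group_ring (GA n)\<^esub> b (m - i) +
          homog n u i \<otimes>\<^bsub>group_ring (GA n)\<^esub> (b (m - i) - homog n v (m - i))"
        using group_ring_mult_diff(1)[OF n norm_below_keys[OF a[OF i]] norm_below_keys[OF h] norm_below_keys[OF b[OF mi]], of u i]
          group_ring_mult_diff(2)[OF n norm_below_keys[OF b[OF mi]] norm_below_keys[OF h[of v "m - i"]] norm_below_keys[OF h[of u i]]]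
        by simp
      show "a i \<otimes>\<^bsub>group_ring (GA n)\<^esub> b (m - i) - homog n u i \<otimes>\<^bsub>group_ring (GA n)\<^esub> homog n v (m - i) \<in> norm_below n m"
        unfolding e
        by (intro norm_below_add norm_below_mult[OF n da[OF i] b[OF mi]] norm_below_mult[OF n h db[OF mi]]) (use i in auto)
    qed
    ultimately show "?s a b - homog n (u \<otimes>\<^bsub>G_ring\<^esub> v) m \<in> norm_below n m"
      using norm_below_add[OF _ homog_mult[OF n u v, of m]] by fastforce
  qed
  have P0: "?P (homog n u) (homog n v)" by (simp add: graded_map_def coset_iff[OF n] norm_below_zero)
  have "{?c (?s a b) | a b. ?P a b} = {?c (homog n (u \<otimes>\<^bsub>G_ring\<^esub> v) m)}"
    using coset P0 by blast
  hence "(graded_map n u \<otimes>\<^bsub>Gn_ring n\<^esub> graded_map n v) m = \<Union>{?c (homog n (u \<otimes>\<^bsub>G_ring\<^esub> v) m)}"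
    unfolding Gn_ring_def graded_ring_def monoid.select_convs by (simp only:)
  thus "graded_map n (u \<otimes>\<^bsub>G_ring\<^esub> v) m = (graded_map n u \<otimes>\<^bsub>Gn_ring n\<^esub> graded_map n v) m"
    by (simp add: graded_map_def)
qed

text \<open>The coefficient at a type \<open>z\<close> is read off from the component of degree
  \<open>anorm z\<close> at a representative of the class. In degree \<open>m\<close> the result
  agrees with the chosen coset representative on all matrices of norm \<open>m\<close>, and smaller
  norms are divided out.\<close>

lemma graded_map_surj:
  fixes x :: "nat \<Rightarrow> ('a::{field,finite} mat \<Rightarrow>\<^sub>0 int) set"
  assumes n: "n \<ge> 1" and x: "x \<in> carrier (graded_group (Aring n) (Afilt n))"
  shows "\<exists>u\<in>carrier G_ring. graded_map n u = x"
proof -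
  let ?G = "carrier (GA n :: 'a mat monoid)"
  have "x m \<in> (\<lambda>a. below (Aring n) (Afilt n) m +>\<^bsub>Aring n\<^esub> a) ` Afilt n m" for m
    using x unfolding carrier_graded_group[OF n] carrier_graded_part by blast
  hence "\<forall>m. \<exists>a. a \<in> norm_below n (Suc m) \<and> x m = below (Aring n) (Afilt n) m +>\<^bsub>Aring n\<^esub> a"
    using Afilt_eq[OF n, where 'a = 'a] by blast
  then obtain a where a: "\<And>m. a m \<in> norm_below n (Suc m)"
    and xa: "\<And>m. x m = below (Aring n) (Afilt n) m +>\<^bsub>Aring n\<^esub> a m" by metis
  define rep where "rep z = (SOME A. A \<in> ?G \<and> mtype n A = z)" for z
  have rep: "rep (mtype n A) \<in> ?G \<and> mtype n (rep (mtype n A)) = mtype n A" if "A \<in> ?G" for A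
    unfolding rep_def by (rule someI[of _ A]) (use that in simp)
  define u where "u = (\<Sum>z\<in>mtype n ` ?G. frag_cmul (Poly_Mapping.lookup (a (anorm z)) (rep z)) (frag_of z))"
  have lu: "Poly_Mapping.lookup u z = (if z \<in> mtype n ` ?G then Poly_Mapping.lookup (a (anorm z)) (rep z) else 0)" for z
  proof -
    have "Poly_Mapping.lookup u z = (\<Sum>w\<in>mtype n ` ?G. if w = z then Poly_Mapping.lookup (a (anorm w)) (rep w) else 0)"
      unfolding u_def lookup_sum by (intro sum.cong refl) simp
    also have "\<dots> = (if z \<in> mtype n ` ?G then Poly_Mapping.lookup (a (anorm z)) (rep z) else 0)"
      by (rule sum.delta) (rule finite_imageI[OF finite_GA[OF n]])
    finally show ?thesis .
  qed
  have val: "class_value n u A = Poly_Mapping.lookup (a (mnorm n A)) A" if A: "A \<in> ?G" for A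
  proof -
    have "class_function n (a (mnorm n A))" using a by (simp add: norm_below_def)
    from class_functionD[OF this _ A, of "rep (mtype n A)"] rep[OF A]
    show ?thesis using A by (simp add: class_value_def lu mnorm_def)
  qed
  have "u \<in> carrier G_ring"
    using mtype_Phat[OF n] by (auto simp: in_keys_iff lu split: if_splits)
  moreover have "graded_map n u m = x m" for m
    unfolding graded_map_def xa
  proof (rule coset_eqI[OF n])
    have d: "homog n u m - a m \<in> norm_below n (Suc m)"
      by (rule norm_below_diff[OF homog_norm_below[OF n] a])
    have "Poly_Mapping.lookup (homog n u m - a m) A = 0" if A: "m \<le> mnorm n A" for A
    proof (cases "A \<in> ?G \<and> mnorm n A = m")
      case True
      thus ?thesis by (simp add: lookup_minus lookup_homog[OF n] val)
    next
      case False
      have cd: "class_function n (homog n u m - a m)" using d by (simp add: norm_below_def)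
      show ?thesis
      proof (cases "A \<in> ?G")
        case True
        hence "Suc m \<le> mnorm n A" using False A by simp
        thus ?thesis using d unfolding norm_below_def by blast
      qed (rule class_function_outside[OF cd])
    qed
    thus "homog n u m - a m \<in> norm_below n m" using d by (simp add: norm_below_def)
  qed
  ultimately show ?thesis by blast
qed

section \<open>Ring structure of the graded ring and transfer of the multiplication rule\<close>

lemma Gn_ring_simps:
  "carrier (Gn_ring n) = carrier (graded_group (Aring n) (Afilt n))"
  "ring.add (Gn_ring n) = monoid.mult (graded_group (Aring n) (Afilt n))"
  "\<zero>\<^bsub>Gn_ring n\<^esub> = (\<lambda>m. below (Aring n) (Afilt n) m)"
  "\<one>\<^bsub>Gn_ring n\<^esub> = (\<lambda>m. below (Aring n) (Afilt n) m +>\<^bsub>Aring n\<^esub> (if m = 0 then frag_of (1\<^sub>m n) else 0))"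
  by (simp_all add: Gn_ring_def graded_ring_def graded_group_def fun_eq_iff)

lemma graded_map_zero:
  assumes n: "n \<ge> 1"
  shows "graded_map n (0 :: ('a::{field,finite} ptype \<times> nat) \<Rightarrow>\<^sub>0 int) = \<zero>\<^bsub>Gn_ring n\<^esub>"
proof
  fix m
  have h: "homog n (0 :: ('a ptype \<times> nat) \<Rightarrow>\<^sub>0 int) m = 0"
    by (rule poly_mapping_eqI) (simp add: lookup_homog[OF n] class_value_def)
  show "graded_map n (0 :: ('a ptype \<times> nat) \<Rightarrow>\<^sub>0 int) m = \<zero>\<^bsub>Gn_ring n\<^esub> m"
    unfolding graded_map_def Gn_ring_simps h coset_zero[OF n] ..
qed

lemma graded_map_ring_hom:
  assumes n: "n \<ge> 1"
  shows "graded_map n \<in> Ring.ring_hom (G_ring :: ('a::{field,finite} ptype \<times> nat \<Rightarrow>\<^sub>0 int) ring) (Gn_ring n)"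
proof (rule ring_hom_memI)
  fix u v :: "('a ptype \<times> nat) \<Rightarrow>\<^sub>0 int"
  show "graded_map n u \<in> carrier (Gn_ring n)" unfolding Gn_ring_simps by (rule graded_map_carrier[OF n])
  assume u: "u \<in> carrier G_ring" and v: "v \<in> carrier G_ring"
  show "graded_map n (u \<otimes>\<^bsub>G_ring\<^esub> v) = graded_map n u \<otimes>\<^bsub>Gn_ring n\<^esub> graded_map n v"
    by (rule graded_map_mult[OF n u v])
  show "graded_map n (u \<oplus>\<^bsub>G_ring\<^esub> v) = graded_map n u \<oplus>\<^bsub>Gn_ring n\<^esub> graded_map n v"
    unfolding Gn_ring_simps G_ring_simps by (rule graded_map_add[OF n])
next
  show "graded_map n \<one>\<^bsub>G_ring\<^esub> = \<one>\<^bsub>Gn_ring n :: (nat \<Rightarrow> ('a mat \<Rightarrow>\<^sub>0 int) set) ring\<^esub>"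
    unfolding Gn_ring_simps G_ring_simps graded_map_def homog_one[OF n] ..
qed

lemma graded_map_image:
  assumes n: "n \<ge> 1"
  shows "graded_map n ` carrier (G_ring :: ('a::{field,finite} ptype \<times> nat \<Rightarrow>\<^sub>0 int) ring) = carrier (Gn_ring n)"
  unfolding Gn_ring_simps using graded_map_carrier[OF n] graded_map_surj[OF n] by blast

text \<open>The image of a ring under a map that respects the operations is a ring, and here the
  image is the whole carrier.\<close>

lemma Gn_ring_ring:
  assumes n: "n \<ge> 1" shows "ring (Gn_ring n :: (nat \<Rightarrow> ('a::{field,finite} mat \<Rightarrow>\<^sub>0 int) set) ring)"
proof -
  have "ring ((Gn_ring n)\<lparr>carrier := graded_map n ` carrier (G_ring :: ('a ptype \<times> nat \<Rightarrow>\<^sub>0 int) ring), zero := graded_map n \<zero>\<^bsub>G_ring\<^esub>\<rparr>)"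
    by (rule ring.ring_hom_imp_img_ring[OF G_ring_ring graded_map_ring_hom[OF n]])
  moreover have "graded_map n \<zero>\<^bsub>G_ring :: ('a ptype \<times> nat \<Rightarrow>\<^sub>0 int) ring\<^esub> = \<zero>\<^bsub>Gn_ring n\<^esub>"
    unfolding G_ring_simps by (rule graded_map_zero[OF n])
  ultimately show ?thesis unfolding graded_map_image[OF n] by simp
qed

lemma graded_map_class: "n \<ge> 1 \<Longrightarrow> graded_map n (frag_of x) = graded_class_sum n x"
  unfolding graded_map_def graded_class_sum_def graded_class_def homog_frag_of by (simp cong: if_cong)

text \<open>Integer multiples in a ring are powers in its additive monoid; this identifies them with
  \<open>frag_cmul\<close>, so that a homomorphism can be applied to them.\<close>

lemma G_ring_pow:
  fixes u :: "('a::{field,finite} ptype \<times> nat) \<Rightarrow>\<^sub>0 int" and k :: int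
  assumes u: "u \<in> carrier G_ring" shows "u [^]\<^bsub>add_monoid G_ring\<^esub> k = frag_cmul k u"
proof -
  interpret ring "G_ring :: ('a ptype \<times> nat \<Rightarrow>\<^sub>0 int) ring" by (rule G_ring_ring)
  have nat: "u [^]\<^bsub>add_monoid G_ring\<^esub> (j :: nat) = frag_cmul (int j) u" for j
  proof (induction j)
    case (Suc j)
    have "u [^]\<^bsub>add_monoid G_ring\<^esub> Suc j = u [^]\<^bsub>add_monoid G_ring\<^esub> j + u" by (simp add: nat_pow_def)
    also have "\<dots> = frag_cmul (int j) u + u" unfolding Suc.IH ..
    finally show ?case by (simp add: frag_cmul_distrib add.commute)
  qed (simp add: nat_pow_def)
  have "inv\<^bsub>add_monoid G_ring\<^esub> frag_cmul j u = - frag_cmul j u" for j :: int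
    using u by (intro group.inv_equality[OF a_group]) (auto simp: subset_iff in_keys_iff simp flip: frag_cmul_distrib)
  thus ?thesis unfolding int_pow_def2 nat by simp
qed

lemma graded_map_cmul:
  fixes u :: "('a::{field,finite} ptype \<times> nat) \<Rightarrow>\<^sub>0 int"
  assumes n: "n \<ge> 1" and u: "u \<in> carrier G_ring"
  shows "graded_map n (frag_cmul k u) = [k] \<cdot>\<^bsub>Gn_ring n\<^esub> graded_map n u"
proof -
  interpret h: ring_hom_ring "G_ring :: ('a ptype \<times> nat \<Rightarrow>\<^sub>0 int) ring" "Gn_ring n" "graded_map n"
    by (rule ring_hom_ringI2[OF G_ring_ring Gn_ring_ring[OF n] graded_map_ring_hom[OF n]])
  have "graded_map n (u [^]\<^bsub>add_monoid G_ring\<^esub> k) = graded_map n u [^]\<^bsub>add_monoid (Gn_ring n)\<^esub> k"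
    using u by (intro group_hom.hom_int_pow[OF h.a_group_hom]) simp
  thus ?thesis unfolding G_ring_pow[OF u] add_pow_def .
qed

lemma graded_map_sum:
  fixes f :: "'i \<Rightarrow> ('a::{field,finite} ptype \<times> nat) \<Rightarrow>\<^sub>0 int"
  assumes n: "n \<ge> 1" and "finite S"
  shows "graded_map n (sum f S) = (\<Oplus>\<^bsub>Gn_ring n\<^esub>i\<in>S. graded_map n (f i))"
proof -
  interpret ring "Gn_ring n :: (nat \<Rightarrow> ('a mat \<Rightarrow>\<^sub>0 int) set) ring" by (rule Gn_ring_ring[OF n])
  have c: "graded_map n u \<in> carrier (Gn_ring n)" for u :: "('a ptype \<times> nat) \<Rightarrow>\<^sub>0 int"
    unfolding Gn_ring_simps by (rule graded_map_carrier[OF n])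
  show ?thesis using assms(2)
  proof (induction S rule: finite_induct)
    case empty
    show ?case by (simp add: graded_map_zero[OF n])
  next
    case (insert i S)
    have "graded_map n (f i + sum f S) = graded_map n (f i) \<oplus>\<^bsub>Gn_ring n\<^esub> graded_map n (sum f S)"
      unfolding Gn_ring_simps by (rule graded_map_add[OF n])
    thus ?case using insert c by (simp add: Pi_def)
  qed
qed

theorem theorem1p2:
  fixes n :: nat
  assumes "n \<ge> 1"
  shows "(\<forall>x \<in> Phat. \<forall>y \<in> Phat.
            graded_class_sum n x \<otimes>\<^bsub>Gn_ring n\<^esub> graded_class_sum n y =
            (\<Oplus>\<^bsub>Gn_ring n\<^esub> z \<in> {z \<in> (Phat :: ('a::{field, finite} ptype \<times> nat) set).
                               anorm z = anorm x + anorm y}.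
               [stable_const x y z] \<cdot>\<^bsub>Gn_ring n\<^esub> graded_class_sum n z)) \<and>
         (\<exists>\<phi>. ring_hom_ring (G_ring :: ('a ptype \<times> nat \<Rightarrow>\<^sub>0 int) ring) (Gn_ring n) \<phi> \<and>
              \<phi> ` carrier (G_ring :: ('a ptype \<times> nat \<Rightarrow>\<^sub>0 int) ring) = carrier (Gn_ring n) \<and>
              (\<forall>x \<in> Phat. \<phi> (frag_of x) = graded_class_sum n x))"
proof (intro conjI ballI exI[of _ "graded_map n"])
  note n = assms
  fix x y :: "'a ptype \<times> nat" assume x: "x \<in> Phat" and y: "y \<in> Phat"
  interpret ring "Gn_ring n :: (nat \<Rightarrow> ('a mat \<Rightarrow>\<^sub>0 int) set) ring" by (rule Gn_ring_ring[OF n])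
  let ?Z = "{z \<in> (Phat :: ('a ptype \<times> nat) set). anorm z = anorm x + anorm y}"
  have fc: "frag_of z \<in> carrier G_ring" if "z \<in> Phat" for z :: "'a ptype \<times> nat" using that by simp
  have c: "graded_map n u \<in> carrier (Gn_ring n)" for u :: "('a ptype \<times> nat) \<Rightarrow>\<^sub>0 int"
    unfolding Gn_ring_simps by (rule graded_map_carrier[OF n])
  \<comment> \<open>On basis symbols the product of the stable algebra is its defining sum, so the
    multiplication rule of the graded ring is the image of this sum under the homomorphism.\<close>
  have "frag_of x \<otimes>\<^bsub>G_ring\<^esub> frag_of y = (\<Sum>z\<in>?Z. frag_cmul (stable_const x y z) (frag_of z))"
    by (simp add: G_ring_def)
  hence "graded_class_sum n x \<otimes>\<^bsub>Gn_ring n\<^esub> graded_class_sum n y =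
      graded_map n (\<Sum>z\<in>?Z. frag_cmul (stable_const x y z) (frag_of z))"
    using graded_map_mult[OF n fc[OF x] fc[OF y]] by (simp add: graded_map_class[OF n])
  also have "\<dots> = (\<Oplus>\<^bsub>Gn_ring n\<^esub>z\<in>?Z. graded_map n (frag_cmul (stable_const x y z) (frag_of z)))"
    by (rule graded_map_sum[OF n finite_anorm])
  also have "\<dots> = (\<Oplus>\<^bsub>Gn_ring n\<^esub>z\<in>?Z. [stable_const x y z] \<cdot>\<^bsub>Gn_ring n\<^esub> graded_class_sum n z)"
  proof (rule finsum_cong'[OF refl])
    have e: "graded_map n (frag_cmul (stable_const x y z) (frag_of z)) = [stable_const x y z] \<cdot>\<^bsub>Gn_ring n\<^esub> graded_class_sum n z"
      if "z \<in> ?Z" for z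
      using graded_map_cmul[OF n fc, of z "stable_const x y z"] that by (simp add: graded_map_class[OF n])
    show "graded_map n (frag_cmul (stable_const x y z) (frag_of z)) = [stable_const x y z] \<cdot>\<^bsub>Gn_ring n\<^esub> graded_class_sum n z"
      if "z \<in> ?Z" for z using that by (rule e)
    show "(\<lambda>z. [stable_const x y z] \<cdot>\<^bsub>Gn_ring n\<^esub> graded_class_sum n z) \<in> ?Z \<rightarrow> carrier (Gn_ring n)"
      using c e by (metis (no_types, lifting) Pi_I)
  qed
  finally show "graded_class_sum n x \<otimes>\<^bsub>Gn_ring n\<^esub> graded_class_sum n y =
    (\<Oplus>\<^bsub>Gn_ring n\<^esub>z\<in>?Z. [stable_const x y z] \<cdot>\<^bsub>Gn_ring n\<^esub> graded_class_sum n z)" .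
next
  note n = assms
  show "ring_hom_ring (G_ring :: ('a ptype \<times> nat \<Rightarrow>\<^sub>0 int) ring) (Gn_ring n) (graded_map n)"
    by (rule ring_hom_ringI2[OF G_ring_ring Gn_ring_ring[OF n] graded_map_ring_hom[OF n]])
  show "graded_map n ` carrier (G_ring :: ('a ptype \<times> nat \<Rightarrow>\<^sub>0 int) ring) = carrier (Gn_ring n)"
    by (rule graded_map_image[OF n])
  show "graded_map n (frag_of x) = graded_class_sum n x" for x :: "'a ptype \<times> nat"
    by (rule graded_map_class[OF n])
qed

end
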